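(* With the notation and standing assumptions of the context, the second order differential operator $R_{C_2}$ (the radial part on $F_{\vec\varkappa}$ of the Casimir element $C_2=\sum_{1\le i,j\le m+n}E_{ij}E_{ji}$) has the form $$2(R_{C_2}\psi)(x)=\delta_{\vec s}^{-1}(x)\left(\Delta_A-u_{\vec r}(x)+C_{\vec\varkappa}\right)\delta_{\vec s}(x)\psi(x),$$ where $\Delta_A=\sum_{i=1}^n\frac{\partial^2}{\partial x_i^2}$, $$C_{\vec\varkappa}=\frac{m+n-(m+n)^3}{6}+\frac{(m-n)^3-m+n}{6}+(\varkappa_{(1)}+\varkappa_{(2)})^2n+2(m-n)\varkappa_{(1)}^2,$$ $$u_{\vec r}(x)=\sum_{\alpha\in\Sigma_+}\frac{r_\alpha(r_\alpha+2r_{2\alpha}-1)(\alpha,\alpha)}{\sinh^2(\alpha(a(x)))}.$$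
   Context: **Groups.** Let $m\ge n\ge 1$ be integers, $G=GL(m+n,\mathbb C)$ with Lie algebra $\mathfrak g$ and matrix units $E_{ij}$, and let $K=K_{(1)}\times K_{(2)}=GL(m)\times GL(n)\subset G$ be the block diagonal subgroup; write $k=k_{(1)}k_{(2)}$. For $x\in\mathbb C^n$ put $a(x)=\sum_{i=1}^n x_i(E_{i+m,i}+E_{i,i+m})$ and $A=\{e^{a(x)}:x\in\mathbb C^n\}$. **Parameters.** $\vec\varkappa=(\varkappa_{(1)},\varkappa_{(2)},\tilde\varkappa_{(1)},\varkappa_v)$ are integers with $\varkappa_v\ge0$. Put $\vec\kappa=(\kappa_1,\kappa_2,\kappa_3)=(\varkappa_{(2)}-\varkappa_{(1)},\varkappa_v,\tilde\varkappa_{(1)}-\varkappa_{(2)})$ and assume $\kappa_3\ge\kappa_1+\kappa_3\ge0$. Put $\vec s=(m-n,1,\tfrac12)$ and $\vec r=\vec\kappa+\vec s$. **Roots.** $\Sigma$ is the root system $BC_n$ with positive roots $\Sigma_+$: short $\varepsilon_i$ ($1\le i\le n$), medium $\varepsilon_i\pm\varepsilon_j$ ($1\le i<j\le n$), long $2\varepsilon_i$ ($1\le i\le n$); $\varepsilon_i(a(x))=x_i$ and $(\varepsilon_i,\varepsilon_j)=\delta_{ij}$. For $\vec p=(p_1,p_2,p_3)$, $p_\alpha=p_1,p_2,p_3$ for $\alpha$ short, medium, long respectively, and $p_\alpha=0$ if $\alpha\notin\Sigma$. Put $\delta_{\vec p}(x)=\prod_{\alpha\in\Sigma_+}\sinh^{p_\alpha}(\alpha(a(x)))$.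 **Spherical functions.** $L_\lambda$ denotes the irreducible representation of $GL(r)$ with highest weight $\lambda\in\mathbb Z^r$, $\lambda_1\ge\dots\ge\lambda_r$; $1^n$ is the vector with ones in the first $n$ places and zeros elsewhere. Let $W_{\vec\varkappa}$ be the irreducible $GL(m)$-representation with highest weight $(\tilde\varkappa_{(1)}-\varkappa_{(1)})1^n+\varkappa_{(1)}1^m$, let $V_{\vec\varkappa}=L_{(\varkappa_v(n-1),-\varkappa_v,\dots,-\varkappa_v)}\otimes\det^{\varkappa_{(2)}+\varkappa_{(1)}-\tilde\varkappa_{(1)}}$ as a $GL(n)$-representation, and $U_{\vec\varkappa}=W_{\vec\varkappa}\boxtimes V_{\vec\varkappa}$ as a $K$-representation. $F_{\vec\varkappa}$ is the space of polynomial (i.e. regular algebraic) functions $f:G\to U_{\vec\varkappa}$ with $f(kg)=kf(g)$ and $f(gk)=\det(k_{(1)})^{\varkappa_{(1)}}\det(k_{(2)})^{\varkappa_{(2)}}f(g)$ for all $g\in G$, $k\in K$. There is a one-dimensional subspace $\tilde U_{\vec\varkappa}\subset U_{\vec\varkappa}$ such that $f(e^{a(x)})\in\tilde U_{\vec\varkappa}$ for every $f\in F_{\vec\varkappa}$ and $x$: namely $\tilde U_{\vec\varkappa}=\tilde W_{\vec\varkappa}\boxtimes\tilde V_{\vec\varkappa}$, where $\tilde W_{\vec\varkappa}\subset W_{\vec\varkappa}$ is the subspace on which the $GL(m-n)$ acting on coordinates $n+1,\dots,m$ acts by $\det^{\varkappa_{(1)}}$ and $\tilde V_{\vec\varkappa}\subset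 V_{\vec\varkappa}$ is the weight space of weight $(\varkappa_{(1)}+\varkappa_{(2)}-\tilde\varkappa_{(1)})1^n$. Hence $f(e^{a(x)})$ is regarded as a scalar function of $x$. **Radial parts.** For $X\in\mathfrak g$, $D_Xf(g)=\frac{d}{dt}f(ge^{tX})|_{t=0}$, extended to $U(\mathfrak g)$ by $D_{XY}=D_XD_Y$. For $C$ in the center of $U(\mathfrak g)$, $D_C$ preserves $F_{\vec\varkappa}$, and its radial part $R_C$ is the unique scalar differential operator in $x_1,\dots,x_n$ with $(D_Cf)(e^{a(x)})=R_C\big(f(e^{a(x)})\big)$ for all $f\in F_{\vec\varkappa}$. *)

theory Defs
  imports "HOL-Analysis.Analysis"
begin

section \<open>The general linear group and its rational representations\<close>

text \<open>
  The index set \<open>{1..r}\<close> is rendered as a finite linearly ordered type, so that \<open>\<complex>\<^sup>r\<close> is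
  \<open>complex ^ 'r\<close>. The index set \<open>{1..m+n}\<close> is the sum type \<open>'m + 'n\<close>: the index \<open>i \<le> m\<close> is
  \<open>Inl i\<close> and the index \<open>i + m\<close> is \<open>Inr i\<close>.
\<close>

type_synonym 'r cvec = "(complex, 'r) vec"
type_synonym 'r rvec = "(real, 'r) vec"
type_synonym 'r cmat = "((complex, 'r) vec, 'r) vec"

definition GL :: "('r::finite cmat) set" where
  "GL = {g. invertible g}"

definition matrix_unit :: "'r::finite \<Rightarrow> 'r \<Rightarrow> 'r cmat" where
  "matrix_unit p q = (\<chi> i j. if i = p \<and> j = q then 1 else 0)"

definition diag_matrix :: "'r::finite cvec \<Rightarrow> 'r cmat" where
  "diag_matrix t = (\<chi> i j. if i = j then t $ i else 0)"

definition mexp :: "'r::finite cmat \<Rightarrow> 'r cmat" where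
  "mexp X = (\<Sum>k. (1 / fact k) *\<^sub>R (((**) X ^^ k) (mat 1)))"

text \<open>The coordinate ring of \<open>GL(r)\<close>: generated by the matrix entries and \<open>1 / det\<close>.\<close>

inductive polynomial_GL :: "('r::finite cmat \<Rightarrow> complex) \<Rightarrow> bool" where
  const: "polynomial_GL (\<lambda>g. c)"
| entry: "polynomial_GL (\<lambda>g. g $ i $ j)"
| inverse_det: "polynomial_GL (\<lambda>g. inverse (det g))"
| add: "polynomial_GL p \<Longrightarrow> polynomial_GL q \<Longrightarrow> polynomial_GL (\<lambda>g. p g + q g)"
| mult: "polynomial_GL p \<Longrightarrow> polynomial_GL q \<Longrightarrow> polynomial_GL (\<lambda>g. p g * q g)"

definition regular_GL :: "('r::finite cmat \<Rightarrow> complex) \<Rightarrow> bool" where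
  "regular_GL f \<longleftrightarrow> (\<exists>p. polynomial_GL p \<and> (\<forall>g\<in>GL. f g = p g))"

definition rational_rep :: "('r::finite cmat \<Rightarrow> 'd::finite cmat) \<Rightarrow> bool" where
  "rational_rep \<rho> \<longleftrightarrow>
     (\<forall>i j. regular_GL (\<lambda>g. \<rho> g $ i $ j)) \<and>
     \<rho> (mat 1) = mat 1 \<and>
     (\<forall>g\<in>GL. \<forall>h\<in>GL. \<rho> (g ** h) = \<rho> g ** \<rho> h)"

definition irreducible_rep :: "('r::finite cmat \<Rightarrow> 'd::finite cmat) \<Rightarrow> bool" where
  "irreducible_rep \<rho> \<longleftrightarrow> rational_rep \<rho> \<and>
     (\<forall>S. vec.subspace S \<and> (\<forall>g\<in>GL. \<forall>v\<in>S. \<rho> g *v v \<in> S) \<longrightarrow> S = {0} \<or> S = UNIV)"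

text \<open>
  A highest weight vector is an eigenvector of the Borel subgroup of upper triangular matrices.
\<close>

definition has_highest_weight ::
    "('r::{finite,linorder} cmat \<Rightarrow> 'd::finite cmat) \<Rightarrow> ('r \<Rightarrow> int) \<Rightarrow> bool" where
  "has_highest_weight \<rho> \<mu> \<longleftrightarrow>
     (\<exists>v. v \<noteq> 0 \<and>
        (\<forall>b\<in>GL. (\<forall>i j. j < i \<longrightarrow> b $ i $ j = 0) \<longrightarrow>
           \<rho> b *v v = (\<Prod>i\<in>UNIV. b $ i $ i powi \<mu> i) *s v))"

text \<open>
  \<open>L\<^sub>\<mu>\<close> is determined up to isomorphism only; the following says that \<open>\<rho>\<close> is a realization of it.
\<close>

definition is_L :: "('r::{finite,linorder} \<Rightarrow> int) \<Rightarrow>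
    ('r cmat \<Rightarrow> 'd::finite cmat) \<Rightarrow> bool" where
  "is_L \<mu> \<rho> \<longleftrightarrow> irreducible_rep \<rho> \<and> has_highest_weight \<rho> \<mu>"

definition det_twist :: "int \<Rightarrow> ('r::finite cmat \<Rightarrow> 'd::finite cmat) \<Rightarrow>
    'r cmat \<Rightarrow> 'd cmat" where
  "det_twist c \<rho> g = (\<chi> i j. det g powi c * \<rho> g $ i $ j)"

text \<open>The tensor product of \<open>\<complex>\<^sup>w\<close> and \<open>\<complex>\<^sup>v\<close> is \<open>complex ^ ('w \<times> 'v)\<close>.\<close>

definition tensor_vec :: "'w::finite cvec \<Rightarrow> 'v::finite cvec \<Rightarrow> ('w \<times> 'v) cvec" where
  "tensor_vec w v = (\<chi> p. w $ fst p * v $ snd p)"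

definition tensor_mat ::
    "'w::finite cmat \<Rightarrow> 'v::finite cmat \<Rightarrow> ('w \<times> 'v) cmat" where
  "tensor_mat A B = (\<chi> p q. A $ fst p $ fst q * B $ snd p $ snd q)"


section \<open>The subgroups \<open>K\<close> and \<open>A\<close>\<close>

definition block_diag ::
    "'m::finite cmat \<Rightarrow> 'n::finite cmat \<Rightarrow> ('m + 'n) cmat" where
  "block_diag k1 k2 = (\<chi> p q. case (p, q) of
       (Inl i, Inl j) \<Rightarrow> k1 $ i $ j
     | (Inr i, Inr j) \<Rightarrow> k2 $ i $ j
     | _ \<Rightarrow> 0)"

text \<open>The first \<open>k\<close> elements of a finite linear order.\<close>

definition initial :: "nat \<Rightarrow> 'r::{finite,linorder} set" where
  "initial k = {i. card {..<i} < k}"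

text \<open>
  The inclusion of \<open>{1..n}\<close> into \<open>{1..m}\<close>: it preserves the position in the order. It is only
  meaningful for \<open>n \<le> m\<close>.
\<close>

definition emb :: "'n::{finite,linorder} \<Rightarrow> 'm::{finite,linorder}" where
  "emb i = (THE j. card {..<j} = card {..<i})"

definition a_matrix ::
    "'n::{finite,linorder} cvec \<Rightarrow> ('m::{finite,linorder} + 'n) cmat" where
  "a_matrix x = (\<chi> p q. \<Sum>i\<in>UNIV. x $ i *
     (matrix_unit (Inr i) (Inl (emb i)) + matrix_unit (Inl (emb i)) (Inr i)) $ p $ q)"


section \<open>The root system \<open>BC\<^sub>n\<close>\<close>

definition pos_short :: "('n::{finite,linorder} rvec) set" where
  "pos_short = {axis i 1 | i. True}"

definition pos_medium :: "('n::{finite,linorder} rvec) set" where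
  "pos_medium = {axis i 1 - axis j 1 | i j. i < j} \<union> {axis i 1 + axis j 1 | i j. i < j}"

definition pos_long :: "('n::{finite,linorder} rvec) set" where
  "pos_long = {2 *\<^sub>R axis i 1 | i. True}"

definition pos_roots :: "('n::{finite,linorder} rvec) set" where
  "pos_roots = pos_short \<union> pos_medium \<union> pos_long"

definition mult_param :: "real \<times> real \<times> real \<Rightarrow> 'n::{finite,linorder} rvec \<Rightarrow> real" where
  "mult_param p \<alpha> = (case p of (p1, p2, p3) \<Rightarrow>
     if \<alpha> \<in> pos_short \<union> uminus ` pos_short then p1
     else if \<alpha> \<in> pos_medium \<union> uminus ` pos_medium then p2
     else if \<alpha> \<in> pos_long \<union> uminus ` pos_long then p3
     else 0)"

text \<open>The value \<open>\<alpha>(a(x))\<close>.\<close>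

definition root_eval :: "'n::finite rvec \<Rightarrow> 'n cvec \<Rightarrow> complex" where
  "root_eval \<alpha> x = (\<Sum>i\<in>UNIV. of_real (\<alpha> $ i) * x $ i)"

definition regular_set :: "('n::{finite,linorder} cvec) set" where
  "regular_set = {x. \<forall>\<alpha>\<in>pos_roots. sinh (root_eval \<alpha> x) \<noteq> 0}"

text \<open>
  \<open>\<delta>\<^sub>p\<close> may involve fractional powers of \<open>sinh\<close> and is multivalued on the regular set. A branch on an
  open set is specified by continuous branches \<open>\<theta> \<alpha>\<close> of \<open>log (sinh (\<alpha>(a(x))))\<close>, one for each
  positive root.
\<close>

definition log_sinh_branch ::
    "('n::{finite,linorder} cvec) set \<Rightarrow> ('n rvec \<Rightarrow> 'n cvec \<Rightarrow> complex) \<Rightarrow> bool" where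
  "log_sinh_branch U \<theta> \<longleftrightarrow>
     (\<forall>\<alpha>\<in>pos_roots. continuous_on U (\<theta> \<alpha>) \<and> (\<forall>x\<in>U. exp (\<theta> \<alpha> x) = sinh (root_eval \<alpha> x)))"

definition delta :: "real \<times> real \<times> real \<Rightarrow>
    ('n::{finite,linorder} rvec \<Rightarrow> 'n cvec \<Rightarrow> complex) \<Rightarrow> 'n cvec \<Rightarrow> complex" where
  "delta p \<theta> x = (\<Prod>\<alpha>\<in>pos_roots. exp (of_real (mult_param p \<alpha>) * \<theta> \<alpha> x))"

definition u_potential :: "real \<times> real \<times> real \<Rightarrow> 'n::{finite,linorder} cvec \<Rightarrow> complex" where
  "u_potential r x = (\<Sum>\<alpha>\<in>pos_roots.
     of_real (mult_param r \<alpha> * (mult_param r \<alpha> + 2 * mult_param r (2 *\<^sub>R \<alpha>) - 1) * (\<alpha> \<bullet> \<alpha>))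
       / (sinh (root_eval \<alpha> x))\<^sup>2)"


section \<open>Scalar differential operators\<close>

definition holomorphic_several :: "('n::finite cvec \<Rightarrow> complex) \<Rightarrow> ('n cvec) set \<Rightarrow> bool" where
  "holomorphic_several f U \<longleftrightarrow>
     (\<forall>x\<in>U. \<exists>f'. (f has_derivative f') (at x) \<and> (\<forall>c v. f' (c *s v) = c * f' v))"

definition partial :: "'n::finite \<Rightarrow> ('n cvec \<Rightarrow> complex) \<Rightarrow> 'n cvec \<Rightarrow> complex" where
  "partial i f x = deriv (\<lambda>t. f (x + t *s axis i 1)) 0"

definition laplacian_A :: "('n::finite cvec \<Rightarrow> complex) \<Rightarrow> 'n cvec \<Rightarrow> complex" where
  "laplacian_A f x = (\<Sum>i\<in>UNIV. partial i (partial i f) x)"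

text \<open>
  Differential operators on the regular set with holomorphic coefficients. The derivatives are
  indexed by words in the coordinate directions; on holomorphic functions only the multi-index of a
  word matters.
\<close>

definition scalar_diff_op ::
    "(('n::{finite,linorder} cvec \<Rightarrow> complex) \<Rightarrow> 'n cvec \<Rightarrow> complex) \<Rightarrow> bool" where
  "scalar_diff_op R \<longleftrightarrow>
     (\<exists>(S :: 'n list set) c. finite S \<and> (\<forall>I\<in>S. holomorphic_several (c I) regular_set) \<and>
        (\<forall>\<psi>. \<forall>x\<in>regular_set. R \<psi> x = (\<Sum>I\<in>S. c I x * foldr partial I \<psi> x)))"


section \<open>Spherical functions\<close>

definition W_weight :: "nat \<Rightarrow> int \<Rightarrow> int \<Rightarrow> 'm::{finite,linorder} \<Rightarrow> int" where
  "W_weight n \<kappa>1 \<kappa>t1 = (\<lambda>j. (\<kappa>t1 - \<kappa>1) * (if j \<in> initial n then 1 else 0) + \<kappa>1)"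

definition V_weight :: "int \<Rightarrow> 'n::{finite,linorder} \<Rightarrow> int" where
  "V_weight \<kappa>v = (\<lambda>i. if i \<in> initial 1 then \<kappa>v * (int CARD('n) - 1) else - \<kappa>v)"

text \<open>
  Here \<open>\<rho>\<close> and \<open>\<tau>\<close> are the actions of the two factors of \<open>K\<close> on the two tensor factors of \<open>U\<close>.
  Values of the functions outside \<open>GL\<close> are irrelevant.
\<close>

definition spherical_functions :: "int \<Rightarrow> int \<Rightarrow>
    ('m::finite cmat \<Rightarrow> 'w::finite cmat) \<Rightarrow> ('n::finite cmat \<Rightarrow> 'v::finite cmat) \<Rightarrow>
    (('m + 'n) cmat \<Rightarrow> ('w \<times> 'v) cvec) set" where
  "spherical_functions \<kappa>1 \<kappa>2 \<rho> \<tau> = {f.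
     (\<forall>p. regular_GL (\<lambda>g. f g $ p)) \<and>
     (\<forall>g\<in>GL. \<forall>k1\<in>GL. \<forall>k2\<in>GL.
        f (block_diag k1 k2 ** g) = tensor_mat (\<rho> k1) (\<tau> k2) *v f g \<and>
        f (g ** block_diag k1 k2) = (det k1 powi \<kappa>1 * det k2 powi \<kappa>2) *s f g)}"

text \<open>\<open>h\<close> ranges over the copy of \<open>GL(m-n)\<close> acting on the coordinates \<open>n+1, \<dots>, m\<close>.\<close>

definition W_tilde :: "nat \<Rightarrow> int \<Rightarrow>
    ('m::{finite,linorder} cmat \<Rightarrow> 'w::finite cmat) \<Rightarrow> ('w cvec) set" where
  "W_tilde n \<kappa>1 \<rho> = {w. \<forall>h\<in>GL.
     (\<forall>i j. i \<in> initial n \<or> j \<in> initial n \<longrightarrow> h $ i $ j = mat 1 $ i $ j) \<longrightarrow>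
     \<rho> h *v w = (det h powi \<kappa>1) *s w}"

definition V_tilde :: "int \<Rightarrow>
    ('n::finite cmat \<Rightarrow> 'v::finite cmat) \<Rightarrow> ('v cvec) set" where
  "V_tilde c \<tau> = {v. \<forall>t. (\<forall>i. t $ i \<noteq> 0) \<longrightarrow>
     \<tau> (diag_matrix t) *v v = (\<Prod>i\<in>UNIV. t $ i powi c) *s v}"

definition U_tilde :: "int \<Rightarrow> int \<Rightarrow> int \<Rightarrow>
    ('m::{finite,linorder} cmat \<Rightarrow> 'w::finite cmat) \<Rightarrow>
    ('n::finite cmat \<Rightarrow> 'v::finite cmat) \<Rightarrow> (('w \<times> 'v) cvec) set" where
  "U_tilde \<kappa>1 \<kappa>2 \<kappa>t1 \<rho> \<tau> = vec.span
     {tensor_vec w v | w v. w \<in> W_tilde CARD('n) \<kappa>1 \<rho> \<and> v \<in> V_tilde (\<kappa>1 + \<kappa>2 - \<kappa>t1) \<tau>}"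

text \<open>The restriction of \<open>f\<close> to \<open>A\<close> as a scalar function, relative to a basis vector \<open>e\<close> of the line
  \<open>U_tilde\<close>.\<close>

definition A_scalar :: "'d::finite cvec \<Rightarrow>
    (('m::{finite,linorder} + 'n::{finite,linorder}) cmat \<Rightarrow> 'd cvec) \<Rightarrow>
    'n cvec \<Rightarrow> complex" where
  "A_scalar e f x = (THE c. f (mexp (a_matrix x)) = c *s e)"


section \<open>The Casimir element and radial parts\<close>

definition lie_deriv :: "'r::finite cmat \<Rightarrow>
    ('r cmat \<Rightarrow> 'd::finite cvec) \<Rightarrow> 'r cmat \<Rightarrow> 'd cvec" where
  "lie_deriv X f g = vector_derivative (\<lambda>t::real. f (g ** mexp (t *\<^sub>R X))) (at 0)"

definition D_casimir ::
    "('r::finite cmat \<Rightarrow> 'd::finite cvec) \<Rightarrow> 'r cmat \<Rightarrow> 'd cvec" where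
  "D_casimir f g =
     (\<Sum>i\<in>UNIV. \<Sum>j\<in>UNIV. lie_deriv (matrix_unit i j) (lie_deriv (matrix_unit j i) f) g)"

text \<open>
  \<open>R\<close> is a radial part, on the function space \<open>F\<close>, of the operator \<open>D\<close>. Uniqueness of \<open>R\<close> (as an
  operator on holomorphic functions) is not part of the definition. The coefficients of \<open>R\<close> may be
  singular on the walls, whence the restriction to the regular set.
\<close>

definition is_radial_part ::
    "(('m::{finite,linorder} + 'n::{finite,linorder}) cmat \<Rightarrow> 'd::finite cvec) set \<Rightarrow>
     'd cvec \<Rightarrow>
     ((('m + 'n) cmat \<Rightarrow> 'd cvec) \<Rightarrow>
        ('m + 'n) cmat \<Rightarrow> 'd cvec) \<Rightarrow>
     (('n cvec \<Rightarrow> complex) \<Rightarrow> 'n cvec \<Rightarrow> complex) \<Rightarrow> bool" where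
  "is_radial_part F e D R \<longleftrightarrow> scalar_diff_op R \<and>
     (\<forall>f\<in>F. \<forall>x\<in>regular_set. D f (mexp (a_matrix x)) = R (A_scalar e f) x *s e)"

definition C_const :: "nat \<Rightarrow> nat \<Rightarrow> int \<Rightarrow> int \<Rightarrow> real" where
  "C_const m n \<kappa>1 \<kappa>2 =
     (real m + real n - (real m + real n) ^ 3) / 6
     + ((real m - real n) ^ 3 - real m + real n) / 6
     + (real_of_int \<kappa>1 + real_of_int \<kappa>2)\<^sup>2 * real n
     + 2 * (real m - real n) * (real_of_int \<kappa>1)\<^sup>2"

end

theory Submission
 imports Defs "HOL-Complex_Analysis.Complex_Analysis"
begin

text \<open>
  The radial part is found by expressing the Casimir element at a point
  \<open>a = exp (a(x))\<close> of A through derivatives along A and along K on both sides. For a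
  root vector Y outside the Lie algebra of K there is Z inside it and numbers s, c (hyperbolic
  functions of a root) with \<open>s Y = c Z - Ad (a^-1) Z\<close>. Derivatives of a
  spherical function along Z on the right are known from the semi-invariance, and derivatives along
  \<open>Ad (a^-1) Z\<close> are derivatives along Z on the left, known from the equivariance.
  Applying this twice (root_first, root_second) turns each pair \<open>E p q\<close>,
  \<open>E q p\<close> into a first order derivative along A with coefficient \<open>coth\<close>
  of a root and a potential \<open>1 / sinh^2\<close> of a root (casimir_radial). The numerators
  are values of products of Lie algebra elements of K on the line of values on A.

  These values require facts about the two representations of K. Both have a highest weight that
  takes only two values, and everything is derived from one matrix coefficient,
  \<open>det g ^ \<beta>\<close> times a power of a minor of g (is_L_rectangular). Vectors are
  then functions on the group: the highest weight vector of W is the function of the minor, and the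
  vector of weight zero in V is the monomial with equal exponents in the first row of g, on which
  \<open>E i j E j i\<close> acts by \<open>\<kappa> (\<kappa> + 1)\<close>.

  Conjugation by \<open>\<delta>\<close> removes the first order terms, since their coefficients are
  the logarithmic derivatives of \<open>\<delta>\<close> (delta_laplacian). The remaining potential
  is the sum of the squares and derivatives of these coefficients; in the variables
  \<open>cosh (2 x_i)\<close> its mixed terms cancel to constants by symmetrization
  (drift_square_sum), and comparison with the potential of the Casimir element gives u and the
  constant (drift_potential_identity).

  The statement concerns every radial part, applied to every holomorphic function. Uniqueness
  amounts to the jets at a regular point of the restrictions of spherical functions to A being
  arbitrary. There is an explicit spherical function without zeros on the regular set
  (nonvanishing_spherical_function), built from the blocks of the projection
  \<open>g J g^-1\<close>, where J projects onto the first block. It can be multiplied by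
  functions invariant under K on both sides, whose restrictions include all power sums of
  \<open>- sinh^2 (x_i)\<close>; a polynomial interpolation argument shows that these have
  arbitrary jets where the numbers \<open>- sinh^2 (x_i)\<close> are distinct and have nonzero
  derivative (power_sum_algebra_jets_dense). Radial parts are therefore equal on the regular set
  (radial_part_unique).
\<close>

(* The symbol $ stands for components of vectors, not for coefficients of power series. *)
no_notation fps_nth (infixl "$" 75)

section \<open>Sums and determinants\<close>

abbreviation E :: "'r::finite \<Rightarrow> 'r \<Rightarrow> 'r cmat" where "E \<equiv> matrix_unit"

lemma sum_off_diag_swap:
 fixes g :: "'n::finite \<Rightarrow> 'n \<Rightarrow> 'z::comm_monoid_add"
 shows "(\<Sum>k\<in>UNIV. \<Sum>l\<in>UNIV - {k}. g k l) = (\<Sum>l\<in>UNIV. \<Sum>k\<in>UNIV - {l}. g k l)"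
proof -
 have "(\<Sum>k\<in>UNIV. \<Sum>l\<in>UNIV - {k}. g k l) = (\<Sum>k\<in>UNIV. \<Sum>l\<in>UNIV. if k = l then 0 else g k l)"
  by (rule sum.cong[OF refl], rule sum.mono_neutral_cong_left) auto
 also have "\<dots> = (\<Sum>l\<in>UNIV. \<Sum>k\<in>UNIV. if k = l then 0 else g k l)" by (rule sum.swap)
 also have "\<dots> = (\<Sum>l\<in>UNIV. \<Sum>k\<in>UNIV - {l}. g k l)"
  by (rule sum.cong[OF refl], rule sum.mono_neutral_cong_right) auto
 finally show ?thesis .
qed

lemma sum_delta_mult:
 fixes f u :: "'b::finite \<Rightarrow> complex"
 shows "(\<Sum>k\<in>UNIV. (if i = k then u k else 0) * f k) = u i * f i"
  "(\<Sum>k\<in>UNIV. (if k = i then u k else 0) * f k) = u i * f i"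
 by (simp_all add: if_distrib[where f = "\<lambda>z. z * _"] cong: if_cong)

text \<open>
  Only permutations fixing every index outside the range of f contribute, and these come from
  permutations of the source.
\<close>

lemma det_embed:
 fixes f :: "'a::finite \<Rightarrow> 'b::finite" and M :: "'b cmat"
 assumes inj: "inj f"
  and M: "\<And>i j. i \<notin> range f \<or> j \<notin> range f \<Longrightarrow> M $ i $ j = (if i = j then 1 else 0)"
 shows "det M = det (\<chi> i j. M $ f i $ f j)"
proof -
 let ?F = "map_permutation UNIV f"
 have bij: "bij_betw ?F {p. p permutes UNIV} {p. p permutes range f}"
 proof -
  have "?F = (\<lambda>\<pi> x. if x \<in> range f then f (\<pi> (inv_into UNIV f x)) else x)"
   by (simp add: map_permutation_def restrict_id_def fun_eq_iff)
  then show ?thesis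
   using bij_betw_permutations[of f UNIV "range f"] inj by (simp add: inj_on_imp_bij_betw)
 qed
 have "det M = (\<Sum>p\<in>{p. p permutes range f}. of_int (sign p) * (\<Prod>i\<in>UNIV. M $ i $ p i))"
  unfolding det_def
 proof (rule sum.mono_neutral_right)
  show "{p. p permutes range f} \<subseteq> {p. p permutes UNIV}"
   by (auto intro: permutes_subset)
  show "\<forall>p\<in>{p. p permutes UNIV} - {p. p permutes range f}.
      of_int (sign p) * (\<Prod>i\<in>UNIV. M $ i $ p i) = 0"
  proof
   fix p assume p: "p \<in> {p. p permutes UNIV} - {p. p permutes range f}"
   have "\<exists>i. i \<notin> range f \<and> p i \<noteq> i"
   proof (rule ccontr)
    assume "\<not> ?thesis"
    then have "p permutes range f"
     using p by (auto simp: permutes_def)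
    with p show False by auto
   qed
   then obtain i where "i \<notin> range f" "p i \<noteq> i" by blast
   then have "M $ i $ p i = 0" using M[of i "p i"] by auto
   then have "(\<Prod>i\<in>UNIV. M $ i $ p i) = 0" by (metis UNIV_I finite_class.finite_UNIV prod_zero)
   then show "of_int (sign p) * (\<Prod>i\<in>UNIV. M $ i $ p i) = 0" by simp
  qed
 qed (simp add: finite_permutations)
 also have "\<dots> = (\<Sum>p\<in>{p. p permutes UNIV}. of_int (sign (?F p)) * (\<Prod>i\<in>UNIV. M $ i $ ?F p i))"
  by (rule sum.reindex_bij_betw[OF bij, symmetric])
 also have "\<dots> = (\<Sum>p\<in>{p. p permutes UNIV}. of_int (sign p) * (\<Prod>i\<in>UNIV. M $ f i $ f (p i)))"
 proof (rule sum.cong[OF refl])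
  fix p :: "'a \<Rightarrow> 'a" assume p: "p \<in> {p. p permutes UNIV}"
  have "sign (?F p) = sign p" using p inj by (intro sign_map_permutation) auto
  moreover have "(\<Prod>i\<in>UNIV. M $ i $ ?F p i) = (\<Prod>i\<in>range f. M $ i $ ?F p i)"
   by (rule prod.mono_neutral_right) (auto simp: M map_permutation_def restrict_id_def)
  moreover have "\<dots> = (\<Prod>i\<in>UNIV. M $ f i $ f (p i))"
   using inj by (subst prod.reindex) (auto simp: map_permutation_def restrict_id_def inv_into_f_f)
  ultimately show "of_int (sign (?F p)) * (\<Prod>i\<in>UNIV. M $ i $ ?F p i) =
    of_int (sign p) * (\<Prod>i\<in>UNIV. M $ f i $ f (p i))" by simp
 qed
 also have "\<dots> = det (\<chi> i j. M $ f i $ f j)"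
  unfolding det_def by simp
 finally show ?thesis .
qed

section \<open>Polynomial functions\<close>

lemma GL_iff_det: "g \<in> GL \<longleftrightarrow> det g \<noteq> 0"
 by (simp add: GL_def invertible_det_nz)

lemma mat_1_GL [simp]: "mat 1 \<in> GL" by (simp add: GL_iff_det)

lemma mult_GL [simp]: "g \<in> GL \<Longrightarrow> h \<in> GL \<Longrightarrow> g ** h \<in> GL"
 by (simp add: GL_iff_det det_mul)

lemma matrix_inv_GL: assumes "g \<in> GL" shows "g ** matrix_inv g = mat 1" "matrix_inv g ** g = mat 1"
  "matrix_inv g \<in> GL"
proof -
 show 1: "g ** matrix_inv g = mat 1" "matrix_inv g ** g = mat 1"
  using assms someI_ex[of "\<lambda>h. g ** h = mat 1 \<and> h ** g = mat 1"]
  by (simp_all add: GL_def invertible_def matrix_inv_def)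
 have "det g * det (matrix_inv g) = 1" using 1(1) by (metis det_I det_mul)
 then show "matrix_inv g \<in> GL" unfolding GL_iff_det by auto
qed

lemma det_matrix_inv: "g \<in> GL \<Longrightarrow> det (matrix_inv g) = inverse (det (g::'r::finite cmat))"
 by (metis GL_iff_det det_I det_mul inverse_unique matrix_inv_GL(1))

lemma continuous_on_det: "continuous_on S (\<lambda>g::'r::finite cmat. det g)"
 unfolding det_def by (intro continuous_intros)

lemma open_GL: "open (GL :: 'r::finite cmat set)"
proof -
 have "open ((\<lambda>g::'r cmat. det g) -` (-{0}))"
  by (rule open_vimage) (auto simp: continuous_on_det)
 moreover have "((\<lambda>g::'r cmat. det g) -` (-{0})) = GL" by (auto simp: GL_iff_det)
 ultimately show ?thesis by simp
qed

lemma polynomial_GL_sum: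
 "(\<And>i. i \<in> A \<Longrightarrow> polynomial_GL (p i)) \<Longrightarrow> polynomial_GL (\<lambda>g. \<Sum>i\<in>A. p i g)"
 by (induction A rule: infinite_finite_induct) (auto intro: polynomial_GL.intros)

lemma polynomial_GL_prod:
 "(\<And>i. i \<in> A \<Longrightarrow> polynomial_GL (p i)) \<Longrightarrow> polynomial_GL (\<lambda>g. \<Prod>i\<in>A. p i g)"
 by (induction A rule: infinite_finite_induct) (auto intro: polynomial_GL.intros)

lemma polynomial_GL_det: "polynomial_GL (\<lambda>g. det g)"
 unfolding det_def by (intro polynomial_GL_sum polynomial_GL.mult polynomial_GL_prod polynomial_GL.intros)

lemma regular_GL_const: "regular_GL (\<lambda>g. c)"
 and regular_GL_entry: "regular_GL (\<lambda>g. g $ i $ j)"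
 and regular_GL_det: "regular_GL (\<lambda>g. det g)"
 and regular_GL_inverse_det: "regular_GL (\<lambda>g. inverse (det g))"
 unfolding regular_GL_def using polynomial_GL.intros polynomial_GL_det by blast+

lemma regular_GL_add: "regular_GL p \<Longrightarrow> regular_GL q \<Longrightarrow> regular_GL (\<lambda>g. p g + q g)"
 unfolding regular_GL_def by (metis polynomial_GL.add)

lemma regular_GL_mult: "regular_GL p \<Longrightarrow> regular_GL q \<Longrightarrow> regular_GL (\<lambda>g. p g * q g)"
 unfolding regular_GL_def by (metis polynomial_GL.mult)

lemma regular_GL_cong: "(\<And>g. g \<in> GL \<Longrightarrow> p g = q g) \<Longrightarrow> regular_GL p \<longleftrightarrow> regular_GL q"
 unfolding regular_GL_def by simp

lemma regular_GL_sum: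
 "(\<And>i. i \<in> A \<Longrightarrow> regular_GL (p i)) \<Longrightarrow> regular_GL (\<lambda>g. \<Sum>i\<in>A. p i g)"
 by (induction A rule: infinite_finite_induct) (auto intro: regular_GL_add regular_GL_const)

lemma regular_GL_prod:
 "(\<And>i. i \<in> A \<Longrightarrow> regular_GL (p i)) \<Longrightarrow> regular_GL (\<lambda>g. \<Prod>i\<in>A. p i g)"
 by (induction A rule: infinite_finite_induct) (auto intro: regular_GL_mult regular_GL_const)

lemma regular_GL_power: "regular_GL p \<Longrightarrow> regular_GL (\<lambda>g. p g ^ k)"
 by (induction k) (auto intro: regular_GL_mult regular_GL_const)

lemma regular_GL_det_powi: "regular_GL (\<lambda>g. det g powi k)"
 unfolding power_int_def by (cases "0 \<le> k") (auto intro: regular_GL_power regular_GL_det regular_GL_inverse_det)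

lemma regular_GL_det_of:
 "(\<And>i j. regular_GL (\<lambda>g. M g $ i $ j)) \<Longrightarrow> regular_GL (\<lambda>g. det (M g))"
 unfolding det_def by (intro regular_GL_sum regular_GL_mult regular_GL_prod regular_GL_const)

lemma regular_GL_matrix_mult:
 "(\<And>i j. regular_GL (\<lambda>g. M g $ i $ j)) \<Longrightarrow> (\<And>i j. regular_GL (\<lambda>g. N g $ i $ j)) \<Longrightarrow>
  regular_GL (\<lambda>g. (M g ** N g) $ i $ j)"
 unfolding matrix_matrix_mult_def by (simp add: regular_GL_sum regular_GL_mult)

lemma regular_GL_matrix_inv: "regular_GL (\<lambda>g. matrix_inv g $ k $ l)"
proof -
 let ?M = "\<lambda>g::'a cmat. \<chi> i j. if j = k then axis l 1 $ i else g $ i $ j"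
 have e: "regular_GL (\<lambda>g. ?M g $ i $ j)" for i j
  by (cases "j = k") (simp_all add: regular_GL_const regular_GL_entry)
 have "matrix_inv g $ k $ l = det (?M g) * inverse (det g)" if "g \<in> GL" for g :: "'a cmat"
 proof -
  have "g *v (matrix_inv g *v axis l 1) = axis l 1"
   by (simp add: matrix_vector_mul_assoc matrix_inv_GL[OF that])
  then have "matrix_inv g *v axis l 1 = (\<chi> k. det (\<chi> i j. if j = k then axis l 1 $ i else g $ i $ j) / det g)"
   using cramer[of g] that by (simp add: GL_iff_det)
  moreover have "(matrix_inv g *v axis l 1) $ k = matrix_inv g $ k $ l"
   by (simp add: matrix_vector_mult_def axis_def if_distrib cong: if_cong)
  ultimately show ?thesis by (simp add: divide_inverse)
 qed
 moreover have "regular_GL (\<lambda>g. det (?M g) * inverse (det g))"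
  by (rule regular_GL_mult[OF regular_GL_det_of[OF e] regular_GL_inverse_det])
 ultimately show ?thesis by (subst regular_GL_cong)
qed

section \<open>Derivatives of regular functions\<close>

text \<open>
  The gradient is again made of polynomial functions, so that Lie derivatives of regular functions
  can be differentiated once more.
\<close>

definition gl_smooth :: "('r::finite cmat \<Rightarrow> complex) \<Rightarrow> bool" where
 "gl_smooth p \<longleftrightarrow> (\<exists>P. (\<forall>a b. polynomial_GL (P a b)) \<and>
   (\<forall>g\<in>GL. (p has_derivative (\<lambda>H. \<Sum>a\<in>UNIV. \<Sum>b\<in>UNIV. H $ a $ b * P a b g)) (at g)))"

lemma gl_smoothE:
 assumes "gl_smooth p"
 obtains P where "\<And>a b. polynomial_GL (P a b)" "\<And>g. g \<in> GL \<Longrightarrow>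
   (p has_derivative (\<lambda>H. \<Sum>a\<in>UNIV. \<Sum>b\<in>UNIV. H $ a $ b * P a b g)) (at g)"
 using assms unfolding gl_smooth_def by auto

lemma gl_smooth_const: "gl_smooth (\<lambda>g. c)"
 unfolding gl_smooth_def
 by (rule exI[of _ "\<lambda>a b g. 0"]) (auto intro: polynomial_GL.const)

lemma gl_smooth_entry: "gl_smooth (\<lambda>g. g $ i $ j)"
 unfolding gl_smooth_def
proof (rule exI[of _ "\<lambda>a b g. if a = i \<and> b = j then 1 else 0"], intro conjI allI ballI)
 fix a b show "polynomial_GL (\<lambda>g. if a = i \<and> b = j then 1 else 0 :: complex)"
  by (rule polynomial_GL.const)
next
 fix g :: "'a cmat"
 have "(\<Sum>a\<in>UNIV. \<Sum>b\<in>UNIV. H $ a $ b * (if a = i \<and> b = j then 1 else 0)) = H $ i $ j" for H :: "'a cmat"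
 proof -
  have "H $ a $ b * (if a = i \<and> b = j then 1 else 0) =
    (if b = j then (if a = i then H $ i $ j else 0) else 0)" for a b by simp
  then show ?thesis by simp
 qed
 moreover have "((\<lambda>g::'a cmat. g $ i $ j) has_derivative (\<lambda>H. H $ i $ j)) (at g)"
  by (intro bounded_linear.has_derivative[OF bounded_linear_vec_nth] has_derivative_ident)
 ultimately show "((\<lambda>g. g $ i $ j) has_derivative
   (\<lambda>H. \<Sum>a\<in>UNIV. \<Sum>b\<in>UNIV. H $ a $ b * (if a = i \<and> b = j then 1 else 0))) (at g)" by simp
qed

lemma gl_smooth_add: assumes "gl_smooth p" "gl_smooth q" shows "gl_smooth (\<lambda>g. p g + q g)"
proof -
 obtain P where P: "\<And>a b. polynomial_GL (P a b)" "\<And>g. g \<in> GL \<Longrightarrow>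
   (p has_derivative (\<lambda>H. \<Sum>a\<in>UNIV. \<Sum>b\<in>UNIV. H $ a $ b * P a b g)) (at g)"
  by (rule gl_smoothE[OF assms(1)]) blast
 obtain Q where Q: "\<And>a b. polynomial_GL (Q a b)" "\<And>g. g \<in> GL \<Longrightarrow>
   (q has_derivative (\<lambda>H. \<Sum>a\<in>UNIV. \<Sum>b\<in>UNIV. H $ a $ b * Q a b g)) (at g)"
  by (rule gl_smoothE[OF assms(2)]) blast
 show ?thesis unfolding gl_smooth_def
 proof (rule exI[of _ "\<lambda>a b g. P a b g + Q a b g"], intro conjI allI ballI)
  fix g :: "'a cmat" assume g: "g \<in> GL"
  show "((\<lambda>g. p g + q g) has_derivative
    (\<lambda>H. \<Sum>a\<in>UNIV. \<Sum>b\<in>UNIV. H $ a $ b * (P a b g + Q a b g))) (at g)"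
   by (rule has_derivative_eq_rhs[OF has_derivative_add[OF P(2)[OF g] Q(2)[OF g]]])
     (simp add: algebra_simps sum.distrib)
 qed (rule polynomial_GL.add[OF P(1) Q(1)])
qed

lemma gl_smooth_mult: assumes "gl_smooth p" "gl_smooth q" "polynomial_GL p" "polynomial_GL q"
 shows "gl_smooth (\<lambda>g. p g * q g)"
proof -
 obtain P where P: "\<And>a b. polynomial_GL (P a b)" "\<And>g. g \<in> GL \<Longrightarrow>
   (p has_derivative (\<lambda>H. \<Sum>a\<in>UNIV. \<Sum>b\<in>UNIV. H $ a $ b * P a b g)) (at g)"
  by (rule gl_smoothE[OF assms(1)]) blast
 obtain Q where Q: "\<And>a b. polynomial_GL (Q a b)" "\<And>g. g \<in> GL \<Longrightarrow>
   (q has_derivative (\<lambda>H. \<Sum>a\<in>UNIV. \<Sum>b\<in>UNIV. H $ a $ b * Q a b g)) (at g)"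
  by (rule gl_smoothE[OF assms(2)]) blast
 show ?thesis unfolding gl_smooth_def
 proof (rule exI[of _ "\<lambda>a b g. p g * Q a b g + P a b g * q g"], intro conjI allI ballI)
  fix g :: "'a cmat" assume g: "g \<in> GL"
  show "((\<lambda>g. p g * q g) has_derivative
    (\<lambda>H. \<Sum>a\<in>UNIV. \<Sum>b\<in>UNIV. H $ a $ b * (p g * Q a b g + P a b g * q g))) (at g)"
   by (rule has_derivative_eq_rhs[OF has_derivative_mult[OF P(2)[OF g] Q(2)[OF g]]])
     (simp add: algebra_simps sum.distrib sum_distrib_left)
 qed (intro polynomial_GL.add polynomial_GL.mult assms P(1) Q(1))
qed

lemma gl_smooth_sum:
 "(\<And>i. i \<in> A \<Longrightarrow> gl_smooth (p i)) \<Longrightarrow> gl_smooth (\<lambda>g. \<Sum>i\<in>A. p i g)"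
 by (induction A rule: infinite_finite_induct) (auto intro: gl_smooth_add gl_smooth_const)

lemma gl_smooth_prod:
 "(\<And>i. i \<in> A \<Longrightarrow> gl_smooth (p i)) \<Longrightarrow> (\<And>i. i \<in> A \<Longrightarrow> polynomial_GL (p i)) \<Longrightarrow>
  gl_smooth (\<lambda>g. \<Prod>i\<in>A. p i g)"
 by (induction A rule: infinite_finite_induct)
   (simp_all add: gl_smooth_mult gl_smooth_const polynomial_GL_prod)

lemma gl_smooth_det: "gl_smooth (\<lambda>g. det g)"
 unfolding det_def
 by (intro gl_smooth_sum gl_smooth_mult gl_smooth_prod gl_smooth_const gl_smooth_entry
    polynomial_GL_prod polynomial_GL.intros)

lemma gl_smooth_inverse_det: "gl_smooth (\<lambda>g. inverse (det g))"
proof -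
 obtain P where P: "\<And>a b. polynomial_GL (P a b)" "\<And>g. g \<in> GL \<Longrightarrow>
   (det has_derivative (\<lambda>H. \<Sum>a\<in>UNIV. \<Sum>b\<in>UNIV. H $ a $ b * P a b g)) (at (g::'a cmat))"
  by (rule gl_smoothE[OF gl_smooth_det]) blast
 show ?thesis unfolding gl_smooth_def
 proof (rule exI[of _ "\<lambda>a b g. (- 1) * (inverse (det g) * (P a b g * inverse (det g)))"],
   intro conjI allI ballI)
  fix g :: "'a cmat" assume g: "g \<in> GL"
  then have "det g \<noteq> 0" by (simp add: GL_iff_det)
  then show "((\<lambda>g. inverse (det g)) has_derivative
    (\<lambda>H. \<Sum>a\<in>UNIV. \<Sum>b\<in>UNIV. H $ a $ b * (- 1 * (inverse (det g) * (P a b g * inverse (det g)))))) (at g)"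
   by (rule has_derivative_eq_rhs[OF Deriv.has_derivative_inverse[OF _ P(2)[OF g]]])
     (simp add: algebra_simps sum_distrib_left sum_negf)
 qed (intro polynomial_GL.mult polynomial_GL.const polynomial_GL.inverse_det P(1))
qed

lemma gl_smooth_polynomial: "polynomial_GL p \<Longrightarrow> gl_smooth p"
 by (induction rule: polynomial_GL.induct)
   (auto intro: gl_smooth_const gl_smooth_entry gl_smooth_inverse_det gl_smooth_add gl_smooth_mult)

text \<open>
  The Frechet derivative of p at g in the direction H. It is complex linear, and the derivative of p
  along any holomorphic curve is read off from it.
\<close>

definition dder :: "('r::finite cmat \<Rightarrow> complex) \<Rightarrow> 'r cmat \<Rightarrow> 'r cmat \<Rightarrow> complex" where
 "dder p g H = frechet_derivative p (at g) H"

lemma regular_GL_gradient: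
 assumes "regular_GL p"
 obtains P where "\<And>a b. polynomial_GL (P a b)"
  "\<And>g. g \<in> GL \<Longrightarrow> (p has_derivative dder p g) (at g)"
  "\<And>g H. g \<in> GL \<Longrightarrow> dder p g H = (\<Sum>a\<in>UNIV. \<Sum>b\<in>UNIV. H $ a $ b * P a b g)"
proof -
 obtain q where q: "polynomial_GL q" "\<And>g. g \<in> GL \<Longrightarrow> p g = q g"
  using assms unfolding regular_GL_def by blast
 obtain P where P: "\<And>a b. polynomial_GL (P a b)" "\<And>g. g \<in> GL \<Longrightarrow>
   (q has_derivative (\<lambda>H. \<Sum>a\<in>UNIV. \<Sum>b\<in>UNIV. H $ a $ b * P a b g)) (at g)"
  by (rule gl_smoothE[OF gl_smooth_polynomial[OF q(1)]]) blast
 have *: "(p has_derivative (\<lambda>H. \<Sum>a\<in>UNIV. \<Sum>b\<in>UNIV. H $ a $ b * P a b g)) (at g)" if "g \<in> GL" for g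
  by (rule has_derivative_transform_within_open[OF P(2)[OF that] open_GL that]) (simp add: q)
 then have **: "dder p g = (\<lambda>H. \<Sum>a\<in>UNIV. \<Sum>b\<in>UNIV. H $ a $ b * P a b g)" if "g \<in> GL" for g
  using frechet_derivative_at[OF *[OF that]] that by (simp add: dder_def[abs_def])
 show ?thesis
  by (rule that[of P]) (use P(1) * ** in auto)
qed

lemma dder_has_derivative: "regular_GL p \<Longrightarrow> g \<in> GL \<Longrightarrow> (p has_derivative dder p g) (at g)"
 by (erule regular_GL_gradient) blast

lemma regular_GL_dder:
 assumes "regular_GL p" "\<And>a b. regular_GL (\<lambda>g. M g $ a $ b)"
 shows "regular_GL (\<lambda>g. dder p g (M g))"
proof -
 obtain P where P: "\<And>a b. polynomial_GL (P a b)"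
  "\<And>g H. g \<in> GL \<Longrightarrow> dder p g H = (\<Sum>a\<in>UNIV. \<Sum>b\<in>UNIV. H $ a $ b * P a b g)"
  by (rule regular_GL_gradient[OF assms(1)]) blast
 have "regular_GL (\<lambda>g. \<Sum>a\<in>UNIV. \<Sum>b\<in>UNIV. M g $ a $ b * P a b g)"
  by (intro regular_GL_sum regular_GL_mult assms) (use P(1) in \<open>auto simp: regular_GL_def\<close>)
 then show ?thesis by (subst regular_GL_cong[OF P(2)]) auto
qed

lemma dder_add: "regular_GL p \<Longrightarrow> g \<in> GL \<Longrightarrow> dder p g (H + K) = dder p g H + dder p g K"
 by (erule regular_GL_gradient) (simp add: algebra_simps sum.distrib)

lemma dder_scale: "regular_GL p \<Longrightarrow> g \<in> GL \<Longrightarrow> dder p g (\<chi> i j. c * H $ i $ j) = c * dder p g H"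
 by (erule regular_GL_gradient) (simp add: algebra_simps sum_distrib_left)

lemma dder_diff: "regular_GL p \<Longrightarrow> g \<in> GL \<Longrightarrow> dder p g (H - K) = dder p g H - dder p g K"
 by (erule regular_GL_gradient) (simp add: algebra_simps sum_subtractf)

lemma dder_0: "regular_GL p \<Longrightarrow> g \<in> GL \<Longrightarrow> dder p g 0 = 0"
 by (erule regular_GL_gradient) simp

lemma dder_curve:
 assumes "regular_GL p" "c z \<in> GL"
  and c: "\<And>a b. DERIV (\<lambda>z. c z $ a $ b) z :> c' $ a $ b"
 shows "DERIV (\<lambda>z. p (c z)) z :> dder p (c z) c'"
proof -
 have "(c has_derivative (\<lambda>h. \<chi> a b. c' $ a $ b * h)) (at z)"
  by (subst has_derivative_componentwise_within)
    (use c in \<open>auto simp: has_field_derivative_def Basis_vec_def inner_axis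
     intro!: derivative_intros\<close>)
 then have "((\<lambda>z. p (c z)) has_derivative (\<lambda>h. dder p (c z) (\<chi> a b. c' $ a $ b * h))) (at z)"
  by (rule has_derivative_compose[where g = p and f = c, OF _ dder_has_derivative[OF assms(1,2)]])
 moreover have "(\<lambda>h. dder p (c z) (\<chi> a b. c' $ a $ b * h)) = (*) (dder p (c z) c')"
  using dder_scale[OF assms(1,2), of _ c'] by (auto simp: mult.commute)
 ultimately show ?thesis by (simp add: has_field_derivative_def)
qed

lemma dder_unique_curve:
 assumes "regular_GL p" "c z \<in> GL"
  and c: "\<And>a b. DERIV (\<lambda>z. c z $ a $ b) z :> c' $ a $ b"
  and "DERIV (\<lambda>z. p (c z)) z :> d"
 shows "dder p (c z) c' = d"
 using DERIV_unique[OF dder_curve[OF assms(1-3)] assms(4)] .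

section \<open>Minors and triangular factorization\<close>

lemma permutes_increasing_id:
 fixes p :: "'r::{finite,linorder} \<Rightarrow> 'r"
 assumes p: "p permutes UNIV" and le: "\<And>i. i \<le> p i"
 shows "p = id"
proof -
 have mono: "card {..<i} \<le> card {..<p i}" for i
  by (rule card_mono) (use le[of i] in auto)
 have eq: "(\<Sum>i\<in>UNIV. card {..<p i}) = (\<Sum>i\<in>(UNIV::'r set). card {..<i})"
  using sum.permute[OF p, of "\<lambda>i. card {..<i}"] unfolding o_def by (rule sym)
 have "card {..<p i} = card {..<i}" for i
 proof (rule ccontr)
  assume "card {..<p i} \<noteq> card {..<i}"
  then have "card {..<i} < card {..<p i}" using mono[of i] by simp
  then have "(\<Sum>i\<in>(UNIV::'r set). card {..<i}) < (\<Sum>i\<in>UNIV. card {..<p i})"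
   using mono by (intro sum_strict_mono_ex1) auto
  with eq show False by simp
 qed
 moreover have "card {..<i} < card {..<p i}" if "i < p i" for i
  by (rule psubset_card_mono) (use that in auto)
 ultimately show ?thesis using le by (metis eq_id_iff le_neq_trans nat_less_le)
qed

lemma det_upper_triangular:
 fixes A :: "'r::{finite,linorder} cmat"
 assumes "\<And>i j. j < i \<Longrightarrow> A $ i $ j = 0"
 shows "det A = (\<Prod>i\<in>UNIV. A $ i $ i)"
proof -
 have "det A = (\<Sum>p\<in>{id}. of_int (sign p) * (\<Prod>i\<in>UNIV. A $ i $ p i))"
  unfolding det_def
 proof (rule sum.mono_neutral_right)
  show "\<forall>p\<in>{p. p permutes UNIV} - {id}. of_int (sign p) * (\<Prod>i\<in>UNIV. A $ i $ p i) = 0"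
  proof
   fix p :: "'r \<Rightarrow> 'r" assume p: "p \<in> {p. p permutes UNIV} - {id}"
   then obtain i where "\<not> i \<le> p i" using permutes_increasing_id[of p] by auto
   then have "A $ i $ p i = 0" using assms by auto
   then have "(\<Prod>i\<in>UNIV. A $ i $ p i) = 0" by (metis UNIV_I finite_class.finite_UNIV prod_zero)
   then show "of_int (sign p) * (\<Prod>i\<in>UNIV. A $ i $ p i) = 0" by simp
  qed
 qed (auto simp: permutes_id)
 then show ?thesis by simp
qed

lemma det_lower_triangular:
 fixes A :: "'r::{finite,linorder} cmat"
 assumes "\<And>i j. i < j \<Longrightarrow> A $ i $ j = 0"
 shows "det A = (\<Prod>i\<in>UNIV. A $ i $ i)"
 using det_upper_triangular[of "transpose A"] assms by (simp add: transpose_def det_transpose[unfolded transpose_def])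

definition mask :: "'r::finite set \<Rightarrow> 'r cmat \<Rightarrow> 'r cmat" where
 "mask A g = (\<chi> i j. if i \<in> A \<and> j \<in> A then g $ i $ j else if i = j then 1 else 0)"

text \<open>
  The determinant of the submatrix with rows and columns in A, as a determinant of full size, so
  that A can vary inside a statement.
\<close>

definition minor :: "'r::finite set \<Rightarrow> 'r cmat \<Rightarrow> complex" where
 "minor A g = det (mask A g)"

lemma mask_mult_left:
 assumes "\<And>i j. i \<in> A \<Longrightarrow> j \<notin> A \<Longrightarrow> L $ i $ j = 0"
 shows "mask A (L ** g) = mask A L ** mask A g"
proof -
 have "mask A (L ** g) $ i $ j = (\<Sum>k\<in>UNIV. mask A L $ i $ k * mask A g $ k $ j)" for i j
 proof (cases "i \<in> A \<and> j \<in> A")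
  case True
  then have "mask A L $ i $ k * mask A g $ k $ j = L $ i $ k * g $ k $ j" for k
   using assms by (auto simp: mask_def)
  then show ?thesis using True by (simp add: mask_def matrix_matrix_mult_def)
 next
  case False
  show ?thesis
  proof (cases "i \<in> A")
   case True
   then have "mask A L $ i $ k * mask A g $ k $ j = 0" for k
    using False by (auto simp: mask_def)
   then have "(\<Sum>k\<in>UNIV. mask A L $ i $ k * mask A g $ k $ j) = 0" by (rule sum.neutral[OF ballI])
   then show ?thesis using True False by (auto simp: mask_def)
  next
   case i: False
   have "(\<Sum>k\<in>UNIV. mask A L $ i $ k * mask A g $ k $ j) =
     (\<Sum>k\<in>UNIV. if k = i then mask A g $ i $ j else 0)"
    by (rule sum.cong) (use i in \<open>auto simp: mask_def\<close>)
   then show ?thesis using i by (simp add: mask_def)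
  qed
 qed
 then show ?thesis by (simp add: vec_eq_iff matrix_matrix_mult_def)
qed

lemma mask_transpose: "mask A (transpose g) = transpose (mask A g)"
 by (auto simp: mask_def transpose_def vec_eq_iff)

text \<open>
  Where the rows of L in A are supported on columns in A, masking is multiplicative.
\<close>

lemma minor_mult_left:
 assumes "\<And>i j. i \<in> A \<Longrightarrow> j \<notin> A \<Longrightarrow> L $ i $ j = 0"
 shows "minor A (L ** g) = minor A L * minor A g"
 unfolding minor_def by (subst mask_mult_left[OF assms]) (auto simp: det_mul)

lemma minor_transpose: "minor A (transpose g) = minor A g"
 by (simp add: minor_def mask_transpose det_transpose)

lemma minor_mult_right:
 assumes "\<And>i j. i \<notin> A \<Longrightarrow> j \<in> A \<Longrightarrow> p $ i $ j = 0"
 shows "minor A (g ** p) = minor A g * minor A p"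
proof -
 have "minor A (g ** p) = minor A (transpose p ** transpose g)"
  using minor_transpose[of A "g ** p"] by (simp add: matrix_transpose_mul)
 also have "\<dots> = minor A p * minor A g"
  by (subst minor_mult_left) (use assms in \<open>auto simp: transpose_def minor_transpose[unfolded transpose_def]\<close>)
 finally show ?thesis by simp
qed

lemma minor_mat_1 [simp]: "minor A (mat 1) = 1"
proof -
 have "mask A (mat 1) = mat 1" by (auto simp: mask_def mat_def vec_eq_iff)
 then show ?thesis by (simp add: minor_def)
qed

lemma minor_UNIV: "minor UNIV g = det g"
 by (simp add: minor_def mask_def vec_lambda_eta)

lemma minor_upper:
 fixes A :: "'r::{finite,linorder} set"
 assumes "\<And>i j. i \<in> A \<Longrightarrow> j \<in> A \<Longrightarrow> j < i \<Longrightarrow> b $ i $ j = 0"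
 shows "minor A b = (\<Prod>i\<in>A. b $ i $ i)"
proof -
 have "minor A b = (\<Prod>i\<in>UNIV. mask A b $ i $ i)"
  unfolding minor_def by (rule det_upper_triangular) (use assms in \<open>auto simp: mask_def\<close>)
 also have "\<dots> = (\<Prod>i\<in>A. b $ i $ i)"
  by (rule prod.mono_neutral_cong_right) (auto simp: mask_def)
 finally show ?thesis .
qed

lemma minor_singleton: "minor {i} g = g $ i $ (i::'r::{finite,linorder})"
 by (subst minor_upper) auto

lemma continuous_on_minor: "continuous_on S (\<lambda>g. minor A g)"
proof -
 have "minor A g = det (\<chi> i j. if i \<in> A \<and> j \<in> A then g $ i $ j else if i = j then 1 else 0)" for g
  by (simp add: minor_def mask_def)
 moreover have "continuous_on S (\<lambda>g. (\<chi> i j. if i \<in> A \<and> j \<in> A then g $ i $ j else if i = j then 1 else 0) :: 'a cmat)"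
 proof (intro continuous_on_vec_lambda)
  fix i j show "continuous_on S (\<lambda>g::'a cmat. if i \<in> A \<and> j \<in> A then g $ i $ j else if i = j then 1 else 0)"
   by (cases "i \<in> A \<and> j \<in> A") (auto intro!: continuous_intros)
 qed
 ultimately show ?thesis
  using continuous_on_compose2[OF continuous_on_det[of UNIV]] by auto
qed

text \<open>
  Along this line every minor is a nonzero polynomial in the parameter, because it equals 1 at the
  identity. Hence every matrix is a limit of invertible matrices with nonvanishing minors, which is
  how identities pass from the big cell to all of GL.
\<close>

definition path_to_1 :: "'r::finite cmat \<Rightarrow> complex \<Rightarrow> 'r cmat" where
 "path_to_1 g s = (\<chi> i j. g $ i $ j + s * (mat 1 $ i $ j - g $ i $ j))"

lemma path_to_1_tendsto: "(path_to_1 g \<longlongrightarrow> g) (at 0)"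
proof -
 have "((\<lambda>s. path_to_1 g s $ i $ j) \<longlongrightarrow> g $ i $ j + 0 * (mat 1 $ i $ j - g $ i $ j)) (at 0)" for i j
  unfolding path_to_1_def by (simp only: vec_lambda_beta) (intro tendsto_intros)
 then show ?thesis by (intro vec_tendstoI) simp
qed

lemma eventually_minor_path: "\<forall>\<^sub>F s in at 0. minor A (path_to_1 g s) \<noteq> 0"
proof -
 define e where "e i j = (if i \<in> A \<and> j \<in> A then [:g $ i $ j, mat 1 $ i $ j - g $ i $ j:] else if i = j then 1 else 0)" for i j
 define q where "q = (\<Sum>p\<in>{p. p permutes (UNIV::'a set)}. of_int (sign p) * (\<Prod>i\<in>UNIV. e i (p i)))"
 have "mask A (path_to_1 g s) $ i $ j = poly (e i j) s" for s i j
  by (auto simp: mask_def path_to_1_def e_def)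
 then have q: "minor A (path_to_1 g s) = poly q s" for s
  by (simp add: minor_def det_def q_def poly_sum poly_prod of_int_poly)
 have "path_to_1 g 1 = mat 1" by (simp add: path_to_1_def vec_eq_iff)
 then have "poly q 1 = 1" using q[of 1] by simp
 then have "q \<noteq> 0" by auto
 then have "finite {s. poly q s = 0}" by (rule poly_roots_finite)
 then have "\<forall>\<^sub>F s in at 0. s \<notin> {s. poly q s = 0}"
  using islimpt_finite islimpt_iff_eventually by blast
 then show ?thesis by eventually_elim (simp add: q)
qed

definition unilower :: "'r::{finite,linorder} cmat \<Rightarrow> bool" where
 "unilower L \<longleftrightarrow> (\<forall>i. L $ i $ i = 1) \<and> (\<forall>i j. i < j \<longrightarrow> L $ i $ j = 0)"

lemma unilower_mat_1: "unilower (mat 1)"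
 by (auto simp: unilower_def mat_def)

lemma unilower_mult: assumes "unilower L" "unilower M" shows "unilower (L ** M)"
proof -
 have z: "L $ i $ k * M $ k $ j = 0" if "i < j" for i j k
  using assms that by (cases "i < k") (auto simp: unilower_def)
 have d: "(\<Sum>k\<in>UNIV. L $ i $ k * M $ k $ i) = 1" for i
 proof -
  have "L $ i $ k * M $ k $ i = (if k = i then 1 else 0)" for k
   using assms by (cases k i rule: linorder_cases) (auto simp: unilower_def)
  then show ?thesis by simp
 qed
 have "(\<Sum>k\<in>UNIV. L $ i $ k * M $ k $ j) = 0" if "i < j" for i j
  by (rule sum.neutral) (use z[OF that] in blast)
 then show ?thesis using d by (simp add: unilower_def matrix_matrix_mult_def)
qed

lemma unilower_det: "unilower L \<Longrightarrow> det L = 1"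
 by (subst det_lower_triangular) (auto simp: unilower_def)

lemma unilower_GL: "unilower L \<Longrightarrow> L \<in> GL"
 by (simp add: GL_iff_det unilower_det)

lemma minor_unilower: "unilower L \<Longrightarrow> minor A L = 1"
 unfolding minor_def by (subst det_lower_triangular) (auto simp: unilower_def mask_def intro!: prod.neutral)

lemma matrix_diff_ldistrib': "(A::'r::finite cmat) ** (B - C) = A ** B - A ** C"
 by (simp add: matrix_matrix_mult_def vec_eq_iff algebra_simps sum_subtractf)

lemma matrix_diff_rdistrib': "((B::'r::finite cmat) - C) ** A = B ** A - C ** A"
 by (simp add: matrix_matrix_mult_def vec_eq_iff algebra_simps sum_subtractf)

lemma matrix_add_rdistrib': "((B::'r::finite cmat) + C) ** A = B ** A + C ** A"
 by (simp add: matrix_matrix_mult_def vec_eq_iff algebra_simps sum.distrib)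

text \<open>
  Gaussian elimination column by column. The leading minor through column b is the product of the
  diagonal entries reached so far, so each pivot is nonzero.
\<close>

lemma LU_factorization:
 fixes g :: "'r::{finite,linorder} cmat"
 assumes nz: "\<And>b. minor {..b} g \<noteq> 0"
 shows "\<exists>L b. unilower L \<and> (\<forall>i j. j < i \<longrightarrow> b $ i $ j = 0) \<and> g = L ** b"
proof -
 have "(\<forall>a\<in>A. \<forall>x<a. x \<in> A) \<Longrightarrow> \<exists>L h. unilower L \<and> (\<forall>j\<in>A. \<forall>i>j. h $ i $ j = 0) \<and> g = L ** h"
  if "finite A" for A :: "'r set"
  using that
 proof (induction A rule: finite_linorder_max_induct)
  case empty
  show ?case by (rule exI[of _ "mat 1"], rule exI[of _ g]) (simp add: unilower_mat_1)
 next
  case (insert b A)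
  have A: "A = {..<b}" using insert.hyps insert.prems by auto
  have "\<forall>a\<in>A. \<forall>x<a. x \<in> A" unfolding A by auto
  from insert.IH[OF this] obtain L h where L: "unilower L" and h': "\<forall>j\<in>A. \<forall>i>j. h $ i $ j = 0"
   and g: "g = L ** h" by blast
  from h' have h: "h $ i $ j = 0" if "j < b" "j < i" for i j using that unfolding A by blast
  have "minor {..b} g = minor {..b} L * minor {..b} h"
   unfolding g by (rule minor_mult_left) (use L in \<open>auto simp: unilower_def\<close>)
  also have "\<dots> = (\<Prod>i\<in>{..b}. h $ i $ i)"
   by (subst minor_upper) (use h in \<open>auto simp: minor_unilower[OF L]\<close>)
  finally have pivot: "h $ b $ b \<noteq> 0" using nz[of b] by auto
  \<comment> \<open>the elimination matrix of column b; it squares to zero, so \<open>1 + C\<close> and \<open>1 - C\<close> are inverse to each other\<close>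
  define C :: "'r cmat" where "C = (\<chi> i j. if j = b \<and> b < i then h $ i $ b / h $ b $ b else 0)"
  have CC: "C ** C = 0" by (auto simp: C_def matrix_matrix_mult_def vec_eq_iff intro!: sum.neutral)
  have Ch: "(C ** h) $ i $ j = (if b < i then h $ i $ b / h $ b $ b * h $ b $ j else 0)" for i j
  proof -
   have "C $ i $ k * h $ k $ j = (if k = b then (if b < i then h $ i $ b / h $ b $ b * h $ b $ j else 0) else 0)" for k
    by (auto simp: C_def)
   then show ?thesis by (simp add: matrix_matrix_mult_def)
  qed
  have one: "(mat 1 + C) ** (mat 1 - C) = mat 1"
   by (simp add: matrix_add_ldistrib matrix_add_rdistrib' matrix_diff_ldistrib' matrix_diff_rdistrib' CC)
  show ?case
  proof (rule exI[of _ "L ** (mat 1 + C)"], rule exI[of _ "(mat 1 - C) ** h"], intro conjI ballI allI impI)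
   show "unilower (L ** (mat 1 + C))"
    by (rule unilower_mult[OF L]) (auto simp: unilower_def C_def mat_def)
   show "g = L ** (mat 1 + C) ** ((mat 1 - C) ** h)"
    using one by (metis g matrix_mul_assoc matrix_mul_lid)
   fix j i assume j: "j \<in> insert b A" "j < i"
   have "((mat 1 - C) ** h) $ i $ j = h $ i $ j - (C ** h) $ i $ j"
    by (simp add: matrix_diff_rdistrib')
   then show "((mat 1 - C) ** h) $ i $ j = 0"
    using j pivot h[of j i] h[of j b] unfolding Ch A by auto
  qed
 qed
 from this[of UNIV] obtain L h where "unilower L" "\<forall>j\<in>UNIV. \<forall>i>j. h $ i $ j = 0" "g = L ** h" by auto
 then show ?thesis by blast
qed

section \<open>Representations with a highest weight\<close>

definition dot :: "'d::finite cvec \<Rightarrow> 'd cvec \<Rightarrow> complex" where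
 "dot v w = (\<Sum>i\<in>UNIV. v $ i * w $ i)"

lemma dot_add: "dot v (w + w') = dot v w + dot v w'" "dot (v + v') w = dot v w + dot v' w"
 and dot_scale: "dot v (c *s w) = c * dot v w" "dot (c *s v) w = c * dot v w"
 and dot_diff: "dot v (w - w') = dot v w - dot v w'"
 and dot_zero: "dot v 0 = 0" "dot 0 w = 0"
 by (simp_all add: dot_def algebra_simps sum.distrib sum_distrib_left sum_subtractf)

lemma dot_sum: "dot v (\<Sum>i\<in>A. w i) = (\<Sum>i\<in>A. dot v (w i))"
 by (induction A rule: infinite_finite_induct) (simp_all add: dot_zero dot_add)

lemma dot_sum_left: "dot (\<Sum>i\<in>A. v i) w = (\<Sum>i\<in>A. dot (v i) w)"
 by (induction A rule: infinite_finite_induct) (simp_all add: dot_zero dot_add)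

lemma dot_axis: "dot (axis i 1) w = w $ i"
proof -
 have "axis i 1 $ k * w $ k = (if k = i then w $ i else 0)" for k by (simp add: axis_def)
 then show ?thesis by (simp add: dot_def)
qed

lemma dot_matrix: "dot v (M *v w) = dot (v v* M) w"
 unfolding dot_def matrix_vector_mult_def vector_matrix_mult_def
 by (simp add: sum_distrib_left sum_distrib_right mult_ac) (rule sum.swap)

lemma mv_scale: "M *v (c *s v) = c *s (M *v (v::'a::finite cvec))"
 by (simp add: vec_eq_iff matrix_vector_mult_def sum_distrib_left mult_ac)

lemma mv_sum: "M *v (\<Sum>i\<in>A. v i) = (\<Sum>i\<in>A. M *v (v i :: 'a::finite cvec))"
 by (induction A rule: infinite_finite_induct) (simp_all add: matrix_vector_right_distrib)

lemma representation_dot: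
 fixes B :: "'d::finite cvec set"
 assumes B: "vec.independent B" "vec.span B = UNIV"
 shows "vec.representation B v b = dot (\<chi> i. vec.representation B (axis i 1) b) v"
proof -
 have "v = (\<Sum>i\<in>UNIV. v $ i *s axis i 1)"
  by (simp add: vec_eq_iff axis_def if_distrib cong: if_cong)
 then have "vec.representation B v b = vec.representation B (\<Sum>i\<in>UNIV. v $ i *s axis i 1) b" by simp
 also have "\<dots> = (\<Sum>i\<in>UNIV. v $ i * vec.representation B (axis i 1) b)"
  by (subst vec.representation_sum) (simp_all add: B vec.representation_scale)
 finally show ?thesis by (simp add: dot_def mult.commute)
qed

lemma proper_subspace_annihilated:
 fixes S :: "'d::finite cvec set"
 assumes S: "vec.subspace S" "S \<noteq> UNIV"
 shows "\<exists>w. w \<noteq> 0 \<and> (\<forall>x\<in>S. dot x w = 0)"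
proof -
 obtain B where B: "B \<subseteq> S" "vec.independent B" "S \<subseteq> vec.span B"
  using vec.maximal_independent_subset[of S] by auto
 have spanB: "vec.span B = S" using B S(1) by (simp add: vec.span_minimal subset_antisym)
 obtain B' where B': "B \<subseteq> B'" "vec.independent B'" "vec.span B' = UNIV"
  using vec.maximal_independent_subset_extend[OF subset_UNIV B(2)] by (metis UNIV_I subsetI subset_antisym subset_UNIV)
 obtain b where b: "b \<in> B'" "b \<notin> B" using B' spanB S(2) by (metis subset_antisym subsetI)
 define w where "w = (\<chi> i. vec.representation B' (axis i 1) b)"
 have w: "dot x w = vec.representation B' x b" for x
  using representation_dot[OF B'(2,3), of x b] by (simp add: w_def dot_def mult.commute)
 have "dot x w = 0" if "x \<in> S" for x
 proof -
  have "vec.representation B' x = vec.representation B x"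
   using that spanB B'(1,2) by (intro vec.representation_extend) auto
  then show ?thesis using b(2) vec.representation_ne_zero[of B x b] by (auto simp: w)
 qed
 moreover have "dot b w = 1" using b(1) B'(2) by (simp add: w vec.representation_basis)
 then have "w \<noteq> 0" by (auto simp: dot_zero)
 ultimately show ?thesis by blast
qed

lemma rational_rep_mult: "rational_rep \<rho> \<Longrightarrow> g \<in> GL \<Longrightarrow> h \<in> GL \<Longrightarrow> \<rho> (g ** h) = \<rho> g ** \<rho> h"
 and rational_rep_one: "rational_rep \<rho> \<Longrightarrow> \<rho> (mat 1) = mat 1"
 and rational_rep_regular: "rational_rep \<rho> \<Longrightarrow> regular_GL (\<lambda>g. \<rho> g $ i $ j)"
 unfolding rational_rep_def by auto

lemma regular_GL_tendsto:
 assumes "regular_GL p" "g \<in> GL" "(c \<longlongrightarrow> g) F"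
 shows "((\<lambda>s. p (c s)) \<longlongrightarrow> p g) F"
proof -
 have "isCont p g" using dder_has_derivative[OF assms(1,2)] has_derivative_continuous by blast
 then show ?thesis using assms(3) by (rule isCont_tendsto_compose)
qed

lemma rational_rep_tendsto:
 assumes \<rho>: "rational_rep \<rho>" and g: "g \<in> GL" "(c \<longlongrightarrow> g) F"
 shows "((\<lambda>s. \<rho> (c s) *v v) \<longlongrightarrow> \<rho> g *v v) F"
proof (rule vec_tendstoI)
 fix i
 have "((\<lambda>s. \<Sum>j\<in>UNIV. \<rho> (c s) $ i $ j * v $ j) \<longlongrightarrow> (\<Sum>j\<in>UNIV. \<rho> g $ i $ j * v $ j)) F"
  by (intro tendsto_sum tendsto_mult_right regular_GL_tendsto[OF rational_rep_regular[OF \<rho>] g])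
 then show "((\<lambda>s. (\<rho> (c s) *v v) $ i) \<longlongrightarrow> (\<rho> g *v v) $ i) F"
  by (simp add: matrix_vector_mult_def)
qed

lemma eventually_path_LU:
 "\<forall>\<^sub>F s in at 0. \<forall>b. minor {..b} (path_to_1 g s) \<noteq> 0"
 by (rule eventually_all_finite) (rule eventually_minor_path)

lemma eventually_path_GL: "\<forall>\<^sub>F s in at 0. path_to_1 g s \<in> GL"
 using eventually_minor_path[of UNIV g] by (simp add: minor_UNIV GL_iff_det)

text \<open>
  The span of an orbit is invariant.
\<close>

lemma irreducible_span:
 assumes \<rho>: "irreducible_rep \<rho>" and v: "v \<noteq> 0"
 shows "vec.span {\<rho> g *v v | g. g \<in> GL} = UNIV"
proof -
 let ?S = "vec.span {\<rho> g *v v | g. g \<in> GL}"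
 have r: "rational_rep \<rho>" using \<rho> by (simp add: irreducible_rep_def)
 have "\<rho> g *v w \<in> ?S" if "g \<in> GL" "w \<in> ?S" for g w
  using that(2)
 proof (induction rule: vec.span_induct_alt)
  case (step c x y)
  then obtain h where "h \<in> GL" "x = \<rho> h *v v" by auto
  then have "\<rho> g *v x = \<rho> (g ** h) *v v" "g ** h \<in> GL"
   using that(1) by (auto simp: rational_rep_mult[OF r] matrix_vector_mul_assoc)
  then have "\<rho> g *v x \<in> ?S" by (intro vec.span_base) auto
  then show ?case using step
   by (simp add: matrix_vector_right_distrib mv_scale vec.span_add vec.span_scale)
 qed (simp add: vec.span_zero)
 then have "?S = {0} \<or> ?S = UNIV"
  using \<rho> unfolding irreducible_rep_def by (simp add: vec.subspace_span)
 moreover have "v \<in> ?S"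
 proof (rule vec.span_base)
  have "v = \<rho> (mat 1) *v v" by (simp add: rational_rep_one[OF r])
  then show "v \<in> {\<rho> g *v v | g. g \<in> GL}" using mat_1_GL by blast
 qed
 ultimately show ?thesis using v by blast
qed

text \<open>
  The conjugate of L by the diagonal matrix with entries \<open>t ^ 0, t ^ 1, ...\<close>,
  written without negative powers of t; it tends to the identity as t tends to 0.
\<close>

definition torus_scaling :: "'r::{finite,linorder} cmat \<Rightarrow> complex \<Rightarrow> 'r cmat" where
 "torus_scaling L t = (\<chi> i j. if i = j then 1 else if j < i then t ^ (card {..<i} - card {..<j}) * L $ i $ j else 0)"

lemma card_lessThan_strict: "i < j \<Longrightarrow> card {..<i} < card {..<(j::'r::{finite,linorder})}"
 by (rule psubset_card_mono) auto

lemma det_diag_matrix: "det (diag_matrix t) = (\<Prod>i\<in>UNIV. t $ (i::'r::finite))"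
 by (subst det_diagonal) (auto simp: diag_matrix_def)

text \<open>
  Conjugation by a one-parameter torus contracts the lower unipotent group to the identity. Applied
  to a linear relation between translates of the highest weight vector, it turns every term into a
  multiple of the highest weight vector in the limit, and the coefficients can be compared. This
  replaces weight space decompositions.
\<close>

lemma unilower_coefficients_sum:
 fixes \<rho> :: "'r::{finite,linorder} cmat \<Rightarrow> 'd::finite cmat"
 assumes \<rho>: "rational_rep \<rho>" and v: "v \<noteq> 0"
  and hw: "\<And>b. b \<in> GL \<Longrightarrow> (\<And>i j. j < i \<Longrightarrow> b $ i $ j = 0) \<Longrightarrow> \<rho> b *v v = (\<Prod>i\<in>UNIV. b $ i $ i powi \<mu> i) *s v"
  and n: "\<And>b. b \<in> B \<Longrightarrow> unilower (n b)" and L: "unilower L"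
  and eq: "\<rho> L *v v = (\<Sum>b\<in>B. c b *s (\<rho> (n b) *v v))"
 shows "(\<Sum>b\<in>B. c b) = 1"
proof -
 define d where "d t = diag_matrix (\<chi> i::'r. t ^ card {..<i})" for t :: complex
 have dGL: "d t \<in> GL" if "t \<noteq> 0" for t
  using that unfolding GL_iff_det d_def det_diag_matrix by simp
 have comm: "d t ** M = torus_scaling M t ** d t" if "unilower M" for M t
 proof -
  have "(\<Sum>k\<in>UNIV. d t $ i $ k * M $ k $ j) = t ^ card {..<i} * M $ i $ j" for i j
  proof -
   have "d t $ i $ k * M $ k $ j = (if k = i then t ^ card {..<i} * M $ i $ j else 0)" for k
    by (auto simp: d_def diag_matrix_def)
   then show ?thesis by simp
  qed
  moreover have "(\<Sum>k\<in>UNIV. torus_scaling M t $ i $ k * d t $ k $ j) = torus_scaling M t $ i $ j * t ^ card {..<j}" for i j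
  proof -
   have "torus_scaling M t $ i $ k * d t $ k $ j = (if k = j then torus_scaling M t $ i $ j * t ^ card {..<j} else 0)" for k
    by (auto simp: d_def diag_matrix_def)
   then show ?thesis by simp
  qed
  moreover have "t ^ card {..<i} * M $ i $ j = torus_scaling M t $ i $ j * t ^ card {..<j}" for i j
  proof (cases i j rule: linorder_cases)
   case greater
   then have "card {..<i} = (card {..<i} - card {..<j}) + card {..<j}"
    using card_lessThan_strict[of j i] by simp
   then have "t ^ card {..<i} = t ^ (card {..<i} - card {..<j}) * t ^ card {..<j}" by (metis power_add)
   then show ?thesis using greater by (simp add: torus_scaling_def)
  qed (use that in \<open>auto simp: unilower_def torus_scaling_def\<close>)
  ultimately show ?thesis by (simp add: vec_eq_iff matrix_matrix_mult_def)
 qed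
 have low: "unilower (torus_scaling M t)" for M t
  by (auto simp: unilower_def torus_scaling_def)
 have "\<exists>ch. ch \<noteq> 0 \<and> \<rho> (d t) *v v = ch *s v" if "t \<noteq> 0" for t
  by (rule exI[of _ "\<Prod>i\<in>UNIV. d t $ i $ i powi \<mu> i"], subst hw[OF dGL[OF that]])
    (use that in \<open>auto simp: d_def diag_matrix_def\<close>)
 then have "\<forall>t. \<exists>ch. t \<noteq> 0 \<longrightarrow> ch \<noteq> 0 \<and> \<rho> (d t) *v v = ch *s v" by blast
 from choice[OF this] obtain ch where "\<forall>t. t \<noteq> 0 \<longrightarrow> ch t \<noteq> 0 \<and> \<rho> (d t) *v v = ch t *s v" ..
 then have ch: "\<And>t. t \<noteq> 0 \<Longrightarrow> ch t \<noteq> 0" "\<And>t. t \<noteq> 0 \<Longrightarrow> \<rho> (d t) *v v = ch t *s v" by blast+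
 have act: "\<rho> (d t) *v (\<rho> M *v v) = ch t *s (\<rho> (torus_scaling M t) *v v)" if "t \<noteq> 0" "unilower M" for t M
 proof -
  have "\<rho> (d t) *v (\<rho> M *v v) = \<rho> (torus_scaling M t) *v (\<rho> (d t) *v v)"
   using comm[OF that(2), of t] dGL[OF that(1)] unilower_GL[OF that(2)] unilower_GL[OF low]
   by (metis matrix_vector_mul_assoc rational_rep_mult[OF \<rho>])
  then show ?thesis by (simp add: ch(2)[OF that(1)] mv_scale)
 qed
 have scaled: "\<rho> (torus_scaling L t) *v v = (\<Sum>b\<in>B. c b *s (\<rho> (torus_scaling (n b) t) *v v))" if t: "t \<noteq> 0" for t
 proof -
  have "ch t *s (\<rho> (torus_scaling L t) *v v) = \<rho> (d t) *v (\<Sum>b\<in>B. c b *s (\<rho> (n b) *v v))"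
   using act[OF t L] eq by simp
  also have "\<dots> = (\<Sum>b\<in>B. c b *s (ch t *s (\<rho> (torus_scaling (n b) t) *v v)))"
   by (simp add: mv_sum mv_scale act[OF t n] cong: sum.cong)
  also have "\<dots> = ch t *s (\<Sum>b\<in>B. c b *s (\<rho> (torus_scaling (n b) t) *v v))"
   by (simp add: vec_eq_iff sum_distrib_left mult_ac)
  finally show ?thesis using ch(1)[OF t] by (simp add: vec_eq_iff)
 qed
 have lim: "((\<lambda>t. \<rho> (torus_scaling M t) *v v) \<longlongrightarrow> v) (at 0)" for M
 proof -
  have "((\<lambda>t. torus_scaling M t $ i $ j) \<longlongrightarrow> mat 1 $ i $ j) (at 0)" for i j
  proof (cases "j < i")
   case True
   then have "card {..<j} < card {..<i}" by (rule card_lessThan_strict)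
   then have "((\<lambda>t::complex. t ^ (card {..<i} - card {..<j}) * M $ i $ j) \<longlongrightarrow> 0 ^ (card {..<i} - card {..<j}) * M $ i $ j) (at 0)"
    by (intro tendsto_intros)
   then show ?thesis using True \<open>card {..<j} < card {..<i}\<close>
    by (auto simp: torus_scaling_def mat_def power_0_left)
  qed (auto simp: torus_scaling_def mat_def)
  then have "(torus_scaling M \<longlongrightarrow> mat 1) (at 0)" by (intro vec_tendstoI) simp
  from rational_rep_tendsto[OF \<rho> mat_1_GL this, of v] show ?thesis
   by (simp add: rational_rep_one[OF \<rho>])
 qed
 have "((\<lambda>t. \<Sum>b\<in>B. c b *s (\<rho> (torus_scaling (n b) t) *v v)) \<longlongrightarrow> (\<Sum>b\<in>B. c b *s v)) (at 0)"
 proof (intro tendsto_sum vec_tendstoI)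
  fix b i
  show "((\<lambda>t. (c b *s (\<rho> (torus_scaling (n b) t) *v v)) $ i) \<longlongrightarrow> (c b *s v) $ i) (at 0)"
   using tendsto_vec_nth[OF lim[of "n b"], of i] by (auto intro: tendsto_mult_left)
 qed
 moreover have "\<forall>\<^sub>F t in at 0. (\<Sum>b\<in>B. c b *s (\<rho> (torus_scaling (n b) t) *v v)) = \<rho> (torus_scaling L t) *v v"
  unfolding eventually_at by (rule exI[of _ 1]) (use scaled in auto)
 ultimately have "((\<lambda>t. \<rho> (torus_scaling L t) *v v) \<longlongrightarrow> (\<Sum>b\<in>B. c b *s v)) (at 0)"
  by (rule Lim_transform_eventually)
 from tendsto_unique[OF _ this lim[of L]] have "(\<Sum>b\<in>B. c b *s v) = v" by simp
 then have "(\<Sum>b\<in>B. c b) *s v = v" by (simp add: vec_eq_iff sum_distrib_right)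
 with v show ?thesis by (auto simp: vec_eq_iff)
qed

lemma vec_subspace_closed:
 assumes "vec.subspace (S :: 'd::finite cvec set)" shows "closed S"
proof -
 have "subspace S"
  unfolding subspace_def
 proof (intro conjI ballI allI)
  fix c :: real and x assume "x \<in> S"
  then have "complex_of_real c *s x \<in> S" using assms by (simp add: vec.subspace_scale)
  moreover have "complex_of_real c *s x = c *\<^sub>R x" by (simp add: vec_eq_iff scaleR_conv_of_real[where 'a = complex])
  ultimately show "c *\<^sub>R x \<in> S" by simp
 qed (use assms in \<open>auto simp: vec.subspace_0 vec.subspace_add\<close>)
 then show ?thesis by (rule closed_subspace)
qed

text \<open>
  By the triangular factorization a translate of the highest weight vector by a generic group
  element is a multiple of a translate by a lower unipotent one; the others are limits of these.
\<close>

lemma unilower_span: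
 fixes \<rho> :: "'r::{finite,linorder} cmat \<Rightarrow> 'd::finite cmat"
 assumes irr: "irreducible_rep \<rho>" and v: "v \<noteq> 0"
  and hw: "\<And>b. b \<in> GL \<Longrightarrow> (\<And>i j. j < i \<Longrightarrow> b $ i $ j = 0) \<Longrightarrow> \<rho> b *v v = (\<Prod>i\<in>UNIV. b $ i $ i powi \<mu> i) *s v"
 shows "vec.span {\<rho> L *v v | L. unilower L} = UNIV"
proof -
 let ?S = "vec.span {\<rho> L *v v | L. unilower L}"
 have \<rho>: "rational_rep \<rho>" using irr by (simp add: irreducible_rep_def)
 have LU: "\<rho> g *v v \<in> ?S" if g: "g \<in> GL" and m: "\<forall>b. minor {..b} g \<noteq> 0" for g
 proof -
  obtain L b where L: "unilower L" and b: "\<And>i j. j < i \<Longrightarrow> b $ i $ j = 0" and gLb: "g = L ** b"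
   using LU_factorization[of g] m by blast
  have bGL: "b \<in> GL" using g gLb by (auto simp: GL_iff_det det_mul)
  have "\<rho> g *v v = \<rho> L *v (\<rho> b *v v)"
   by (simp add: gLb rational_rep_mult[OF \<rho> unilower_GL[OF L] bGL] matrix_vector_mul_assoc)
  also have "\<dots> = (\<Prod>i\<in>UNIV. b $ i $ i powi \<mu> i) *s (\<rho> L *v v)"
   by (simp add: hw[OF bGL b] mv_scale)
  also have "\<dots> \<in> ?S" by (intro vec.span_scale vec.span_base) (use L in auto)
  finally show ?thesis .
 qed
 have "\<rho> g *v v \<in> ?S" if g: "g \<in> GL" for g
 proof (rule Lim_in_closed_set[OF vec_subspace_closed[OF vec.subspace_span]])
  show "((\<lambda>s. \<rho> (path_to_1 g s) *v v) \<longlongrightarrow> \<rho> g *v v) (at 0)"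
   by (rule rational_rep_tendsto[OF \<rho> g path_to_1_tendsto])
  show "\<forall>\<^sub>F s in at 0. \<rho> (path_to_1 g s) *v v \<in> ?S"
   using eventually_path_LU[of g] eventually_path_GL[of g] by eventually_elim (rule LU)
 qed simp
 then have "vec.span {\<rho> g *v v | g. g \<in> GL} \<subseteq> ?S"
  by (intro vec.span_minimal) auto
 then show ?thesis using irreducible_span[OF irr v] by auto
qed

text \<open>
  The functional that takes the sum of the coefficients with respect to a basis of translates of the
  highest weight vector. It is the lowest weight functional of the dual representation, normalized
  at v.
\<close>

lemma highest_weight_covector:
 fixes \<rho> :: "'r::{finite,linorder} cmat \<Rightarrow> 'd::finite cmat"
 assumes irr: "irreducible_rep \<rho>" and v: "v \<noteq> 0"
  and hw: "\<And>b. b \<in> GL \<Longrightarrow> (\<And>i j. j < i \<Longrightarrow> b $ i $ j = 0) \<Longrightarrow> \<rho> b *v v = (\<Prod>i\<in>UNIV. b $ i $ i powi \<mu> i) *s v"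
 obtains \<xi> where "\<And>L. unilower L \<Longrightarrow> dot \<xi> (\<rho> L *v v) = 1"
proof -
 have \<rho>: "rational_rep \<rho>" using irr by (simp add: irreducible_rep_def)
 let ?X = "{\<rho> L *v v | L. unilower L}"
 obtain B where B: "B \<subseteq> ?X" "vec.independent B" "?X \<subseteq> vec.span B"
  using vec.maximal_independent_subset[of ?X] by auto
 have spanB: "vec.span B = UNIV"
  using vec.span_mono[OF B(3)] unilower_span[OF irr v hw] by (auto simp: vec.span_span)
 have finB: "finite B" using B(2) by (rule vec.finiteI_independent)
 have "\<forall>b. \<exists>n. b \<in> B \<longrightarrow> unilower n \<and> b = \<rho> n *v v" using B(1) by blast
 from choice[OF this] obtain n where n: "\<forall>b. b \<in> B \<longrightarrow> unilower (n b) \<and> b = \<rho> (n b) *v v" ..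
 define \<xi> where "\<xi> = (\<Sum>b\<in>B. \<chi> i. vec.representation B (axis i 1) b)"
 have xi: "dot \<xi> w = (\<Sum>b\<in>B. vec.representation B w b)" for w
  by (simp add: \<xi>_def dot_sum_left representation_dot[OF B(2) spanB, of w])
 have "dot \<xi> (\<rho> L *v v) = 1" if L: "unilower L" for L
  unfolding xi
 proof (rule unilower_coefficients_sum[OF \<rho> v hw _ L, of B n])
  have "\<rho> L *v v = (\<Sum>b\<in>B. vec.representation B (\<rho> L *v v) b *s b)"
   by (rule vec.sum_representation_eq[symmetric]) (use B spanB finB in auto)
  also have "\<dots> = (\<Sum>b\<in>B. vec.representation B (\<rho> L *v v) b *s (\<rho> (n b) *v v))"
   by (rule sum.cong) (use n in auto)
  finally show "\<rho> L *v v = (\<Sum>b\<in>B. vec.representation B (\<rho> L *v v) b *s (\<rho> (n b) *v v))" .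
 qed (use n in auto)
 then show ?thesis by (rule that)
qed

section \<open>Representations of rectangular highest weight\<close>

text \<open>
  Here the highest weight takes only two values, \<open>\<beta> + c\<close> on I and
  \<open>\<beta>\<close> elsewhere. The matrix coefficient between the highest weight vector and the
  lowest weight functional is then an explicit function of g, and the whole representation can be
  computed from it: w is determined by the function \<open>dot \<xi> (\<rho> g *v w)\<close> of
  g.
\<close>

locale rectangular_rep =
 fixes \<rho> :: "'r::{finite,linorder} cmat \<Rightarrow> 'd::finite cmat"
  and I :: "'r set" and \<beta> :: int and c :: nat and \<xi> v0 :: "'d cvec"
 assumes irr: "irreducible_rep \<rho>"
  and theta: "g \<in> GL \<Longrightarrow> dot \<xi> (\<rho> g *v v0) = det g powi \<beta> * minor I g ^ c"
begin

lemma rational: "rational_rep \<rho>"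
 using irr by (simp add: irreducible_rep_def)

lemmas rho_mult = rational_rep_mult[OF rational]
lemmas rho_one = rational_rep_one[OF rational]

lemma xi_v0: "dot \<xi> v0 = 1"
 using theta[OF mat_1_GL] by (simp add: rho_one)

lemma v0_nonzero: "v0 \<noteq> 0"
 using xi_v0 by (auto simp: dot_zero)

text \<open>
  The vectors with vanishing coefficient function form an invariant subspace that does not contain
  v0.
\<close>

lemma separation:
 assumes "\<And>g. g \<in> GL \<Longrightarrow> dot \<xi> (\<rho> g *v w) = 0"
 shows "w = 0"
proof -
 define S where "S = {w. \<forall>g\<in>GL. dot \<xi> (\<rho> g *v w) = 0}"
 have "vec.subspace S"
  by (auto simp: S_def vec.subspace_def dot_zero dot_add dot_scale matrix_vector_right_distrib mv_scale)
 moreover have "\<rho> g *v u \<in> S" if "g \<in> GL" "u \<in> S" for g u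
  using that by (auto simp: S_def matrix_vector_mul_assoc rho_mult[symmetric])
 ultimately have "S = {0} \<or> S = UNIV" using irr unfolding irreducible_rep_def by blast
 moreover have "v0 \<notin> S"
 proof
  assume "v0 \<in> S"
  then have "dot \<xi> (\<rho> (mat 1) *v v0) = 0" using mat_1_GL unfolding S_def by blast
  then show False using xi_v0 by (simp add: rho_one)
 qed
 ultimately have "S = {0}" by auto
 moreover have "w \<in> S" using assms by (simp add: S_def)
 ultimately show ?thesis by simp
qed

lemma separation_eq:
 assumes "\<And>g. g \<in> GL \<Longrightarrow> dot \<xi> (\<rho> g *v w) = dot \<xi> (\<rho> g *v w')"
 shows "w = w'"
 using separation[of "w - w'"] assms by (simp add: matrix_vector_mult_diff_distrib dot_diff)

text \<open>
  Since finitely many functionals \<open>w \<mapsto> dot \<xi> (\<rho> h *v w)\<close> span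
  the dual space, a vector is recovered linearly from finitely many values of its coefficient
  function. This makes the space of coefficient functions closed under pointwise limits and lets
  vectors depend algebraically on the functions that represent them.
\<close>

lemma interpolation:
 obtains G a where "finite G" "G \<subseteq> GL" "\<And>w. w = (\<Sum>h\<in>G. dot \<xi> (\<rho> h *v w) *s a h)"
proof -
 let ?X = "{\<xi> v* \<rho> h | h. h \<in> GL}"
 have "vec.span ?X = UNIV"
 proof (rule ccontr)
  assume "vec.span ?X \<noteq> UNIV"
  then obtain w where w: "w \<noteq> 0" "\<forall>x\<in>vec.span ?X. dot x w = 0"
   using proper_subspace_annihilated[OF vec.subspace_span, of ?X] by blast
  have "dot \<xi> (\<rho> g *v w) = 0" if "g \<in> GL" for g
   unfolding dot_matrix by (rule w(2)[rule_format], rule vec.span_base) (use that in blast)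
  then show False using separation w(1) by blast
 qed
 then have "axis p 1 \<in> vec.span ?X" for p by simp
 then have "\<forall>p. \<exists>t u. finite t \<and> t \<subseteq> ?X \<and> axis p 1 = (\<Sum>x\<in>t. u x *s x)"
  unfolding vec.span_explicit by blast
 then have "\<forall>p. \<exists>T u. finite T \<and> T \<subseteq> GL \<and> (\<forall>w. w $ p = (\<Sum>h\<in>T. u h * dot \<xi> (\<rho> h *v w)))"
 proof (rule all_forward, elim exE conjE)
  fix p t u assume t: "finite t" "t \<subseteq> ?X" and eq: "axis p 1 = (\<Sum>x\<in>t. u x *s x)"
  have "\<forall>x. \<exists>h. x \<in> t \<longrightarrow> h \<in> GL \<and> x = \<xi> v* \<rho> h" using t(2) by blast
  from choice[OF this] obtain k where k: "\<forall>x. x \<in> t \<longrightarrow> k x \<in> GL \<and> x = \<xi> v* \<rho> (k x)" ..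
  have inj: "inj_on k t" by (rule inj_onI) (metis k)
  show "\<exists>T u. finite T \<and> T \<subseteq> GL \<and> (\<forall>w. w $ p = (\<Sum>h\<in>T. u h * dot \<xi> (\<rho> h *v w)))"
  proof (rule exI[of _ "k ` t"], rule exI[of _ "\<lambda>h. u (\<xi> v* \<rho> h)"], intro conjI allI)
   fix w
   have "w $ p = dot (\<Sum>x\<in>t. u x *s x) w" by (simp add: eq[symmetric] dot_axis)
   also have "\<dots> = (\<Sum>x\<in>t. u x * dot x w)" by (simp add: dot_sum_left dot_scale)
   also have "\<dots> = (\<Sum>x\<in>t. u (\<xi> v* \<rho> (k x)) * dot \<xi> (\<rho> (k x) *v w))"
    by (rule sum.cong) (use k in \<open>auto simp: dot_matrix\<close>)
   finally show "w $ p = (\<Sum>h\<in>k ` t. u (\<xi> v* \<rho> h) * dot \<xi> (\<rho> h *v w))"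
    by (simp add: sum.reindex[OF inj])
  qed (use t k in auto)
 qed
 from choice[OF this] obtain T where "\<forall>p. \<exists>u. finite (T p) \<and> T p \<subseteq> GL \<and> (\<forall>w. w $ p = (\<Sum>h\<in>T p. u h * dot \<xi> (\<rho> h *v w)))" ..
 from choice[OF this] obtain u where
  Tu: "\<forall>p. finite (T p) \<and> T p \<subseteq> GL \<and> (\<forall>w. w $ p = (\<Sum>h\<in>T p. u p h * dot \<xi> (\<rho> h *v w)))" ..
 define G where "G = (\<Union>p. T p)"
 have "finite G" "G \<subseteq> GL" using Tu by (auto simp: G_def)
 moreover have "w = (\<Sum>h\<in>G. dot \<xi> (\<rho> h *v w) *s (\<chi> p. if h \<in> T p then u p h else 0))" for w
 proof -
  have "w $ p = (\<Sum>h\<in>G. dot \<xi> (\<rho> h *v w) * (if h \<in> T p then u p h else 0))" for p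
  proof -
   have "w $ p = (\<Sum>h\<in>T p. u p h * dot \<xi> (\<rho> h *v w))" using Tu by blast
   also have "\<dots> = (\<Sum>h\<in>G. dot \<xi> (\<rho> h *v w) * (if h \<in> T p then u p h else 0))"
    by (rule sum.mono_neutral_cong_left) (use \<open>finite G\<close> in \<open>auto simp: G_def mult.commute\<close>)
   finally show ?thesis .
  qed
  then show ?thesis by (simp add: vec_eq_iff)
 qed
 ultimately show ?thesis by (rule that)
qed

definition model :: "('r cmat \<Rightarrow> complex) set" where
 "model = {F. \<exists>w. \<forall>g\<in>GL. F g = dot \<xi> (\<rho> g *v w)}"

lemma model_add: "F \<in> model \<Longrightarrow> F' \<in> model \<Longrightarrow> (\<lambda>g. F g + F' g) \<in> model"
 unfolding model_def by (auto simp: dot_add(1)[symmetric] matrix_vector_right_distrib[symmetric])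

lemma model_scale: "F \<in> model \<Longrightarrow> (\<lambda>g. a * F g) \<in> model"
 unfolding model_def by (auto simp: dot_scale(1)[symmetric] mv_scale[symmetric])

lemma model_zero: "(\<lambda>g. 0) \<in> model"
 unfolding model_def by (auto intro!: exI[of _ 0] simp: dot_zero)

lemma model_sum: "(\<And>i. i \<in> A \<Longrightarrow> F i \<in> model) \<Longrightarrow> (\<lambda>g. \<Sum>i\<in>A. F i g) \<in> model"
 by (induction A rule: infinite_finite_induct) (simp_all add: model_zero model_add)

lemma model_limit:
 assumes F: "\<forall>\<^sub>F s in f. F s \<in> model" and lim: "\<And>g. g \<in> GL \<Longrightarrow> ((\<lambda>s. F s g) \<longlongrightarrow> F0 g) f" and f: "f \<noteq> bot"
 shows "F0 \<in> model"
proof -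
 obtain G a where G: "finite G" "G \<subseteq> GL" and a: "\<And>w. w = (\<Sum>h\<in>G. dot \<xi> (\<rho> h *v w) *s a h)"
  using interpolation by blast
 define b where "b g h = dot \<xi> (\<rho> g *v a h)" for g h
 have closed: "F g = (\<Sum>h\<in>G. F h * b g h)" if F: "F \<in> model" and g: "g \<in> GL" for F g
 proof -
  obtain w where "\<forall>g\<in>GL. F g = dot \<xi> (\<rho> g *v w)" using F unfolding model_def by blast
  then have w: "\<And>g. g \<in> GL \<Longrightarrow> F g = dot \<xi> (\<rho> g *v w)" by blast
  have "F g = dot \<xi> (\<rho> g *v (\<Sum>h\<in>G. dot \<xi> (\<rho> h *v w) *s a h))" using w[OF g] a[of w] by simp
  also have "\<dots> = (\<Sum>h\<in>G. F h * b g h)"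
   using w G by (auto simp: mv_sum mv_scale dot_sum dot_scale b_def intro!: sum.cong)
  finally show ?thesis .
 qed
 have "F0 g = dot \<xi> (\<rho> g *v (\<Sum>h\<in>G. F0 h *s a h))" if g: "g \<in> GL" for g
 proof -
  have "((\<lambda>s. \<Sum>h\<in>G. F s h * b g h) \<longlongrightarrow> (\<Sum>h\<in>G. F0 h * b g h)) f"
   using G by (intro tendsto_sum tendsto_mult_right lim) auto
  moreover have "\<forall>\<^sub>F s in f. (\<Sum>h\<in>G. F s h * b g h) = F s g"
   using F by eventually_elim (use closed[OF _ g] in simp)
  ultimately have "((\<lambda>s. F s g) \<longlongrightarrow> (\<Sum>h\<in>G. F0 h * b g h)) f"
   by (rule Lim_transform_eventually)
  then have "F0 g = (\<Sum>h\<in>G. F0 h * b g h)" using tendsto_unique[OF f lim[OF g]] by blast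
  then show ?thesis
   by (simp add: mv_sum mv_scale dot_sum dot_scale b_def)
 qed
 then show ?thesis unfolding model_def by blast
qed

end

lemma prod_powi: "(\<Prod>i\<in>A. f i powi k) = (\<Prod>i\<in>A. f i :: complex) powi k"
 by (induction A rule: infinite_finite_induct) (simp_all add: power_int_mult_distrib)

text \<open>
  On the big cell the coefficient is computed from the triangular factorization, since the diagonal
  entries of the upper triangular factor multiply to minors of g. Both sides are continuous.
\<close>

theorem is_L_rectangular:
 fixes \<rho> :: "'r::{finite,linorder} cmat \<Rightarrow> 'd::finite cmat"
 assumes L: "is_L (\<lambda>i. if i \<in> I then \<beta> + int c else \<beta>) \<rho>"
  and I: "\<And>i j. i \<in> I \<Longrightarrow> j < i \<Longrightarrow> j \<in> I"
 shows "\<exists>\<xi> v0. rectangular_rep \<rho> I \<beta> c \<xi> v0"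
proof -
 let ?\<mu> = "\<lambda>i. if i \<in> I then \<beta> + int c else \<beta>"
 have irr: "irreducible_rep \<rho>" using L by (simp add: is_L_def)
 then have \<rho>: "rational_rep \<rho>" by (simp add: irreducible_rep_def)
 obtain v where v: "v \<noteq> 0"
  and hw: "\<And>b. b \<in> GL \<Longrightarrow> (\<And>i j. j < i \<Longrightarrow> b $ i $ j = 0) \<Longrightarrow> \<rho> b *v v = (\<Prod>i\<in>UNIV. b $ i $ i powi ?\<mu> i) *s v"
  using L unfolding is_L_def has_highest_weight_def by blast
 obtain \<xi> where xi: "\<And>L. unilower L \<Longrightarrow> dot \<xi> (\<rho> L *v v) = 1"
  using highest_weight_covector[OF irr v hw] by blast
 have LU: "dot \<xi> (\<rho> g *v v) = det g powi \<beta> * minor I g ^ c" if g: "g \<in> GL" and m: "\<forall>b. minor {..b} g \<noteq> 0" for g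
 proof -
  obtain L b where L: "unilower L" and b: "\<And>i j. j < i \<Longrightarrow> b $ i $ j = 0" and gLb: "g = L ** b"
   using LU_factorization[of g] m by blast
  have bGL: "b \<in> GL" using g gLb by (auto simp: GL_iff_det det_mul)
  have detb: "det b = (\<Prod>i\<in>UNIV. b $ i $ i)" by (rule det_upper_triangular[OF b])
  have nz: "b $ i $ i \<noteq> 0" for i using bGL by (auto simp: GL_iff_det detb)
  have "\<rho> g *v v = \<rho> L *v (\<rho> b *v v)"
   by (simp add: gLb rational_rep_mult[OF \<rho> unilower_GL[OF L] bGL] matrix_vector_mul_assoc)
  then have "dot \<xi> (\<rho> g *v v) = (\<Prod>i\<in>UNIV. b $ i $ i powi ?\<mu> i)"
   by (simp only: hw[OF bGL b] mv_scale dot_scale xi[OF L] mult_1_right)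
  also have "\<dots> = (\<Prod>i\<in>UNIV. b $ i $ i powi \<beta> * (if i \<in> I then b $ i $ i ^ c else 1))"
   by (rule prod.cong) (use nz in \<open>auto simp: power_int_add\<close>)
  also have "\<dots> = det b powi \<beta> * (\<Prod>i\<in>I. b $ i $ i) ^ c"
   by (simp add: prod.distrib detb prod_power_distrib prod_powi prod.If_cases)
  also have "det b = det g" by (simp add: gLb det_mul unilower_det[OF L])
  also have "(\<Prod>i\<in>I. b $ i $ i) = minor I g"
  proof -
   have "minor I g = minor I L * minor I b"
    unfolding gLb
   proof (rule minor_mult_left)
    fix i j assume "i \<in> I" "j \<notin> I"
    then have "i < j" using I[of i j] by (metis linorder_neqE)
    then show "L $ i $ j = 0" using L by (simp add: unilower_def)
   qed
   then show ?thesis by (simp add: minor_unilower[OF L] minor_upper b)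
  qed
  finally show ?thesis .
 qed
 have "dot \<xi> (\<rho> g *v v) = det g powi \<beta> * minor I g ^ c" if g: "g \<in> GL" for g
 proof -
  have l1: "((\<lambda>s. dot \<xi> (\<rho> (path_to_1 g s) *v v)) \<longlongrightarrow> dot \<xi> (\<rho> g *v v)) (at 0)"
   unfolding dot_def
   by (intro tendsto_sum tendsto_mult_left tendsto_vec_nth rational_rep_tendsto[OF \<rho> g path_to_1_tendsto])
  have l2: "((\<lambda>s. det (path_to_1 g s) powi \<beta> * minor I (path_to_1 g s) ^ c) \<longlongrightarrow> det g powi \<beta> * minor I g ^ c) (at 0)"
  proof (intro tendsto_mult tendsto_power regular_GL_tendsto[OF regular_GL_det_powi g path_to_1_tendsto])
   have "isCont (minor I) g"
    using continuous_on_minor[of UNIV I] by (simp add: continuous_on_eq_continuous_at)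
   then show "((\<lambda>s. minor I (path_to_1 g s)) \<longlongrightarrow> minor I g) (at 0)"
    using path_to_1_tendsto by (rule isCont_tendsto_compose)
  qed
  have ev: "\<forall>\<^sub>F s in at 0. dot \<xi> (\<rho> (path_to_1 g s) *v v) = det (path_to_1 g s) powi \<beta> * minor I (path_to_1 g s) ^ c"
   using eventually_path_LU[of g] eventually_path_GL[of g] by eventually_elim (rule LU)
  show ?thesis by (rule tendsto_unique[OF at_neq_bot Lim_transform_eventually[OF l1 ev] l2])
 qed
 then have "rectangular_rep \<rho> I \<beta> c \<xi> v" by (unfold_locales) (use irr in auto)
 then show ?thesis by blast
qed

section \<open>The action of the Lie algebra\<close>

lemma DERIV_eventually:
 assumes "DERIV f x :> d" "\<forall>\<^sub>F y in nhds x. f y = g y"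
 shows "DERIV g x :> d"
 using assms DERIV_cong_ev[OF refl assms(2) refl] by blast

text \<open>
  A line through the identity has the same tangent as the one-parameter group of X and has
  polynomial entries.
\<close>

definition line1 :: "'r::finite cmat \<Rightarrow> complex \<Rightarrow> 'r cmat" where
 "line1 X t = (\<chi> a b. mat 1 $ a $ b + t * X $ a $ b)"

lemma line1_0 [simp]: "line1 X 0 = mat 1"
 by (simp add: line1_def vec_eq_iff)

lemma line1_derivative: "DERIV (\<lambda>t. line1 X t $ a $ b) t :> X $ a $ b"
 unfolding line1_def by (auto intro!: derivative_eq_intros)

lemma eventually_line1_GL: "\<forall>\<^sub>F t in nhds 0. line1 X t \<in> GL"
proof -
 have "(line1 X \<longlongrightarrow> line1 X 0) (nhds 0)"
 proof (intro vec_tendstoI)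
  fix a b
  have "isCont (\<lambda>t. line1 X t $ a $ b) 0" using line1_derivative DERIV_isCont by blast
  then show "((\<lambda>t. line1 X t $ a $ b) \<longlongrightarrow> line1 X 0 $ a $ b) (nhds 0)"
   using tendsto_at_iff_tendsto_nhds[of "\<lambda>t. line1 X t $ a $ b" 0] by (simp add: isCont_def)
 qed
 then show ?thesis by (rule topological_tendstoD[OF _ open_GL]) simp
qed

text \<open>
  The differential of \<open>\<rho>\<close> at the identity.
\<close>

definition drep :: "('r::finite cmat \<Rightarrow> 'd::finite cmat) \<Rightarrow> 'r cmat \<Rightarrow> 'd cmat" where
 "drep \<rho> X = (\<chi> p q. dder (\<lambda>g. \<rho> g $ p $ q) (mat 1) X)"

lemma drep_curve:
 assumes \<rho>: "rational_rep \<rho>" and c: "\<And>a b. DERIV (\<lambda>t. c t $ a $ b) t0 :> X $ a $ b" "c t0 = mat 1"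
 shows "DERIV (\<lambda>t. \<rho> (c t) $ p $ q) t0 :> drep \<rho> X $ p $ q"
proof -
 have "DERIV (\<lambda>t. \<rho> (c t) $ p $ q) t0 :> dder (\<lambda>g. \<rho> g $ p $ q) (c t0) X"
  by (rule dder_curve[OF rational_rep_regular[OF \<rho>] _ c(1)]) (simp add: c(2))
 then show ?thesis by (simp add: drep_def c(2))
qed

lemma drep_curve_vec:
 assumes \<rho>: "rational_rep \<rho>" and c: "\<And>a b. DERIV (\<lambda>t. c t $ a $ b) t0 :> X $ a $ b" "c t0 = mat 1"
 shows "DERIV (\<lambda>t. (\<rho> (c t) *v w) $ p) t0 :> (drep \<rho> X *v w) $ p"
 unfolding matrix_vector_mult_def
 by (simp, intro DERIV_sum DERIV_cmult_right drep_curve[OF assms])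

lemma drep_add: "rational_rep \<rho> \<Longrightarrow> drep \<rho> (X + Y) = drep \<rho> X + drep \<rho> Y"
 by (simp add: drep_def vec_eq_iff dder_add rational_rep_regular)

lemma drep_diff: "rational_rep \<rho> \<Longrightarrow> drep \<rho> (X - Y) = drep \<rho> X - drep \<rho> Y"
 by (simp add: drep_def vec_eq_iff dder_diff rational_rep_regular)

lemma drep_scale: "rational_rep \<rho> \<Longrightarrow> drep \<rho> (\<chi> a b. k * X $ a $ b) = (\<chi> a b. k * drep \<rho> X $ a $ b)"
 by (simp add: drep_def vec_eq_iff dder_scale rational_rep_regular)

lemma drep_conjugate:
 assumes \<rho>: "rational_rep \<rho>" and h: "h \<in> GL" "h' \<in> GL" "h ** h' = mat 1"
 shows "\<rho> h ** drep \<rho> X ** \<rho> h' = drep \<rho> (h ** X ** h')"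
proof -
 have "(\<rho> h ** drep \<rho> X ** \<rho> h') $ p $ q = drep \<rho> (h ** X ** h') $ p $ q" for p q
 proof -
  have "DERIV (\<lambda>t. \<rho> (h ** line1 X t ** h') $ p $ q) 0 :> drep \<rho> (h ** X ** h') $ p $ q"
  proof (rule drep_curve[OF \<rho>])
   fix a b
   show "DERIV (\<lambda>t. (h ** line1 X t ** h') $ a $ b) 0 :> (h ** X ** h') $ a $ b"
    unfolding matrix_matrix_mult_def
    by (simp, intro DERIV_sum DERIV_cmult_right DERIV_cmult line1_derivative)
  qed (simp add: h)
  moreover have "DERIV (\<lambda>t. \<rho> (h ** line1 X t ** h') $ p $ q) 0 :> (\<rho> h ** drep \<rho> X ** \<rho> h') $ p $ q"
  proof -
   have "DERIV (\<lambda>t. (\<rho> h ** \<rho> (line1 X t) ** \<rho> h') $ p $ q) 0 :> (\<rho> h ** drep \<rho> X ** \<rho> h') $ p $ q"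
    unfolding matrix_matrix_mult_def
    by (simp, intro DERIV_sum DERIV_cmult_right DERIV_cmult drep_curve[OF \<rho>] line1_derivative) simp
   moreover have "\<forall>\<^sub>F t in nhds 0. (\<rho> h ** \<rho> (line1 X t) ** \<rho> h') $ p $ q = \<rho> (h ** line1 X t ** h') $ p $ q"
    using eventually_line1_GL[of X] by eventually_elim (simp add: rational_rep_mult[OF \<rho>] h)
   ultimately show ?thesis by (rule DERIV_eventually)
  qed
  ultimately show ?thesis by (rule DERIV_unique[symmetric])
 qed
 then show ?thesis by (simp add: vec_eq_iff)
qed

lemma matrix_unit_mult: "E i j ** E k l = (if j = k then E i l else 0)"
proof -
 have "(\<Sum>x\<in>UNIV. E i j $ a $ x * E k l $ x $ b) =
   (if j = k then E i l $ a $ b else 0)" for a b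
 proof -
  have "E i j $ a $ x * E k l $ x $ b =
    (if x = j then (if j = k then E i l $ a $ b else 0) else 0)" for x
   by (auto simp: matrix_unit_def)
  then show ?thesis by simp
 qed
 then show ?thesis by (simp add: matrix_matrix_mult_def vec_eq_iff)
qed

lemma line1_unit_det: "det (line1 (E i j) t) = (if i = j then 1 + t else 1)"
 for i j :: "'r::{finite,linorder}"
proof (cases "i = j")
 case True
 have e: "line1 (E i i) t $ k $ k = (if k = i then 1 + t else 1)" for k
  by (simp add: line1_def matrix_unit_def mat_def)
 have "det (line1 (E i i) t) = (\<Prod>k\<in>UNIV. line1 (E i i) t $ k $ k)"
  by (rule det_upper_triangular) (auto simp: line1_def matrix_unit_def mat_def)
 then have "det (line1 (E i i) t) = (\<Prod>k\<in>UNIV. if k = i then 1 + t else 1)"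
  by (simp only: e)
 then show ?thesis using True by simp
next
 case False
 have d: "(\<Prod>k\<in>UNIV. line1 (E i j) t $ k $ k) = 1"
  using False by (intro prod.neutral) (auto simp: line1_def matrix_unit_def mat_def)
 show ?thesis
 proof (cases "i < j")
  case True
  then show ?thesis using d False
   by (subst det_upper_triangular) (auto simp: line1_def matrix_unit_def mat_def)
 next
  case False
  then show ?thesis using d \<open>i \<noteq> j\<close>
   by (subst det_lower_triangular) (auto simp: line1_def matrix_unit_def mat_def)
 qed
qed

lemma mask_line1: "mask A (line1 (E i j) t) =
  (if i \<in> A \<and> j \<in> A then line1 (E i j) t else mat 1)"
 by (auto simp: mask_def line1_def matrix_unit_def mat_def vec_eq_iff)

lemma minor_line1: "minor A (line1 (E i j) t) = (if i = j \<and> i \<in> A then 1 + t else 1)"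
 for i j :: "'r::{finite,linorder}"
 by (auto simp: minor_def mask_line1 line1_unit_det)

lemma line1_unit_mult:
 assumes "i \<noteq> j" shows "line1 (E i j) s ** line1 (E i j) t = line1 (E i j) (s + t)"
proof -
 have l: "line1 X t = mat 1 + (\<chi> a b. t * X $ a $ b)" for X :: "'a cmat" and t by (simp add: line1_def vec_eq_iff)
 have "(\<chi> a b. s * E i j $ a $ b) ** (\<chi> a b. t * E i j $ a $ b) = 0"
  using assms by (auto simp: matrix_matrix_mult_def vec_eq_iff matrix_unit_def intro!: sum.neutral)
 then show ?thesis
  by (simp add: l matrix_add_ldistrib matrix_add_rdistrib') (simp add: vec_eq_iff algebra_simps)
qed

lemma mult_line1_unit_row: "(g ** line1 (E i j) t) $ a $ b = g $ a $ b + (if b = j then t * g $ a $ i else 0)"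
proof -
 have "g $ a $ k * line1 (E i j) t $ k $ b =
   (if k = b then g $ a $ b else 0) + (if k = i then (if b = j then t * g $ a $ i else 0) else 0)" for k
  by (auto simp: line1_def mat_def matrix_unit_def algebra_simps)
 then show ?thesis by (simp add: matrix_matrix_mult_def sum.distrib)
qed

context rectangular_rep
begin

lemma model_derivative:
 assumes g: "g \<in> GL"
 shows "DERIV (\<lambda>t. dot \<xi> (\<rho> (g ** line1 X t) *v w)) 0 :> dot \<xi> (\<rho> g *v (drep \<rho> X *v w))"
proof -
 have "DERIV (\<lambda>t. dot \<xi> (\<rho> g *v (\<rho> (line1 X t) *v w))) 0 :> dot \<xi> (\<rho> g *v (drep \<rho> X *v w))"
  unfolding dot_matrix[of _ "\<rho> g"] unfolding dot_def
  by (intro DERIV_sum DERIV_cmult drep_curve_vec[OF rational] line1_derivative line1_0)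
 moreover have "\<forall>\<^sub>F t in nhds 0. dot \<xi> (\<rho> g *v (\<rho> (line1 X t) *v w)) = dot \<xi> (\<rho> (g ** line1 X t) *v w)"
  using eventually_line1_GL[of X] by eventually_elim (simp add: rho_mult g matrix_vector_mul_assoc)
 ultimately show ?thesis by (rule DERIV_eventually)
qed

text \<open>
  The action of the Lie algebra on vectors is the action of left invariant vector fields on
  coefficient functions.
\<close>

lemma drep_eqI:
 assumes "\<And>g. g \<in> GL \<Longrightarrow> DERIV (\<lambda>t. dot \<xi> (\<rho> (g ** line1 X t) *v w)) 0 :> dot \<xi> (\<rho> g *v u)"
 shows "drep \<rho> X *v w = u"
 by (rule separation_eq) (rule DERIV_unique[OF model_derivative assms])

text \<open>
  The minor is multiplicative for right factors in the parabolic subgroup of I, so v0 is an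
  eigenvector of that subgroup.
\<close>

lemma parabolic_v0:
 assumes p: "p \<in> GL" "\<And>i j. i \<notin> I \<Longrightarrow> j \<in> I \<Longrightarrow> p $ i $ j = 0"
 shows "\<rho> p *v v0 = (det p powi \<beta> * minor I p ^ c) *s v0"
proof (rule separation_eq)
 fix g :: "'r cmat" assume g: "g \<in> GL"
 have "dot \<xi> (\<rho> g *v (\<rho> p *v v0)) = dot \<xi> (\<rho> (g ** p) *v v0)"
  by (simp add: rho_mult g p matrix_vector_mul_assoc)
 also have "\<dots> = det (g ** p) powi \<beta> * minor I (g ** p) ^ c" by (rule theta) (simp add: g p)
 also have "minor I (g ** p) = minor I g * minor I p" by (rule minor_mult_right) (rule p(2))
 finally show "dot \<xi> (\<rho> g *v (\<rho> p *v v0)) = dot \<xi> (\<rho> g *v ((det p powi \<beta> * minor I p ^ c) *s v0))"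
  by (simp add: mv_scale dot_scale theta[OF g] det_mul power_int_mult_distrib power_mult_distrib)
qed

lemma line1_GL: "i \<noteq> j \<Longrightarrow> line1 (E i j) t \<in> GL" for i j :: 'r
 by (simp add: GL_iff_det line1_unit_det)

lemma line1_parabolic_v0:
 assumes "i \<noteq> j" "i \<in> I \<or> j \<notin> I"
 shows "\<rho> (line1 (E i j) t) *v v0 = v0"
proof -
 have "\<rho> (line1 (E i j) t) *v v0 =
   (det (line1 (E i j) t) powi \<beta> * minor I (line1 (E i j) t) ^ c) *s v0"
  using assms by (intro parabolic_v0 line1_GL) (auto simp: line1_def mat_def matrix_unit_def)
 then show ?thesis using assms by (simp add: line1_unit_det minor_line1)
qed

lemma drep_parabolic_v0:
 assumes "i \<noteq> j" "i \<in> I \<or> j \<notin> I"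
 shows "drep \<rho> (E i j) *v v0 = 0"
proof -
 have "(drep \<rho> (E i j) *v v0) $ p = 0" for p
  using drep_curve_vec[OF rational line1_derivative line1_0, of "E i j" v0 p]
  unfolding line1_parabolic_v0[OF assms] by (rule DERIV_unique[OF _ DERIV_const])
 then show ?thesis by (simp add: vec_eq_iff)
qed

lemma drep_diagonal_v0: "drep \<rho> (E i i) *v v0 = (of_int \<beta> + (if i \<in> I then of_nat c else 0)) *s v0"
proof (rule drep_eqI)
 fix g :: "'r cmat" assume g: "g \<in> GL"
 let ?p = "\<lambda>t. line1 (E i i) t"
 have "DERIV (\<lambda>t::complex. ((1 + t) powi \<beta> * (if i \<in> I then 1 + t else 1) ^ c) * (det g powi \<beta> * minor I g ^ c)) 0 :> (of_int \<beta> + (if i \<in> I then of_nat c else 0)) * (det g powi \<beta> * minor I g ^ c)"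
  by (cases "i \<in> I") (auto intro!: derivative_eq_intros)
 moreover have "\<forall>\<^sub>F t in nhds 0. ((1 + t) powi \<beta> * (if i \<in> I then 1 + t else 1) ^ c) * (det g powi \<beta> * minor I g ^ c)
   = dot \<xi> (\<rho> (g ** ?p t) *v v0)"
  using eventually_line1_GL[of "E i i"]
 proof eventually_elim
  case (elim t)
  have "\<rho> (g ** ?p t) *v v0 = \<rho> g *v (\<rho> (?p t) *v v0)" by (simp add: rho_mult g elim matrix_vector_mul_assoc)
  moreover have "\<rho> (?p t) *v v0 = (det (?p t) powi \<beta> * minor I (?p t) ^ c) *s v0"
   by (rule parabolic_v0[OF elim]) (auto simp: line1_def mat_def matrix_unit_def)
  ultimately show ?case
   by (simp add: mv_scale dot_scale theta[OF g] line1_unit_det minor_line1)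
 qed
 ultimately show "DERIV (\<lambda>t. dot \<xi> (\<rho> (g ** ?p t) *v v0)) 0 :> dot \<xi> (\<rho> g *v ((of_int \<beta> + (if i \<in> I then of_nat c else 0)) *s v0))"
  unfolding mv_scale dot_scale theta[OF g] by (rule DERIV_eventually)
qed

text \<open>
  The commutator \<open>[E k j, E j k] = E k k - E j j\<close> acts on v0 by c, and
  \<open>E k j\<close> annihilates v0. Conjugating by the one-parameter group of
  \<open>E k j\<close> gives this from the group action alone.
\<close>

lemma drep_raise_lower_v0:
 assumes k: "k \<in> I" and j: "j \<notin> I"
 shows "drep \<rho> (E k j) *v (drep \<rho> (E j k) *v v0) = of_nat c *s v0"
proof -
 have kj: "k \<noteq> j" using k j by auto
 define u where "u = drep \<rho> (E j k) *v v0"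
 have line: "\<rho> (line1 (E k j) s) *v u = u + s *s (of_nat c *s v0)" for s
 proof -
  let ?e = "\<lambda>s. line1 (E k j) s"
  have inv: "?e s ** ?e (- s) = mat 1" by (simp add: line1_unit_mult[OF kj])
  have conj: "?e s ** E j k ** ?e (- s) =
    (E j k + (\<chi> a b. s * (E k k - E j j) $ a $ b)) - (\<chi> a b. s\<^sup>2 * E k j $ a $ b)"
  proof -
   have l: "?e s = mat 1 + (\<chi> a b. s * E k j $ a $ b)" for s by (simp add: line1_def vec_eq_iff)
   have sc: "(\<chi> a b. s * M $ a $ b) ** N = (\<chi> a b. s * (M ** N) $ a $ b)"
     "N ** (\<chi> a b. s * M $ a $ b) = (\<chi> a b. s * (N ** M) $ a $ b)" for s and M N :: "'r cmat"
    by (simp_all add: matrix_matrix_mult_def sum_distrib_left vec_eq_iff mult_ac)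
   show ?thesis
    unfolding l matrix_add_ldistrib matrix_add_rdistrib' sc matrix_unit_mult matrix_mul_lid matrix_mul_rid
    by (simp add: matrix_unit_mult vec_eq_iff algebra_simps power2_eq_square kj kj[symmetric])
  qed
  have "\<rho> (?e s) *v u = (\<rho> (?e s) ** drep \<rho> (E j k) ** \<rho> (?e (- s))) *v v0"
   by (simp add: u_def matrix_vector_mul_assoc[symmetric] line1_parabolic_v0[OF kj] k)
  also have "\<dots> = drep \<rho> (?e s ** E j k ** ?e (- s)) *v v0"
   by (subst drep_conjugate[OF rational line1_GL[OF kj] line1_GL[OF kj] inv]) simp
  also have "\<dots> = u + s *s ((of_int \<beta> + of_nat c) *s v0 - of_int \<beta> *s v0) - s\<^sup>2 *s 0"
  proof -
   have mv: "(\<chi> a b. s * M $ a $ b) *v w = s *s (M *v w)" for s and M :: "'d cmat" and w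
    by (simp add: vec_eq_iff matrix_vector_mult_def sum_distrib_left mult_ac)
   show ?thesis
    unfolding conj drep_add[OF rational] drep_diff[OF rational] drep_scale[OF rational]
     matrix_vector_mult_add_rdistrib matrix_vector_mult_diff_rdistrib mv drep_diagonal_v0
    using k j drep_parabolic_v0[OF kj] by (simp add: u_def)
  qed
  finally show ?thesis by (simp add: vec_eq_iff algebra_simps)
 qed
 have "(drep \<rho> (E k j) *v u) $ p = (of_nat c *s v0) $ p" for p
 proof (rule DERIV_unique[OF drep_curve_vec[OF rational line1_derivative line1_0]])
  show "DERIV (\<lambda>t. (\<rho> (line1 (E k j) t) *v u) $ p) 0 :> (of_nat c *s v0) $ p"
   unfolding line by (auto intro!: derivative_eq_intros)
 qed
 then show ?thesis by (simp add: vec_eq_iff u_def)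
qed

text \<open>
  Up to a power of the determinant, coefficient functions extend to polynomials on all matrices,
  because translates of v0 span the representation.
\<close>

lemma model_polynomial:
 "\<exists>Q T a. continuous_on UNIV Q \<and> Q = (\<lambda>g. \<Sum>h\<in>T. a h * minor I (g ** h) ^ c) \<and>
   (\<forall>g\<in>GL. dot \<xi> (\<rho> g *v w) = det g powi \<beta> * Q g)"
proof -
 have "w \<in> vec.span {\<rho> g *v v0 | g. g \<in> GL}" using irreducible_span[OF irr v0_nonzero] by simp
 then obtain t u where t: "finite t" "t \<subseteq> {\<rho> g *v v0 | g. g \<in> GL}" "w = (\<Sum>x\<in>t. u x *s x)"
  unfolding vec.span_explicit by blast
 have "\<forall>x. \<exists>h. x \<in> t \<longrightarrow> h \<in> GL \<and> x = \<rho> h *v v0" using t(2) by blast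
 from choice[OF this] obtain k where k: "\<forall>x. x \<in> t \<longrightarrow> k x \<in> GL \<and> x = \<rho> (k x) *v v0" ..
 have inj: "inj_on k t" by (rule inj_onI) (metis k)
 define a where "a h = u (\<rho> h *v v0) * det h powi \<beta>" for h
 define Q where "Q g = (\<Sum>h\<in>k ` t. a h * minor I (g ** h) ^ c)" for g
 have "continuous_on UNIV (\<lambda>g::'r cmat. g ** h)" for h
  unfolding matrix_matrix_mult_def by (intro continuous_intros)
 then have cont: "continuous_on UNIV Q"
  unfolding Q_def
  by (intro continuous_on_sum continuous_on_mult continuous_on_const continuous_on_power
    continuous_on_compose2[OF continuous_on_minor[of UNIV]]) auto
 have "dot \<xi> (\<rho> g *v w) = det g powi \<beta> * Q g" if g: "g \<in> GL" for g
 proof -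
  have "w = (\<Sum>x\<in>t. u (\<rho> (k x) *v v0) *s (\<rho> (k x) *v v0))"
   unfolding t(3) by (rule sum.cong) (use k in auto)
  also have "\<dots> = (\<Sum>h\<in>k ` t. u (\<rho> h *v v0) *s (\<rho> h *v v0))" by (simp add: sum.reindex[OF inj])
  finally have "dot \<xi> (\<rho> g *v w) = (\<Sum>h\<in>k ` t. u (\<rho> h *v v0) * dot \<xi> (\<rho> g *v (\<rho> h *v v0)))"
   by (simp add: mv_sum mv_scale dot_sum dot_scale)
  also have "\<dots> = (\<Sum>h\<in>k ` t. det g powi \<beta> * (a h * minor I (g ** h) ^ c))"
  proof (rule sum.cong[OF refl])
   fix h assume "h \<in> k ` t"
   then have h: "h \<in> GL" using k by auto
   have "dot \<xi> (\<rho> g *v (\<rho> h *v v0)) = dot \<xi> (\<rho> (g ** h) *v v0)"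
    by (simp add: rho_mult g h matrix_vector_mul_assoc)
   then show "u (\<rho> h *v v0) * dot \<xi> (\<rho> g *v (\<rho> h *v v0)) = det g powi \<beta> * (a h * minor I (g ** h) ^ c)"
    by (simp add: theta g h det_mul power_int_mult_distrib a_def)
  qed
  finally show ?thesis by (simp add: Q_def sum_distrib_left)
 qed
 moreover have "Q = (\<lambda>g. \<Sum>h\<in>k ` t. a h * minor I (g ** h) ^ c)"
  by (auto simp: Q_def)
 ultimately show ?thesis using cont by blast
qed

end

section \<open>Polarization\<close>

lemma alternating_sum_Pow:
 assumes "finite D"
 shows "(\<Sum>S\<in>Pow D. (-1) ^ card (D - S) :: complex) = (if D = {} then 1 else 0)"
 using assms
proof (induction D rule: finite_induct)
 case (insert a D)
 have "(\<Sum>S\<in>Pow (insert a D). (-1) ^ card (insert a D - S) :: complex) =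
   (\<Sum>S\<in>Pow D. (-1) ^ card (insert a D - S)) + (\<Sum>S\<in>insert a ` Pow D. (-1) ^ card (insert a D - S))"
  unfolding Pow_insert by (rule sum.union_disjoint) (use insert in auto)
 also have "(\<Sum>S\<in>insert a ` Pow D. (-1) ^ card (insert a D - S) :: complex) = (\<Sum>S\<in>Pow D. (-1) ^ card (insert a D - insert a S))"
  using insert by (subst sum.reindex) (auto simp: inj_on_def)
 also have "\<dots> = (\<Sum>S\<in>Pow D. (-1) ^ card (D - S))"
  using insert by (intro sum.cong refl) (auto simp: insert_Diff_if intro!: arg_cong[of _ _ "\<lambda>A. (-1) ^ card A"])
 also have "(\<Sum>S\<in>Pow D. (-1) ^ card (insert a D - S) :: complex) = (\<Sum>S\<in>Pow D. - ((-1) ^ card (D - S)))"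
 proof (rule sum.cong[OF refl])
  fix S assume S: "S \<in> Pow D"
  then have "insert a D - S = insert a (D - S)" using insert by auto
  then show "(-1) ^ card (insert a D - S) = - ((-1) ^ card (D - S) :: complex)"
   using insert by simp
 qed
 finally show ?case by (simp add: sum_negf)
qed simp

text \<open>
  Inclusion and exclusion over the set of factors: only the surjective, hence bijective, selections
  of factors survive.
\<close>

lemma polarization:
 fixes x :: "'a \<Rightarrow> complex"
 assumes T: "finite T"
 obtains M :: complex where "M \<noteq> 0"
  "\<And>x::'a \<Rightarrow> complex. (\<Sum>S\<in>Pow T. (-1) ^ card (T - S) * (\<Sum>i\<in>S. x i) ^ card T) = M * (\<Prod>i\<in>T. x i)"
proof -
 let ?F = "PiE T (\<lambda>_. T)"
 let ?B = "{f \<in> ?F. f ` T = T}"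
 have finF: "finite ?F" using T by (intro finite_PiE) auto
 have expand: "(\<Sum>i\<in>S. x i) ^ card T = (\<Sum>f\<in>?F. if f ` T \<subseteq> S then \<Prod>k\<in>T. x (f k) else 0)"
  if S: "S \<subseteq> T" for S and x :: "'a \<Rightarrow> complex"
 proof -
  have fS: "finite S" using S T finite_subset by blast
  have "(\<Sum>i\<in>S. x i) ^ card T = (\<Prod>k\<in>T. \<Sum>i\<in>S. x i)" by simp
  also have "\<dots> = (\<Sum>f\<in>PiE T (\<lambda>_. S). \<Prod>k\<in>T. x (f k))"
   using T fS by (subst prod_sum_PiE) auto
  also have "\<dots> = (\<Sum>f\<in>?F. if f ` T \<subseteq> S then \<Prod>k\<in>T. x (f k) else 0)"
   by (rule sum.mono_neutral_cong_left[OF finF]) (use S in \<open>auto simp: PiE_def Pi_def image_subset_iff\<close>)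
  finally show ?thesis .
 qed
 have "(\<Sum>S\<in>Pow T. (-1) ^ card (T - S) * (\<Sum>i\<in>S. x i) ^ card T) = of_nat (card ?B) * (\<Prod>i\<in>T. x i)" for x :: "'a \<Rightarrow> complex"
 proof -
  have "(\<Sum>S\<in>Pow T. (-1) ^ card (T - S) * (\<Sum>i\<in>S. x i) ^ card T) =
    (\<Sum>S\<in>Pow T. \<Sum>f\<in>?F. (if f ` T \<subseteq> S then (-1) ^ card (T - S) else 0) * (\<Prod>k\<in>T. x (f k)))"
   by (rule sum.cong[OF refl]) (auto simp: expand sum_distrib_left intro!: sum.cong)
  also have "\<dots> = (\<Sum>f\<in>?F. (\<Sum>S\<in>Pow T. if f ` T \<subseteq> S then (-1) ^ card (T - S) else 0) * (\<Prod>k\<in>T. x (f k)))"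
   by (subst sum.swap) (simp add: sum_distrib_right)
  also have "\<dots> = (\<Sum>f\<in>?F. if f ` T = T then \<Prod>i\<in>T. x i else 0)"
  proof (rule sum.cong[OF refl])
   fix f assume f: "f \<in> ?F"
   then have fT: "f ` T \<subseteq> T" by auto
   have "(\<Sum>S\<in>Pow T. if f ` T \<subseteq> S then (-1) ^ card (T - S) else 0 :: complex) =
     (\<Sum>S\<in>{S\<in>Pow T. f ` T \<subseteq> S}. (-1) ^ card (T - S))"
    using T by (subst sum.inter_filter[symmetric]) auto
   also have "\<dots> = (\<Sum>S\<in>Pow (T - f ` T). (-1) ^ card (T - f ` T - S))"
    by (rule sum.reindex_bij_witness[of _ "\<lambda>S. S \<union> f ` T" "\<lambda>S. S - f ` T"])
      (use fT in \<open>auto intro!: arg_cong[of _ _ "\<lambda>A. (-1) ^ card A"]\<close>)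
   also have "\<dots> = (if f ` T = T then 1 else 0)"
    using T fT by (subst alternating_sum_Pow) auto
   finally have 1: "(\<Sum>S\<in>Pow T. if f ` T \<subseteq> S then (-1) ^ card (T - S) else 0 :: complex) = (if f ` T = T then 1 else 0)" .
   have "(\<Prod>k\<in>T. x (f k)) = (\<Prod>i\<in>T. x i)" if "f ` T = T"
    using prod.reindex[of f T x] eq_card_imp_inj_on[OF T, of f] that by simp
   with 1 show "(\<Sum>S\<in>Pow T. if f ` T \<subseteq> S then (-1) ^ card (T - S) else 0) * (\<Prod>k\<in>T. x (f k)) =
     (if f ` T = T then \<Prod>i\<in>T. x i else 0)" by simp
  qed
  also have "\<dots> = of_nat (card ?B) * (\<Prod>i\<in>T. x i)"
   using finF by (simp add: sum.inter_filter[symmetric])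
  finally show ?thesis .
 qed
 moreover have "restrict id T \<in> ?B" by auto
 then have "card ?B \<noteq> 0" using finF by (metis (no_types, lifting) card_eq_0_iff empty_iff finite_Collect_conjI finite_subset mem_Collect_eq subsetI)
 then have "of_nat (card ?B) \<noteq> (0::complex)" by simp
 ultimately show ?thesis using that by blast
qed

context rectangular_rep
begin

section \<open>Vectors of special weight\<close>

definition complement_diag :: "complex \<Rightarrow> 'r cmat" where
 "complement_diag t = diag_matrix (\<chi> i. if i \<in> I then 1 else t)"

lemma complement_diag_entry: "complement_diag t $ i $ j = (if i = j then if i \<in> I then 1 else t else 0)"
 by (simp add: complement_diag_def diag_matrix_def)

text \<open>
  The coefficient function of w, extended to all matrices, is unchanged by
  \<open>complement_diag t\<close> for \<open>t \<noteq> 0\<close> on the right, hence also for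
  \<open>t = 0\<close>. At \<open>t = 0\<close> it depends on g only through its columns in I,
  and multiplicativity of the minor shows that it is a multiple of the coefficient function of v0.
\<close>

lemma complement_weight_multiple_v0:
 assumes w: "\<And>t. t \<noteq> 0 \<Longrightarrow> \<rho> (complement_diag t) *v w = (det (complement_diag t) powi \<beta>) *s w"
 shows "\<exists>k. w = k *s v0"
proof -
 from model_polynomial[of w] obtain Q T a where cont: "continuous_on UNIV Q"
  and Qa: "Q = (\<lambda>g. \<Sum>h\<in>T. a h * minor I (g ** h) ^ c)"
  and Q': "\<forall>g\<in>GL. dot \<xi> (\<rho> g *v w) = det g powi \<beta> * Q g" by blast
 note Q = bspec[OF Q']
 define k where "k = (\<Sum>h\<in>T. a h * minor I h ^ c)"
 have dGL: "complement_diag t \<in> GL" if "t \<noteq> 0" for t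
  using that by (simp add: GL_iff_det complement_diag_def det_diag_matrix)
 have "Q g = minor I g ^ c * k" if g: "g \<in> GL" for g
 proof -
  have "Q (g ** complement_diag s) = Q g" if s: "s \<noteq> 0" for s
  proof -
   have "det (g ** complement_diag s) powi \<beta> * Q (g ** complement_diag s) = dot \<xi> (\<rho> (g ** complement_diag s) *v w)"
    using Q[of "g ** complement_diag s"] g dGL[OF s] by simp
   also have "\<dots> = dot \<xi> (\<rho> g *v (\<rho> (complement_diag s) *v w))"
    by (simp add: rho_mult g dGL[OF s] matrix_vector_mul_assoc)
   also have "\<dots> = det (complement_diag s) powi \<beta> * (det g powi \<beta> * Q g)"
    by (simp add: w[OF s] mv_scale dot_scale Q[OF g])
   finally show ?thesis
    using g dGL[OF s] by (simp add: det_mul power_int_mult_distrib GL_iff_det)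
  qed
  then have ev: "\<forall>\<^sub>F s in at 0. Q g = Q (g ** complement_diag s)"
   unfolding eventually_at by (intro exI[of _ 1]) auto
  have "((\<lambda>s. g ** complement_diag s) \<longlongrightarrow> g ** complement_diag 0) (at 0)"
  proof (intro vec_tendstoI)
   fix i j
   have "((\<lambda>s. complement_diag s $ k $ j) \<longlongrightarrow> complement_diag 0 $ k $ j) (at 0)" for k
    by (cases "k = j"; cases "k \<in> I") (auto simp: complement_diag_entry intro!: tendsto_eq_intros)
   then have "((\<lambda>s. \<Sum>k\<in>UNIV. g $ i $ k * complement_diag s $ k $ j) \<longlongrightarrow>
     (\<Sum>k\<in>UNIV. g $ i $ k * complement_diag 0 $ k $ j)) (at 0)"
    by (intro tendsto_sum tendsto_mult_left)
   then show "((\<lambda>s. (g ** complement_diag s) $ i $ j) \<longlongrightarrow> (g ** complement_diag 0) $ i $ j) (at 0)"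
    by (simp add: matrix_matrix_mult_def)
  qed
  moreover have "isCont Q (g ** complement_diag 0)"
   using cont by (simp add: continuous_on_eq_continuous_at)
  ultimately have "((\<lambda>s. Q (g ** complement_diag s)) \<longlongrightarrow> Q (g ** complement_diag 0)) (at 0)"
   by (rule isCont_tendsto_compose[rotated])
  moreover have "((\<lambda>s. Q (g ** complement_diag s)) \<longlongrightarrow> Q g) (at 0)"
   by (rule Lim_transform_eventually[OF tendsto_const ev])
  ultimately have "Q g = Q (g ** complement_diag 0)" using tendsto_unique at_neq_bot by blast
  also have "\<dots> = (\<Sum>h\<in>T. a h * (minor I g * minor I h) ^ c)"
  proof -
   have ent: "(g ** complement_diag 0) $ i $ j = (if j \<in> I then g $ i $ j else 0)" for i j
   proof -
    have "g $ i $ k * complement_diag 0 $ k $ j = (if k = j then (if j \<in> I then g $ i $ j else 0) else 0)" for k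
     by (auto simp: complement_diag_entry)
    then show ?thesis by (simp add: matrix_matrix_mult_def)
   qed
   have "mask I (g ** complement_diag 0) = mask I g" by (auto simp: mask_def vec_eq_iff ent)
   then have "minor I (g ** complement_diag 0 ** h) = minor I g * minor I h" for h
    by (subst minor_mult_left) (auto simp: ent minor_def)
   then show ?thesis by (simp add: Qa)
  qed
  finally show ?thesis by (simp add: k_def power_mult_distrib sum_distrib_left mult_ac)
 qed
 then have "w = k *s v0"
  by (intro separation_eq) (simp add: Q theta mv_scale dot_scale mult_ac)
 then show ?thesis ..
qed

section \<open>Functions in the image of the representation\<close>

text \<open>
  For invertible Z this is the function of a multiple of \<open>\<rho> Z *v v0\<close>; the
  general case is a limit.
\<close>

lemma minor_model: "(\<lambda>g. det g powi \<beta> * minor I (g ** Z) ^ c) \<in> model"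
proof (rule model_limit[of "\<lambda>s g. det g powi \<beta> * minor I (g ** path_to_1 Z s) ^ c" "at 0"])
 show "\<forall>\<^sub>F s in at 0. (\<lambda>g. det g powi \<beta> * minor I (g ** path_to_1 Z s) ^ c) \<in> model"
  using eventually_path_GL[of Z]
 proof eventually_elim
  case (elim s)
  let ?Z = "path_to_1 Z s"
  have "det g powi \<beta> * minor I (g ** ?Z) ^ c = dot \<xi> (\<rho> g *v (inverse (det ?Z powi \<beta>) *s (\<rho> ?Z *v v0)))"
   if g: "g \<in> GL" for g
  proof -
   have "dot \<xi> (\<rho> g *v (\<rho> ?Z *v v0)) = dot \<xi> (\<rho> (g ** ?Z) *v v0)"
    by (simp add: rho_mult g elim matrix_vector_mul_assoc)
   then show ?thesis using elim g
    by (simp add: theta mv_scale dot_scale det_mul power_int_mult_distrib GL_iff_det)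
  qed
  then show ?case unfolding model_def by blast
 qed
 fix g :: "'r cmat"
 have "((\<lambda>s. g ** path_to_1 Z s) \<longlongrightarrow> g ** Z) (at 0)"
 proof (intro vec_tendstoI)
  fix i j
  have "((\<lambda>s. \<Sum>k\<in>UNIV. g $ i $ k * path_to_1 Z s $ k $ j) \<longlongrightarrow> (\<Sum>k\<in>UNIV. g $ i $ k * Z $ k $ j)) (at 0)"
   by (intro tendsto_sum tendsto_mult_left tendsto_vec_nth path_to_1_tendsto)
  then show "((\<lambda>s. (g ** path_to_1 Z s) $ i $ j) \<longlongrightarrow> (g ** Z) $ i $ j) (at 0)"
   by (simp add: matrix_matrix_mult_def)
 qed
 moreover have "isCont (minor I) (g ** Z)"
  using continuous_on_minor[of UNIV I] by (simp add: continuous_on_eq_continuous_at)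
 ultimately have "((\<lambda>s. minor I (g ** path_to_1 Z s)) \<longlongrightarrow> minor I (g ** Z)) (at 0)"
  by (rule isCont_tendsto_compose[rotated])
 then show "((\<lambda>s. det g powi \<beta> * minor I (g ** path_to_1 Z s) ^ c) \<longlongrightarrow> det g powi \<beta> * minor I (g ** Z) ^ c) (at 0)"
  by (intro tendsto_mult_left tendsto_power)
qed simp

text \<open>
  One linear formula in the values of F represents every function of the model.
\<close>

lemma model_vector:
 obtains G a where "finite G" "G \<subseteq> GL"
  "\<And>F g. F \<in> model \<Longrightarrow> g \<in> GL \<Longrightarrow> dot \<xi> (\<rho> g *v (\<Sum>h\<in>G. F h *s a h)) = F g"
proof -
 obtain G a where G: "finite G" "G \<subseteq> GL" and a: "\<And>w. w = (\<Sum>h\<in>G. dot \<xi> (\<rho> h *v w) *s a h)"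
  using interpolation by blast
 have "dot \<xi> (\<rho> g *v (\<Sum>h\<in>G. F h *s a h)) = F g" if F: "F \<in> model" and g: "g \<in> GL" for F g
 proof -
  obtain w where w: "\<forall>g\<in>GL. F g = dot \<xi> (\<rho> g *v w)" using F unfolding model_def by blast
  have "(\<Sum>h\<in>G. F h *s a h) = (\<Sum>h\<in>G. dot \<xi> (\<rho> h *v w) *s a h)"
   by (rule sum.cong) (use w G in auto)
  then show ?thesis using a[of w] w g by simp
 qed
 then show ?thesis using that G by blast
qed

text \<open>
  For a one element set I the functions of the model are forms of degree c in the row i0 of g. The
  powers of linear forms belong to it by the case of rank one matrices Z, and polarization gives all
  products of linear forms.
\<close>

lemma product_model:
 assumes I: "I = {i0}" and T: "finite T" "card T = c"
 shows "(\<lambda>g. det g powi \<beta> * (\<Prod>k\<in>T. \<Sum>b\<in>UNIV. g $ i0 $ b * y k b)) \<in> model"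
proof -
 obtain M :: complex where M: "M \<noteq> 0"
  "\<And>x. (\<Sum>S\<in>Pow T. (-1) ^ card (T - S) * (\<Sum>i\<in>S. x i) ^ card T) = M * (\<Prod>i\<in>T. x i)"
  using polarization[OF T(1)] by blast
 have "(\<lambda>g. \<Sum>S\<in>Pow T. ((-1) ^ card (T - S) / M) * (det g powi \<beta> * minor I (g ** (\<chi> a b. \<Sum>k\<in>S. y k a)) ^ c)) \<in> model"
  by (intro model_sum model_scale minor_model)
 moreover have "(\<Sum>S\<in>Pow T. ((-1) ^ card (T - S) / M) * (det g powi \<beta> * minor I (g ** (\<chi> a b. \<Sum>k\<in>S. y k a)) ^ c)) =
   det g powi \<beta> * (\<Prod>k\<in>T. \<Sum>b\<in>UNIV. g $ i0 $ b * y k b)" for g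
 proof -
  have "minor I (g ** (\<chi> a b. \<Sum>k\<in>S. y k a)) = (\<Sum>k\<in>S. \<Sum>b\<in>UNIV. g $ i0 $ b * y k b)" for S
   by (subst sum.swap) (simp add: I minor_singleton matrix_matrix_mult_def sum_distrib_left)
  then have "(\<Sum>S\<in>Pow T. ((-1) ^ card (T - S) / M) * (det g powi \<beta> * minor I (g ** (\<chi> a b. \<Sum>k\<in>S. y k a)) ^ c)) =
   det g powi \<beta> / M * (\<Sum>S\<in>Pow T. (-1) ^ card (T - S) * (\<Sum>k\<in>S. \<Sum>b\<in>UNIV. g $ i0 $ b * y k b) ^ card T)"
   by (simp add: sum_distrib_left mult_ac T(2))
  then show ?thesis using M by simp
 qed
 ultimately show ?thesis by simp
qed

text \<open>
  The power of the determinant expands into products of c linear forms in the row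
  \<open>g $ i0\<close>.
\<close>

lemma det_model:
 fixes N :: "'r \<Rightarrow> 'r cmat"
 assumes I: "I = {i0}" and c: "c = \<kappa> * CARD('r)"
 shows "(\<lambda>g. det g powi \<beta> * det (\<chi> i b. \<Sum>a\<in>UNIV. g $ i0 $ a * N i $ a $ b) ^ \<kappa>) \<in> model"
proof -
 let ?P = "{p. p permutes (UNIV::'r set)}"
 let ?F = "PiE {..<\<kappa>} (\<lambda>_. ?P)"
 let ?K = "\<lambda>g i b. \<Sum>a\<in>UNIV. g $ i0 $ a * N i $ a $ b"
 have eq: "det g powi \<beta> * det (\<chi> i b. ?K g i b) ^ \<kappa> =
   (\<Sum>f\<in>?F. (\<Prod>m<\<kappa>. of_int (sign (f m))) * (det g powi \<beta> * (\<Prod>(m, i)\<in>{..<\<kappa>} \<times> UNIV. ?K g i (f m i))))" for g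
 proof -
  have "det (\<chi> i b. ?K g i b) ^ \<kappa> = (\<Prod>m<\<kappa>. \<Sum>p\<in>?P. of_int (sign p) * (\<Prod>i\<in>UNIV. ?K g i (p i)))"
   by (simp add: det_def)
  also have "\<dots> = (\<Sum>f\<in>?F. \<Prod>m<\<kappa>. of_int (sign (f m)) * (\<Prod>i\<in>UNIV. ?K g i (f m i)))"
   by (subst prod_sum_PiE) (auto simp: finite_permutations)
  also have "\<dots> = (\<Sum>f\<in>?F. (\<Prod>m<\<kappa>. of_int (sign (f m))) * (\<Prod>(m, i)\<in>{..<\<kappa>} \<times> UNIV. ?K g i (f m i)))"
   by (simp add: prod.distrib prod.cartesian_product)
  finally show ?thesis by (simp add: sum_distrib_left mult_ac)
 qed
 have prodm: "(\<lambda>g. det g powi \<beta> * (\<Prod>(m, i)\<in>{..<\<kappa>} \<times> UNIV. ?K g i (f m i))) \<in> model" for f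
  using product_model[OF I, of "{..<\<kappa>} \<times> UNIV" "\<lambda>(m, i) a. N i $ a $ f m i"] c
  by (simp add: case_prod_beta)
 have "(\<lambda>g. \<Sum>f\<in>?F. (\<Prod>m<\<kappa>. of_int (sign (f m))) * (det g powi \<beta> * (\<Prod>(m, i)\<in>{..<\<kappa>} \<times> UNIV. ?K g i (f m i)))) \<in> model"
  by (intro model_sum model_scale prodm)
 then show ?thesis by (simp only: eq)
qed

section \<open>The zero weight space\<close>

text \<open>
  The function is a form in the first row of g and has to be invariant under rescaling the columns;
  this leaves only the monomial with equal exponents.
\<close>

lemma zero_weight_function:
 assumes I: "I = {i0}" and least: "\<And>i. i0 \<le> i" and c: "c = \<kappa> * CARD('r)" and b: "\<beta> = - int \<kappa>"
  and w: "\<And>t. (\<And>i. t $ i \<noteq> 0) \<Longrightarrow> \<rho> (diag_matrix t) *v w = w"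
 shows "\<exists>k. \<forall>g\<in>GL. dot \<xi> (\<rho> g *v w) = k * (det g powi \<beta> * (\<Prod>b\<in>UNIV. g $ i0 $ b ^ \<kappa>))"
proof -
 from model_polynomial[of w] obtain Q T a where Qa: "Q = (\<lambda>g. \<Sum>h\<in>T. a h * minor I (g ** h) ^ c)"
  and Q': "\<forall>g\<in>GL. dot \<xi> (\<rho> g *v w) = det g powi \<beta> * Q g" by blast
 note Q = bspec[OF Q']
 define P where "P r = (\<Sum>h\<in>T. a h * (\<Sum>b\<in>UNIV. r $ b * h $ b $ i0) ^ c)" for r :: "'r cvec"
 have QP: "Q g = P (g $ i0)" for g
  by (simp add: Qa P_def I minor_singleton matrix_matrix_mult_def)
 \<comment> \<open>an invertible matrix with first row \<open>(1, ..., 1)\<close>: multiplied by a diagonal matrix it realizes any first row without zeros\<close>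
 define g1 :: "'r cmat" where "g1 = (\<chi> a b. if a = i0 then 1 else mat 1 $ a $ b)"
 have "det g1 = (\<Prod>i\<in>UNIV. g1 $ i $ i)"
  by (rule det_upper_triangular) (use least in \<open>auto simp: g1_def mat_def leD\<close>)
 moreover have "g1 $ i $ i = 1" for i by (simp add: g1_def mat_def)
 ultimately have det1: "det g1 = 1" by simp
 then have g1: "g1 \<in> GL" by (simp add: GL_iff_det)
 have row: "(g1 ** diag_matrix t) $ i0 = t" for t
 proof -
  have "g1 $ i0 $ k * diag_matrix t $ k $ j = (if k = j then t $ j else 0)" for k j
   by (simp add: g1_def diag_matrix_def)
  then show ?thesis by (simp add: vec_eq_iff matrix_matrix_mult_def)
 qed
 have row1: "g1 $ i0 = (\<chi> i. 1)" by (simp add: g1_def vec_eq_iff)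
 have nz: "P t = (\<Prod>b\<in>UNIV. t $ b ^ \<kappa>) * P (\<chi> i. 1)" if t: "\<And>i. t $ i \<noteq> 0" for t
 proof -
  have dGL: "diag_matrix t \<in> GL" using t by (simp add: GL_iff_det det_diag_matrix)
  have "dot \<xi> (\<rho> (g1 ** diag_matrix t) *v w) = dot \<xi> (\<rho> g1 *v (\<rho> (diag_matrix t) *v w))"
   by (simp add: rho_mult g1 dGL matrix_vector_mul_assoc)
  then have "det (diag_matrix t) powi \<beta> * P t = P (\<chi> i. 1)"
   using Q[of "g1 ** diag_matrix t"] Q[OF g1] g1 dGL
   by (simp add: w[OF t] QP row row1 det_mul det1)
  then have "(\<Prod>i\<in>UNIV. t $ i) powi \<beta> * P t = P (\<chi> i. 1)" by (simp add: det_diag_matrix)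
  moreover have "(\<Prod>i\<in>UNIV. t $ i) \<noteq> 0" using t by simp
  ultimately show ?thesis
   by (simp add: b power_int_minus prod_power_distrib[symmetric] field_simps)
 qed
 have all: "P r = (\<Prod>b\<in>UNIV. r $ b ^ \<kappa>) * P (\<chi> i. 1)" for r
 proof -
  \<comment> \<open>rows with zeros are limits of rows without\<close>
  define p where "p s = (\<chi> i. r $ i + s * (1 - r $ i))" for s
  have "\<forall>\<^sub>F s in at 0. \<forall>i. minor {i} (path_to_1 (diag_matrix r) s) \<noteq> 0"
   by (intro eventually_all_finite eventually_minor_path)
  then have ev: "\<forall>\<^sub>F s in at 0. P (p s) = (\<Prod>b\<in>UNIV. p s $ b ^ \<kappa>) * P (\<chi> i. 1)"
   by eventually_elim (rule nz, simp add: minor_singleton path_to_1_def diag_matrix_def p_def mat_def)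
  have lim: "((\<lambda>s. p s $ i) \<longlongrightarrow> r $ i) (at 0)" for i
   by (auto simp: p_def intro!: tendsto_eq_intros)
  have "((\<lambda>s. P (p s)) \<longlongrightarrow> P r) (at 0)"
   unfolding P_def by (intro tendsto_sum tendsto_mult_left tendsto_power tendsto_mult_right lim)
  moreover have "((\<lambda>s. (\<Prod>b\<in>UNIV. p s $ b ^ \<kappa>) * P (\<chi> i. 1)) \<longlongrightarrow> (\<Prod>b\<in>UNIV. r $ b ^ \<kappa>) * P (\<chi> i. 1)) (at 0)"
   by (intro tendsto_mult_right tendsto_prod tendsto_power lim)
  ultimately show ?thesis
   by (rule tendsto_unique[OF at_neq_bot Lim_transform_eventually[OF _ ev]])
 qed
 show ?thesis
 proof (intro exI[of _ "P (\<chi> i. 1)"] ballI)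
  fix g :: "'r cmat" assume "g \<in> GL"
  then show "dot \<xi> (\<rho> g *v w) = P (\<chi> i. 1) * (det g powi \<beta> * (\<Prod>b\<in>UNIV. g $ i0 $ b ^ \<kappa>))"
   using Q[of g] all[of "g $ i0"] by (simp only: QP mult_ac)
 qed
qed

text \<open>
  On the monomial \<open>\<Prod>b. r_b ^ \<kappa>\<close> the operators act as
  \<open>r_j \<partial>/\<partial>r_i\<close> and \<open>r_i \<partial>/\<partial>r_j\<close>.
\<close>

lemma zero_weight_raise_lower:
 assumes w: "\<And>g. g \<in> GL \<Longrightarrow> dot \<xi> (\<rho> g *v w) = k * (det g powi \<beta> * (\<Prod>b\<in>UNIV. g $ i0 $ b ^ \<kappa>))"
  and ij: "i \<noteq> j"
 shows "drep \<rho> (E i j) *v (drep \<rho> (E j i) *v w) = (of_nat \<kappa> * (of_nat \<kappa> + 1)) *s w"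
proof -
 define R where "R g = (\<Prod>b\<in>UNIV - {i} - {j}. g $ i0 $ b ^ \<kappa>)" for g :: "'r cmat"
 have split: "(\<Prod>b\<in>UNIV. f b) = f i * (f j * (\<Prod>b\<in>UNIV - {i} - {j}. f b))" for f :: "'r \<Rightarrow> complex"
  using ij by (simp add: prod.remove[of UNIV i] prod.remove[of "UNIV - {i}" j])
 have E: "dot \<xi> (\<rho> g *v w) = k * (det g powi \<beta> * (g $ i0 $ i ^ \<kappa> * (g $ i0 $ j ^ \<kappa> * R g)))" if "g \<in> GL" for g
  using w[OF that] by (simp add: split R_def)
 have first: "dot \<xi> (\<rho> g *v (drep \<rho> (E j i) *v w)) =
   k * (det g powi \<beta> * (of_nat \<kappa> * g $ i0 $ i ^ (\<kappa> - 1) * (g $ i0 $ j ^ Suc \<kappa> * R g)))" if g: "g \<in> GL" for g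
 proof (rule DERIV_unique[OF model_derivative[OF g]])
  let ?l = "\<lambda>t. line1 (E j i) t"
  have "g ** ?l t \<in> GL" for t using g line1_GL[of j i t] ij by simp
  moreover have "R (g ** ?l t) = R g" for t
   unfolding R_def by (rule prod.cong) (auto simp: mult_line1_unit_row)
  ultimately have "dot \<xi> (\<rho> (g ** ?l t) *v w) =
    k * (det g powi \<beta> * ((g $ i0 $ i + t * g $ i0 $ j) ^ \<kappa> * (g $ i0 $ j ^ \<kappa> * R g)))" for t
   using ij by (simp add: E mult_line1_unit_row det_mul line1_unit_det)
  then show "DERIV (\<lambda>t. dot \<xi> (\<rho> (g ** ?l t) *v w)) 0 :> k * (det g powi \<beta> * (of_nat \<kappa> * g $ i0 $ i ^ (\<kappa> - 1) * (g $ i0 $ j ^ Suc \<kappa> * R g)))"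
   by (auto intro!: derivative_eq_intros)
 qed
 show ?thesis
 proof (rule drep_eqI)
  fix g :: "'r cmat" assume g: "g \<in> GL"
  let ?l = "\<lambda>t. line1 (E i j) t"
  have "g ** ?l t \<in> GL" for t using g line1_GL[of i j t] ij by simp
  moreover have "R (g ** ?l t) = R g" for t
   unfolding R_def by (rule prod.cong) (auto simp: mult_line1_unit_row)
  ultimately have f: "dot \<xi> (\<rho> (g ** ?l t) *v (drep \<rho> (E j i) *v w)) =
    k * (det g powi \<beta> * (of_nat \<kappa> * g $ i0 $ i ^ (\<kappa> - 1) * ((g $ i0 $ j + t * g $ i0 $ i) ^ Suc \<kappa> * R g)))" for t
   using ij by (simp add: first mult_line1_unit_row det_mul line1_unit_det)
  have p: "of_nat \<kappa> * (z * z ^ (\<kappa> - 1)) = of_nat \<kappa> * z ^ \<kappa>" for z :: complex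
   by (cases \<kappa>) auto
  have "DERIV (\<lambda>t. dot \<xi> (\<rho> (g ** ?l t) *v (drep \<rho> (E j i) *v w))) 0 :> k * (det g powi \<beta> * (of_nat \<kappa> * g $ i0 $ i ^ (\<kappa> - 1) * ((of_nat (Suc \<kappa>) * g $ i0 $ i * g $ i0 $ j ^ \<kappa>) * R g)))"
   unfolding f by (rule derivative_eq_intros refl | simp)+
  moreover have "k * (det g powi \<beta> * (of_nat \<kappa> * g $ i0 $ i ^ (\<kappa> - 1) * ((of_nat (Suc \<kappa>) * g $ i0 $ i * g $ i0 $ j ^ \<kappa>) * R g))) =
    (of_nat \<kappa> * (g $ i0 $ i * g $ i0 $ i ^ (\<kappa> - 1))) * (of_nat (Suc \<kappa>) * (k * det g powi \<beta> * (g $ i0 $ j ^ \<kappa> * R g)))"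
   by (simp add: mult_ac)
  moreover have "\<dots> = dot \<xi> (\<rho> g *v ((of_nat \<kappa> * (of_nat \<kappa> + 1)) *s w))"
   unfolding p mv_scale dot_scale E[OF g] by (simp add: algebra_simps)
  ultimately show "DERIV (\<lambda>t. dot \<xi> (\<rho> (g ** ?l t) *v (drep \<rho> (E j i) *v w))) 0 :> dot \<xi> (\<rho> g *v ((of_nat \<kappa> * (of_nat \<kappa> + 1)) *s w))" by (simp only:)
 qed
qed

lemma zero_weight_diagonal:
 assumes w: "\<And>t. (\<And>i. t $ i \<noteq> 0) \<Longrightarrow> \<rho> (diag_matrix t) *v w = w"
 shows "drep \<rho> (E i i) *v w = 0"
proof -
 have "(drep \<rho> (E i i) *v w) $ p = 0" for p
 proof (rule DERIV_unique[OF drep_curve_vec[OF rational line1_derivative line1_0]])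
  have "\<forall>\<^sub>F t in nhds 0. w $ p = (\<rho> (line1 (E i i) t) *v w) $ p"
   using eventually_line1_GL[of "E i i"]
  proof eventually_elim
   case (elim t)
   have "line1 (E i i) t = diag_matrix (\<chi> k. if k = i then 1 + t else 1)"
    by (auto simp: line1_def mat_def matrix_unit_def diag_matrix_def vec_eq_iff)
   moreover have "1 + t \<noteq> 0" using elim by (simp add: GL_iff_det line1_unit_det)
   ultimately show ?case using w[of "\<chi> k. if k = i then 1 + t else 1"] by simp
  qed
  then show "DERIV (\<lambda>t. (\<rho> (line1 (E i i) t) *v w) $ p) 0 :> 0"
   by (rule DERIV_eventually[OF DERIV_const])
 qed
 then show ?thesis by (simp add: vec_eq_iff)
qed

end

section \<open>The subgroup A\<close>

lemma rank_less: "card {..<(i::'r::{finite,linorder})} < CARD('r)"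
 by (rule psubset_card_mono) auto

lemma rank_inj: "card {..<i} = card {..<(j::'r::{finite,linorder})} \<longleftrightarrow> i = j"
 using card_lessThan_strict[of i j] card_lessThan_strict[of j i] by (cases i j rule: linorder_cases) auto

lemma rank_surj: assumes "k < CARD('r)" shows "\<exists>i::'r::{finite,linorder}. card {..<i} = k"
proof -
 have "inj (\<lambda>i::'r. card {..<i})" by (simp add: inj_def rank_inj)
 then have "card (range (\<lambda>i::'r. card {..<i})) = CARD('r)" by (rule card_image)
 moreover have "range (\<lambda>i::'r. card {..<i}) \<subseteq> {..<CARD('r)}" using rank_less by auto
 ultimately have "range (\<lambda>i::'r. card {..<i}) = {..<CARD('r)}" by (intro card_subset_eq) auto
 with assms have "k \<in> range (\<lambda>i::'r. card {..<i})" by simp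
 then show ?thesis by (elim rangeE) (metis)
qed

lemma rank_emb:
 assumes "CARD('n::{finite,linorder}) \<le> CARD('m::{finite,linorder})"
 shows "card {..<(emb (i::'n) :: 'm)} = card {..<i}"
proof -
 have "card {..<i} < CARD('m)" using rank_less[of i] assms by simp
 then obtain j :: 'm where j: "card {..<j} = card {..<i}" using rank_surj by blast
 show ?thesis unfolding emb_def by (rule theI[of _ j]) (rule j, metis j rank_inj)
qed

lemma emb_inj:
 assumes "CARD('n::{finite,linorder}) \<le> CARD('m::{finite,linorder})"
 shows "inj (emb :: 'n \<Rightarrow> 'm)"
 by (rule injI) (metis assms rank_emb rank_inj)

lemma range_emb:
 assumes "CARD('n::{finite,linorder}) \<le> CARD('m::{finite,linorder})"
 shows "range (emb :: 'n \<Rightarrow> 'm) = initial CARD('n)"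
proof (rule set_eqI)
 fix j :: 'm
 have "j \<in> range (emb :: 'n \<Rightarrow> 'm)" if j: "card {..<j} < CARD('n)"
 proof -
  obtain i :: 'n where i: "card {..<i} = card {..<j}" using rank_surj[OF j] by blast
  then have "card {..<(emb i :: 'm)} = card {..<j}" using rank_emb[OF assms, of i] by simp
  then have "emb i = j" by (simp only: rank_inj)
  then show ?thesis by blast
 qed
 then show "j \<in> range (emb :: 'n \<Rightarrow> 'm) \<longleftrightarrow> j \<in> initial CARD('n)"
  using rank_less rank_emb[OF assms] by (auto simp: initial_def)
qed

lemma initial_down_closed: "i \<in> initial k \<Longrightarrow> j < i \<Longrightarrow> j \<in> initial k"
 using card_lessThan_strict[of j i] by (simp add: initial_def)

lemma initial_1: "initial 1 = {i::'r::{finite,linorder}. \<forall>j. i \<le> j}"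
 by (auto simp: initial_def set_eq_iff not_less)

text \<open>
  The eigenvalue parameter attached to the index i, extended by 0 beyond the first
  \<open>CARD('n)\<close> indices.
\<close>

definition a_coord :: "'n::{finite,linorder} cvec \<Rightarrow> 'm::{finite,linorder} \<Rightarrow> complex" where
 "a_coord x i = (\<Sum>l\<in>UNIV. if emb l = i then x $ l else 0)"

text \<open>
  The value of \<open>exp (a(x))\<close>: a hyperbolic rotation in each plane spanned by the l-th
  vectors of the two blocks.
\<close>

definition amat :: "'n::{finite,linorder} cvec \<Rightarrow> ('m::{finite,linorder} + 'n) cmat" where
 "amat x = (\<chi> p q. case (p, q) of
   (Inl i, Inl j) \<Rightarrow> if i = j then cosh (a_coord x i) else 0
  | (Inr i, Inr j) \<Rightarrow> if i = j then cosh (x $ i) else 0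
  | (Inl i, Inr j) \<Rightarrow> if i = emb j then sinh (x $ j) else 0
  | (Inr i, Inl j) \<Rightarrow> if j = emb i then sinh (x $ i) else 0)"

lemma sum_UNIV_Plus:
 fixes f :: "'a::finite + 'b::finite \<Rightarrow> 'c::comm_monoid_add"
 shows "(\<Sum>p\<in>UNIV. f p) = (\<Sum>i\<in>UNIV. f (Inl i)) + (\<Sum>j\<in>UNIV. f (Inr j))"
 by (simp add: UNIV_Plus_UNIV[symmetric] sum.Plus del: UNIV_Plus_UNIV)

lemma vec_Plus_eqI:
 fixes A B :: "('m::finite + 'n::finite) cmat"
 assumes "\<And>i j. A $ Inl i $ Inl j = B $ Inl i $ Inl j" "\<And>i j. A $ Inl i $ Inr j = B $ Inl i $ Inr j"
  "\<And>i j. A $ Inr i $ Inl j = B $ Inr i $ Inl j" "\<And>i j. A $ Inr i $ Inr j = B $ Inr i $ Inr j"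
 shows "A = B"
 unfolding vec_eq_iff
proof (intro allI)
 fix p q show "A $ p $ q = B $ p $ q" by (cases p; cases q) (use assms in auto)
qed

lemma mexp_eqI:
 fixes X :: "'r::finite cmat"
 assumes "\<And>i j. (\<lambda>k. (((**) X ^^ k) (mat 1)) $ i $ j / fact k) sums (M $ i $ j)"
 shows "mexp X = M"
proof -
 have "(\<lambda>k. (1 / fact k) *\<^sub>R (((**) X ^^ k) (mat 1))) sums M"
  unfolding sums_def
 proof (intro vec_tendstoI)
  fix i j
  have "((\<Sum>k<n. (1 / fact k) *\<^sub>R (((**) X ^^ k) (mat 1))) :: 'r cmat) $ i $ j = (\<Sum>k<n. (((**) X ^^ k) (mat 1)) $ i $ j / fact k)" for n
   by (simp add: scaleR_conv_of_real[where 'a = complex])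
  then show "(\<lambda>n. (\<Sum>k<n. (1 / fact k) *\<^sub>R (((**) X ^^ k) (mat 1))) $ i $ j) \<longlonglongrightarrow> M $ i $ j"
   using assms[of i j] by (simp add: sums_def)
 qed
 then show ?thesis unfolding mexp_def by (rule sums_unique[symmetric])
qed

lemma a_matrix_entry:
 fixes x :: "'n::{finite,linorder} cvec"
 shows "(a_matrix x :: ('m::{finite,linorder} + 'n) cmat) $ Inl i $ Inl j = 0"
  "(a_matrix x :: ('m + 'n) cmat) $ Inr i' $ Inr j' = 0"
  "(a_matrix x :: ('m + 'n) cmat) $ Inl i $ Inr j' = (if i = emb j' then x $ j' else 0)"
  "(a_matrix x :: ('m + 'n) cmat) $ Inr i' $ Inl j = (if j = emb i' then x $ i' else 0)"
proof -
 have 1: "x $ l * (if i = (emb l::'m) \<and> j' = l then 1 else 0) = (if l = j' then (if i = emb j' then x $ j' else 0) else 0)" for l by auto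
 have 2: "x $ l * (if i' = l \<and> j = (emb l::'m) then 1 else 0) = (if l = i' then (if j = emb i' then x $ i' else 0) else 0)" for l by auto
 show "(a_matrix x :: ('m::{finite,linorder} + 'n) cmat) $ Inl i $ Inl j = 0"
  "(a_matrix x :: ('m + 'n) cmat) $ Inr i' $ Inr j' = 0"
  by (simp_all add: a_matrix_def matrix_unit_def)
 show "(a_matrix x :: ('m + 'n) cmat) $ Inl i $ Inr j' = (if i = emb j' then x $ j' else 0)"
  by (simp add: a_matrix_def matrix_unit_def 1)
 show "(a_matrix x :: ('m + 'n) cmat) $ Inr i' $ Inl j = (if j = emb i' then x $ i' else 0)"
  by (simp add: a_matrix_def matrix_unit_def 2)
qed

context
 fixes dummy_m :: "'m::{finite,linorder}" and dummy_n :: "'n::{finite,linorder}"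
 assumes le: "CARD('n) \<le> CARD('m)"
begin

lemma emb_eq: "(emb i :: 'm) = emb j \<longleftrightarrow> i = (j::'n)"
 using emb_inj[OF le] by (auto simp: inj_def)

lemma a_coord_emb: "a_coord x (emb l :: 'm) = x $ (l::'n)"
 by (simp add: a_coord_def emb_eq)

lemma a_coord_complement: "i \<notin> range (emb :: 'n \<Rightarrow> 'm) \<Longrightarrow> a_coord (x::'n cvec) i = 0"
 by (auto simp: a_coord_def intro!: sum.neutral)

text \<open>
  In each of these planes \<open>a(x)\<close> is \<open>x_l\<close> times the exchange of the two
  basis vectors, so its powers alternate between diagonal and exchange.
\<close>

lemma a_matrix_power:
 fixes x :: "'n cvec"
 shows "((**) (a_matrix x :: ('m + 'n) cmat) ^^ k) (mat 1) = (\<chi> p q. case (p, q) of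
   (Inl i, Inl j) \<Rightarrow> if i = j \<and> even k then a_coord x i ^ k else 0
  | (Inr i, Inr j) \<Rightarrow> if i = j \<and> even k then x $ i ^ k else 0
  | (Inl i, Inr j) \<Rightarrow> if i = emb j \<and> odd k then x $ j ^ k else 0
  | (Inr i, Inl j) \<Rightarrow> if j = emb i \<and> odd k then x $ i ^ k else 0)" (is "_ = ?P k")
proof (induction k)
 case 0
 show ?case by (rule vec_Plus_eqI) (auto simp: mat_def)
next
 case (Suc k)
 have "a_matrix x ** ?P k = ?P (Suc k)"
 proof (rule vec_Plus_eqI)
  fix i j :: 'm
  have "(\<Sum>l\<in>UNIV. (if i = emb l then x $ l else 0) * (if j = emb l \<and> odd k then x $ l ^ k else 0)) =
    (if i = j \<and> odd k then a_coord x i ^ Suc k else 0)"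
  proof (cases "i \<in> range (emb :: 'n \<Rightarrow> 'm)")
   case True
   then obtain l0 :: 'n where l0: "i = emb l0" by auto
   have "(if i = emb l then x $ l else 0) * (if j = emb l \<and> odd k then x $ l ^ k else 0) =
     (if l = l0 then (if i = j \<and> odd k then x $ l0 ^ Suc k else 0) else 0)" for l
    using l0 by (cases "j = i") (auto simp: emb_eq)
   then show ?thesis using l0 by (cases "j = i") (auto simp: a_coord_emb)
  next
   case False
   then have "(if i = emb l then x $ l else 0) = 0" for l by auto
   then show ?thesis using a_coord_complement[OF False] by (cases "i = j") auto
  qed
  then show "(a_matrix x ** ?P k) $ Inl i $ Inl j = ?P (Suc k) $ Inl i $ Inl j"
   by (simp add: matrix_matrix_mult_def sum_UNIV_Plus a_matrix_entry)
 next
  fix i :: 'm and j :: 'n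
  have "(if i = emb l then x $ l else 0) * (if l = j \<and> even k then x $ l ^ k else 0) =
    (if l = j then (if i = emb j \<and> even k then x $ j ^ Suc k else 0) else 0)" for l by auto
  then show "(a_matrix x ** ?P k) $ Inl i $ Inr j = ?P (Suc k) $ Inl i $ Inr j"
   by (simp add: matrix_matrix_mult_def sum_UNIV_Plus a_matrix_entry)
 next
  fix i :: 'n and j :: 'm
  have "(if l = emb i then x $ i else 0) * (if l = j \<and> even k then a_coord x l ^ k else 0) =
    (if l = j then (if j = emb i \<and> even k then x $ i ^ Suc k else 0) else 0)" for l
   by (auto simp: a_coord_emb)
  then show "(a_matrix x ** ?P k) $ Inr i $ Inl j = ?P (Suc k) $ Inr i $ Inl j"
   by (simp add: matrix_matrix_mult_def sum_UNIV_Plus a_matrix_entry)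
 next
  fix i j :: 'n
  have "(if l = emb i then x $ i else 0) * (if l = emb j \<and> odd k then x $ j ^ k else 0) =
    (if l = (emb i::'m) then (if i = j \<and> odd k then x $ i ^ Suc k else 0) else 0)" for l
   by (auto simp: emb_eq)
  then show "(a_matrix x ** ?P k) $ Inr i $ Inr j = ?P (Suc k) $ Inr i $ Inr j"
   by (simp add: matrix_matrix_mult_def sum_UNIV_Plus a_matrix_entry)
 qed
 then show ?case using Suc by simp
qed

lemma mexp_a_matrix: "mexp (a_matrix (x::'n cvec) :: ('m + 'n) cmat) = amat x"
proof (rule mexp_eqI)
 have ch: "(\<lambda>k. (if even k then z ^ k else 0) / fact k) sums cosh z" for z :: complex
 proof -
  have "(\<lambda>k. (if even k then z ^ k else 0) / fact k) = (\<lambda>k. if even k then z ^ k /\<^sub>R fact k else 0)"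
   by (auto simp: fun_eq_iff scaleR_conv_of_real divide_inverse)
  then show ?thesis using cosh_converges[of z] by simp
 qed
 have sh: "(\<lambda>k. (if odd k then z ^ k else 0) / fact k) sums sinh z" for z :: complex
 proof -
  have "(\<lambda>k. (if odd k then z ^ k else 0) / fact k) = (\<lambda>k. if even k then 0 else z ^ k /\<^sub>R fact k)"
   by (auto simp: fun_eq_iff scaleR_conv_of_real divide_inverse)
  then show ?thesis using sinh_converges[of z] by simp
 qed
 fix p q :: "'m + 'n"
 show "(\<lambda>k. ((**) (a_matrix x) ^^ k) (mat 1) $ p $ q / fact k) sums (amat x $ p $ q)"
  unfolding a_matrix_power
  by (cases p; cases q) (auto simp: amat_def ch sh)
qed

end

lemma mexp_nilpotent_unit:
 assumes "i \<noteq> j"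
 shows "mexp (t *\<^sub>R E i j :: 'r::finite cmat) = line1 (E i j) (of_real t)"
proof (rule mexp_eqI)
 have m: "t *\<^sub>R E i j ** (t *\<^sub>R E i j :: 'r cmat) = 0"
  using assms by (auto simp: matrix_matrix_mult_def vec_eq_iff matrix_unit_def intro!: sum.neutral)
 have P: "((**) (t *\<^sub>R E i j :: 'r cmat) ^^ k) (mat 1) =
   (if k = 0 then mat 1 else if k = 1 then t *\<^sub>R E i j else 0)" for k
  by (induction k) (auto simp: m)
 fix a b :: 'r
 let ?f = "\<lambda>k. ((**) (t *\<^sub>R E i j :: 'r cmat) ^^ k) (mat 1) $ a $ b / fact k"
 have "?f sums (\<Sum>k\<in>{0, 1}. ?f k)"
  by (rule sums_finite) (auto simp: P)
 also have "(\<Sum>k\<in>{0, 1}. ?f k) = line1 (E i j) (of_real t) $ a $ b"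
  by (simp add: P line1_def scaleR_conv_of_real[where 'a = complex])
 finally show "?f sums (line1 (E i j) (of_real t) $ a $ b)" .
qed

lemma mexp_idempotent_unit:
 "mexp (t *\<^sub>R E i i :: 'r::finite cmat) = line1 (E i i) (of_real (exp t) - 1)"
proof (rule mexp_eqI)
 have m: "t *\<^sub>R E i i ** ((t ^ k) *\<^sub>R E i i :: 'r cmat) = (t ^ Suc k) *\<^sub>R E i i" for k
 proof -
  have "(t *\<^sub>R E i i :: 'r cmat) $ a $ x * ((t ^ k) *\<^sub>R E i i :: 'r cmat) $ x $ b =
    (if x = i then ((t ^ Suc k) *\<^sub>R E i i :: 'r cmat) $ a $ b else 0)" for a b x
   by (auto simp: matrix_unit_def scaleR_conv_of_real[where 'a = complex])
  then show ?thesis by (simp add: matrix_matrix_mult_def vec_eq_iff)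
 qed
 have P: "((**) (t *\<^sub>R E i i :: 'r cmat) ^^ k) (mat 1) =
   (if k = 0 then mat 1 else (t ^ k) *\<^sub>R E i i)" for k
  by (induction k) (auto simp: m[of 0, simplified] m simp del: power_Suc)
 fix a b :: 'r
 have e: "((**) (t *\<^sub>R E i i :: 'r cmat) ^^ k) (mat 1) $ a $ b / fact k =
   (if a = i \<and> b = i then (of_real t) ^ k / fact k else if k = 0 then mat 1 $ a $ b else 0)" for k
  unfolding P by (auto simp: matrix_unit_def mat_def scaleR_conv_of_real[where 'a = complex])
 show "(\<lambda>k. ((**) (t *\<^sub>R E i i :: 'r cmat) ^^ k) (mat 1) $ a $ b / fact k) sums
   (line1 (E i i) (of_real (exp t) - 1) $ a $ b)"
 proof (cases "a = i \<and> b = i")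
  case True
  have "(\<lambda>k. (of_real t :: complex) ^ k / fact k) sums exp (of_real t)"
   using exp_converges[of "of_real t :: complex"] by (simp add: scaleR_conv_of_real divide_inverse mult.commute)
  then show ?thesis unfolding e using True by (simp add: line1_def mat_def matrix_unit_def exp_of_real)
 next
  case False
  have "(\<lambda>k. if k = 0 then mat 1 $ a $ b else 0 :: complex) sums (\<Sum>k\<in>{0::nat}. if k = 0 then mat 1 $ a $ b else 0)"
   by (rule sums_finite) auto
  moreover have "line1 (E i i) (of_real (exp t) - 1) $ a $ b = mat 1 $ a $ b"
   using False by (auto simp: line1_def matrix_unit_def)
  ultimately show ?thesis unfolding e using False by (simp only: if_False) simp
 qed
qed

text \<open>
  The exponentials of matrix units are lines (off the diagonal) or reparametrized lines (on it), so
  the derivatives along one-parameter groups are Frechet derivatives.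
\<close>

lemma lie_deriv_unit:
 assumes f: "\<And>p. regular_GL (\<lambda>g. f g $ p)" and g: "g \<in> GL"
 shows "lie_deriv (E i j) f g = (\<chi> p. dder (\<lambda>g. f g $ p) g (g ** E i j))"
proof -
 define s where "s z = (if i = j then exp z - 1 else z)" for z :: complex
 have E: "mexp (t *\<^sub>R E i j) = line1 (E i j) (s (of_real t))" for t
  by (auto simp: s_def mexp_nilpotent_unit mexp_idempotent_unit exp_of_real)
 have s: "DERIV s 0 :> 1" "s 0 = 0"
  unfolding s_def by (cases "i = j"; auto intro!: derivative_eq_intros)+
 have "((\<lambda>t. f (g ** mexp (t *\<^sub>R E i j))) has_vector_derivative
   (\<chi> p. dder (\<lambda>g. f g $ p) g (g ** E i j))) (at 0)"
 proof -
  have "((\<lambda>t. f (g ** mexp (t *\<^sub>R E i j)) $ p) has_vector_derivative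
    dder (\<lambda>g. f g $ p) g (g ** E i j)) (at 0)" for p
  proof -
   have "DERIV (\<lambda>z. f (g ** line1 (E i j) z) $ p) 0 :> dder (\<lambda>g. f g $ p) (g ** line1 (E i j) 0) (g ** E i j)"
   proof (rule dder_curve[OF f])
    fix a b
    show "DERIV (\<lambda>z. (g ** line1 (E i j) z) $ a $ b) 0 :> (g ** E i j) $ a $ b"
     unfolding matrix_matrix_mult_def by (simp, intro DERIV_sum DERIV_cmult line1_derivative)
   qed (simp add: g)
   then have 1: "DERIV (\<lambda>z. f (g ** line1 (E i j) z) $ p) (s 0) :> dder (\<lambda>g. f g $ p) g (g ** E i j)" by (simp add: s)
   have "DERIV (\<lambda>z. f (g ** line1 (E i j) (s z)) $ p) (of_real 0) :> dder (\<lambda>g. f g $ p) g (g ** E i j)"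
    using DERIV_chain2[OF 1 s(1)] by simp
   from has_vector_derivative_real_field[OF this] show ?thesis by (simp add: E)
  qed
  then have "((\<lambda>t. axis p b \<bullet> f (g ** mexp (t *\<^sub>R E i j))) has_derivative
    (\<lambda>h. axis p b \<bullet> (h *\<^sub>R (\<chi> p. dder (\<lambda>g. f g $ p) g (g ** E i j))))) (at 0)" for p b
  proof -
   have "((\<lambda>t. f (g ** mexp (t *\<^sub>R E i j)) $ p) has_derivative
     (\<lambda>h. h *\<^sub>R dder (\<lambda>g. f g $ p) g (g ** E i j))) (at 0)"
    using \<open>\<And>p. ((\<lambda>t. f (g ** mexp (t *\<^sub>R E i j)) $ p) has_vector_derivative
     dder (\<lambda>g. f g $ p) g (g ** E i j)) (at 0)\<close>[of p] by (simp add: has_vector_derivative_def)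
   from has_derivative_inner_right[OF this, of b] show ?thesis by (simp add: inner_axis')
  qed
  then show ?thesis
   unfolding has_vector_derivative_def
   by (subst has_derivative_componentwise_within) (auto simp: Basis_vec_def inner_commute)
 qed
 then show ?thesis unfolding lie_deriv_def by (rule vector_derivative_at)
qed

section \<open>Block matrices and tensor products\<close>

lemma block_diag_entry [simp]:
 "block_diag k1 k2 $ Inl i $ Inl j = k1 $ i $ j" "block_diag k1 k2 $ Inl i $ Inr j' = 0"
 "block_diag k1 k2 $ Inr i' $ Inl j = 0" "block_diag k1 k2 $ Inr i' $ Inr j' = k2 $ i' $ j'"
 by (simp_all add: block_diag_def)

lemma block_diag_mult: "block_diag k1 k2 ** block_diag l1 l2 = block_diag (k1 ** l1) (k2 ** l2)"
 by (rule vec_Plus_eqI) (simp_all add: matrix_matrix_mult_def sum_UNIV_Plus)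

lemma block_diag_1: "block_diag (mat 1) (mat 1) = mat 1"
 by (rule vec_Plus_eqI) (simp_all add: mat_def)

lemma det_block_diag: "det (block_diag k1 k2) = det k1 * det k2"
proof -
 have 1: "det (block_diag k1 (mat 1 :: 'b cmat)) = det k1"
 proof -
  have "det (block_diag k1 (mat 1 :: 'b cmat)) = det (\<chi> i j. block_diag k1 (mat 1 :: 'b cmat) $ Inl i $ Inl j)"
  proof (rule det_embed)
   fix i j :: "'a + 'b" assume "i \<notin> range Inl \<or> j \<notin> range Inl"
   then show "block_diag k1 (mat 1) $ i $ j = (if i = j then 1 else 0)"
    by (cases i; cases j) (auto simp: mat_def)
  qed simp
  then show ?thesis by (simp add: vec_lambda_eta)
 qed
 have 2: "det (block_diag (mat 1 :: 'a cmat) k2) = det k2"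
 proof -
  have "det (block_diag (mat 1 :: 'a cmat) k2) = det (\<chi> i j. block_diag (mat 1 :: 'a cmat) k2 $ Inr i $ Inr j)"
  proof (rule det_embed)
   fix i j :: "'a + 'b" assume "i \<notin> range Inr \<or> j \<notin> range Inr"
   then show "block_diag (mat 1) k2 $ i $ j = (if i = j then 1 else 0)"
    by (cases i; cases j) (auto simp: mat_def)
  qed simp
  then show ?thesis by (simp add: vec_lambda_eta)
 qed
 have "block_diag k1 k2 = block_diag k1 (mat 1) ** block_diag (mat 1) k2" by (simp add: block_diag_mult)
 then show ?thesis by (simp add: det_mul 1 2)
qed

lemma block_diag_GL: "k1 \<in> GL \<Longrightarrow> k2 \<in> GL \<Longrightarrow> block_diag k1 k2 \<in> GL"
 by (simp add: GL_iff_det det_block_diag)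

lemma line1_Inl: "line1 (E (Inl i) (Inl j)) t = block_diag (line1 (E i j) t) (mat 1)"
 by (rule vec_Plus_eqI) (simp_all add: line1_def matrix_unit_def mat_def)

lemma line1_Inr: "line1 (E (Inr i) (Inr j)) t = block_diag (mat 1) (line1 (E i j) t)"
 by (rule vec_Plus_eqI) (simp_all add: line1_def matrix_unit_def mat_def)

lemma tensor_mat_mult: "tensor_mat A B ** tensor_mat C D = tensor_mat (A ** C) (B ** D)"
proof -
 have "(\<Sum>k\<in>UNIV. A $ i $ fst k * B $ j $ snd k * (C $ fst k $ i' * D $ snd k $ j')) =
   (\<Sum>k\<in>UNIV. A $ i $ k * C $ k $ i') * (\<Sum>k\<in>UNIV. B $ j $ k * D $ k $ j')" for i j i' j'
  by (simp add: sum_product sum.cartesian_product case_prod_beta UNIV_Times_UNIV[symmetric] mult_ac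
    del: UNIV_Times_UNIV)
 then show ?thesis by (simp add: tensor_mat_def matrix_matrix_mult_def vec_eq_iff)
qed

lemma tensor_mat_vec: "tensor_mat A B *v tensor_vec u v = tensor_vec (A *v u) (B *v v)"
proof -
 have "(\<Sum>k\<in>UNIV. A $ i $ fst k * B $ j $ snd k * (u $ fst k * v $ snd k)) =
   (\<Sum>k\<in>UNIV. A $ i $ k * u $ k) * (\<Sum>k\<in>UNIV. B $ j $ k * v $ k)" for i j
  by (simp add: sum_product sum.cartesian_product case_prod_beta UNIV_Times_UNIV[symmetric] mult_ac
    del: UNIV_Times_UNIV)
 then show ?thesis by (simp add: tensor_mat_def tensor_vec_def matrix_vector_mult_def vec_eq_iff)
qed

section \<open>Right and left derivatives of vector-valued functions\<close>

definition scm :: "complex \<Rightarrow> 'r::finite cmat \<Rightarrow> 'r cmat" where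
 "scm c M = (\<chi> i j. c * M $ i $ j)"

lemma scm_mult: "A ** scm c B = scm c (A ** B)" "scm c A ** B = scm c (A ** B)"
 by (simp_all add: scm_def matrix_matrix_mult_def vec_eq_iff sum_distrib_left mult_ac)

lemma scm_entry [simp]: "scm c M $ i $ j = c * M $ i $ j"
 by (simp add: scm_def)

definition regular_vec :: "('r::finite cmat \<Rightarrow> 'd::finite cvec) \<Rightarrow> bool" where
 "regular_vec f \<longleftrightarrow> (\<forall>p. regular_GL (\<lambda>g. f g $ p))"

lemma regular_vecD: "regular_vec f \<Longrightarrow> regular_GL (\<lambda>g. f g $ p)"
 by (simp add: regular_vec_def)

definition dv :: "('r::finite cmat \<Rightarrow> 'd::finite cvec) \<Rightarrow> 'r cmat \<Rightarrow> 'r cmat \<Rightarrow> 'd cvec" where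
 "dv f g H = (\<chi> p. dder (\<lambda>g. f g $ p) g H)"

text \<open>
  The left invariant derivative in the direction Y.
\<close>

definition rd :: "'r::finite cmat \<Rightarrow> ('r cmat \<Rightarrow> 'd::finite cvec) \<Rightarrow> 'r cmat \<Rightarrow> 'd cvec" where
 "rd Y f g = dv f g (g ** Y)"

lemma regular_rd: "regular_vec f \<Longrightarrow> regular_vec (rd Y f)"
 unfolding regular_vec_def rd_def dv_def
 by (simp add: regular_GL_dder regular_GL_matrix_mult regular_GL_entry regular_GL_const)

lemma dv_add: "regular_vec f \<Longrightarrow> g \<in> GL \<Longrightarrow> dv f g (H + K) = dv f g H + dv f g K"
 and dv_diff: "regular_vec f \<Longrightarrow> g \<in> GL \<Longrightarrow> dv f g (H - K) = dv f g H - dv f g K"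
 and dv_scale: "regular_vec f \<Longrightarrow> g \<in> GL \<Longrightarrow> dv f g (scm c H) = c *s dv f g H"
 by (simp_all add: dv_def vec_eq_iff dder_add dder_diff dder_0 dder_scale[folded scm_def] regular_vec_def)

lemma dder_eqI:
 assumes "(p has_derivative D) (at g)" shows "dder p g H = D H"
 unfolding dder_def using frechet_derivative_at[OF assms] by simp

lemma dder_cong:
 assumes "regular_GL p" "g \<in> GL" "\<And>g. g \<in> GL \<Longrightarrow> p g = q g"
 shows "dder p g H = dder q g H"
 by (rule dder_eqI[symmetric])
   (rule has_derivative_transform_within_open[OF dder_has_derivative[OF assms(1,2)] open_GL assms(2,3)])

lemma dv_cong:
 assumes "regular_vec f" "g \<in> GL" "\<And>g. g \<in> GL \<Longrightarrow> f g = f' g"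
 shows "dv f g H = dv f' g H"
proof -
 have "dder (\<lambda>g. f g $ p) g H = dder (\<lambda>g. f' g $ p) g H" for p
  by (rule dder_cong[OF regular_vecD[OF assms(1)] assms(2)]) (simp add: assms(3))
 then show ?thesis by (simp add: dv_def)
qed

lemma dv_fun_add:
 assumes "regular_vec f" "regular_vec f'" "g \<in> GL"
 shows "dv (\<lambda>g. f g + f' g) g H = dv f g H + dv f' g H"
 using assms unfolding dv_def vec_eq_iff
 by (auto intro!: dder_eqI has_derivative_add dder_has_derivative simp: regular_vecD)

lemma dv_fun_scale:
 assumes "regular_vec f" "g \<in> GL"
 shows "dv (\<lambda>g. c *s f g) g H = c *s dv f g H"
 using assms unfolding dv_def vec_eq_iff
 by (auto intro!: dder_eqI has_derivative_mult_right dder_has_derivative simp: regular_vecD)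

lemma rd_add: "regular_vec f \<Longrightarrow> g \<in> GL \<Longrightarrow> rd (Y + Y') f g = rd Y f g + rd Y' f g"
 and rd_scale: "regular_vec f \<Longrightarrow> g \<in> GL \<Longrightarrow> rd (scm c Y) f g = c *s rd Y f g"
 by (simp_all add: rd_def matrix_add_ldistrib scm_mult dv_add dv_scale)

lemma rd_rd_add: "regular_vec f \<Longrightarrow> g \<in> GL \<Longrightarrow> rd Z (rd (Y + Y') f) g = rd Z (rd Y f) g + rd Z (rd Y' f) g"
proof -
 assume f: "regular_vec f" and g: "g \<in> GL"
 have "dv (rd (Y + Y') f) g (g ** Z) = dv (\<lambda>g. rd Y f g + rd Y' f g) g (g ** Z)"
  by (rule dv_cong[OF regular_rd[OF f] g]) (simp add: rd_add f)
 then show ?thesis by (simp add: rd_def[of Z] dv_fun_add regular_rd f g)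
qed

lemma rd_rd_scale: "regular_vec f \<Longrightarrow> g \<in> GL \<Longrightarrow> rd Z (rd (scm c Y) f) g = c *s rd Z (rd Y f) g"
proof -
 assume f: "regular_vec f" and g: "g \<in> GL"
 have "dv (rd (scm c Y) f) g (g ** Z) = dv (\<lambda>g. c *s rd Y f g) g (g ** Z)"
  by (rule dv_cong[OF regular_rd[OF f] g]) (simp add: rd_scale f)
 then show ?thesis by (simp add: rd_def[of Z] dv_fun_scale regular_rd f g)
qed

lemma DERIV_matrix_mult:
 assumes "\<And>a b. DERIV (\<lambda>t. A t $ a $ b) t0 :> A' $ a $ b"
  "\<And>a b. DERIV (\<lambda>t. B t $ a $ b) t0 :> B' $ a $ b"
 shows "DERIV (\<lambda>t. (A t ** B t) $ a $ b) t0 :> (A' ** B t0 + A t0 ** B') $ a $ b"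
proof -
 have "DERIV (\<lambda>t. \<Sum>k\<in>UNIV. A t $ a $ k * B t $ k $ b) t0 :> (\<Sum>k\<in>UNIV. A' $ a $ k * B t0 $ k $ b + B' $ k $ b * A t0 $ a $ k)"
  by (intro DERIV_sum DERIV_mult assms)
 then show ?thesis by (simp add: matrix_matrix_mult_def sum.distrib mult.commute)
qed

lemma dder_linear_curve:
 assumes p: "regular_GL p" "g \<in> GL"
  and H: "\<And>a b. DERIV (\<lambda>t. H t $ a $ b) t0 :> H' $ a $ b"
 shows "DERIV (\<lambda>t. dder p g (H t)) t0 :> dder p g H'"
proof -
 obtain P where "\<And>a b. polynomial_GL (P a b)"
  "\<And>g. g \<in> GL \<Longrightarrow> (p has_derivative dder p g) (at g)"
  and P: "\<And>g H. g \<in> GL \<Longrightarrow> dder p g H = (\<Sum>a\<in>UNIV. \<Sum>b\<in>UNIV. H $ a $ b * P a b g)"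
  by (rule regular_GL_gradient[OF p(1)]) blast
 have "DERIV (\<lambda>t. \<Sum>a\<in>UNIV. \<Sum>b\<in>UNIV. H t $ a $ b * P a b g) t0 :> (\<Sum>a\<in>UNIV. \<Sum>b\<in>UNIV. H' $ a $ b * P a b g)"
  by (intro DERIV_sum DERIV_cmult_right H)
 then show ?thesis by (simp add: P[OF p(2)])
qed

lemma DERIV_const_matrix: "DERIV (\<lambda>t. M $ a $ b) t0 :> (0::'r::finite cmat) $ a $ b"
 by simp

lemma dv_semi_invariant:
 assumes f: "regular_vec f" and g: "g \<in> GL" and k: "k \<in> GL"
  and inv: "\<And>g. g \<in> GL \<Longrightarrow> f (g ** k) = d *s f g"
 shows "dv f (g ** k) (H ** k) = d *s dv f g H"
proof -
 define c where "c s = (\<chi> a b. g $ a $ b + s * H $ a $ b)" for s :: complex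
 have c0: "c 0 = g" by (simp add: c_def vec_eq_iff)
 have dc: "DERIV (\<lambda>s. c s $ a $ b) 0 :> H $ a $ b" for a b
  unfolding c_def by (auto intro!: derivative_eq_intros)
 have ev: "\<forall>\<^sub>F s in nhds 0. c s \<in> GL"
 proof -
  have "(c \<longlongrightarrow> c 0) (nhds 0)"
  proof (intro vec_tendstoI)
   fix a b
   have "isCont (\<lambda>s. c s $ a $ b) 0" using dc DERIV_isCont by blast
   then show "((\<lambda>s. c s $ a $ b) \<longlongrightarrow> c 0 $ a $ b) (nhds 0)"
    using tendsto_at_iff_tendsto_nhds[of "\<lambda>s. c s $ a $ b" 0] by (simp add: isCont_def)
  qed
  then show ?thesis by (rule topological_tendstoD[OF _ open_GL]) (simp add: c0 g)
 qed
 have "dder (\<lambda>g. f g $ p) (g ** k) (H ** k) = d * dder (\<lambda>g. f g $ p) g H" for p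
 proof -
  have "dder (\<lambda>g. f g $ p) (c 0 ** k) (H ** k) = d * dder (\<lambda>g. f g $ p) (c 0) H"
  proof (rule dder_unique_curve[OF regular_vecD[OF f]])
   show "c 0 ** k \<in> GL" by (simp add: c0 g k)
   fix a b show "DERIV (\<lambda>z. (c z ** k) $ a $ b) 0 :> (H ** k) $ a $ b"
    unfolding matrix_matrix_mult_def by (simp, intro DERIV_sum DERIV_cmult_right dc)
  next
   have "DERIV (\<lambda>z. d * f (c z) $ p) 0 :> d * dder (\<lambda>g. f g $ p) (c 0) H"
    by (intro DERIV_cmult dder_curve[OF regular_vecD[OF f] _ dc]) (simp add: c0 g)
   then show "DERIV (\<lambda>z. f (c z ** k) $ p) 0 :> d * dder (\<lambda>g. f g $ p) (c 0) H"
    by (rule DERIV_eventually) (use ev in eventually_elim, simp add: inv)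
  qed
  then show ?thesis by (simp add: c0)
 qed
 then show ?thesis by (simp add: dv_def vec_eq_iff)
qed

text \<open>
  The first identity differentiates the semi-invariance; the second differentiates
  \<open>f (g ** k t) = ch t *s f g\<close> after a derivative in the direction Y, where
  moving Y past the curve produces the commutator.
\<close>

lemma semi_invariant_curve:
 fixes f :: "'r::finite cmat \<Rightarrow> 'd::finite cvec"
 assumes f: "regular_vec f" and g: "g \<in> GL"
  and k: "k 0 = mat 1" "\<And>a b. DERIV (\<lambda>t. k t $ a $ b) 0 :> Z $ a $ b"
  and k': "k' 0 = mat 1" "\<And>a b. DERIV (\<lambda>t. k' t $ a $ b) 0 :> (- Z) $ a $ b"
  and X: "ch 0 = 1" "DERIV ch 0 :> d"
  and ev: "\<forall>\<^sub>F t in nhds (0::complex). k t \<in> GL \<and> k' t ** k t = mat 1 \<and> (\<forall>g\<in>GL. f (g ** k t) = ch t *s f g)"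
 shows "rd Z f g = d *s f g"
  and "rd Z (rd Y f) g = d *s rd Y f g + rd (Z ** Y - Y ** Z) f g"
proof -
 have gk: "DERIV (\<lambda>t. (g ** k t) $ a $ b) 0 :> (g ** Z) $ a $ b" for a b
  unfolding matrix_matrix_mult_def by (simp, intro DERIV_sum DERIV_cmult k)
 have "dder (\<lambda>g. f g $ p) (g ** k 0) (g ** Z) = d * f g $ p" for p
 proof (rule dder_unique_curve[OF regular_vecD[OF f] _ gk])
  have "DERIV (\<lambda>t. ch t * f g $ p) 0 :> d * f g $ p"
   by (intro DERIV_cmult_right X)
  then show "DERIV (\<lambda>t. f (g ** k t) $ p) 0 :> d * f g $ p"
   by (rule DERIV_eventually) (use ev in eventually_elim, simp add: g)
 qed (simp add: k g)
 then show "rd Z f g = d *s f g" by (simp add: rd_def dv_def vec_eq_iff k)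
 have "dder (\<lambda>g. rd Y f g $ p) (g ** k 0) (g ** Z) = d * rd Y f g $ p + rd (Z ** Y - Y ** Z) f g $ p" for p
 proof (rule dder_unique_curve[OF regular_vecD[OF regular_rd[OF f]] _ gk])
  have H: "DERIV (\<lambda>t. (g ** k t ** Y ** k' t) $ a $ b) 0 :> (g ** (Z ** Y - Y ** Z)) $ a $ b" for a b
  proof -
   have 1: "DERIV (\<lambda>t. (g ** k t ** Y) $ a $ b) 0 :> (g ** Z ** Y) $ a $ b" for a b
    using DERIV_matrix_mult[OF gk DERIV_const_matrix, of Y a b] by simp
   have "DERIV (\<lambda>t. (g ** k t ** Y ** k' t) $ a $ b) 0 :> (g ** Z ** Y ** k' 0 + g ** k 0 ** Y ** (- Z)) $ a $ b"
    by (rule DERIV_matrix_mult[OF 1 k'(2)])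
   moreover have "g ** Z ** Y ** k' 0 + g ** k 0 ** Y ** (- Z) = g ** (Z ** Y - Y ** Z)"
   proof -
    have "M ** (- Z) = - (M ** Z)" for M :: "'r cmat"
     by (simp add: matrix_matrix_mult_def vec_eq_iff sum_negf)
    then show ?thesis by (simp add: k k' matrix_diff_ldistrib' matrix_mul_assoc)
   qed
   ultimately show ?thesis by simp
  qed
  have "DERIV (\<lambda>t. ch t * dder (\<lambda>g. f g $ p) g (g ** k t ** Y ** k' t)) 0 :> d * dder (\<lambda>g. f g $ p) g (g ** k 0 ** Y ** k' 0) + dder (\<lambda>g. f g $ p) g (g ** (Z ** Y - Y ** Z)) * ch 0"
   by (intro DERIV_mult X dder_linear_curve[OF regular_vecD[OF f] g] H)
  moreover have "\<forall>\<^sub>F t in nhds 0. ch t * dder (\<lambda>g. f g $ p) g (g ** k t ** Y ** k' t) = rd Y f (g ** k t) $ p"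
   using ev
  proof eventually_elim
   case (elim t)
   have "dv f (g ** k t) (g ** k t ** Y ** k' t ** k t) = ch t *s dv f g (g ** k t ** Y ** k' t)"
    by (rule dv_semi_invariant[OF f g]) (use elim in auto)
   moreover have "g ** k t ** Y ** k' t ** k t = g ** k t ** Y"
    using elim by (simp add: matrix_mul_assoc[symmetric])
   ultimately show ?case by (simp add: rd_def dv_def vec_eq_iff)
  qed
  ultimately have "DERIV (\<lambda>t. rd Y f (g ** k t) $ p) 0 :> d * dder (\<lambda>g. f g $ p) g (g ** k 0 ** Y ** k' 0) + dder (\<lambda>g. f g $ p) g (g ** (Z ** Y - Y ** Z)) * ch 0"
   by (rule DERIV_eventually)
  then show "DERIV (\<lambda>t. rd Y f (g ** k t) $ p) 0 :> d * rd Y f g $ p + rd (Z ** Y - Y ** Z) f g $ p"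
   by (simp add: k k' X rd_def dv_def)
 qed (simp add: k g)
 then show "rd Z (rd Y f) g = d *s rd Y f g + rd (Z ** Y - Y ** Z) f g"
  by (simp add: rd_def[of Z "rd Y f"] dv_def vec_eq_iff k)
qed

lemma dv_left_equivariant:
 assumes f: "regular_vec f" and g: "g \<in> GL" and k: "k \<in> GL"
  and inv: "\<And>g. g \<in> GL \<Longrightarrow> f (k ** g) = M *v f g"
 shows "dv f (k ** g) (k ** H) = M *v dv f g H"
proof -
 define c where "c s = (\<chi> a b. g $ a $ b + s * H $ a $ b)" for s :: complex
 have c0: "c 0 = g" by (simp add: c_def vec_eq_iff)
 have dc: "DERIV (\<lambda>s. c s $ a $ b) 0 :> H $ a $ b" for a b
  unfolding c_def by (auto intro!: derivative_eq_intros)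
 have ev: "\<forall>\<^sub>F s in nhds 0. c s \<in> GL"
 proof -
  have "(c \<longlongrightarrow> c 0) (nhds 0)"
  proof (intro vec_tendstoI)
   fix a b
   have "isCont (\<lambda>s. c s $ a $ b) 0" using dc DERIV_isCont by blast
   then show "((\<lambda>s. c s $ a $ b) \<longlongrightarrow> c 0 $ a $ b) (nhds 0)"
    using tendsto_at_iff_tendsto_nhds[of "\<lambda>s. c s $ a $ b" 0] by (simp add: isCont_def)
  qed
  then show ?thesis by (rule topological_tendstoD[OF _ open_GL]) (simp add: c0 g)
 qed
 have "dder (\<lambda>g. f g $ p) (k ** g) (k ** H) = (\<Sum>q\<in>UNIV. M $ p $ q * dder (\<lambda>g. f g $ q) g H)" for p
 proof -
  have "dder (\<lambda>g. f g $ p) (k ** c 0) (k ** H) = (\<Sum>q\<in>UNIV. M $ p $ q * dder (\<lambda>g. f g $ q) (c 0) H)"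
  proof (rule dder_unique_curve[OF regular_vecD[OF f]])
   show "k ** c 0 \<in> GL" by (simp add: c0 g k)
   fix a b show "DERIV (\<lambda>z. (k ** c z) $ a $ b) 0 :> (k ** H) $ a $ b"
    unfolding matrix_matrix_mult_def by (simp, intro DERIV_sum DERIV_cmult dc)
  next
   have "DERIV (\<lambda>z. \<Sum>q\<in>UNIV. M $ p $ q * f (c z) $ q) 0 :> (\<Sum>q\<in>UNIV. M $ p $ q * dder (\<lambda>g. f g $ q) (c 0) H)"
    by (intro DERIV_sum DERIV_cmult dder_curve[OF regular_vecD[OF f] _ dc]) (simp add: c0 g)
   then show "DERIV (\<lambda>z. f (k ** c z) $ p) 0 :> (\<Sum>q\<in>UNIV. M $ p $ q * dder (\<lambda>g. f g $ q) (c 0) H)"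
    by (rule DERIV_eventually) (use ev in eventually_elim, simp add: inv matrix_vector_mult_def)
  qed
  then show ?thesis by (simp add: c0)
 qed
 then show ?thesis by (simp add: dv_def vec_eq_iff matrix_vector_mult_def)
qed

section \<open>Functions equivariant under K on both sides\<close>

locale spherical =
 fixes \<rho> :: "'m::{finite,linorder} cmat \<Rightarrow> 'w::finite cmat"
  and \<tau> :: "'n::{finite,linorder} cmat \<Rightarrow> 'v::finite cmat"
  and \<kappa>1 \<kappa>2 :: int
  and f :: "('m + 'n) cmat \<Rightarrow> ('w \<times> 'v) cvec"
 assumes le: "CARD('n) \<le> CARD('m)"
  and \<rho>: "rational_rep \<rho>" and \<tau>: "rational_rep \<tau>"
  and f: "f \<in> spherical_functions \<kappa>1 \<kappa>2 \<rho> \<tau>"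
begin

lemma regular_f: "regular_vec f"
 using f by (simp add: spherical_functions_def regular_vec_def)

definition left_equivariant :: "(('m + 'n) cmat \<Rightarrow> ('w \<times> 'v) cvec) \<Rightarrow> bool" where
 "left_equivariant h \<longleftrightarrow> regular_vec h \<and> (\<forall>g\<in>GL. \<forall>k1\<in>GL. \<forall>k2\<in>GL.
   h (block_diag k1 k2 ** g) = tensor_mat (\<rho> k1) (\<tau> k2) *v h g)"

lemma left_f: "left_equivariant f"
 using f regular_f by (simp add: spherical_functions_def left_equivariant_def)

lemma right_f: "g \<in> GL \<Longrightarrow> k1 \<in> GL \<Longrightarrow> k2 \<in> GL \<Longrightarrow>
  f (g ** block_diag k1 k2) = (det k1 powi \<kappa>1 * det k2 powi \<kappa>2) *s f g"
 using f by (simp add: spherical_functions_def)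

lemma left_rd: "left_equivariant h \<Longrightarrow> left_equivariant (rd Y h)"
 unfolding left_equivariant_def
proof (intro conjI ballI)
 assume h: "regular_vec h \<and> (\<forall>g\<in>GL. \<forall>k1\<in>GL. \<forall>k2\<in>GL. h (block_diag k1 k2 ** g) = tensor_mat (\<rho> k1) (\<tau> k2) *v h g)"
 then show "regular_vec (rd Y h)" by (simp add: regular_rd)
 fix g :: "('m + 'n) cmat" and k1 :: "'m cmat" and k2 :: "'n cmat" assume g: "g \<in> GL" "k1 \<in> GL" "k2 \<in> GL"
 have "dv h (block_diag k1 k2 ** g) (block_diag k1 k2 ** (g ** Y)) = tensor_mat (\<rho> k1) (\<tau> k2) *v dv h g (g ** Y)"
  by (rule dv_left_equivariant) (use h g block_diag_GL in auto)
 then show "rd Y h (block_diag k1 k2 ** g) = tensor_mat (\<rho> k1) (\<tau> k2) *v rd Y h g"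
  by (simp add: rd_def matrix_mul_assoc)
qed

definition pi1 :: "'m cmat \<Rightarrow> ('w \<times> 'v) cmat" where "pi1 X = tensor_mat (drep \<rho> X) (mat 1)"
definition pi2 :: "'n cmat \<Rightarrow> ('w \<times> 'v) cmat" where "pi2 X = tensor_mat (mat 1) (drep \<tau> X)"

lemma pi_commute: "pi1 X *v (pi2 Y *v v) = pi2 Y *v (pi1 X *v v)"
 by (simp add: pi1_def pi2_def matrix_vector_mul_assoc tensor_mat_mult)

text \<open>
  Z is a Lie algebra element of K that acts by the scalar d through the right semi-invariance and by
  the matrix M through the left equivariance. Stated for Z complex linearly, so that combinations
  over both blocks are covered.
\<close>

definition in_k :: "('m + 'n) cmat \<Rightarrow> complex \<Rightarrow> ('w \<times> 'v) cmat \<Rightarrow> bool" where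
 "in_k Z d M \<longleftrightarrow> (\<forall>g\<in>GL. rd Z f g = d *s f g) \<and>
   (\<forall>Y. \<forall>g\<in>GL. rd Z (rd Y f) g = d *s rd Y f g + rd (Z ** Y - Y ** Z) f g) \<and>
   (\<forall>h. left_equivariant h \<longrightarrow> (\<forall>g\<in>GL. dv h g (Z ** g) = M *v h g))"

lemma in_k_add:
 assumes "in_k Z d M" "in_k Z' d' M'"
 shows "in_k (Z + scm \<epsilon> Z') (d + \<epsilon> * d') (M + scm \<epsilon> M')"
 unfolding in_k_def
proof (intro conjI allI ballI impI)
 fix g :: "('m + 'n) cmat" assume g: "g \<in> GL"
 show "rd (Z + scm \<epsilon> Z') f g = (d + \<epsilon> * d') *s f g"
  using assms g by (simp add: in_k_def rd_add rd_scale regular_f vec_eq_iff algebra_simps)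
 fix Y
 have br: "(Z + scm \<epsilon> Z') ** Y - Y ** (Z + scm \<epsilon> Z') = (Z ** Y - Y ** Z) + scm \<epsilon> (Z' ** Y - Y ** Z')"
  by (simp add: matrix_add_rdistrib' matrix_add_ldistrib scm_mult) (simp add: vec_eq_iff algebra_simps)
 have "rd (Z + scm \<epsilon> Z') (rd Y f) g = rd Z (rd Y f) g + \<epsilon> *s rd Z' (rd Y f) g"
  using g by (simp add: rd_add rd_scale regular_rd regular_f)
 also have "\<dots> = (d + \<epsilon> * d') *s rd Y f g + (rd (Z ** Y - Y ** Z) f g + \<epsilon> *s rd (Z' ** Y - Y ** Z') f g)"
  using assms g by (simp add: in_k_def vec_eq_iff algebra_simps)
 also have "rd (Z ** Y - Y ** Z) f g + \<epsilon> *s rd (Z' ** Y - Y ** Z') f g =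
   rd ((Z + scm \<epsilon> Z') ** Y - Y ** (Z + scm \<epsilon> Z')) f g"
  unfolding br using g by (simp add: rd_add rd_scale regular_f)
 finally show "rd (Z + scm \<epsilon> Z') (rd Y f) g = (d + \<epsilon> * d') *s rd Y f g + rd ((Z + scm \<epsilon> Z') ** Y - Y ** (Z + scm \<epsilon> Z')) f g" .
next
 fix h and g :: "('m + 'n) cmat" assume h: "left_equivariant h" and g: "g \<in> GL"
 then have "regular_vec h" by (simp add: left_equivariant_def)
 then have "dv h g ((Z + scm \<epsilon> Z') ** g) = dv h g (Z ** g) + \<epsilon> *s dv h g (Z' ** g)"
  using g by (simp add: matrix_add_rdistrib' scm_mult dv_add dv_scale)
 also have "\<dots> = M *v h g + \<epsilon> *s (M' *v h g)" using assms h g by (simp add: in_k_def)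
 also have "\<dots> = (M + scm \<epsilon> M') *v h g"
  by (simp add: matrix_vector_mult_def vec_eq_iff algebra_simps sum.distrib sum_distrib_left)
 finally show "dv h g ((Z + scm \<epsilon> Z') ** g) = (M + scm \<epsilon> M') *v h g" .
qed

lemma in_k_curve:
 assumes k: "k = (\<lambda>t. block_diag (k1 t) (k2 t))" "k1 0 = mat 1" "k2 0 = mat 1"
   "\<And>a b. DERIV (\<lambda>t. k t $ a $ b) 0 :> Z $ a $ b"
  and k': "k' 0 = mat 1" "\<And>a b. DERIV (\<lambda>t. k' t $ a $ b) 0 :> (- Z) $ a $ b"
  and inv: "\<forall>\<^sub>F t in nhds (0::complex). k1 t \<in> GL \<and> k2 t \<in> GL \<and> k' t ** k t = mat 1"
  and ch: "ch = (\<lambda>t. det (k1 t) powi \<kappa>1 * det (k2 t) powi \<kappa>2)" "DERIV ch 0 :> d"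
  and M: "\<And>p q. DERIV (\<lambda>t. tensor_mat (\<rho> (k1 t)) (\<tau> (k2 t)) $ p $ q) 0 :> M $ p $ q"
 shows "in_k Z d M"
proof -
 have k0: "k 0 = mat 1" by (simp add: k block_diag_1)
 have ch0: "ch 0 = 1" by (simp add: ch k)
 have ev: "\<forall>\<^sub>F t in nhds 0. k t \<in> GL \<and> k' t ** k t = mat 1 \<and> (\<forall>g\<in>GL. f (g ** k t) = ch t *s f g)"
  using inv by eventually_elim (auto simp: k(1) ch(1) block_diag_GL right_f)
 show ?thesis
  unfolding in_k_def
 proof (intro conjI allI ballI impI)
  fix g :: "('m + 'n) cmat" and Y assume g: "g \<in> GL"
  show "rd Z f g = d *s f g" "rd Z (rd Y f) g = d *s rd Y f g + rd (Z ** Y - Y ** Z) f g"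
   using semi_invariant_curve[OF regular_f g k0 k(4) k' ch0 ch(2) ev] by blast+
 next
  fix h and g :: "('m + 'n) cmat" assume h: "left_equivariant h" and g: "g \<in> GL"
  have "dder (\<lambda>g. h g $ p) (k 0 ** g) (Z ** g) = (M *v h g) $ p" for p
  proof (rule dder_unique_curve)
   show "regular_GL (\<lambda>g. h g $ p)" by (rule regular_vecD) (use h in \<open>simp add: left_equivariant_def\<close>)
   show "k 0 ** g \<in> GL" by (simp add: k0 g)
   fix a b show "DERIV (\<lambda>z. (k z ** g) $ a $ b) 0 :> (Z ** g) $ a $ b"
    unfolding matrix_matrix_mult_def by (simp, intro DERIV_sum DERIV_cmult_right k(4))
  next
   have "DERIV (\<lambda>t. (tensor_mat (\<rho> (k1 t)) (\<tau> (k2 t)) *v h g) $ p) 0 :> (M *v h g) $ p"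
    unfolding matrix_vector_mult_def by (simp, intro DERIV_sum DERIV_cmult_right M)
   then show "DERIV (\<lambda>t. h (k t ** g) $ p) 0 :> (M *v h g) $ p"
    by (rule DERIV_eventually)
      (use inv in eventually_elim, use h g in \<open>simp add: k(1) left_equivariant_def\<close>)
  qed
  then show "dv h g (Z ** g) = M *v h g" by (simp add: dv_def vec_eq_iff k0)
 qed
qed

text \<open>
  The parameter of the inverse of a line through the identity in the direction of a matrix unit.
\<close>

definition inv_par :: "bool \<Rightarrow> complex \<Rightarrow> complex" where
 "inv_par diag t = (if diag then - t / (1 + t) else - t)"

lemma inv_par_0: "inv_par b 0 = 0"
 by (simp add: inv_par_def)

lemma line1_unit_inverse:
 fixes i j :: "'r::{finite,linorder}"
 assumes "line1 (E i j) t \<in> GL"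
 shows "line1 (E i j) (inv_par (i = j) t) ** line1 (E i j) t = mat 1"
proof (cases "i = j")
 case True
 have t: "1 + t \<noteq> 0" using assms True by (simp add: GL_iff_det line1_unit_det)
 have "(1 - t / (1 + t)) * (1 + t) = 1" using t by (simp add: field_simps)
 moreover have "(line1 (E i i) (- t / (1 + t)) ** line1 (E i i) t) $ a $ b =
   (if a = b then if a = i then (1 - t / (1 + t)) * (1 + t) else 1 else 0)" for a b
  by (simp add: mult_line1_unit_row) (auto simp: line1_def mat_def matrix_unit_def algebra_simps add_divide_distrib)
 ultimately show ?thesis using True by (simp add: inv_par_def vec_eq_iff mat_def)
next
 case False
 then show ?thesis by (simp add: inv_par_def line1_unit_mult)
qed

lemma inv_par_derivative: "DERIV (inv_par b) 0 :> - 1"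
 unfolding inv_par_def by (cases b) (auto intro!: derivative_eq_intros)

lemma line1_inv_derivative:
 "DERIV (\<lambda>t. line1 X (inv_par b t) $ p $ q) 0 :> (- X) $ p $ q"
proof -
 have "DERIV (\<lambda>t. line1 X t $ p $ q) (inv_par b 0) :> X $ p $ q"
  by (rule line1_derivative)
 from DERIV_chain2[OF this inv_par_derivative] show ?thesis by simp
qed

lemma in_k_Inl: "in_k (E (Inl i) (Inl j)) (if i = j then of_int \<kappa>1 else 0) (pi1 (E i j))"
proof (rule in_k_curve[of _ "line1 (E i j)" "\<lambda>_. mat 1" _ "\<lambda>t. line1 (E (Inl i) (Inl j)) (inv_par (i = j) t)", OF line1_Inl[THEN ext] _ _ _ _ _ _ refl])
 show "\<forall>\<^sub>F t in nhds 0. line1 (E i j) t \<in> GL \<and> mat 1 \<in> GL \<and>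
   line1 (E (Inl i) (Inl j)) (inv_par (i = j) t) ** line1 (E (Inl i) (Inl j)) t = mat 1"
  using eventually_line1_GL[of "E i j"]
  by eventually_elim (simp add: line1_Inl block_diag_mult line1_unit_inverse block_diag_1)
 show "DERIV (\<lambda>t. det (line1 (E i j) t) powi \<kappa>1 * det (mat 1 :: 'n cmat) powi \<kappa>2) 0 :> (if i = j then of_int \<kappa>1 else 0)"
  by (cases "i = j") (auto simp: line1_unit_det intro!: derivative_eq_intros)
 fix p q :: "'w \<times> 'v"
 have "DERIV (\<lambda>t. \<rho> (line1 (E i j) t) $ fst p $ fst q * mat 1 $ snd p $ snd q) 0 :> drep \<rho> (E i j) $ fst p $ fst q * mat 1 $ snd p $ snd q"
  by (intro DERIV_cmult_right drep_curve[OF \<rho>] line1_derivative line1_0)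
 then show "DERIV (\<lambda>t. tensor_mat (\<rho> (line1 (E i j) t)) (\<tau> (mat 1)) $ p $ q) 0 :> pi1 (E i j) $ p $ q"
  by (simp add: tensor_mat_def pi1_def rational_rep_one[OF \<tau>])
qed (rule line1_derivative line1_inv_derivative | simp add: inv_par_0)+

lemma in_k_Inr: "in_k (E (Inr i) (Inr j)) (if i = j then of_int \<kappa>2 else 0) (pi2 (E i j))"
proof (rule in_k_curve[of _ "\<lambda>_. mat 1" "line1 (E i j)" _ "\<lambda>t. line1 (E (Inr i) (Inr j)) (inv_par (i = j) t)", OF line1_Inr[THEN ext] _ _ _ _ _ _ refl])
 show "\<forall>\<^sub>F t in nhds 0. mat 1 \<in> GL \<and> line1 (E i j) t \<in> GL \<and>
   line1 (E (Inr i) (Inr j)) (inv_par (i = j) t) ** line1 (E (Inr i) (Inr j)) t = mat 1"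
  using eventually_line1_GL[of "E i j"]
  by eventually_elim (simp add: line1_Inr block_diag_mult line1_unit_inverse block_diag_1)
 show "DERIV (\<lambda>t. det (mat 1 :: 'm cmat) powi \<kappa>1 * det (line1 (E i j) t) powi \<kappa>2) 0 :> (if i = j then of_int \<kappa>2 else 0)"
  by (cases "i = j") (auto simp: line1_unit_det intro!: derivative_eq_intros)
 fix p q :: "'w \<times> 'v"
 have "DERIV (\<lambda>t. mat 1 $ fst p $ fst q * \<tau> (line1 (E i j) t) $ snd p $ snd q) 0 :> mat 1 $ fst p $ fst q * drep \<tau> (E i j) $ snd p $ snd q"
  by (intro DERIV_cmult drep_curve[OF \<tau>] line1_derivative line1_0)
 then show "DERIV (\<lambda>t. tensor_mat (\<rho> (mat 1)) (\<tau> (line1 (E i j) t)) $ p $ q) 0 :> pi2 (E i j) $ p $ q"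
  by (simp add: tensor_mat_def pi2_def rational_rep_one[OF \<rho>])
qed (rule line1_derivative line1_inv_derivative | simp add: inv_par_0)+

text \<open>
  If \<open>s Y = c Z - Ad (a^-1) Z\<close>, the derivative in the direction Y at
  \<open>a\<close> is a combination of a right and a left derivative along K, both of which are
  known.
\<close>

lemma root_first:
 assumes Z: "in_k Z d M" and a: "a \<in> GL" and root: "scm s (a ** Y) = scm c (a ** Z) - Z ** a"
 shows "s *s rd Y f a = (c * d) *s f a - M *v f a"
proof -
 have "dv f a (scm s (a ** Y)) = dv f a (scm c (a ** Z)) - dv f a (Z ** a)"
  unfolding root by (rule dv_diff[OF regular_f a])
 then have "s *s rd Y f a = c *s rd Z f a - dv f a (Z ** a)"
  by (simp add: dv_scale[OF regular_f a] rd_def)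
 then show ?thesis using Z a left_f by (simp add: in_k_def vec_eq_iff)
qed

text \<open>
  The same relation applied to a derivative of f, which is still equivariant on the left, but on the
  right only up to a commutator.
\<close>

lemma root_second:
 assumes Z: "in_k Z d M" and a: "a \<in> GL" and root: "scm s (a ** Y) = scm c (a ** Z) - Z ** a"
 shows "s *s rd Y (rd Y' f) a = (c * d) *s rd Y' f a + c *s rd (Z ** Y' - Y' ** Z) f a - M *v rd Y' f a"
proof -
 have r: "regular_vec (rd Y' f)" by (rule regular_rd[OF regular_f])
 have "dv (rd Y' f) a (scm s (a ** Y)) = dv (rd Y' f) a (scm c (a ** Z)) - dv (rd Y' f) a (Z ** a)"
  unfolding root by (rule dv_diff[OF r a])
 then have "s *s rd Y (rd Y' f) a = c *s rd Z (rd Y' f) a - dv (rd Y' f) a (Z ** a)"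
  by (simp add: dv_scale[OF r a] rd_def[of _ "rd Y' f"])
 then show ?thesis using Z a left_rd[OF left_f, of Y'] by (simp add: in_k_def vec_eq_iff algebra_simps)
qed

end

lemma mult_unit_entry: "(M ** E p q) $ a $ b = (if b = q then M $ a $ p else 0)"
proof -
 have "M $ a $ k * E p q $ k $ b = (if k = p then (if b = q then M $ a $ p else 0) else 0)" for k
  by (auto simp: matrix_unit_def)
 then show ?thesis by (simp add: matrix_matrix_mult_def)
qed

context
 fixes x :: "'n::{finite,linorder} cvec" and a :: "('m::{finite,linorder} + 'n) cmat"
 assumes le: "CARD('n) \<le> CARD('m)" and a: "a = amat x"
begin

lemma amat_entries:
 "a $ Inl i $ Inl j = (if i = j then cosh (a_coord x i) else 0)"
 "a $ Inr i' $ Inr j' = (if i' = j' then cosh (x $ i') else 0)"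
 "a $ Inl i $ Inr j' = (if i = emb j' then sinh (x $ j') else 0)"
 "a $ Inr i' $ Inl j = (if j = emb i' then sinh (x $ i') else 0)"
 by (simp_all add: a amat_def)

lemma amat_column:
 "a ** E (Inl (emb l)) q =
   scm (cosh (x $ l)) (E (Inl (emb l)) q) + scm (sinh (x $ l)) (E (Inr l) q)"
 "a ** E (Inr l) q =
   scm (sinh (x $ l)) (E (Inl (emb l)) q) + scm (cosh (x $ l)) (E (Inr l) q)"
 "j \<notin> range (emb :: 'n \<Rightarrow> 'm) \<Longrightarrow> a ** E (Inl j) q = E (Inl j) q"
proof -
 have "(a ** E (Inl (emb l)) q) $ p $ b =
   (scm (cosh (x $ l)) (E (Inl (emb l)) q) + scm (sinh (x $ l)) (E (Inr l) q)) $ p $ b" for p b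
  by (subst mult_unit_entry, cases p) (auto simp: amat_entries matrix_unit_def a_coord_emb[OF le] emb_eq[OF le])
 then show "a ** E (Inl (emb l)) q =
   scm (cosh (x $ l)) (E (Inl (emb l)) q) + scm (sinh (x $ l)) (E (Inr l) q)"
  by (simp add: vec_eq_iff)
 have "(a ** E (Inr l) q) $ p $ b =
   (scm (sinh (x $ l)) (E (Inl (emb l)) q) + scm (cosh (x $ l)) (E (Inr l) q)) $ p $ b" for p b
  by (subst mult_unit_entry, cases p) (auto simp: amat_entries matrix_unit_def a_coord_emb[OF le] emb_eq[OF le])
 then show "a ** E (Inr l) q =
   scm (sinh (x $ l)) (E (Inl (emb l)) q) + scm (cosh (x $ l)) (E (Inr l) q)"
  by (simp add: vec_eq_iff)
 assume j: "j \<notin> range (emb :: 'n \<Rightarrow> 'm)"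
 have "(a ** E (Inl j) q) $ p $ b = E (Inl j) q $ p $ b" for p b
  using j a_coord_complement[OF le j, of x]
  by (subst mult_unit_entry, cases p) (auto simp: amat_entries matrix_unit_def)
 then show "a ** E (Inl j) q = E (Inl j) q" by (simp add: vec_eq_iff)
qed

lemma amat_row:
 "E p (Inl (emb l)) ** a =
   scm (cosh (x $ l)) (E p (Inl (emb l))) + scm (sinh (x $ l)) (E p (Inr l))"
 "E p (Inr l) ** a =
   scm (sinh (x $ l)) (E p (Inl (emb l))) + scm (cosh (x $ l)) (E p (Inr l))"
 "j \<notin> range (emb :: 'n \<Rightarrow> 'm) \<Longrightarrow> E p (Inl j) ** a = E p (Inl j)"
proof -
 have t: "transpose a = a"
  by (rule vec_Plus_eqI) (auto simp: transpose_def amat_entries)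
 have tu: "transpose (E p q) = (E q p :: ('m + 'n) cmat)" for p q
  by (auto simp: transpose_def matrix_unit_def vec_eq_iff)
 have ts: "transpose (scm k M) = scm k (transpose M)" "transpose (M + M') = transpose M + transpose M'"
  for k and M M' :: "('m + 'n) cmat"
  by (simp_all add: transpose_def scm_def vec_eq_iff)
 have row: "E p r ** a = transpose (a ** E r p)" for r
  by (simp add: matrix_transpose_mul t tu)
 show "E p (Inl (emb l)) ** a =
   scm (cosh (x $ l)) (E p (Inl (emb l))) + scm (sinh (x $ l)) (E p (Inr l))"
  "E p (Inr l) ** a =
   scm (sinh (x $ l)) (E p (Inl (emb l))) + scm (cosh (x $ l)) (E p (Inr l))"
  "j \<notin> range (emb :: 'n \<Rightarrow> 'm) \<Longrightarrow> E p (Inl j) ** a = E p (Inl j)"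
  unfolding row by (simp_all add: amat_column ts tu)
qed

lemma amat_mult_minus: "a ** amat (- x) = mat 1"
proof (rule vec_Plus_eqI)
 fix i j :: 'm
 have n: "a_coord (- x) i = - a_coord x i" for i :: 'm
  by (simp add: a_coord_def sum_negf[symmetric]) (auto intro!: sum.cong)
 have "(\<Sum>l\<in>UNIV. (if i = emb l then sinh (x $ l) else 0) * (if j = emb l then sinh ((- x) $ l) else 0)) =
   (if i = j then - (sinh (a_coord x i) ^ 2) else 0)"
 proof (cases "i \<in> range (emb :: 'n \<Rightarrow> 'm)")
  case True
  then obtain l0 :: 'n where l0: "i = emb l0" by auto
  have "(if i = emb l then sinh (x $ l) else 0) * (if j = emb l then sinh ((- x) $ l) else 0) =
    (if l = l0 then (if i = j then - (sinh (x $ l0) ^ 2) else 0) else 0)" for l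
   using l0 by (cases "j = i") (auto simp: emb_eq[OF le] power2_eq_square vector_uminus_component)
  then show ?thesis using l0 by (cases "j = i") (auto simp: a_coord_emb[OF le])
 next
  case False
  then have "(if i = emb l then sinh (x $ l) else 0) = 0" for l by auto
  then show ?thesis using a_coord_complement[OF le False, of x] by (cases "i = j") auto
 qed
 moreover have "(\<Sum>k\<in>UNIV. (if i = k then cosh (a_coord x i) else 0) * (if k = j then cosh (a_coord (- x) k) else 0)) =
   (if i = j then cosh (a_coord x i) ^ 2 else 0)"
 proof -
  have "(if i = k then cosh (a_coord x i) else 0) * (if k = j then cosh (a_coord (- x) k) else 0) =
    (if k = i then (if i = j then cosh (a_coord x i) ^ 2 else 0) else 0)" for k
   by (auto simp: n power2_eq_square)
  then show ?thesis by simp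
 qed
 ultimately show "(a ** amat (- x)) $ Inl i $ Inl j = mat 1 $ Inl i $ Inl j"
  by (simp add: matrix_matrix_mult_def sum_UNIV_Plus amat_entries amat_def mat_def cosh_square_eq)
next
 fix i :: 'm and j :: 'n
 have 1: "(if i = k then cosh (a_coord x i) else 0) * (if k = emb j then sinh ((- x) $ j) else 0) =
  (if k = i then (if i = emb j then - cosh (x $ j) * sinh (x $ j) else 0) else 0)" for k
  by (auto simp: a_coord_emb[OF le] vector_uminus_component)
 have 2: "(if i = emb l then sinh (x $ l) else 0) * (if l = j then cosh ((- x) $ l) else 0) =
  (if l = j then (if i = emb j then sinh (x $ j) * cosh (x $ j) else 0) else 0)" for l
  by (auto simp: vector_uminus_component)
 show "(a ** amat (- x)) $ Inl i $ Inr j = mat 1 $ Inl i $ Inr j"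
  by (simp add: matrix_matrix_mult_def sum_UNIV_Plus amat_entries amat_def mat_def 1 2 del: sinh_minus cosh_minus)
next
 fix i :: 'n and j :: 'm
 have n: "a_coord (- x) (emb i :: 'm) = - (x $ i)" by (simp add: a_coord_emb[OF le])
 have 1: "(if k = emb i then sinh (x $ i) else 0) * (if k = j then cosh (a_coord (- x) k) else 0) =
  (if k = emb i then (if j = emb i then sinh (x $ i) * cosh (x $ i) else 0) else 0)" for k
  by (auto simp: n)
 have 2: "(if i = l then cosh (x $ i) else 0) * (if j = emb l then sinh ((- x) $ l) else 0) =
  (if l = i then (if j = emb i then - cosh (x $ i) * sinh (x $ i) else 0) else 0)" for l
  by (auto simp: vector_uminus_component)
 show "(a ** amat (- x)) $ Inr i $ Inl j = mat 1 $ Inr i $ Inl j"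
  using 2 by (simp add: matrix_matrix_mult_def sum_UNIV_Plus amat_entries amat_def mat_def 1)
next
 fix i j :: 'n
 have 1: "(if k = emb i then sinh (x $ i) else 0) * (if k = emb j then sinh ((- x) $ j) else 0) =
  (if k = (emb i :: 'm) then (if i = j then - (sinh (x $ i) ^ 2) else 0) else 0)" for k
  by (auto simp: emb_eq[OF le] power2_eq_square vector_uminus_component)
 have 2: "(if i = l then cosh (x $ i) else 0) * (if l = j then cosh ((- x) $ l) else 0) =
  (if l = i then (if i = j then cosh (x $ i) ^ 2 else 0) else 0)" for l
  by (auto simp: power2_eq_square vector_uminus_component)
 show "(a ** amat (- x)) $ Inr i $ Inr j = mat 1 $ Inr i $ Inr j"
  using 1 2 by (simp add: matrix_matrix_mult_def sum_UNIV_Plus amat_entries amat_def mat_def cosh_square_eq)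
qed

lemma amat_GL: "a \<in> GL"
proof -
 note amat_mult_minus
 then have "det a * det (amat (- x) :: ('m + 'n) cmat) = 1" by (metis det_I det_mul)
 then show ?thesis by (auto simp: GL_iff_det)
qed

text \<open>
  The relation between root vectors that expresses Y outside the Lie algebra of K through Z and its
  conjugate. The parameter \<open>\<epsilon> = \<plusminus>1\<close> selects the roots
  \<open>\<epsilon>_k - \<epsilon>_l\<close> and \<open>\<epsilon>_k + \<epsilon>_l\<close>.
\<close>

lemma amat_pair_relation:
 fixes \<epsilon> s c :: complex
 assumes eps: "\<epsilon> * \<epsilon> = 1"
  and ch: "cosh (x $ k) = c * cosh (x $ l) - s * sinh (x $ l)"
  and sh: "sinh (x $ k) = \<epsilon> * (c * sinh (x $ l) - s * cosh (x $ l))"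
 shows "scm (\<epsilon> * s) (a ** (E (Inl (emb l)) (Inr k) + scm \<epsilon> (E (Inr l) (Inl (emb k))))) =
   scm c (a ** (E (Inl (emb l)) (Inl (emb k)) + scm \<epsilon> (E (Inr l) (Inr k))))
   - (E (Inl (emb l)) (Inl (emb k)) + scm \<epsilon> (E (Inr l) (Inr k))) ** a"
proof -
 let ?C = "cosh (x $ l)" and ?S = "sinh (x $ l)"
 have "scm (\<epsilon> * s) (a ** (E (Inl (emb l)) (Inr k) + scm \<epsilon> (E (Inr l) (Inl (emb k))))) $ p $ q =
   (scm c (a ** (E (Inl (emb l)) (Inl (emb k)) + scm \<epsilon> (E (Inr l) (Inr k))))
   - (E (Inl (emb l)) (Inl (emb k)) + scm \<epsilon> (E (Inr l) (Inr k))) ** a) $ p $ q" for p q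
 proof -
  define u1 where "u1 = (E (Inl (emb l)) (Inl (emb k)) :: ('m + 'n) cmat) $ p $ q"
  define u2 where "u2 = (E (Inl (emb l)) (Inr k) :: ('m + 'n) cmat) $ p $ q"
  define u3 where "u3 = (E (Inr l) (Inl (emb k)) :: ('m + 'n) cmat) $ p $ q"
  define u4 where "u4 = (E (Inr l) (Inr k) :: ('m + 'n) cmat) $ p $ q"
  have lhs: "scm (\<epsilon> * s) (a ** (E (Inl (emb l)) (Inr k) + scm \<epsilon> (E (Inr l) (Inl (emb k))))) $ p $ q =
    \<epsilon> * s * (?C * u2 + ?S * u4 + \<epsilon> * (?S * u1 + ?C * u3))"
   by (simp add: matrix_add_ldistrib scm_mult amat_column u1_def u2_def u3_def u4_def)
  have rhs: "(scm c (a ** (E (Inl (emb l)) (Inl (emb k)) + scm \<epsilon> (E (Inr l) (Inr k))))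
   - (E (Inl (emb l)) (Inl (emb k)) + scm \<epsilon> (E (Inr l) (Inr k))) ** a) $ p $ q =
    c * (?C * u1 + ?S * u3 + \<epsilon> * (?S * u2 + ?C * u4))
    - (cosh (x $ k) * u1 + sinh (x $ k) * u2 + \<epsilon> * (sinh (x $ k) * u3 + cosh (x $ k) * u4))"
   by (simp add: matrix_add_ldistrib matrix_add_rdistrib' scm_mult amat_column amat_row u1_def u2_def u3_def u4_def)
  show ?thesis
   unfolding lhs rhs ch sh using eps by algebra
 qed
 then show ?thesis by (simp add: vec_eq_iff)
qed

lemma amat_complement_relation:
 assumes j: "j \<notin> range (emb :: 'n \<Rightarrow> 'm)"
 shows "scm (sinh (x $ k)) (a ** E (Inr k) (Inl j)) =
   scm (cosh (x $ k)) (a ** E (Inl (emb k)) (Inl j)) - E (Inl (emb k)) (Inl j) ** a"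
  "scm (- sinh (x $ k)) (a ** E (Inl j) (Inr k)) =
   scm (cosh (x $ k)) (a ** E (Inl j) (Inl (emb k))) - E (Inl j) (Inl (emb k)) ** a"
proof -
 have sq: "sinh (x $ k) * sinh (x $ k) = cosh (x $ k) * cosh (x $ k) - 1"
  using cosh_square_eq[of "x $ k"] by (simp add: power2_eq_square)
 have e: "sinh (x $ k) * (sinh (x $ k) * u + cosh (x $ k) * v) =
   cosh (x $ k) * (cosh (x $ k) * u + sinh (x $ k) * v) - u" for u v
  using sq by algebra
 have "scm (sinh (x $ k)) (a ** E (Inr k) (Inl j)) $ p $ q =
   (scm (cosh (x $ k)) (a ** E (Inl (emb k)) (Inl j)) - E (Inl (emb k)) (Inl j) ** a) $ p $ q" for p q
  unfolding amat_column amat_row(3)[OF j] by (simp add: e)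
 then show "scm (sinh (x $ k)) (a ** E (Inr k) (Inl j)) =
   scm (cosh (x $ k)) (a ** E (Inl (emb k)) (Inl j)) - E (Inl (emb k)) (Inl j) ** a"
  by (simp add: vec_eq_iff)
 show "scm (- sinh (x $ k)) (a ** E (Inl j) (Inr k)) =
   scm (cosh (x $ k)) (a ** E (Inl j) (Inl (emb k))) - E (Inl j) (Inl (emb k)) ** a"
  unfolding amat_column(3)[OF j] amat_row by (simp add: vec_eq_iff)
qed

end

section \<open>The radial part of the Casimir element\<close>

lemma solve_mult: "(s::complex) \<noteq> 0 \<Longrightarrow> s * X = R \<Longrightarrow> X = R / s"
 by (auto simp: field_simps)

lemma sum_const_vec: "(\<Sum>i\<in>A. v) = of_nat (card A) *s (v :: 'd::finite cvec)"
 by (induction A rule: infinite_finite_induct) (simp_all add: vec_eq_iff algebra_simps)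

lemma scm_vec: "scm s M *v v = s *s (M *v v)"
 by (simp add: matrix_vector_mult_def vec_eq_iff sum_distrib_left mult_ac)

lemma axis_entry: "axis i r $ k = (if k = i then r else 0)"
 by (simp add: axis_def)

lemma root_eval_axis: "root_eval (axis i r) x = of_real r * x $ i"
proof -
 have "of_real (axis i r $ k) * x $ k = (if k = i then of_real r * x $ i else 0)" for k
  by (simp add: axis_entry)
 then show ?thesis by (simp add: root_eval_def)
qed

lemma root_eval_simps:
 "root_eval (\<alpha> + \<beta>) x = root_eval \<alpha> x + root_eval \<beta> x"
 "root_eval (\<alpha> - \<beta>) x = root_eval \<alpha> x - root_eval \<beta> x"
 "root_eval (r *\<^sub>R \<alpha>) x = of_real r * root_eval \<alpha> x"
 by (simp_all add: root_eval_def algebra_simps sum.distrib sum_subtractf sum_distrib_left)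

lemma regular_set_sinh:
 fixes x :: "'n::{finite,linorder} cvec"
 assumes x: "x \<in> regular_set"
 shows "sinh (x $ k) \<noteq> 0" "sinh (2 * x $ k) \<noteq> 0" "k \<noteq> l \<Longrightarrow> sinh (x $ k - x $ l) \<noteq> 0"
  "k \<noteq> l \<Longrightarrow> sinh (x $ k + x $ l) \<noteq> 0"
proof -
 have reg: "sinh (root_eval \<alpha> x) \<noteq> 0" if "\<alpha> \<in> pos_roots" for \<alpha>
  using x that by (auto simp: regular_set_def)
 show "sinh (x $ k) \<noteq> 0"
  using reg[of "axis k 1"] by (auto simp: pos_roots_def pos_short_def root_eval_axis)
 have "2 *\<^sub>R axis k 1 \<in> (pos_roots :: 'n rvec set)" by (auto simp: pos_roots_def pos_long_def)
 from reg[OF this] show "sinh (2 * x $ k) \<noteq> 0" by (simp add: root_eval_simps root_eval_axis)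
 have lt: "sinh (x $ k - x $ l) \<noteq> 0" "sinh (x $ k + x $ l) \<noteq> 0" if "k < l" for k l
  using reg[of "axis k 1 - axis l 1"] reg[of "axis k 1 + axis l 1"] that
  by (auto simp: pos_roots_def pos_medium_def root_eval_simps root_eval_axis)
 assume kl: "k \<noteq> l"
 have "sinh (x $ k - x $ l) = - sinh (x $ l - x $ k)" by (metis minus_diff_eq sinh_minus)
 then show "sinh (x $ k - x $ l) \<noteq> 0"
  using lt(1)[of k l] lt(1)[of l k] kl by (cases k l rule: linorder_cases) auto
 show "sinh (x $ k + x $ l) \<noteq> 0"
  using lt(2)[of k l] lt(2)[of l k] kl by (cases k l rule: linorder_cases) (auto simp: add.commute)
qed

text \<open>
  The tangent vector of A in the l-th coordinate.
\<close>

definition a_unit :: "'n::{finite,linorder} \<Rightarrow> ('m::{finite,linorder} + 'n) cmat" where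
 "a_unit l = E (Inl (emb l)) (Inr l) + E (Inr l) (Inl (emb l))"

text \<open>
  The value of a spherical function at a regular point \<open>a\<close> of A, on a vector e whose
  behaviour under the Lie algebra of K is prescribed: these are the only facts about the
  representations that enter the radial part of the Casimir element.
\<close>

locale spherical_line = spherical \<rho> \<tau> \<kappa>1 \<kappa>2 f
 for \<rho> :: "'m::{finite,linorder} cmat \<Rightarrow> 'w::finite cmat"
  and \<tau> :: "'n::{finite,linorder} cmat \<Rightarrow> 'v::finite cmat"
  and \<kappa>1 \<kappa>2 f +
 fixes e :: "('w \<times> 'v) cvec" and tW tV c K :: complex and x :: "'n cvec" and \<phi> :: complex
  and a :: "('m + 'n) cmat"
 assumes W_emb: "\<And>k l :: 'n. k \<noteq> l \<Longrightarrow> pi1 (E (emb k) (emb l)) *v e = 0"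
  and W_upper: "\<And>(k :: 'n) j. j \<notin> range (emb :: 'n \<Rightarrow> 'm) \<Longrightarrow> pi1 (E (emb k) j) *v e = 0"
  and W_diag: "\<And>k :: 'n. pi1 (E (emb k) (emb k)) *v e = tW *s e"
  and W_raise: "\<And>(k :: 'n) j. j \<notin> range (emb :: 'n \<Rightarrow> 'm) \<Longrightarrow>
    pi1 (E (emb k) j) *v (pi1 (E j (emb k)) *v e) = c *s e"
  and V_raise: "\<And>k l. k \<noteq> l \<Longrightarrow> pi2 (E k l) *v (pi2 (E l k) *v e) = K *s e"
  and V_diag: "\<And>k. pi2 (E k k) *v e = tV *s e"
  and a_def: "a = amat x" and line: "f a = \<phi> *s e" and x: "x \<in> regular_set"
begin

lemmas sinh_regular = regular_set_sinh[OF x]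

lemma aGL: "a \<in> GL" using amat_GL[OF le a_def] .

abbreviation LL :: "'n \<Rightarrow> 'n \<Rightarrow> ('m + 'n) cmat" where "LL k l \<equiv> E (Inl (emb k)) (Inl (emb l))"
abbreviation LR :: "'n \<Rightarrow> 'n \<Rightarrow> ('m + 'n) cmat" where "LR k l \<equiv> E (Inl (emb k)) (Inr l)"
abbreviation RL :: "'n \<Rightarrow> 'n \<Rightarrow> ('m + 'n) cmat" where "RL k l \<equiv> E (Inr k) (Inl (emb l))"
abbreviation RR :: "'n \<Rightarrow> 'n \<Rightarrow> ('m + 'n) cmat" where "RR k l \<equiv> E (Inr k) (Inr l)"

definition D2 :: "('m + 'n) cmat \<Rightarrow> ('m + 'n) cmat \<Rightarrow> ('w \<times> 'v) cvec" where "D2 Y Y' = rd Y (rd Y' f) a"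
text \<open>
  Root vectors outside (YY) and inside (ZZ) the Lie algebra of K, for the roots of medium length,
  and for \<open>k = l\<close> the long roots.
\<close>

definition YY :: "complex \<Rightarrow> 'n \<Rightarrow> 'n \<Rightarrow> ('m + 'n) cmat" where "YY \<epsilon> k l = LR k l + scm \<epsilon> (RL k l)"
definition ZZ :: "complex \<Rightarrow> 'n \<Rightarrow> 'n \<Rightarrow> ('m + 'n) cmat" where "ZZ \<epsilon> k l = LL k l + scm \<epsilon> (RR k l)"

lemma D2_add: "D2 (Y + Y') W = D2 Y W + D2 Y' W" "D2 W (Y + Y') = D2 W Y + D2 W Y'"
 and D2_scale: "D2 (scm s Y) W = s *s D2 Y W" "D2 W (scm s Y) = s *s D2 W Y"
 by (simp_all add: D2_def rd_add rd_scale rd_rd_add rd_rd_scale regular_rd regular_f aGL)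

lemma in_k_ZZ: "in_k (ZZ \<epsilon> k l) (if k = l then of_int \<kappa>1 + \<epsilon> * of_int \<kappa>2 else 0)
  (pi1 (E (emb k) (emb l)) + scm \<epsilon> (pi2 (E k l)))"
 using in_k_add[OF in_k_Inl[of "emb k" "emb l"] in_k_Inr[of k l], of \<epsilon>]
 by (cases "k = l") (simp_all add: ZZ_def emb_eq[OF le])

lemma pair_relation:
 assumes "\<epsilon> = 1 \<or> \<epsilon> = -1"
 shows "scm (\<epsilon> * sinh (x $ k - \<epsilon> * x $ l)) (a ** YY \<epsilon> k l) = scm (cosh (x $ k - \<epsilon> * x $ l)) (a ** ZZ \<epsilon> k l) - ZZ \<epsilon> k l ** a"
 unfolding YY_def ZZ_def
proof (rule amat_pair_relation[OF le a_def])
 show "\<epsilon> * \<epsilon> = 1" using assms by auto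
 have l: "\<epsilon> * x $ l = x $ k - (x $ k - \<epsilon> * x $ l)" by simp
 have c: "cosh (\<epsilon> * x $ l) = cosh (x $ l)" and s: "sinh (\<epsilon> * x $ l) = \<epsilon> * sinh (x $ l)" using assms by auto
 have "cosh (x $ l) = cosh (x $ k - (x $ k - \<epsilon> * x $ l))" using c l by simp
 then show "cosh (x $ l) = cosh (x $ k - \<epsilon> * x $ l) * cosh (x $ k) - sinh (x $ k - \<epsilon> * x $ l) * sinh (x $ k)"
  by (simp only: cosh_diff[of "x $ k" "x $ k - \<epsilon> * x $ l"]) (simp add: mult.commute)
 have "\<epsilon> * sinh (x $ l) = sinh (x $ k - (x $ k - \<epsilon> * x $ l))" using s l by simp
 then have "\<epsilon> * sinh (x $ l) = cosh (x $ k - \<epsilon> * x $ l) * sinh (x $ k) - sinh (x $ k - \<epsilon> * x $ l) * cosh (x $ k)"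
  by (simp only: sinh_diff[of "x $ k" "x $ k - \<epsilon> * x $ l"]) (simp add: mult.commute)
 then have "\<epsilon> * (\<epsilon> * sinh (x $ l)) = \<epsilon> * (cosh (x $ k - \<epsilon> * x $ l) * sinh (x $ k) - sinh (x $ k - \<epsilon> * x $ l) * cosh (x $ k))" by simp
 moreover have "\<epsilon> * (\<epsilon> * sinh (x $ l)) = sinh (x $ l)" using assms by auto
 ultimately show "sinh (x $ l) = \<epsilon> * (cosh (x $ k - \<epsilon> * x $ l) * sinh (x $ k) - sinh (x $ k - \<epsilon> * x $ l) * cosh (x $ k))"
  by simp
qed

lemma bracket_ZZ_YY:
 assumes "\<epsilon> = 1 \<or> \<epsilon> = -1"
 shows "ZZ \<epsilon> k l ** YY \<epsilon> l k - YY \<epsilon> l k ** ZZ \<epsilon> k l = a_unit k - scm \<epsilon> (a_unit l)"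
proof -
 have "ZZ \<epsilon> k l ** YY \<epsilon> l k = a_unit k" "YY \<epsilon> l k ** ZZ \<epsilon> k l = scm \<epsilon> (a_unit l)"
  using assms unfolding ZZ_def YY_def a_unit_def
  by (auto simp: matrix_add_ldistrib matrix_add_rdistrib' scm_mult matrix_unit_mult vec_eq_iff)
 then show ?thesis by simp
qed

text \<open>
  Applying root_second leaves the commutator, a derivative along A, and a product of two elements of
  the Lie algebra of K acting on e; the terms with an off-diagonal element of the first block vanish
  on e, and the remaining one contributes K.
\<close>

lemma pair_off_diagonal:
 assumes kl: "k \<noteq> l" and eps: "\<epsilon> = 1 \<or> \<epsilon> = -1"
 shows "\<epsilon> *s D2 (YY \<epsilon> k l) (YY \<epsilon> l k) =
   (cosh (x $ k - \<epsilon> * x $ l) / sinh (x $ k - \<epsilon> * x $ l)) *s (rd (a_unit k) f a - \<epsilon> *s rd (a_unit l) f a)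
   - (K / (sinh (x $ k - \<epsilon> * x $ l))\<^sup>2) *s f a"
proof -
 define s where "s = sinh (x $ k - \<epsilon> * x $ l)"
 define ch where "ch = cosh (x $ k - \<epsilon> * x $ l)"
 have s0: "s \<noteq> 0" using sinh_regular(3,4)[OF kl] eps by (auto simp: s_def)
 have ee: "\<epsilon> * \<epsilon> = 1" using eps by auto
 have sw: "\<epsilon> * sinh (x $ l - \<epsilon> * x $ k) = - s"
  using eps sinh_minus[of "x $ k - x $ l"] by (auto simp: s_def add.commute)
 let ?v = "pi2 (E l k) *v e"
 have first: "(- s) *s rd (YY \<epsilon> l k) f a = - (\<phi> * \<epsilon>) *s ?v"
 proof -
  have "(\<epsilon> * sinh (x $ l - \<epsilon> * x $ k)) *s rd (YY \<epsilon> l k) f a =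
    (cosh (x $ l - \<epsilon> * x $ k) * 0) *s f a - (pi1 (E (emb l) (emb k)) + scm \<epsilon> (pi2 (E l k))) *v f a"
   using root_first[OF in_k_ZZ aGL pair_relation[OF eps], of l k] kl by simp
  also have "(pi1 (E (emb l) (emb k)) + scm \<epsilon> (pi2 (E l k))) *v f a =
    \<phi> *s (pi1 (E (emb l) (emb k)) *v e) + (\<phi> * \<epsilon>) *s ?v"
   by (simp add: line matrix_vector_mult_def vec_eq_iff algebra_simps sum.distrib sum_distrib_left)
  also have "pi1 (E (emb l) (emb k)) *v e = 0" by (rule W_emb[OF kl[symmetric]])
  finally show ?thesis unfolding sw by (simp add: vec_eq_iff)
 qed
 have rdY: "rd (YY \<epsilon> l k) f a = (\<phi> * \<epsilon> / s) *s ?v"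
  using first s0 by (simp add: vec_eq_iff field_simps)
 have act: "(pi1 (E (emb k) (emb l)) + scm \<epsilon> (pi2 (E k l))) *v ?v = (\<epsilon> * K) *s e"
 proof -
  have "(pi1 (E (emb k) (emb l)) + scm \<epsilon> (pi2 (E k l))) *v ?v =
    pi1 (E (emb k) (emb l)) *v ?v + \<epsilon> *s (pi2 (E k l) *v ?v)"
   by (simp add: matrix_vector_mult_def vec_eq_iff algebra_simps sum.distrib sum_distrib_left)
  also have "pi1 (E (emb k) (emb l)) *v ?v = pi2 (E l k) *v (pi1 (E (emb k) (emb l)) *v e)"
   by (rule pi_commute)
  also have "pi1 (E (emb k) (emb l)) *v e = 0" by (rule W_emb[OF kl])
  also have "pi2 (E k l) *v ?v = K *s e" by (rule V_raise[OF kl])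
  finally show ?thesis by (simp add: vec_eq_iff)
 qed
 have "(\<epsilon> * s) *s D2 (YY \<epsilon> k l) (YY \<epsilon> l k) =
   (ch * 0) *s rd (YY \<epsilon> l k) f a + ch *s rd (a_unit k - scm \<epsilon> (a_unit l)) f a
   - (pi1 (E (emb k) (emb l)) + scm \<epsilon> (pi2 (E k l))) *v rd (YY \<epsilon> l k) f a"
  using root_second[OF in_k_ZZ aGL pair_relation[OF eps], of k l "YY \<epsilon> l k"] kl
  unfolding bracket_ZZ_YY[OF eps] by (simp add: D2_def s_def ch_def)
 moreover have "rd (a_unit k - scm \<epsilon> (a_unit l)) f a = rd (a_unit k) f a - \<epsilon> *s rd (a_unit l) f a"
  by (simp add: rd_def matrix_diff_ldistrib' scm_mult dv_diff dv_scale regular_f aGL)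
 moreover have "(pi1 (E (emb k) (emb l)) + scm \<epsilon> (pi2 (E k l))) *v rd (YY \<epsilon> l k) f a =
   (\<phi> * K / s) *s e"
  unfolding rdY mv_scale act using ee by (simp add: vec_eq_iff field_simps)
 ultimately have main: "(\<epsilon> * s) *s D2 (YY \<epsilon> k l) (YY \<epsilon> l k) = ch *s (rd (a_unit k) f a - \<epsilon> *s rd (a_unit l) f a) - (\<phi> * K / s) *s e"
  by simp
 have "(\<epsilon> *s D2 (YY \<epsilon> k l) (YY \<epsilon> l k)) $ p =
   ((ch / s) *s (rd (a_unit k) f a - \<epsilon> *s rd (a_unit l) f a) - (K / s\<^sup>2) *s f a) $ p" for p
 proof -
  have "s * (\<epsilon> * D2 (YY \<epsilon> k l) (YY \<epsilon> l k) $ p) = ch * (rd (a_unit k) f a $ p - \<epsilon> * rd (a_unit l) f a $ p) - \<phi> * K / s * e $ p"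
   using arg_cong[OF main, of "\<lambda>v. v $ p"] by (simp add: algebra_simps)
  from solve_mult[OF s0 this] show ?thesis
   by (simp add: line diff_divide_distrib right_diff_distrib power2_eq_square mult_ac)
 qed
 then show ?thesis by (simp add: vec_eq_iff s_def ch_def)
qed

text \<open>
  The long roots: Z is diagonal here and acts by a scalar on either side, and the square of a
  combination of the two scalars appears.
\<close>

lemma pair_diagonal:
 "D2 (YY (-1) k k) (YY (-1) k k) =
   (((tW - tV) - cosh (2 * x $ k) * (of_int \<kappa>1 - of_int \<kappa>2))\<^sup>2 / (sinh (2 * x $ k))\<^sup>2) *s f a
   - (2 * cosh (2 * x $ k) / sinh (2 * x $ k)) *s rd (a_unit k) f a"
proof -
 define s where "s = sinh (2 * x $ k)"
 define ch where "ch = cosh (2 * x $ k)"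
 define d :: complex where "d = of_int \<kappa>1 - of_int \<kappa>2"
 define z where "z = tW - tV"
 have s0: "s \<noteq> 0" using sinh_regular(2) by (simp add: s_def)
 let ?M = "pi1 (E (emb k) (emb k)) + scm (-1) (pi2 (E k k))"
 have Me: "?M *v e = z *s e"
 proof -
  have "?M *v e = tW *s e + (-1) *s (tV *s e)"
   unfolding matrix_vector_mult_add_rdistrib scm_vec W_diag V_diag ..
  then show ?thesis by (simp add: z_def vec_eq_iff algebra_simps)
 qed
 have two: "x $ k - - 1 * x $ k = 2 * x $ k" by simp
 have rel: "scm (- s) (a ** YY (-1) k k) = scm ch (a ** ZZ (-1) k k) - ZZ (-1) k k ** a"
  using pair_relation[of "-1" k k] unfolding two s_def ch_def by simp
 have ink: "in_k (ZZ (-1) k k) d ?M" using in_k_ZZ[of "-1" k k] by (simp add: d_def)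
 have "(- s) *s rd (YY (-1) k k) f a = (ch * d) *s f a - ?M *v f a"
  by (rule root_first[OF ink aGL rel])
 then have "(- s) *s rd (YY (-1) k k) f a = ((ch * d - z) * \<phi>) *s e"
  unfolding line mv_scale Me by (simp add: vec_eq_iff algebra_simps)
 then have rdY: "rd (YY (-1) k k) f a = ((z - ch * d) * \<phi> / s) *s e"
  using s0 by (simp add: vec_eq_iff field_simps)
 have br: "a_unit k - scm (-1) (a_unit k) = scm 2 (a_unit k)" by (simp add: vec_eq_iff)
 have "(- s) *s D2 (YY (-1) k k) (YY (-1) k k) = (ch * d) *s rd (YY (-1) k k) f a
   + ch *s rd (scm 2 (a_unit k)) f a - ?M *v rd (YY (-1) k k) f a"
  using root_second[OF ink aGL rel, of "YY (-1) k k"] unfolding bracket_ZZ_YY[of "-1", simplified] br D2_def by simp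
 moreover have "rd (scm 2 (a_unit k)) f a = 2 *s rd (a_unit k) f a" by (simp add: rd_scale regular_f aGL)
 moreover have "?M *v rd (YY (-1) k k) f a = z *s rd (YY (-1) k k) f a"
  unfolding rdY mv_scale Me by (simp add: vec_eq_iff)
 ultimately have main: "(- s) *s D2 (YY (-1) k k) (YY (-1) k k) = (ch * d) *s rd (YY (-1) k k) f a
   + ch *s (2 *s rd (a_unit k) f a) - z *s rd (YY (-1) k k) f a" by simp
 have "D2 (YY (-1) k k) (YY (-1) k k) $ p = (((z - ch * d)\<^sup>2 / s\<^sup>2) *s f a - (2 * ch / s) *s rd (a_unit k) f a) $ p" for p
 proof -
  have "(- s) * D2 (YY (-1) k k) (YY (-1) k k) $ p = (ch * d) * ((z - ch * d) * \<phi> / s * e $ p)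
    + ch * (2 * rd (a_unit k) f a $ p) - z * ((z - ch * d) * \<phi> / s * e $ p)"
   using arg_cong[OF main, of "\<lambda>v. v $ p"] by (simp add: rdY mult.assoc)
  from solve_mult[OF _ this] s0 have "D2 (YY (-1) k k) (YY (-1) k k) $ p =
    - ((ch * d) * ((z - ch * d) * \<phi> / s * e $ p) + ch * (2 * rd (a_unit k) f a $ p) - z * ((z - ch * d) * \<phi> / s * e $ p)) / s"
   by (simp only: divide_minus_right minus_divide_left neg_equal_0_iff_equal not_False_eq_True)
  also have "\<dots> = (z - ch * d)\<^sup>2 / s\<^sup>2 * (\<phi> * e $ p) - 2 * ch / s * rd (a_unit k) f a $ p"
   using s0 by (simp add: divide_simps power2_eq_square) algebra
  finally show ?thesis by (simp add: line)
 qed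
 then show ?thesis by (simp add: vec_eq_iff s_def ch_def d_def z_def)
qed

text \<open>
  The short roots, coming from the indices of the larger block that do not occur in
  \<open>a\<close>.
\<close>

lemma pair_complement:
 assumes j: "j \<notin> range (emb :: 'n \<Rightarrow> 'm)"
 shows "D2 (E (Inl j) (Inr k)) (E (Inr k) (Inl j)) + D2 (E (Inr k) (Inl j)) (E (Inl j) (Inr k)) =
  (cosh (x $ k) / sinh (x $ k)) *s rd (a_unit k) f a - (c / (sinh (x $ k))\<^sup>2) *s f a"
proof -
 define s where "s = sinh (x $ k)"
 define ch where "ch = cosh (x $ k)"
 have s0: "s \<noteq> 0" using sinh_regular(1) by (simp add: s_def)
 let ?kj = "E (Inl (emb k)) (Inl j) :: ('m + 'n) cmat" and ?jk = "E (Inl j) (Inl (emb k)) :: ('m + 'n) cmat"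
 let ?P = "E (Inl j) (Inr k) :: ('m + 'n) cmat" and ?Q = "E (Inr k) (Inl j) :: ('m + 'n) cmat"
 have ne: "j \<noteq> emb k" "emb k \<noteq> j" using j by auto
 note rel = amat_complement_relation[OF le a_def j, of k, folded s_def ch_def]
 have ink: "in_k ?kj 0 (pi1 (E (emb k) j))" "in_k ?jk 0 (pi1 (E j (emb k)))"
  using in_k_Inl[of "emb k" j] in_k_Inl[of j "emb k"] ne by simp_all
 have Q0: "rd ?Q f a = 0"
 proof -
  have "s *s rd ?Q f a = 0"
   unfolding root_first[OF ink(1) aGL rel(1)] line mv_scale W_upper[OF j] by simp
  then show ?thesis using s0 by (simp add: vec_eq_iff)
 qed
 have P1: "(- s) *s rd ?P f a = - (\<phi> *s (pi1 (E j (emb k)) *v e))"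
  using root_first[OF ink(2) aGL rel(2)] by (simp add: line mv_scale)
 then have P: "rd ?P f a = (\<phi> / s) *s (pi1 (E j (emb k)) *v e)"
  using s0 by (simp add: vec_eq_iff field_simps)
 have b1: "?kj ** ?P - ?P ** ?kj = LR k k" and b2: "?jk ** ?Q - ?Q ** ?jk = scm (-1) (RL k k)"
  using ne by (simp_all add: matrix_unit_mult vec_eq_iff)
 have "s *s D2 ?Q ?P = ch *s rd (LR k k) f a - pi1 (E (emb k) j) *v rd ?P f a"
  using root_second[OF ink(1) aGL rel(1), of ?P] unfolding b1 D2_def by simp
 then have 1: "s *s D2 ?Q ?P = ch *s rd (LR k k) f a - (\<phi> / s * c) *s e"
  unfolding P mv_scale W_raise[OF j] by (simp add: vec_eq_iff)
 have "(- s) *s D2 ?P ?Q = ch *s rd (scm (-1) (RL k k)) f a - pi1 (E j (emb k)) *v rd ?Q f a"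
  using root_second[OF ink(2) aGL rel(2), of ?Q] unfolding b2 D2_def by simp
 then have 2: "(- s) *s D2 ?P ?Q = ch *s ((-1) *s rd (RL k k) f a)"
  by (simp add: Q0 rd_scale regular_f aGL)
 have X: "rd (a_unit k) f a = rd (LR k k) f a + rd (RL k k) f a" by (simp add: a_unit_def rd_add regular_f aGL)
 have "(D2 ?P ?Q + D2 ?Q ?P) $ p = ((ch / s) *s rd (a_unit k) f a - (c / s\<^sup>2) *s f a) $ p" for p
 proof -
  have "s * D2 ?Q ?P $ p = ch * rd (LR k k) f a $ p - \<phi> / s * c * e $ p"
   "s * D2 ?P ?Q $ p = ch * rd (RL k k) f a $ p"
   using arg_cong[OF 1, of "\<lambda>v. v $ p"] arg_cong[OF 2, of "\<lambda>v. v $ p"] by simp_all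
  from solve_mult[OF s0 this(1)] solve_mult[OF s0 this(2)] show ?thesis
   by (simp add: X line diff_divide_distrib add_divide_distrib distrib_left power2_eq_square mult_ac)
 qed
 then show ?thesis by (simp add: vec_eq_iff s_def ch_def)
qed

definition pair_term :: "'n \<Rightarrow> 'n \<Rightarrow> ('w \<times> 'v) cvec" where
 "pair_term k l = D2 (LR k l) (RL l k) + D2 (RL k l) (LR l k)"

lemma pair_term_polar:
 "2 *s pair_term k l = D2 (YY 1 k l) (YY 1 l k) - D2 (YY (-1) k l) (YY (-1) l k)"
 by (simp add: pair_term_def YY_def D2_add D2_scale vec_eq_iff algebra_simps)

lemma pair_term_off:
 assumes "k \<noteq> l"
 shows "2 *s pair_term k l =
   (cosh (x $ k - x $ l) / sinh (x $ k - x $ l)) *s (rd (a_unit k) f a - rd (a_unit l) f a)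
   + (cosh (x $ k + x $ l) / sinh (x $ k + x $ l)) *s (rd (a_unit k) f a + rd (a_unit l) f a)
   - (K / (sinh (x $ k - x $ l))\<^sup>2 + K / (sinh (x $ k + x $ l))\<^sup>2) *s f a"
proof -
 have 1: "D2 (YY 1 k l) (YY 1 l k) = (cosh (x $ k - x $ l) / sinh (x $ k - x $ l)) *s (rd (a_unit k) f a - rd (a_unit l) f a)
   - (K / (sinh (x $ k - x $ l))\<^sup>2) *s f a"
  using pair_off_diagonal[OF assms, of 1] by simp
 have 2: "- D2 (YY (-1) k l) (YY (-1) l k) = (cosh (x $ k + x $ l) / sinh (x $ k + x $ l)) *s (rd (a_unit k) f a + rd (a_unit l) f a)
   - (K / (sinh (x $ k + x $ l))\<^sup>2) *s f a"
  using pair_off_diagonal[OF assms, of "-1"] by (simp add: vec_eq_iff)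
 have "2 *s pair_term k l = D2 (YY 1 k l) (YY 1 l k) + (- D2 (YY (-1) k l) (YY (-1) l k))"
  by (simp add: pair_term_polar)
 then show ?thesis unfolding 1 2 by (simp add: vec_eq_iff algebra_simps)
qed

lemma pair_term_diag:
 "2 *s pair_term k k = rd (a_unit k) (rd (a_unit k) f) a
   + (2 * cosh (2 * x $ k) / sinh (2 * x $ k)) *s rd (a_unit k) f a
   - (((tW - tV) - cosh (2 * x $ k) * (of_int \<kappa>1 - of_int \<kappa>2))\<^sup>2 / (sinh (2 * x $ k))\<^sup>2) *s f a"
proof -
 have X: "YY 1 k k = a_unit k" by (simp add: YY_def a_unit_def vec_eq_iff)
 show ?thesis
  unfolding pair_term_polar pair_diagonal X unfolding D2_def by (simp add: vec_eq_iff)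
qed

definition first_order :: "'n \<Rightarrow> complex" where
 "first_order k = of_nat (CARD('m) - CARD('n)) * (cosh (x $ k) / sinh (x $ k)) + cosh (2 * x $ k) / sinh (2 * x $ k)
   + (\<Sum>l\<in>UNIV - {k}. cosh (x $ k - x $ l) / sinh (x $ k - x $ l) + cosh (x $ k + x $ l) / sinh (x $ k + x $ l))"

definition zero_order :: complex where
 "zero_order = of_nat CARD('m) * (of_int \<kappa>1)\<^sup>2 + of_nat CARD('n) * (of_int \<kappa>2)\<^sup>2
   - (\<Sum>k\<in>UNIV. \<Sum>l\<in>UNIV - {k}. (K / (sinh (x $ k - x $ l))\<^sup>2 + K / (sinh (x $ k + x $ l))\<^sup>2) / 2)
   - (\<Sum>k\<in>UNIV. of_nat (CARD('m) - CARD('n)) * (c / (sinh (x $ k))\<^sup>2))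
   - (\<Sum>k\<in>UNIV. ((tW - tV) - cosh (2 * x $ k) * (of_int \<kappa>1 - of_int \<kappa>2))\<^sup>2 / (sinh (2 * x $ k))\<^sup>2 / 2)"

lemma D_casimir_D2: "D_casimir f a = (\<Sum>p\<in>UNIV. \<Sum>q\<in>UNIV. D2 (E p q) (E q p))"
proof -
 have reg: "\<And>p. regular_GL (\<lambda>g. f g $ p)" by (rule regular_vecD[OF regular_f])
 have 1: "lie_deriv (E q p) f g = rd (E q p) f g" if "g \<in> GL" for p q g
  by (simp add: lie_deriv_unit[OF reg that] rd_def dv_def)
 have "lie_deriv (E p q) (lie_deriv (E q p) f) a = D2 (E p q) (E q p)" for p q
 proof -
  have r: "regular_vec (lie_deriv (E q p) f)"
   using regular_rd[OF regular_f, of "E q p"] 1[of _ q p]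
   unfolding regular_vec_def by (metis (no_types, lifting) regular_GL_cong)
  have "lie_deriv (E p q) (lie_deriv (E q p) f) a = dv (lie_deriv (E q p) f) a (a ** E p q)"
   using lie_deriv_unit[OF regular_vecD[OF r] aGL] by (simp add: dv_def)
  also have "\<dots> = dv (rd (E q p) f) a (a ** E p q)"
   by (rule dv_cong[OF r aGL 1])
  finally show ?thesis by (simp add: D2_def rd_def[of _ "rd _ _"])
 qed
 then show ?thesis by (simp add: D_casimir_def)
qed

lemma D2_k_part:
 "D2 (E (Inl i) (Inl j)) (E (Inl j) (Inl i)) = (if i = j then (of_int \<kappa>1)\<^sup>2 else 0) *s f a"
 "D2 (E (Inr i') (Inr j')) (E (Inr j') (Inr i')) = (if i' = j' then (of_int \<kappa>2)\<^sup>2 else 0) *s f a"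
proof -
 have *: "rd Z (rd Z' f) a = (d * d') *s f a" if "in_k Z d M" "in_k Z' d' M'" for Z Z' d d' M M'
 proof -
  have "rd Z (rd Z' f) a = dv (rd Z' f) a (a ** Z)" by (simp add: rd_def)
  also have "\<dots> = dv (\<lambda>g. d' *s f g) a (a ** Z)"
   by (rule dv_cong[OF regular_rd[OF regular_f] aGL]) (use that(2) in \<open>simp add: in_k_def\<close>)
  also have "\<dots> = d' *s rd Z f a" by (simp add: dv_fun_scale regular_f aGL rd_def)
  finally show ?thesis using that(1) aGL by (simp add: in_k_def vec_eq_iff)
 qed
 show "D2 (E (Inl i) (Inl j)) (E (Inl j) (Inl i)) = (if i = j then (of_int \<kappa>1)\<^sup>2 else 0) *s f a"
  unfolding D2_def *[OF in_k_Inl in_k_Inl] by (simp add: power2_eq_square)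
 show "D2 (E (Inr i') (Inr j')) (E (Inr j') (Inr i')) = (if i' = j' then (of_int \<kappa>2)\<^sup>2 else 0) *s f a"
  unfolding D2_def *[OF in_k_Inr in_k_Inr] by (simp add: power2_eq_square)
qed

lemma card_complement: "card (UNIV - range (emb :: 'n \<Rightarrow> 'm)) = CARD('m) - CARD('n)"
 using card_image[OF emb_inj[OF le]] by (subst card_Diff_subset) auto

text \<open>
  The part of the Casimir element inside the Lie algebra of K contributes constants. The remaining
  pairs \<open>E p q\<close>, \<open>E q p\<close> with p and q in different blocks group into
  roots: polarization over the sign \<open>\<epsilon>\<close> writes each group as a difference of
  products of root vectors.
\<close>

theorem casimir_radial:
 "D_casimir f a = (\<Sum>k\<in>UNIV. (1/2) *s rd (a_unit k) (rd (a_unit k) f) a + first_order k *s rd (a_unit k) f a) + zero_order *s f a"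
proof -
 let ?c = "\<lambda>z::complex. cosh z / sinh z"
 let ?q = "of_nat (CARD('m) - CARD('n)) :: complex"
 define G where "G i k = D2 (E (Inl i) (Inr k)) (E (Inr k) (Inl i))
   + D2 (E (Inr k) (Inl i)) (E (Inl i) (Inr k))" for i :: 'm and k :: 'n
 have KL: "(\<Sum>i\<in>UNIV. \<Sum>j\<in>UNIV. D2 (E (Inl i) (Inl j)) (E (Inl j) (Inl i))) = (of_nat CARD('m) * (of_int \<kappa>1)\<^sup>2) *s f a"
 proof -
  have "(\<Sum>j\<in>UNIV. (if i = j then (of_int \<kappa>1)\<^sup>2 else 0) *s f a) = (of_int \<kappa>1)\<^sup>2 *s f a" for i :: 'm
   by (subst sum.remove[of _ i]) (auto intro!: sum.neutral)
  then show ?thesis unfolding D2_k_part by (simp add: vec_eq_iff)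
 qed
 have KR: "(\<Sum>i\<in>UNIV. \<Sum>j\<in>UNIV. D2 (E (Inr i) (Inr j)) (E (Inr j) (Inr i))) = (of_nat CARD('n) * (of_int \<kappa>2)\<^sup>2) *s f a"
 proof -
  have "(\<Sum>j\<in>UNIV. (if i = j then (of_int \<kappa>2)\<^sup>2 else 0) *s f a) = (of_int \<kappa>2)\<^sup>2 *s f a" for i :: 'n
   by (subst sum.remove[of _ i]) (auto intro!: sum.neutral)
  then show ?thesis unfolding D2_k_part by (simp add: vec_eq_iff)
 qed
 have "D_casimir f a = (of_nat CARD('m) * (of_int \<kappa>1)\<^sup>2) *s f a + (of_nat CARD('n) * (of_int \<kappa>2)\<^sup>2) *s f a
   + (\<Sum>i\<in>UNIV. \<Sum>k\<in>UNIV. G i k)"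
 proof -
  have "(\<Sum>i\<in>UNIV. \<Sum>k\<in>UNIV. G i k) =
    (\<Sum>i\<in>UNIV. \<Sum>k\<in>UNIV. D2 (E (Inl i) (Inr k)) (E (Inr k) (Inl i))) +
    (\<Sum>k\<in>UNIV. \<Sum>i\<in>UNIV. D2 (E (Inr k) (Inl i)) (E (Inl i) (Inr k)))"
   unfolding G_def sum.distrib by (subst (2) sum.swap) simp
  then show ?thesis
   unfolding D_casimir_D2 sum_UNIV_Plus sum.distrib KL KR by (simp add: algebra_simps)
 qed
 also have "(\<Sum>i\<in>UNIV. \<Sum>k\<in>UNIV. G i k) =
   (\<Sum>i\<in>range (emb :: 'n \<Rightarrow> 'm). \<Sum>k\<in>UNIV. G i k) + (\<Sum>i\<in>UNIV - range (emb :: 'n \<Rightarrow> 'm). \<Sum>k\<in>UNIV. G i k)"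
  by (subst sum.subset_diff[of "range (emb :: 'n \<Rightarrow> 'm)"]) (simp_all add: add.commute)
 also have "(\<Sum>i\<in>UNIV - range (emb :: 'n \<Rightarrow> 'm). \<Sum>k\<in>UNIV. G i k) =
   (\<Sum>k\<in>UNIV. (?q * ?c (x $ k)) *s rd (a_unit k) f a - (?q * (c / (sinh (x $ k))\<^sup>2)) *s f a)"
 proof -
  have "(\<Sum>i\<in>UNIV - range (emb :: 'n \<Rightarrow> 'm). \<Sum>k\<in>UNIV. G i k) =
    (\<Sum>i\<in>UNIV - range (emb :: 'n \<Rightarrow> 'm). \<Sum>k\<in>UNIV. ?c (x $ k) *s rd (a_unit k) f a - (c / (sinh (x $ k))\<^sup>2) *s f a)"
   unfolding G_def by (intro sum.cong refl pair_complement) auto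
  also have "\<dots> = ?q *s (\<Sum>k\<in>UNIV. ?c (x $ k) *s rd (a_unit k) f a - (c / (sinh (x $ k))\<^sup>2) *s f a)"
   unfolding sum_const_vec card_complement ..
  also have "\<dots> = (\<Sum>k\<in>UNIV. (?q * ?c (x $ k)) *s rd (a_unit k) f a - (?q * (c / (sinh (x $ k))\<^sup>2)) *s f a)"
   by (simp add: vec_eq_iff sum_distrib_left right_diff_distrib mult.assoc)
  finally show ?thesis .
 qed
 also have "(\<Sum>i\<in>range (emb :: 'n \<Rightarrow> 'm). \<Sum>k\<in>UNIV. G i k) = (\<Sum>k\<in>UNIV. \<Sum>l\<in>UNIV. pair_term k l)"
 proof -
  have "(\<Sum>i\<in>range (emb :: 'n \<Rightarrow> 'm). \<Sum>k\<in>UNIV. G i k) = (\<Sum>k\<in>UNIV. \<Sum>l\<in>UNIV. G (emb (k::'n)) l)"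
   by (simp add: sum.reindex[OF emb_inj[OF le]] o_def)
  also have "\<dots> = (\<Sum>k\<in>UNIV. \<Sum>l\<in>UNIV. D2 (LR k l) (RL l k)) + (\<Sum>k\<in>UNIV. \<Sum>l\<in>UNIV. D2 (RL l k) (LR k l))"
   by (simp add: G_def sum.distrib)
  also have "(\<Sum>k\<in>UNIV. \<Sum>l\<in>UNIV. D2 (RL l k) (LR k l)) = (\<Sum>k\<in>UNIV. \<Sum>l\<in>UNIV. D2 (RL k l) (LR l k))"
   by (rule sum.swap)
  finally show ?thesis by (simp add: pair_term_def sum.distrib)
 qed
 also have "(\<Sum>k\<in>UNIV. \<Sum>l\<in>UNIV. pair_term k l) = (\<Sum>k\<in>UNIV. pair_term k k) + (\<Sum>k\<in>UNIV. \<Sum>l\<in>UNIV - {k}. pair_term k l)"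
 proof -
  have "(\<Sum>l\<in>UNIV. pair_term k l) = pair_term k k + (\<Sum>l\<in>UNIV - {k}. pair_term k l)" for k
   by (rule sum.remove) auto
  then show ?thesis by (simp add: sum.distrib)
 qed
 also have "(\<Sum>k\<in>UNIV. \<Sum>l\<in>UNIV - {k}. pair_term k l) =
   (\<Sum>k\<in>UNIV. (\<Sum>l\<in>UNIV - {k}. ?c (x $ k - x $ l) + ?c (x $ k + x $ l)) *s rd (a_unit k) f a)
   - (\<Sum>k\<in>UNIV. \<Sum>l\<in>UNIV - {k}. (K / (sinh (x $ k - x $ l))\<^sup>2 + K / (sinh (x $ k + x $ l))\<^sup>2) / 2) *s f a"
 proof -
  define P where "P k l = (?c (x $ k - x $ l) + ?c (x $ k + x $ l)) / 2" for k l
  define N where "N k l = (K / (sinh (x $ k - x $ l))\<^sup>2 + K / (sinh (x $ k + x $ l))\<^sup>2) / 2" for k l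
  have c_odd: "?c (x $ l - x $ k) = - ?c (x $ k - x $ l)" for k l
  proof -
   have "x $ l - x $ k = - (x $ k - x $ l)" by simp
   then show ?thesis by (simp only: sinh_minus cosh_minus divide_minus_right)
  qed
  have "pair_term k l = P k l *s rd (a_unit k) f a + P l k *s rd (a_unit l) f a - N k l *s f a" if "k \<noteq> l" for k l
  proof (rule vec_eq_iff[THEN iffD2], rule allI)
   fix p
   have "2 * pair_term k l $ p = 2 * (P k l *s rd (a_unit k) f a + P l k *s rd (a_unit l) f a - N k l *s f a) $ p"
    using arg_cong[OF pair_term_off[OF that], of "\<lambda>v. v $ p"]
    by (simp add: P_def N_def c_odd[of k l] add.commute[of "x $ l" "x $ k"]) (simp add: algebra_simps)
   then show "pair_term k l $ p = (P k l *s rd (a_unit k) f a + P l k *s rd (a_unit l) f a - N k l *s f a) $ p"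
    by (metis mult_left_cancel zero_neq_numeral)
  qed
  then have "(\<Sum>k\<in>UNIV. \<Sum>l\<in>UNIV - {k}. pair_term k l) =
    (\<Sum>k\<in>UNIV. \<Sum>l\<in>UNIV - {k}. P k l *s rd (a_unit k) f a + P l k *s rd (a_unit l) f a - N k l *s f a)"
   by (intro sum.cong refl) auto
  also have "\<dots> = (\<Sum>k\<in>UNIV. \<Sum>l\<in>UNIV - {k}. P k l *s rd (a_unit k) f a)
    + (\<Sum>k\<in>UNIV. \<Sum>l\<in>UNIV - {k}. P l k *s rd (a_unit l) f a) - (\<Sum>k\<in>UNIV. \<Sum>l\<in>UNIV - {k}. N k l *s f a)"
   by (simp only: sum.distrib sum_subtractf)
  also have "(\<Sum>k\<in>UNIV. \<Sum>l\<in>UNIV - {k}. P l k *s rd (a_unit l) f a) = (\<Sum>l\<in>UNIV. \<Sum>k\<in>UNIV - {l}. P l k *s rd (a_unit l) f a)"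
   by (rule sum_off_diag_swap)
  also have "(\<Sum>k\<in>UNIV. \<Sum>l\<in>UNIV - {k}. P k l *s rd (a_unit k) f a) + (\<Sum>l\<in>UNIV. \<Sum>k\<in>UNIV - {l}. P l k *s rd (a_unit l) f a)
    = (\<Sum>k\<in>UNIV. (\<Sum>l\<in>UNIV - {k}. ?c (x $ k - x $ l) + ?c (x $ k + x $ l)) *s rd (a_unit k) f a)"
   unfolding sum.distrib[symmetric]
   by (simp add: vec_eq_iff P_def sum_distrib_right sum.distrib[symmetric] distrib_right[symmetric])
  also have "(\<Sum>k\<in>UNIV. \<Sum>l\<in>UNIV - {k}. N k l *s f a) = (\<Sum>k\<in>UNIV. \<Sum>l\<in>UNIV - {k}. N k l) *s f a"
   by (simp add: vec_eq_iff sum_distrib_right)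
  finally show ?thesis by (simp add: N_def)
 qed
 also have "(\<Sum>k\<in>UNIV. pair_term k k) = (\<Sum>k\<in>UNIV. (1/2) *s rd (a_unit k) (rd (a_unit k) f) a + ?c (2 * x $ k) *s rd (a_unit k) f a
   - (((tW - tV) - cosh (2 * x $ k) * (of_int \<kappa>1 - of_int \<kappa>2))\<^sup>2 / (sinh (2 * x $ k))\<^sup>2 / 2) *s f a)"
 proof (rule sum.cong[OF refl])
  fix k
  let ?r = "(1/2) *s rd (a_unit k) (rd (a_unit k) f) a + ?c (2 * x $ k) *s rd (a_unit k) f a
    - (((tW - tV) - cosh (2 * x $ k) * (of_int \<kappa>1 - of_int \<kappa>2))\<^sup>2 / (sinh (2 * x $ k))\<^sup>2 / 2) *s f a"
  show "pair_term k k = ?r"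
  proof (rule vec_eq_iff[THEN iffD2], rule allI)
   fix p
   have "2 * pair_term k k $ p = 2 * ?r $ p"
    using arg_cong[OF pair_term_diag[of k], of "\<lambda>v. v $ p"] by (simp add: algebra_simps)
   then show "pair_term k k $ p = ?r $ p" by (metis mult_left_cancel zero_neq_numeral)
  qed
 qed
 finally show ?thesis
  unfolding first_order_def zero_order_def vec_eq_iff
  by (simp add: sum.distrib sum_subtractf sum_distrib_right sum_distrib_left algebra_simps del: sum_divide_distrib)
qed

end

section \<open>Holomorphic functions of several variables\<close>

lemma norm_cvec_smult: "norm (c *s (v::'n::finite cvec)) = cmod c * norm v"
 by (simp add: norm_vec_def norm_mult L2_set_right_distrib)

lemma norm_axis_cvec: "norm (axis i 1 :: 'n::finite cvec) = 1"
 by (simp add: norm_vec_def L2_set_def axis_def if_distrib[of norm] if_distrib[of "\<lambda>x. x\<^sup>2"] cong: if_cong)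

lemma holomorphic_severalI:
 "(\<And>x. x \<in> U \<Longrightarrow> (f has_derivative f' x) (at x)) \<Longrightarrow> (\<And>x c v. x \<in> U \<Longrightarrow> f' x (c *s v) = c * f' x v) \<Longrightarrow>
  holomorphic_several f U"
 unfolding holomorphic_several_def by blast

lemma holo_subset: "holomorphic_several f U \<Longrightarrow> V \<subseteq> U \<Longrightarrow> holomorphic_several f V"
 unfolding holomorphic_several_def by blast

lemma holo_const: "holomorphic_several (\<lambda>x. c) U"
 by (rule holomorphic_severalI[of _ _ "\<lambda>_ _. 0"]) auto

lemma holo_coord: "holomorphic_several (\<lambda>x. x $ i) U"
proof (rule holomorphic_severalI[of _ _ "\<lambda>_ v. v $ i"])
 fix x :: "'a cvec"
 show "((\<lambda>x. x $ i) has_derivative (\<lambda>v. v $ i)) (at x)"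
  by (intro bounded_linear.has_derivative[OF bounded_linear_vec_nth] has_derivative_ident)
qed simp

lemma holo_add:
 assumes "holomorphic_several f U" "holomorphic_several g U"
 shows "holomorphic_several (\<lambda>x. f x + g x) U"
 unfolding holomorphic_several_def
proof
 fix x assume "x \<in> U"
 then obtain f' g' where "(f has_derivative f') (at x)" "(g has_derivative g') (at x)"
  "\<And>c v. f' (c *s v) = c * f' v" "\<And>c v. g' (c *s v) = c * g' v"
  using assms unfolding holomorphic_several_def by blast
 then show "\<exists>f'. ((\<lambda>x. f x + g x) has_derivative f') (at x) \<and> (\<forall>c v. f' (c *s v) = c * f' v)"
  by (intro exI[of _ "\<lambda>v. f' v + g' v"] conjI has_derivative_add) (simp_all add: algebra_simps)
qed

lemma holo_mult:
 assumes "holomorphic_several f U" "holomorphic_several g U"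
 shows "holomorphic_several (\<lambda>x. f x * g x) U"
 unfolding holomorphic_several_def
proof
 fix x assume "x \<in> U"
 then obtain f' g' where "(f has_derivative f') (at x)" "(g has_derivative g') (at x)"
  "\<And>c v. f' (c *s v) = c * f' v" "\<And>c v. g' (c *s v) = c * g' v"
  using assms unfolding holomorphic_several_def by blast
 then show "\<exists>f'. ((\<lambda>x. f x * g x) has_derivative f') (at x) \<and> (\<forall>c v. f' (c *s v) = c * f' v)"
  by (intro exI[of _ "\<lambda>v. f x * g' v + f' v * g x"] conjI has_derivative_mult) (simp_all add: algebra_simps)
qed

lemma holo_compose:
 assumes "holomorphic_several f U" "\<And>x. x \<in> U \<Longrightarrow> F field_differentiable (at (f x))"
 shows "holomorphic_several (\<lambda>x. F (f x)) U"
 unfolding holomorphic_several_def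
proof
 fix x assume x: "x \<in> U"
 then obtain f' where f': "(f has_derivative f') (at x)" "\<And>c v. f' (c *s v) = c * f' v"
  using assms unfolding holomorphic_several_def by blast
 obtain d where "DERIV F (f x) :> d"
  using assms(2)[OF x] by (auto simp: field_differentiable_def)
 then have "((\<lambda>x. F (f x)) has_derivative (\<lambda>v. d * f' v)) (at x)"
  by (intro has_derivative_compose[where g = F and f = f, OF f'(1)]) (simp add: has_field_derivative_def)
 then show "\<exists>f'. ((\<lambda>x. F (f x)) has_derivative f') (at x) \<and> (\<forall>c v. f' (c *s v) = c * f' v)"
  using f'(2) by (intro exI[of _ "\<lambda>v. d * f' v"]) simp
qed

lemma holo_sum:
 "(\<And>i. i \<in> A \<Longrightarrow> holomorphic_several (f i) U) \<Longrightarrow> holomorphic_several (\<lambda>x. \<Sum>i\<in>A. f i x) U"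
 by (induction A rule: infinite_finite_induct)
   (simp_all add: holo_const holo_add)

lemma holo_prod:
 "(\<And>i. i \<in> A \<Longrightarrow> holomorphic_several (f i) U) \<Longrightarrow> holomorphic_several (\<lambda>x. \<Prod>i\<in>A. f i x) U"
 by (induction A rule: infinite_finite_induct)
   (simp_all add: holo_const holo_mult)

lemma holo_power: "holomorphic_several f U \<Longrightarrow> holomorphic_several (\<lambda>x. f x ^ k) U"
 by (induction k) (simp_all add: holo_const holo_mult)

lemma holo_minus: "holomorphic_several f U \<Longrightarrow> holomorphic_several (\<lambda>x. - f x) U"
 using holo_mult[OF holo_const[of "-1"]] by fastforce

lemma holo_diff:
 "holomorphic_several f U \<Longrightarrow> holomorphic_several g U \<Longrightarrow> holomorphic_several (\<lambda>x. f x - g x) U"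
 using holo_add[OF _ holo_minus] by fastforce

lemma holo_inverse:
 "holomorphic_several f U \<Longrightarrow> (\<And>x. x \<in> U \<Longrightarrow> f x \<noteq> 0) \<Longrightarrow> holomorphic_several (\<lambda>x. inverse (f x)) U"
 by (rule holo_compose) (auto intro!: field_differentiable_inverse derivative_intros)

lemma holo_divide:
 "holomorphic_several f U \<Longrightarrow> holomorphic_several g U \<Longrightarrow> (\<And>x. x \<in> U \<Longrightarrow> g x \<noteq> 0) \<Longrightarrow>
  holomorphic_several (\<lambda>x. f x / g x) U"
 unfolding divide_inverse by (intro holo_mult holo_inverse) auto

lemma holo_cong:
 assumes "open U" "\<And>x. x \<in> U \<Longrightarrow> f x = g x" "holomorphic_several f U"
 shows "holomorphic_several g U"
 unfolding holomorphic_several_def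
proof
 fix x assume x: "x \<in> U"
 then obtain f' where f': "(f has_derivative f') (at x)" "\<And>c v. f' (c *s v) = c * f' v"
  using assms(3) unfolding holomorphic_several_def by blast
 have "(g has_derivative f') (at x)"
  by (rule has_derivative_transform_within_open[OF f'(1) assms(1) x assms(2)])
 then show "\<exists>f'. (g has_derivative f') (at x) \<and> (\<forall>c v. f' (c *s v) = c * f' v)"
  using f'(2) by blast
qed

lemma holo_continuous: "holomorphic_several f U \<Longrightarrow> continuous_on U f"
 unfolding holomorphic_several_def
 by (meson continuous_at_imp_continuous_on has_derivative_continuous)

lemma has_derivative_line:
 "((\<lambda>t::complex. x + t *s v) has_derivative (\<lambda>h. h *s v)) (at t)"
proof -
 have "linear (\<lambda>h::complex. h *s v)"
  by (rule linearI) (simp_all add: vec_eq_iff algebra_simps)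
 then have "bounded_linear (\<lambda>h::complex. h *s v)"
  by (rule linear_conv_bounded_linear[THEN iffD1])
 then have "((\<lambda>t::complex. t *s v) has_derivative (\<lambda>h. h *s v)) (at t)"
  by (rule bounded_linear_imp_has_derivative)
 then show ?thesis using has_derivative_add[OF has_derivative_const] by fastforce
qed

lemma partial_eq:
 assumes "DERIV (\<lambda>t. f (x + t *s axis i 1)) 0 :> d"
 shows "partial i f x = d"
 unfolding partial_def using DERIV_imp_deriv[OF assms] .

lemma field_derivative_line:
 fixes x v :: "'n::finite cvec"
 assumes "(f has_derivative f') (at (x + t *s v))" "\<And>c v. f' (c *s v) = c * f' v"
 shows "DERIV (\<lambda>t. f (x + t *s v)) t :> f' v"
proof -
 have "((\<lambda>t. f (x + t *s v)) has_derivative (\<lambda>h. f' (h *s v))) (at t)"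
  by (rule has_derivative_compose[where g = f, OF has_derivative_line[of x v t] assms(1)])
 moreover have "(\<lambda>h. f' (h *s v)) = (*) (f' v)" by (auto simp: assms(2) mult.commute)
 ultimately show ?thesis by (simp add: has_field_derivative_def)
qed

lemma holo_derivative:
 assumes "holomorphic_several f U" "x \<in> U"
 shows "(f has_derivative (\<lambda>v. \<Sum>i\<in>UNIV. v $ i * partial i f x)) (at x)"
proof -
 obtain f' where f': "(f has_derivative f') (at x)" "\<And>c v. f' (c *s v) = c * f' v"
  using assms unfolding holomorphic_several_def by blast
 have p: "partial i f x = f' (axis i 1)" for i
  using field_derivative_line[of f f' x 0 "axis i 1"] f' by (intro partial_eq) auto
 have "f' v = (\<Sum>i\<in>UNIV. v $ i * partial i f x)" for v
 proof -
  have lin: "linear f'" using f'(1) has_derivative_linear by blast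
  have "v = (\<Sum>i\<in>UNIV. v $ i *s axis i 1)"
   by (simp add: vec_eq_iff axis_def if_distrib cong: if_cong)
  then have "f' v = f' (\<Sum>i\<in>UNIV. v $ i *s axis i 1)" by simp
  also have "\<dots> = (\<Sum>i\<in>UNIV. f' (v $ i *s axis i 1))"
   using lin by (rule linear_sum)
  finally show ?thesis by (simp add: f'(2) p)
 qed
 then have "f' = (\<lambda>v. \<Sum>i\<in>UNIV. v $ i * partial i f x)" by auto
 then show ?thesis using f' by simp
qed

lemma holo_line:
 assumes "holomorphic_several f U" "x + t *s v \<in> U"
 shows "DERIV (\<lambda>t. f (x + t *s v)) t :> (\<Sum>i\<in>UNIV. v $ i * partial i f (x + t *s v))"
 by (rule field_derivative_line[OF holo_derivative[OF assms]])
   (simp add: sum_distrib_left mult.assoc)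

lemma partial_has_field_derivative:
 assumes "holomorphic_several f U" "x \<in> U"
 shows "DERIV (\<lambda>t. f (x + t *s axis i 1)) 0 :> partial i f x"
proof -
 have "(\<Sum>k\<in>UNIV. axis i 1 $ k * partial k f x) = (\<Sum>k\<in>UNIV. if k = i then partial k f x else 0)"
  by (rule sum.cong) (auto simp: axis_def)
 then show ?thesis
  using holo_line[of f U x 0 "axis i 1"] assms by simp
qed

lemma partial_cong:
 assumes "open U" "x \<in> U" "\<And>y. y \<in> U \<Longrightarrow> f y = g y"
 shows "partial i f x = partial i g x"
 unfolding partial_def
proof (rule deriv_cong_ev)
 have "((\<lambda>t::complex. x + t *s axis i 1) \<longlongrightarrow> x + 0 *s axis i 1) (nhds 0)"
  using has_derivative_continuous[OF has_derivative_line[of x "axis i 1" 0]]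
  using tendsto_at_iff_tendsto_nhds[of "\<lambda>t::complex. x + t *s axis i 1" 0]
  by (simp add: continuous_within)
 then have "\<forall>\<^sub>F t in nhds 0. x + t *s axis i 1 \<in> U"
  using assms(1,2) by (intro topological_tendstoD) auto
 then show "\<forall>\<^sub>F t in nhds 0. f (x + t *s axis i 1) = g (x + t *s axis i 1)"
  by (rule eventually_mono) (rule assms(3))
qed simp

text \<open>
  Cauchy's formula for the derivative on a circle in one coordinate.
\<close>

lemma partial_cauchy:
 assumes hol: "holomorphic_several f U" and r: "r > 0" and sub: "cball y r \<subseteq> U"
 shows "partial i f y = integral (cbox 0 1)
   (\<lambda>t::real. f (y + (r * exp (2 * of_real pi * \<i> * t)) *s axis i 1) / (r * exp (2 * of_real pi * \<i> * t)))"
proof -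
 let ?h = "\<lambda>u::complex. f (y + u *s axis i 1)"
 have mem: "y + u *s axis i 1 \<in> U" if "u \<in> cball 0 r" for u
  using that sub by (auto simp: subset_iff dist_norm norm_cvec_smult norm_axis_cvec)
 have der: "DERIV ?h u :> (\<Sum>k\<in>UNIV. axis i 1 $ k * partial k f (y + u *s axis i 1))"
  if "u \<in> cball 0 r" for u
  by (rule holo_line[OF hol mem[OF that]])
 have hol1: "?h holomorphic_on cball 0 r"
  unfolding holomorphic_on_def using der
  by (meson field_differentiable_at_within field_differentiable_def)
 have "contour_integral (circlepath 0 r) (\<lambda>u. ?h u / (u - 0)^2) = (2 * pi * \<i>) * deriv ?h 0"
  using hol1 r by (intro Cauchy_contour_integral_circlepath_2)
   (auto intro: holomorphic_on_imp_continuous_on holomorphic_on_subset)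
 then have "partial i f y = contour_integral (circlepath 0 r) (\<lambda>u. ?h u / u^2) / (2 * pi * \<i>)"
  by (simp add: partial_def)
 also have "contour_integral (circlepath 0 r) (\<lambda>u. ?h u / u^2) =
   integral {0..1} (\<lambda>t::real. (2 * pi * \<i>) * (?h (r * exp (2 * of_real pi * \<i> * t)) / (r * exp (2 * of_real pi * \<i> * t))))"
  unfolding contour_integral_integral
 proof (rule Henstock_Kurzweil_Integration.integral_cong)
  fix t :: real assume "t \<in> {0..1}"
  then have v: "vector_derivative (circlepath 0 r) (at t) =
    2 * pi * \<i> * r * exp (2 * of_real pi * \<i> * t)"
   by (simp add: vector_derivative_circlepath)
  show "?h (circlepath 0 r t) / (circlepath 0 r t)\<^sup>2 * vector_derivative (circlepath 0 r) (at t) =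
    (2 * pi * \<i>) * (?h (r * exp (2 * of_real pi * \<i> * t)) / (r * exp (2 * of_real pi * \<i> * t)))"
   unfolding v using r by (simp add: circlepath power2_eq_square)
 qed
 also have "\<dots> = (2 * pi * \<i>) * integral {0..1} (\<lambda>t::real. ?h (r * exp (2 * of_real pi * \<i> * t)) / (r * exp (2 * of_real pi * \<i> * t)))"
  by (rule integral_mult_right)
 finally show ?thesis by simp
qed

lemma circle_continuous:
 assumes f: "continuous_on U f" and r: "r > 0" and sub: "cball x (2 * r) \<subseteq> U"
 shows "continuous_on (ball x r \<times> cbox 0 1)
   (\<lambda>(y, t::real). f (y + (r * exp (2 * of_real pi * \<i> * t)) *s axis i 1) / (r * exp (2 * of_real pi * \<i> * t)))"
proof -
 have mem: "y + (r * exp (2 * of_real pi * \<i> * of_real t)) *s axis i 1 \<in> U" if "y \<in> ball x r" for y and t :: real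
 proof -
  have "dist x (y + (r * exp (2 * of_real pi * \<i> * of_real t)) *s axis i 1) \<le>
    dist x y + norm ((r * exp (2 * of_real pi * \<i> * of_real t)) *s axis i 1 :: 'a cvec)"
   by (metis add_diff_cancel_left' dist_norm dist_triangle norm_minus_commute)
  also have "\<dots> < r + r" using that r
   by (simp add: norm_cvec_smult norm_axis_cvec norm_mult norm_exp_eq_Re del: of_real_mult)
  finally show ?thesis using sub by (auto simp: subset_iff)
 qed
 have "continuous_on (ball x r \<times> cbox 0 1)
   (\<lambda>p::'a cvec \<times> real. fst p + (r * exp (2 * of_real pi * \<i> * snd p)) *s axis i 1)"
  unfolding vector_scalar_mult_def by (intro continuous_intros)
 then have "continuous_on (ball x r \<times> cbox 0 1)
   (\<lambda>p::'a cvec \<times> real. f (fst p + (r * exp (2 * of_real pi * \<i> * snd p)) *s axis i 1))"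
  by (rule continuous_on_compose2[OF f]) (use mem in auto)
 then have "continuous_on (ball x r \<times> cbox 0 1)
   (\<lambda>p::'a cvec \<times> real. f (fst p + (r * exp (2 * of_real pi * \<i> * snd p)) *s axis i 1) / (r * exp (2 * of_real pi * \<i> * snd p)))"
  by (rule continuous_on_divide) (use r in \<open>auto intro!: continuous_intros\<close>)
 then show ?thesis by (simp add: case_prod_beta)
qed

lemma partial_continuous:
 assumes hol: "holomorphic_several f U" and U: "open U"
 shows "continuous_on U (partial i f)"
proof (subst continuous_on_eq_continuous_at[OF U], rule ballI)
 fix x assume "x \<in> U"
 then obtain e where e: "e > 0" "cball x e \<subseteq> U" using U open_contains_cball by blast
 define r where "r = e / 2"
 have r: "r > 0" "cball x (2 * r) \<subseteq> U" using e by (auto simp: r_def)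
 have c: "continuous_on (ball x r) (\<lambda>y. integral (cbox 0 1)
   (\<lambda>t::real. f (y + (r * exp (2 * of_real pi * \<i> * t)) *s axis i 1) / (r * exp (2 * of_real pi * \<i> * t))))"
  by (rule integral_continuous_on_param[OF circle_continuous[OF holo_continuous[OF hol] r]])
 have eq: "partial i f y = integral (cbox 0 1)
   (\<lambda>t::real. f (y + (r * exp (2 * of_real pi * \<i> * t)) *s axis i 1) / (r * exp (2 * of_real pi * \<i> * t)))"
  if "y \<in> ball x r" for y
 proof (rule partial_cauchy[OF hol r(1)])
  show "cball y r \<subseteq> U" using that r(2)
   by (intro order_trans[OF cball_subset_cball_iff[THEN iffD2] r(2)]) (auto simp: dist_commute)
 qed
 have "continuous_on (ball x r) (partial i f)"
  by (rule continuous_on_eq[OF c]) (rule eq[symmetric])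
 then show "continuous (at x) (partial i f)"
  using r(1) by (simp add: continuous_on_eq_continuous_at)
qed

text \<open>
  Differentiation under Cauchy's integral: \<open>partial i f\<close> is an integral of f over
  circles of a fixed radius, and the integrand is complex differentiable in the centre with a
  derivative that is continuous in all variables.
\<close>

lemma partial_holomorphic:
 assumes hol: "holomorphic_several f U" and U: "open U"
 shows "holomorphic_several (partial i f) U"
 unfolding holomorphic_several_def
proof
 fix x assume "x \<in> U"
 then obtain e where e: "e > 0" "cball x e \<subseteq> U" using U open_contains_cball by blast
 define r where "r = e / 2"
 have r: "r > 0" "cball x (2 * r) \<subseteq> U" using e by (auto simp: r_def)
 define \<gamma> where "\<gamma> t = r * exp (2 * of_real pi * \<i> * of_real t)" for t :: real
 define c where "c j y t = partial j f (y + \<gamma> t *s axis i 1) / \<gamma> t" for j and y :: "'a cvec" and t :: real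
 define L where "L y t v = (\<Sum>j\<in>UNIV. v $ j * c j y t)" for y t and v :: "'a cvec"
 define fx where "fx y t = Blinfun (L y t)" for y t
 have bl: "bounded_linear (L y t)" for y t
  unfolding L_def
  by (intro bounded_linear_sum bounded_linear_mult_const bounded_linear_vec_nth)
 have fx: "blinfun_apply (fx y t) = L y t" for y t
  unfolding fx_def by (rule bounded_linear_Blinfun_apply[OF bl])
 have mem: "y + \<gamma> t *s axis i 1 \<in> U" if "y \<in> ball x r" for y and t :: real
 proof -
  have "dist x (y + \<gamma> t *s axis i 1) \<le> dist x y + norm (\<gamma> t *s axis i 1 :: 'a cvec)"
   by (metis add_diff_cancel_left' dist_norm dist_triangle norm_minus_commute)
  also have "\<dots> < r + r" using that r
   by (simp add: \<gamma>_def norm_cvec_smult norm_axis_cvec norm_mult norm_exp_eq_Re del: of_real_mult)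
  finally show ?thesis using r(2) by (auto simp: subset_iff)
 qed
 have cc: "continuous_on (ball x r \<times> cbox 0 1) (\<lambda>(y, t). c j y t)" for j
  unfolding c_def \<gamma>_def by (rule circle_continuous[OF partial_continuous[OF hol U] r])
 have cont: "continuous_on (ball x r \<times> cbox 0 1) (\<lambda>(y, t). fx y t)"
 proof (rule continuous_on_blinfun_componentwise)
  fix b :: "'a cvec" assume "b \<in> Basis"
  have "continuous_on (ball x r \<times> cbox 0 1) (\<lambda>p. \<Sum>j\<in>UNIV. b $ j * (case p of (y, t) \<Rightarrow> c j y t))"
   by (intro continuous_intros cc)
  then show "continuous_on (ball x r \<times> cbox 0 1) (\<lambda>p. blinfun_apply (case p of (y, t) \<Rightarrow> fx y t) b)"
   by (simp add: case_prod_beta fx L_def)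
 qed
 let ?F = "\<lambda>y t. f (y + \<gamma> t *s axis i 1) / \<gamma> t"
 have \<gamma>0: "\<gamma> t \<noteq> 0" for t using r by (simp add: \<gamma>_def)
 have der: "((\<lambda>y. ?F y t) has_derivative blinfun_apply (fx y t)) (at y within ball x r)" if "y \<in> ball x r" for y t
 proof -
  have "((\<lambda>y. f (y + \<gamma> t *s axis i 1)) has_derivative
    (\<lambda>v. \<Sum>j\<in>UNIV. v $ j * partial j f (y + \<gamma> t *s axis i 1))) (at y)"
   by (rule has_derivative_compose[where g = f and f = "\<lambda>y. y + \<gamma> t *s axis i 1",
      OF _ holo_derivative[OF hol mem[OF that, of t]]])
     (auto intro!: derivative_eq_intros)
  then have "((\<lambda>y. f (y + \<gamma> t *s axis i 1) * inverse (\<gamma> t)) has_derivative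
    (\<lambda>v. (\<Sum>j\<in>UNIV. v $ j * partial j f (y + \<gamma> t *s axis i 1)) * inverse (\<gamma> t))) (at y)"
   by (rule has_derivative_mult_left)
  moreover have "(\<lambda>v. (\<Sum>j\<in>UNIV. v $ j * partial j f (y + \<gamma> t *s axis i 1)) * inverse (\<gamma> t)) = L y t"
   by (auto simp: L_def c_def fun_eq_iff sum_distrib_right divide_inverse mult.assoc)
  ultimately show ?thesis
   unfolding fx divide_inverse by (auto intro: has_derivative_at_withinI)
 qed
 have contF: "continuous_on (ball x r \<times> cbox 0 1) (\<lambda>(y, t). ?F y t)"
  unfolding \<gamma>_def by (rule circle_continuous[OF holo_continuous[OF hol] r])
 have int: "?F y integrable_on cbox 0 1" if "y \<in> ball x r" for y
 proof (rule integrable_continuous)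
  have "continuous_on (cbox 0 1) (\<lambda>t. case (y, t) of (y, t) \<Rightarrow> ?F y t)"
   by (rule continuous_on_compose2[OF contF, of _ "\<lambda>t. (y, t)"]) (use that in \<open>auto intro!: continuous_intros\<close>)
  then show "continuous_on (cbox 0 1) (?F y)" by simp
 qed
 have fxint: "fx x integrable_on cbox 0 1"
 proof (rule integrable_continuous)
  have "continuous_on (cbox 0 1) (\<lambda>t. case (x, t) of (y, t) \<Rightarrow> fx y t)"
   by (rule continuous_on_compose2[OF cont, of _ "\<lambda>t. (x, t)"]) (use r in \<open>auto intro!: continuous_intros\<close>)
  then show "continuous_on (cbox 0 1) (fx x)" by simp
 qed
 have "((\<lambda>y. integral (cbox 0 1) (?F y)) has_derivative integral (cbox 0 1) (fx x)) (at x within ball x r)"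
  by (rule leibniz_rule[OF der int cont]) (use r in auto)
 then have d1: "((\<lambda>y. integral (cbox 0 1) (?F y)) has_derivative integral (cbox 0 1) (fx x)) (at x)"
  using r by (simp add: at_within_open[of x "ball x r"])
 have eq: "integral (cbox 0 1) (?F y) = partial i f y" if "y \<in> ball x r" for y
  unfolding \<gamma>_def
 proof (rule partial_cauchy[OF hol r(1), symmetric])
  show "cball y r \<subseteq> U" using that r(2)
   by (intro order_trans[OF cball_subset_cball_iff[THEN iffD2] r(2)]) (auto simp: dist_commute)
 qed
 have d2: "(partial i f has_derivative integral (cbox 0 1) (fx x)) (at x)"
  by (rule has_derivative_transform_within_open[OF d1, of "ball x r"]) (use r eq in auto)
 moreover have "blinfun_apply (integral (cbox 0 1) (fx x)) (a *s v) =
   a * blinfun_apply (integral (cbox 0 1) (fx x)) v" for a v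
 proof -
  have "L x t (a *s v) = a * L x t v" for t
   by (simp add: L_def sum_distrib_left mult.assoc)
  then show ?thesis unfolding blinfun_apply_integral[OF fxint] fx by simp
 qed
 ultimately show "\<exists>f'. (partial i f has_derivative f') (at x) \<and> (\<forall>c v. f' (c *s v) = c * f' v)"
  by blast
qed

lemma foldr_partial_holomorphic:
 "holomorphic_several f U \<Longrightarrow> open U \<Longrightarrow> holomorphic_several (foldr partial I f) U"
 by (induction I) (auto intro: partial_holomorphic)

lemma partial_diff:
 assumes "holomorphic_several f U" "holomorphic_several g U" "x \<in> U"
 shows "partial i (\<lambda>y. f y - g y) x = partial i f x - partial i g x"
 by (rule partial_eq) (intro derivative_intros partial_has_field_derivative[OF _ assms(3)] assms)

lemma foldr_partial_diff:
 assumes "holomorphic_several f U" "holomorphic_several g U" "open U" "x \<in> U"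
 shows "foldr partial I (\<lambda>y. f y - g y) x = foldr partial I f x - foldr partial I g x"
 using assms(4)
proof (induction I arbitrary: x)
 case (Cons i I)
 have "partial i (foldr partial I (\<lambda>y. f y - g y)) x = partial i (\<lambda>y. foldr partial I f y - foldr partial I g y) x"
  by (rule partial_cong[OF assms(3) Cons(2) Cons(1)])
 then show ?case
  using partial_diff[OF foldr_partial_holomorphic[OF assms(1,3)] foldr_partial_holomorphic[OF assms(2,3)] Cons(2)]
  by simp
qed simp

section \<open>Taylor expansions and order of vanishing\<close>

definition words :: "nat \<Rightarrow> 'a list set" where
 "words k = {I. length I = k}"

lemma words_0: "words 0 = {[]}" by (auto simp: words_def)

lemma sum_words_Suc:
 fixes h :: "'a::finite list \<Rightarrow> 'b::comm_monoid_add"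
 shows "(\<Sum>J\<in>words (Suc k). h J) = (\<Sum>I\<in>words k. \<Sum>i\<in>UNIV. h (i # I))"
proof -
 have eq: "words (Suc k) = (\<lambda>(I, i). i # I) ` (words k \<times> (UNIV :: 'a set))"
  by (auto simp: words_def length_Suc_conv image_iff)
 have "inj_on (\<lambda>(I, i). i # I) (words k \<times> (UNIV :: 'a set))"
  by (auto simp: inj_on_def)
 then have "(\<Sum>J\<in>words (Suc k). h J) = (\<Sum>(I, i)\<in>words k \<times> UNIV. h (i # I))"
  unfolding eq by (subst sum.reindex) (auto simp: case_prod_beta o_def)
 then show ?thesis by (simp add: sum.cartesian_product)
qed

definition word_power :: "'n::finite cvec \<Rightarrow> 'n list \<Rightarrow> complex" where
 "word_power v I = prod_list (map (($) v) I)"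

lemma norm_word_power_le: "cmod (word_power v I) \<le> norm v ^ length I"
proof (induction I)
 case (Cons i I)
 have "cmod (v $ i) \<le> norm v" by (rule Finite_Cartesian_Product.norm_nth_le)
 with Cons show ?case by (auto simp: word_power_def norm_mult intro!: mult_mono)
qed (simp add: word_power_def)

text \<open>
  Derivatives are indexed by words rather than by multi-indices. The sum over all words of length k
  repeats each multi-index as often as its multinomial coefficient, which makes
  \<open>1 / fact k\<close> the right factor and avoids commuting partial derivatives.
\<close>

definition taylor_term :: "nat \<Rightarrow> ('n::finite cvec \<Rightarrow> complex) \<Rightarrow> 'n cvec \<Rightarrow> 'n cvec \<Rightarrow> complex" where
 "taylor_term k f x v = (\<Sum>I\<in>words k. word_power v I * foldr partial I f x)"

lemma taylor_term_derivative:
 assumes hol: "holomorphic_several f U" and U: "open U" and x: "x + t *s v \<in> U"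
 shows "DERIV (\<lambda>t. taylor_term k f (x + t *s v) v) t :> taylor_term (Suc k) f (x + t *s v) v"
proof -
 have "DERIV (\<lambda>t. foldr partial I f (x + t *s v)) t :> (\<Sum>i\<in>UNIV. v $ i * partial i (foldr partial I f) (x + t *s v))" for I
  by (rule holo_line[OF foldr_partial_holomorphic[OF hol U] x])
 then have "DERIV (\<lambda>t. taylor_term k f (x + t *s v) v) t :> (\<Sum>I\<in>words k. word_power v I * (\<Sum>i\<in>UNIV. v $ i * partial i (foldr partial I f) (x + t *s v)))"
  unfolding taylor_term_def by (intro DERIV_sum DERIV_cmult)
 moreover have "(\<Sum>I\<in>words k. word_power v I * (\<Sum>i\<in>UNIV. v $ i * partial i (foldr partial I f) (x + t *s v)))
   = taylor_term (Suc k) f (x + t *s v) v"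
  by (simp add: taylor_term_def sum_words_Suc sum_distrib_left word_power_def mult_ac)
 ultimately show ?thesis by simp
qed

definition vanish_order :: "'n::finite cvec \<Rightarrow> nat \<Rightarrow> ('n cvec \<Rightarrow> complex) \<Rightarrow> bool" where
 "vanish_order x k g \<longleftrightarrow> (\<exists>r>0. \<exists>C\<ge>0. \<forall>y\<in>ball x r. cmod (g y) \<le> C * norm (y - x) ^ k)"

lemma vanish_orderI:
 assumes "r > 0" "\<And>y. y \<in> ball x r \<Longrightarrow> cmod (g y) \<le> C * norm (y - x) ^ k"
 shows "vanish_order x k g"
 unfolding vanish_order_def
proof (rule exI[of _ r], rule conjI[OF assms(1)], rule exI[of _ "\<bar>C\<bar>"], rule conjI, simp, rule ballI)
 fix y assume "y \<in> ball x r"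
 then have "cmod (g y) \<le> C * norm (y - x) ^ k" by (rule assms(2))
 also have "\<dots> \<le> \<bar>C\<bar> * norm (y - x) ^ k" by (intro mult_right_mono) auto
 finally show "cmod (g y) \<le> \<bar>C\<bar> * norm (y - x) ^ k" .
qed

text \<open>
  Taylor's formula on each complex line through x, with a bound for the derivatives that is uniform
  in the direction.
\<close>

lemma taylor_vanish:
 assumes hol: "holomorphic_several f U" and U: "open U" and x: "x \<in> U"
 shows "vanish_order x (Suc n) (\<lambda>y. f y - (\<Sum>k\<le>n. taylor_term k f x (y - x) / fact k))"
proof -
 obtain R where R: "R > 0" "cball x R \<subseteq> U" using U x open_contains_cball by blast
 have "\<exists>M. \<forall>y\<in>cball x R. cmod (foldr partial I f y) \<le> M" for I
 proof -
  have "compact (foldr partial I f ` cball x R)"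
   by (intro compact_continuous_image continuous_on_subset[OF holo_continuous[OF
      foldr_partial_holomorphic[OF hol U]] R(2)] compact_cball)
  then show ?thesis by (meson bounded_iff compact_imp_bounded imageI)
 qed
 then obtain M where M: "\<And>I y. y \<in> cball x R \<Longrightarrow> cmod (foldr partial I f y) \<le> M I" by metis
 define C where "C = (\<Sum>I\<in>words (Suc n). M I) / fact n"
 show ?thesis
 proof (rule vanish_orderI[OF R(1)])
  fix y assume y: "y \<in> ball x R"
  define v where "v = y - x"
  have seg: "x + t *s v \<in> cball x R" if "t \<in> cball 0 1" for t :: complex
  proof -
   have "norm (t *s v) \<le> 1 * norm v"
    unfolding norm_cvec_smult using that by (intro mult_right_mono) auto
   then show ?thesis using y by (simp add: v_def dist_norm norm_minus_commute)
  qed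
  have "cmod (taylor_term 0 f (x + 1 *s v) v -
    (\<Sum>i\<le>n. taylor_term i f (x + 0 *s v) v * (1 - 0) ^ i / fact i))
    \<le> ((\<Sum>I\<in>words (Suc n). M I) * norm v ^ Suc n) * cmod (1 - 0) ^ Suc n / fact n"
  proof (rule complex_Taylor[of "cball 0 1" n "\<lambda>i t. taylor_term i f (x + t *s v) v"
     "(\<Sum>I\<in>words (Suc n). M I) * norm v ^ Suc n" 0 1])
   show "convex (cball (0::complex) 1)" "0 \<in> cball (0::complex) 1" "1 \<in> cball (0::complex) 1" by simp_all
   fix t :: complex assume t: "t \<in> cball 0 1"
   show "cmod (taylor_term (Suc n) f (x + t *s v) v) \<le> (\<Sum>I\<in>words (Suc n). M I) * norm v ^ Suc n"
    unfolding taylor_term_def sum_distrib_right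
   proof (rule sum_norm_le)
    fix I :: "'a list" assume I: "I \<in> words (Suc n)"
    have "cmod (word_power v I) \<le> norm v ^ Suc n"
     using norm_word_power_le[of v I] I by (simp add: words_def)
    then have "cmod (word_power v I) * cmod (foldr partial I f (x + t *s v)) \<le> norm v ^ Suc n * M I"
     using M[OF seg[OF t], of I] by (intro mult_mono) auto
    then show "cmod (word_power v I * foldr partial I f (x + t *s v)) \<le> M I * norm v ^ Suc n"
     by (simp add: norm_mult mult.commute)
   qed
  next
   fix i t assume "t \<in> cball (0::complex) 1"
   then show "((\<lambda>t. taylor_term i f (x + t *s v) v) has_field_derivative
     taylor_term (Suc i) f (x + t *s v) v) (at t within cball 0 1)"
    using seg R(2) by (intro has_field_derivative_at_within[OF taylor_term_derivative[OF hol U]]) auto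
  qed
  then show "cmod (f y - (\<Sum>k\<le>n. taylor_term k f x (y - x) / fact k)) \<le> C * norm (y - x) ^ Suc n"
   by (simp add: C_def v_def taylor_term_def[of 0] words_0 word_power_def)
 qed
qed

lemma vanish_orderE:
 assumes "vanish_order x k g" "open U" "x \<in> U"
 obtains r C where "r > 0" "C \<ge> 0" "ball x r \<subseteq> U" "\<And>y. y \<in> ball x r \<Longrightarrow> cmod (g y) \<le> C * norm (y - x) ^ k"
proof -
 obtain r C where rC: "r > 0" "C \<ge> 0" "\<And>y. y \<in> ball x r \<Longrightarrow> cmod (g y) \<le> C * norm (y - x) ^ k"
  using assms(1) unfolding vanish_order_def by blast
 obtain s where s: "s > 0" "ball x s \<subseteq> U" using assms(2,3) openE by blast
 show ?thesis
  by (rule that[of "min r s" C]) (use rC s in auto)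
qed

lemma vanish_order_add:
 assumes "vanish_order x k f" "vanish_order x k g" shows "vanish_order x k (\<lambda>y. f y + g y)"
proof -
 obtain r C where 1: "r > 0" "C \<ge> 0" "\<And>y. y \<in> ball x r \<Longrightarrow> cmod (f y) \<le> C * norm (y - x) ^ k"
  by (rule vanish_orderE[OF assms(1), of UNIV]) auto
 obtain s D where 2: "s > 0" "D \<ge> 0" "\<And>y. y \<in> ball x s \<Longrightarrow> cmod (g y) \<le> D * norm (y - x) ^ k"
  by (rule vanish_orderE[OF assms(2), of UNIV]) auto
 show ?thesis
 proof (rule vanish_orderI[of "min r s" _ _ "C + D"])
  fix y assume "y \<in> ball x (min r s)"
  then have "cmod (f y) \<le> C * norm (y - x) ^ k" "cmod (g y) \<le> D * norm (y - x) ^ k"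
   using 1 2 by auto
  then show "cmod (f y + g y) \<le> (C + D) * norm (y - x) ^ k"
   using norm_triangle_ineq[of "f y" "g y"] by (simp add: algebra_simps)
 qed (use 1 2 in auto)
qed

lemma vanish_order_mult:
 assumes "vanish_order x k f" "vanish_order x l g" shows "vanish_order x (k + l) (\<lambda>y. f y * g y)"
proof -
 obtain r C where 1: "r > 0" "C \<ge> 0" "\<And>y. y \<in> ball x r \<Longrightarrow> cmod (f y) \<le> C * norm (y - x) ^ k"
  by (rule vanish_orderE[OF assms(1), of UNIV]) auto
 obtain s D where 2: "s > 0" "D \<ge> 0" "\<And>y. y \<in> ball x s \<Longrightarrow> cmod (g y) \<le> D * norm (y - x) ^ l"
  by (rule vanish_orderE[OF assms(2), of UNIV]) auto
 show ?thesis
 proof (rule vanish_orderI[of "min r s" _ _ "C * D"])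
  fix y assume "y \<in> ball x (min r s)"
  then have "cmod (f y) \<le> C * norm (y - x) ^ k" "cmod (g y) \<le> D * norm (y - x) ^ l"
   using 1 2 by auto
  then have "cmod (f y) * cmod (g y) \<le> (C * norm (y - x) ^ k) * (D * norm (y - x) ^ l)"
   using 1 by (intro mult_mono) auto
  then show "cmod (f y * g y) \<le> (C * D) * norm (y - x) ^ (k + l)"
   by (simp add: norm_mult power_add mult_ac)
 qed (use 1 2 in auto)
qed

lemma vanish_order_0: assumes "holomorphic_several f U" "open U" "x \<in> U" shows "vanish_order x 0 f"
proof -
 obtain R where R: "R > 0" "cball x R \<subseteq> U" using assms open_contains_cball by blast
 have "compact (f ` cball x R)"
  by (intro compact_continuous_image continuous_on_subset[OF holo_continuous[OF assms(1)] R(2)] compact_cball)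
 then obtain M where "\<forall>y\<in>cball x R. cmod (f y) \<le> M" by (meson bounded_iff compact_imp_bounded imageI)
 then show ?thesis by (intro vanish_orderI[OF R(1), of _ _ M]) auto
qed

lemma vanish_order_zero: "vanish_order x k (\<lambda>y. 0)"
 by (rule vanish_orderI[of 1 _ _ 0]) auto

lemma vanish_order_const: "vanish_order x 0 (\<lambda>y. c)"
 by (rule vanish_orderI[of 1 _ _ "cmod c"]) auto

lemma vanish_order_mono: assumes "vanish_order x k f" "l \<le> k" shows "vanish_order x l f"
proof -
 obtain r C where 1: "r > 0" "C \<ge> 0" "\<And>y. y \<in> ball x r \<Longrightarrow> cmod (f y) \<le> C * norm (y - x) ^ k"
  by (rule vanish_orderE[OF assms(1), of UNIV]) auto
 show ?thesis
 proof (rule vanish_orderI[of "min r 1" _ _ C])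
  fix y assume y: "y \<in> ball x (min r 1)"
  then have "cmod (f y) \<le> C * norm (y - x) ^ k" using 1 by auto
  also have "\<dots> \<le> C * norm (y - x) ^ l"
   using y 1 assms(2) by (intro mult_left_mono power_decreasing) (auto simp: dist_norm norm_minus_commute)
  finally show "cmod (f y) \<le> C * norm (y - x) ^ l" .
 qed (use 1 in auto)
qed

lemma vanish_order_mult_0:
 "vanish_order x 0 f \<Longrightarrow> vanish_order x k g \<Longrightarrow> vanish_order x k (\<lambda>y. f y * g y)"
 "vanish_order x k f \<Longrightarrow> vanish_order x 0 g \<Longrightarrow> vanish_order x k (\<lambda>y. f y * g y)"
 using vanish_order_mult[of x 0 f k g] vanish_order_mult[of x k f 0 g] by simp_all

lemma vanish_order_sum:
 "(\<And>i. i \<in> A \<Longrightarrow> vanish_order x k (f i)) \<Longrightarrow> vanish_order x k (\<lambda>y. \<Sum>i\<in>A. f i y)"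
 by (induction A rule: infinite_finite_induct) (simp_all add: vanish_order_zero vanish_order_add)

lemma vanish_order_minus: "vanish_order x k f \<Longrightarrow> vanish_order x k (\<lambda>y. - f y)"
 unfolding vanish_order_def by simp

lemma vanish_order_diff:
 "vanish_order x k f \<Longrightarrow> vanish_order x k g \<Longrightarrow> vanish_order x k (\<lambda>y. f y - g y)"
 using vanish_order_add[OF _ vanish_order_minus, of x k f g] by simp

text \<open>
  Cauchy's inequality on a circle around y of radius \<open>norm (y - x)\<close>; at
  \<open>y = x\<close> by continuity.
\<close>

lemma vanish_order_partial:
 assumes hol: "holomorphic_several f U" and U: "open U" "x \<in> U" and v: "vanish_order x (Suc k) f"
 shows "vanish_order x k (partial i f)"
proof -
 obtain r C where rC: "r > 0" "C \<ge> 0" "ball x r \<subseteq> U" "\<And>y. y \<in> ball x r \<Longrightarrow> cmod (f y) \<le> C * norm (y - x) ^ Suc k"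
  using vanish_orderE[OF v U] by metis
 have off: "cmod (partial i f y) \<le> (C * 2 ^ Suc k) * norm (y - x) ^ k" if y: "y \<in> ball x (r / 2)" "y \<noteq> x" for y
 proof -
  define \<delta> where "\<delta> = norm (y - x)"
  have \<delta>: "\<delta> > 0" "2 * \<delta> < r" using y by (auto simp: \<delta>_def dist_norm norm_minus_commute)
  let ?h = "\<lambda>u::complex. f (y + u *s axis i 1)"
  have near: "norm (y + u *s axis i 1 - x) \<le> 2 * \<delta>" if "u \<in> cball 0 \<delta>" for u
   using that norm_triangle_ineq[of "y - x" "u *s axis i 1"]
   by (simp add: \<delta>_def norm_cvec_smult norm_axis_cvec algebra_simps)
  have mem: "y + u *s axis i 1 \<in> ball x r" if "u \<in> cball 0 \<delta>" for u
   using near[OF that] \<delta> by (simp add: dist_norm norm_minus_commute)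
  have "?h field_differentiable (at u)" if "u \<in> cball 0 \<delta>" for u
   using holo_line[OF hol subsetD[OF rC(3) mem[OF that]]]
   unfolding field_differentiable_def by blast
  then have hol1: "?h holomorphic_on cball 0 \<delta>"
   unfolding holomorphic_on_def by (auto intro: field_differentiable_at_within)
  have "norm ((deriv ^^ 1) ?h 0) \<le> fact 1 * (C * (2 * \<delta>) ^ Suc k) / \<delta> ^ 1"
  proof (rule Cauchy_inequality)
   fix u :: complex assume "norm (0 - u) = \<delta>"
   then have u: "u \<in> cball 0 \<delta>" by simp
   have "cmod (?h u) \<le> C * norm (y + u *s axis i 1 - x) ^ Suc k" by (rule rC(4)[OF mem[OF u]])
   also have "\<dots> \<le> C * (2 * \<delta>) ^ Suc k"
    using near[OF u] rC(2) by (intro mult_left_mono power_mono) auto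
   finally show "cmod (?h u) \<le> C * (2 * \<delta>) ^ Suc k" .
  qed (use \<delta> hol1 in \<open>auto intro: holomorphic_on_imp_continuous_on holomorphic_on_subset\<close>)
  then have "cmod (partial i f y) \<le> C * (2 * \<delta>) ^ Suc k / \<delta>" by (simp add: partial_def)
  also have "\<dots> = (C * 2 ^ Suc k) * \<delta> ^ k" using \<delta> by (simp add: power_mult_distrib)
  finally show ?thesis by (simp add: \<delta>_def)
 qed
 have c: "continuous_on (ball x (r/2)) (\<lambda>y. (C * 2 ^ Suc k) * norm (y - x) ^ k - cmod (partial i f y))"
  using rC(1,3) by (intro continuous_intros continuous_on_subset[OF partial_continuous[OF hol U(1)]]) auto
 have "0 \<le> (C * 2 ^ Suc k) * norm (y - x) ^ k - cmod (partial i f y)" if y: "y \<in> ball x (r/2)" for y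
 proof (cases "y = x")
  case True
  have "((\<lambda>y. (C * 2 ^ Suc k) * norm (y - x) ^ k - cmod (partial i f y)) \<longlongrightarrow>
    (C * 2 ^ Suc k) * norm (x - x) ^ k - cmod (partial i f x)) (at x)"
   using c rC(1) unfolding continuous_on_eq_continuous_at[OF open_ball] isCont_def
   by (meson centre_in_ball half_gt_zero)
  moreover have "\<forall>\<^sub>F y in at x. 0 \<le> (C * 2 ^ Suc k) * norm (y - x) ^ k - cmod (partial i f y)"
   unfolding eventually_at using off rC(1) by (intro exI[of _ "r/2"]) (auto simp: dist_commute)
  ultimately have "0 \<le> (C * 2 ^ Suc k) * norm (x - x) ^ k - cmod (partial i f x)"
   by (rule tendsto_lowerbound) simp
  with True show ?thesis by simp
 qed (use off[OF y] in auto)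
 then show ?thesis
  using rC(1) by (intro vanish_orderI[of "r/2" _ _ "C * 2 ^ Suc k"]) auto
qed

lemma vanish_order_foldr_partial:
 assumes hol: "holomorphic_several f U" and U: "open U" "x \<in> U"
 shows "vanish_order x (length I + k) f \<Longrightarrow> vanish_order x k (foldr partial I f)"
proof (induction I arbitrary: k)
 case (Cons i I)
 then have "vanish_order x (Suc k) (foldr partial I f)" by simp
 then show ?case using vanish_order_partial[OF foldr_partial_holomorphic[OF hol U(1)] U] by simp
qed simp

lemma foldr_partial_vanish:
 assumes hol: "holomorphic_several f U" and U: "open U" "x \<in> U"
  and v: "vanish_order x k f" and len: "length I < k"
 shows "foldr partial I f x = 0"
proof -
 have "vanish_order x 1 (foldr partial I f)"
  by (rule vanish_order_foldr_partial[OF hol U vanish_order_mono[OF v]]) (use len in auto)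
 then obtain r C where "r > 0" "\<And>y. y \<in> ball x r \<Longrightarrow> cmod (foldr partial I f y) \<le> C * norm (y - x) ^ 1"
  unfolding vanish_order_def by blast
 from this(2)[of x] this(1) show ?thesis by simp
qed

section \<open>Approximation by polynomials in a local coordinate\<close>

lemma holomorphic_root_factor:
 assumes "f holomorphic_on S" "open S" "a \<in> S" "f a = 0"
 obtains g where "g holomorphic_on S" "\<And>z. z \<in> S \<Longrightarrow> f z = (z - a) * g z"
proof -
 let ?g = "\<lambda>z. if z = a then deriv f a else (f z - f a) / (z - a)"
 have "?g holomorphic_on S"
  by (rule pole_lemma_open[OF assms(1,2)])
 then show ?thesis by (rule that) (use assms(4) in auto)
qed

text \<open>
  As \<open>deriv \<zeta> a \<noteq> 0\<close>, the function
  \<open>\<zeta> - \<zeta> a\<close> is a local coordinate, and jets in t are jets in this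
  coordinate.
\<close>

lemma polynomial_jet:
 assumes u: "u holomorphic_on S" and z: "\<zeta> holomorphic_on S" and S: "open S" "a \<in> S"
  and nz: "deriv \<zeta> a \<noteq> 0"
 shows "\<exists>q v. v holomorphic_on S \<and> (\<forall>t\<in>S. u t - poly q (\<zeta> t) = (t - a) ^ k * v t)"
proof (induction k)
 case 0
 show ?case by (rule exI[of _ 0], rule exI[of _ u]) (use u in auto)
next
 case (Suc k)
 then obtain q v where v: "v holomorphic_on S" "\<And>t. t \<in> S \<Longrightarrow> u t - poly q (\<zeta> t) = (t - a) ^ k * v t" by blast
 have "(\<lambda>t. \<zeta> t - \<zeta> a) holomorphic_on S" by (intro holomorphic_intros z)
 then obtain w where w: "w holomorphic_on S" "\<And>t. t \<in> S \<Longrightarrow> \<zeta> t - \<zeta> a = (t - a) * w t"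
  using holomorphic_root_factor[OF _ S, of "\<lambda>t. \<zeta> t - \<zeta> a"] by auto
 have "w a = deriv \<zeta> a"
 proof -
  have "DERIV (\<lambda>t. (t - a) * w t) a :> (w a + (a - a) * deriv w a)"
   using holomorphic_derivI[OF w(1) S] by (auto intro!: derivative_eq_intros)
  then have "DERIV (\<lambda>t. \<zeta> t - \<zeta> a) a :> w a"
   using has_field_derivative_transform_within_open[OF _ S, of "\<lambda>t. (t - a) * w t" _ "\<lambda>t. \<zeta> t - \<zeta> a"] w(2) by auto
  moreover have "DERIV (\<lambda>t. \<zeta> t - \<zeta> a) a :> deriv \<zeta> a"
   using holomorphic_derivI[OF z S] by (auto intro!: derivative_eq_intros)
  ultimately show ?thesis by (rule DERIV_unique)
 qed
 then have wa: "w a \<noteq> 0" using nz by simp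
 \<comment> \<open>the coefficient of \<open>(\<zeta> - \<zeta> a) ^ k\<close> is forced by comparing leading terms\<close>
 define c where "c = v a / w a ^ k"
 have "(\<lambda>t. v t - c * w t ^ k) holomorphic_on S" by (intro holomorphic_intros v w)
 moreover have "v a - c * w a ^ k = 0" using wa by (simp add: c_def)
 ultimately obtain v' where v': "v' holomorphic_on S" "\<And>t. t \<in> S \<Longrightarrow> v t - c * w t ^ k = (t - a) * v' t"
  using holomorphic_root_factor[OF _ S, of "\<lambda>t. v t - c * w t ^ k"] by auto
 show ?case
 proof (rule exI[of _ "q + smult c ([:- \<zeta> a, 1:] ^ k)"], rule exI[of _ v'], intro conjI ballI v')
  fix t assume t: "t \<in> S"
  have "u t - poly (q + smult c ([:- \<zeta> a, 1:] ^ k)) (\<zeta> t) = (u t - poly q (\<zeta> t)) - c * (\<zeta> t - \<zeta> a) ^ k"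
   by (simp add: poly_power)
  also have "\<dots> = (t - a) ^ k * v t - c * ((t - a) * w t) ^ k" by (simp add: v(2) w(2) t)
  also have "\<dots> = (t - a) ^ k * (v t - c * w t ^ k)" by (simp only: power_mult_distrib) (simp add: algebra_simps)
  finally show "u t - poly (q + smult c ([:- \<zeta> a, 1:] ^ k)) (\<zeta> t) = (t - a) ^ Suc k * v' t"
   by (simp add: v'(2)[OF t] mult_ac)
 qed
qed

lemma vanish_order_cong:
 assumes "open U" "x \<in> U" "\<And>y. y \<in> U \<Longrightarrow> f y = g y" "vanish_order x k f"
 shows "vanish_order x k g"
proof -
 obtain r C where rC: "r > 0" "C \<ge> 0" "ball x r \<subseteq> U" "\<And>y. y \<in> ball x r \<Longrightarrow> cmod (f y) \<le> C * norm (y - x) ^ k"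
  by (rule vanish_orderE[OF assms(4,1,2)]) blast
 show ?thesis
  by (rule vanish_orderI[OF rC(1), of _ _ C]) (metis assms(3) rC(3,4) subsetD)
qed

lemma vanish_order_coord: "vanish_order x k (\<lambda>y. (y $ i - x $ i) ^ k)"
proof (rule vanish_orderI[of 1 _ _ 1])
 fix y show "cmod ((y $ i - x $ i) ^ k) \<le> 1 * norm (y - x) ^ k"
  using Finite_Cartesian_Product.norm_nth_le[of "y - x" i] by (simp add: norm_power power_mono)
qed simp

lemma holo_coord_compose:
 assumes "h holomorphic_on S" "open S"
 shows "holomorphic_several (\<lambda>y. h (y $ i)) {y. y $ i \<in> S}"
 by (rule holo_compose[OF holo_coord])
   (use assms holomorphic_on_imp_differentiable_at in blast)

lemma open_coord_vimage: "open S \<Longrightarrow> open {y::'n::finite cvec. y $ i \<in> S}"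
 using open_vimage[of S "\<lambda>y::'n cvec. y $ i"] by (simp add: vimage_def continuous_intros)

lemma vanish_order_coord_mult:
 assumes "h holomorphic_on S" "open S" "x $ i \<in> S"
 shows "vanish_order x k (\<lambda>y. (y $ i - x $ i) ^ k * h (y $ i))"
 by (rule vanish_order_mult_0(2)[OF vanish_order_coord vanish_order_0[OF
    holo_coord_compose[OF assms(1,2)] open_coord_vimage[OF assms(2)]]]) (use assms(3) in simp)

text \<open>
  A polynomial q with \<open>q \<circ> \<zeta>\<close> equal to \<open>t - x_i\<close> to high
  order at \<open>x_i\<close> and to 0 at the other \<open>x_j\<close> exists by interpolation,
  since the values \<open>\<zeta> (x_j)\<close> are distinct.
\<close>

lemma power_sum_jet:
 fixes x :: "'n::finite cvec"
 assumes z: "\<zeta> holomorphic_on UNIV" and inj: "\<And>i j. i \<noteq> j \<Longrightarrow> \<zeta> (x $ i) \<noteq> \<zeta> (x $ j)"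
  and nz: "\<And>i. deriv \<zeta> (x $ i) \<noteq> 0"
 shows "\<exists>q. vanish_order x k (\<lambda>y. (\<Sum>j\<in>UNIV. poly q (\<zeta> (y $ j))) - (y $ i - x $ i))"
proof -
 \<comment> \<open>p vanishes to order k at all the other points; q0 corrects the jet at \<open>x_i\<close>\<close>
 define p where "p = (\<Prod>j\<in>UNIV - {i}. [:- \<zeta> (x $ j), 1:] ^ k)"
 define S where "S = {t. poly p (\<zeta> t) \<noteq> 0}"
 have pz: "(\<lambda>t. poly p (\<zeta> t)) holomorphic_on UNIV"
  using holomorphic_on_compose_gen[OF z, of "poly p" UNIV] by (simp add: o_def poly_holomorphic_on)
 have S: "open S"
 proof -
  have "open ((\<lambda>t. poly p (\<zeta> t)) -` (- {0}))"
   using holomorphic_on_imp_continuous_on[OF pz] by (intro open_vimage) auto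
  moreover have "(\<lambda>t. poly p (\<zeta> t)) -` (- {0}) = S" by (auto simp: S_def)
  ultimately show ?thesis by simp
 qed
 have xi: "x $ i \<in> S" using inj by (auto simp: S_def p_def poly_prod poly_power)
 have "(\<lambda>t. (t - x $ i) / poly p (\<zeta> t)) holomorphic_on S"
  by (intro holomorphic_intros holomorphic_on_subset[OF pz]) (auto simp: S_def)
 then obtain q0 v where v: "v holomorphic_on S"
  "\<And>t. t \<in> S \<Longrightarrow> (t - x $ i) / poly p (\<zeta> t) - poly q0 (\<zeta> t) = (t - x $ i) ^ k * v t"
  using polynomial_jet[OF _ holomorphic_on_subset[OF z] S xi nz, of _ k] by blast
 define q where "q = p * q0"
 have "vanish_order x k (\<lambda>y. (y $ i - x $ i) ^ k * (- poly p (\<zeta> (y $ i)) * v (y $ i)))"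
  by (rule vanish_order_coord_mult[of "\<lambda>t. - poly p (\<zeta> t) * v t", OF _ S xi])
    (intro holomorphic_intros v holomorphic_on_subset[OF pz], simp)
 then have 1: "vanish_order x k (\<lambda>y. poly q (\<zeta> (y $ i)) - (y $ i - x $ i))"
 proof (rule vanish_order_cong[OF open_coord_vimage[OF S], of x i, rotated -1])
  fix y assume "y \<in> {y. y $ i \<in> S}"
  then have y: "y $ i \<in> S" by simp
  then have "poly p (\<zeta> (y $ i)) \<noteq> 0" by (simp add: S_def)
  then show "(y $ i - x $ i) ^ k * (- poly p (\<zeta> (y $ i)) * v (y $ i)) = poly q (\<zeta> (y $ i)) - (y $ i - x $ i)"
   using v(2)[OF y, symmetric] by (simp add: q_def field_simps)
 qed (use xi in simp)
 have 2: "vanish_order x k (\<lambda>y. poly q (\<zeta> (y $ j)))" if j: "j \<noteq> i" for j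
 proof -
  obtain w where w: "w holomorphic_on UNIV" "\<And>t. \<zeta> t - \<zeta> (x $ j) = (t - x $ j) * w t"
   using holomorphic_root_factor[of "\<lambda>t. \<zeta> t - \<zeta> (x $ j)" UNIV "x $ j"]
    holomorphic_on_diff[OF z holomorphic_on_const] by auto
  define p' where "p' = (\<Prod>j\<in>UNIV - {i} - {j}. [:- \<zeta> (x $ j), 1:] ^ k) * q0"
  have q: "q = [:- \<zeta> (x $ j), 1:] ^ k * p'"
   using j by (simp add: q_def p_def p'_def prod.remove[of "UNIV - {i}" j] mult.assoc)
  have "(\<lambda>t. w t ^ k * poly p' (\<zeta> t)) holomorphic_on UNIV"
   using holomorphic_on_mult[OF holomorphic_on_power[OF w(1), of k] holomorphic_on_compose_gen[OF z, of "poly p'" UNIV]]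
   by (simp add: o_def poly_holomorphic_on)
  then have "vanish_order x k (\<lambda>y. (y $ j - x $ j) ^ k * (w (y $ j) ^ k * poly p' (\<zeta> (y $ j))))"
   by (rule vanish_order_coord_mult) auto
  moreover have "poly q (\<zeta> t) = (t - x $ j) ^ k * (w t ^ k * poly p' (\<zeta> t))" for t
  proof -
   have "poly q (\<zeta> t) = (\<zeta> t - \<zeta> (x $ j)) ^ k * poly p' (\<zeta> t)" by (simp add: q poly_power)
   then show ?thesis by (simp only: w(2) power_mult_distrib mult.assoc)
  qed
  ultimately show ?thesis by simp
 qed
 have "vanish_order x k (\<lambda>y. (poly q (\<zeta> (y $ i)) - (y $ i - x $ i)) + (\<Sum>j\<in>UNIV - {i}. poly q (\<zeta> (y $ j))))"
  by (intro vanish_order_add 1 vanish_order_sum 2) auto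
 then have "vanish_order x k (\<lambda>y. (\<Sum>j\<in>UNIV. poly q (\<zeta> (y $ j))) - (y $ i - x $ i))"
  by (simp add: sum.remove[of UNIV i] algebra_simps)
 then show ?thesis by blast
qed

text \<open>
  For \<open>\<zeta> = - sinh^2\<close> these are restrictions to A of functions invariant under
  K on both sides.
\<close>

inductive power_sum_algebra :: "(complex \<Rightarrow> complex) \<Rightarrow> ('n::finite cvec \<Rightarrow> complex) \<Rightarrow> bool" for \<zeta> where
 const: "power_sum_algebra \<zeta> (\<lambda>y. c)"
| power_sum: "power_sum_algebra \<zeta> (\<lambda>y. \<Sum>j\<in>UNIV. poly q (\<zeta> (y $ j)))"
| add: "power_sum_algebra \<zeta> f \<Longrightarrow> power_sum_algebra \<zeta> g \<Longrightarrow> power_sum_algebra \<zeta> (\<lambda>y. f y + g y)"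
| mult: "power_sum_algebra \<zeta> f \<Longrightarrow> power_sum_algebra \<zeta> g \<Longrightarrow> power_sum_algebra \<zeta> (\<lambda>y. f y * g y)"

lemma power_sum_algebra_sum:
 "(\<And>i. i \<in> A \<Longrightarrow> power_sum_algebra \<zeta> (f i)) \<Longrightarrow> power_sum_algebra \<zeta> (\<lambda>y. \<Sum>i\<in>A. f i y)"
 by (induction A rule: infinite_finite_induct)
   (simp_all add: power_sum_algebra.const power_sum_algebra.add)

lemma power_sum_algebra_prod_list:
 "(\<And>i. power_sum_algebra \<zeta> (f i)) \<Longrightarrow> power_sum_algebra \<zeta> (\<lambda>y. prod_list (map (\<lambda>i. f i y) I))"
 by (induction I) (simp_all add: power_sum_algebra.const power_sum_algebra.mult)

lemma power_sum_algebra_holomorphic: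
 "power_sum_algebra \<zeta> f \<Longrightarrow> \<zeta> holomorphic_on UNIV \<Longrightarrow> holomorphic_several f U"
proof (induction rule: power_sum_algebra.induct)
 case (power_sum q)
 have "holomorphic_several (\<lambda>y. poly q (\<zeta> (y $ j))) UNIV" for j
  using holo_coord_compose[of "\<lambda>t. poly q (\<zeta> t)" UNIV j] power_sum
   holomorphic_on_compose_gen[of \<zeta> UNIV "poly q" UNIV] by (simp add: o_def poly_holomorphic_on)
 then show ?case by (intro holo_sum) (blast intro: holo_subset)
qed (auto intro: holo_const holo_add holo_mult)

text \<open>
  Up to any order the algebra contains the coordinates \<open>y_i - x_i\<close>, hence the Taylor
  polynomials of \<open>\<psi> / \<phi>\<close>. So a linear combination of derivatives at x that
  annihilates \<open>\<phi>\<close> times the algebra annihilates \<open>\<psi>\<close>.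
\<close>

theorem power_sum_algebra_jets_dense:
 fixes x :: "'n::finite cvec" and c :: "'n list \<Rightarrow> complex"
 assumes z: "\<zeta> holomorphic_on UNIV" and inj: "\<And>i j. i \<noteq> j \<Longrightarrow> \<zeta> (x $ i) \<noteq> \<zeta> (x $ j)"
  and nz: "\<And>i. deriv \<zeta> (x $ i) \<noteq> 0"
  and S: "finite S"
  and psi: "holomorphic_several \<psi> U" "open U" "x \<in> U"
  and phi: "holomorphic_several \<phi> UNIV" "\<phi> x \<noteq> 0"
  and ann: "\<And>P. power_sum_algebra \<zeta> P \<Longrightarrow> (\<Sum>I\<in>S. c I * foldr partial I (\<lambda>y. \<phi> y * P y) x) = 0"
 shows "(\<Sum>I\<in>S. c I * foldr partial I \<psi> x) = 0"
proof -
 obtain n where n: "\<And>I. I \<in> S \<Longrightarrow> length I \<le> n"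
  using finite_nat_set_iff_bounded_le[of "length ` S"] S by auto
 define V where "V = {y \<in> U. \<phi> y \<noteq> 0}"
 have V: "open V"
 proof -
  have "open (\<phi> -` (- {0}))"
   by (rule open_vimage[OF _ holo_continuous[OF phi(1)]]) auto
  moreover have "V = U \<inter> \<phi> -` (- {0})" by (auto simp: V_def)
  ultimately show ?thesis using psi(2) by auto
 qed
 have xV: "x \<in> V" using psi phi by (simp add: V_def)
 define \<eta> where "\<eta> y = \<psi> y / \<phi> y" for y
 have eta: "holomorphic_several \<eta> V"
  unfolding \<eta>_def
  by (intro holo_divide holo_subset[OF psi(1)] holo_subset[OF phi(1)])
    (auto simp: V_def)
 have "\<forall>i. \<exists>q. vanish_order x (Suc n) (\<lambda>y. (\<Sum>j\<in>UNIV. poly q (\<zeta> (y $ j))) - (y $ i - x $ i))"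
  by (rule allI, rule power_sum_jet[OF z inj nz])
 from choice[OF this] obtain q where
  q: "\<forall>i. vanish_order x (Suc n) (\<lambda>y. (\<Sum>j\<in>UNIV. poly (q i) (\<zeta> (y $ j))) - (y $ i - x $ i))" ..
 define Q where "Q i y = (\<Sum>j\<in>UNIV. poly (q i) (\<zeta> (y $ j)))" for i and y :: "'n cvec"
 have Q: "vanish_order x (Suc n) (\<lambda>y. Q i y - (y $ i - x $ i))" for i
  using q by (simp add: Q_def)
 have QA: "power_sum_algebra \<zeta> (Q i)" for i
  unfolding Q_def by (rule power_sum_algebra.power_sum)
 define M where "M I y = prod_list (map (\<lambda>i. Q i y) I)" for I and y :: "'n cvec"
 have MA: "power_sum_algebra \<zeta> (M I)" for I
  unfolding M_def by (rule power_sum_algebra_prod_list[OF QA])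
 have Mv: "vanish_order x (Suc n) (\<lambda>y. word_power (y - x) I - M I y)" for I
 proof (induction I)
  case (Cons i I)
  have "vanish_order x (Suc n) (\<lambda>y. (y $ i - x $ i) * (word_power (y - x) I - M I y) - (Q i y - (y $ i - x $ i)) * M I y)"
  proof (rule vanish_order_diff[OF vanish_order_mult_0(1)[OF _ Cons] vanish_order_mult_0(2)[OF Q]])
   show "vanish_order x 0 (\<lambda>y. y $ i - x $ i)"
    by (rule vanish_order_0[of _ UNIV]) (auto intro: holo_diff holo_coord holo_const)
   show "vanish_order x 0 (M I)"
    by (rule vanish_order_0[of _ UNIV]) (auto intro: power_sum_algebra_holomorphic[OF MA z])
  qed
  then show ?case by (simp add: word_power_def M_def algebra_simps)
 qed (simp add: word_power_def M_def vanish_order_zero)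
 \<comment> \<open>the Taylor polynomial of \<open>\<eta>\<close> with each coordinate replaced by its approximation from the algebra\<close>
 define H where "H y = (\<Sum>k\<le>n. \<Sum>I\<in>words k. M I y * (foldr partial I \<eta> x / fact k))" for y
 have HA: "power_sum_algebra \<zeta> H"
  unfolding H_def by (intro power_sum_algebra_sum power_sum_algebra.mult MA power_sum_algebra.const)
 have "vanish_order x (Suc n) (\<lambda>y. (\<Sum>k\<le>n. \<Sum>I\<in>words k. (word_power (y - x) I - M I y) * (foldr partial I \<eta> x / fact k)))"
  by (intro vanish_order_sum vanish_order_mult_0(2)[OF Mv] vanish_order_const)
 moreover have "(\<Sum>k\<le>n. \<Sum>I\<in>words k. (word_power (y - x) I - M I y) * (foldr partial I \<eta> x / fact k)) =
   (\<Sum>k\<le>n. taylor_term k \<eta> x (y - x) / fact k) - H y" for y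
  by (simp add: H_def taylor_term_def left_diff_distrib diff_divide_distrib sum_subtractf sum_divide_distrib)
 ultimately have "vanish_order x (Suc n) (\<lambda>y. (\<Sum>k\<le>n. taylor_term k \<eta> x (y - x) / fact k) - H y)" by simp
 from vanish_order_add[OF taylor_vanish[OF eta V xV] this]
 have "vanish_order x (Suc n) (\<lambda>y. \<eta> y - H y)" by simp
 then have "vanish_order x (Suc n) (\<lambda>y. \<phi> y * (\<eta> y - H y))"
  by (intro vanish_order_mult_0(1) vanish_order_0[OF phi(1)]) auto
 then have v: "vanish_order x (Suc n) (\<lambda>y. \<psi> y - \<phi> y * H y)"
  by (rule vanish_order_cong[OF V xV, rotated]) (simp add: \<eta>_def V_def algebra_simps)
 have hpsi: "holomorphic_several \<psi> V" and hH: "holomorphic_several (\<lambda>y. \<phi> y * H y) V"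
  using holo_subset[OF psi(1), of V]
   holo_mult[OF holo_subset[OF phi(1)] power_sum_algebra_holomorphic[OF HA z], of V]
  by (auto simp: V_def)
 have "foldr partial I \<psi> x = foldr partial I (\<lambda>y. \<phi> y * H y) x" if "I \<in> S" for I
 proof -
  have "foldr partial I (\<lambda>y. \<psi> y - \<phi> y * H y) x = 0"
   using foldr_partial_vanish[OF holo_diff[OF hpsi hH] V xV v] n[OF that] by simp
  then show ?thesis using foldr_partial_diff[OF hpsi hH V xV, of I] by simp
 qed
 then have "(\<Sum>I\<in>S. c I * foldr partial I \<psi> x) = (\<Sum>I\<in>S. c I * foldr partial I (\<lambda>y. \<phi> y * H y) x)"
  by (intro sum.cong) auto
 then show ?thesis using ann[OF HA] by simp
qed

section \<open>Sums over the positive roots\<close>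

lemma inner_short: "\<alpha> \<in> pos_short \<union> uminus ` pos_short \<Longrightarrow> \<alpha> \<bullet> \<alpha> = 1"
 by (auto simp: pos_short_def inner_axis_axis)

lemma inner_medium: "\<alpha> \<in> pos_medium \<union> uminus ` pos_medium \<Longrightarrow> \<alpha> \<bullet> \<alpha> = 2"
 by (auto simp: pos_medium_def inner_axis_axis inner_diff_left inner_diff_right inner_add_left inner_add_right)

lemma inner_long: "\<alpha> \<in> pos_long \<union> uminus ` pos_long \<Longrightarrow> \<alpha> \<bullet> \<alpha> = 4"
 by (auto simp: pos_long_def inner_axis_axis)

lemma mult_param_short: "\<alpha> \<in> pos_short \<Longrightarrow> mult_param (p1, p2, p3) \<alpha> = p1"
 by (simp add: mult_param_def)

lemma mult_param_medium: "\<alpha> \<in> pos_medium \<Longrightarrow> mult_param (p1, p2, p3) \<alpha> = p2"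
 using inner_medium[of \<alpha>] inner_short[of \<alpha>] by (auto simp: mult_param_def)

lemma mult_param_long: "\<alpha> \<in> pos_long \<Longrightarrow> mult_param (p1, p2, p3) \<alpha> = p3"
 using inner_medium[of \<alpha>] inner_short[of \<alpha>] inner_long[of \<alpha>] by (auto simp: mult_param_def)

lemma mult_param_double:
 "mult_param (p1, p2, p3) (2 *\<^sub>R axis i 1) = p3"
 "\<alpha> \<in> pos_medium \<Longrightarrow> mult_param (p1, p2, p3) (2 *\<^sub>R \<alpha>) = 0"
 "\<alpha> \<in> pos_long \<Longrightarrow> mult_param (p1, p2, p3) (2 *\<^sub>R \<alpha>) = 0"
proof -
 show "mult_param (p1, p2, p3) (2 *\<^sub>R axis i 1) = p3"
  by (rule mult_param_long) (auto simp: pos_long_def)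
 have *: "mult_param (p1, p2, p3) \<beta> = 0" if "\<beta> \<bullet> \<beta> \<notin> {1, 2, 4}" for \<beta>
  using that inner_medium[of \<beta>] inner_short[of \<beta>] inner_long[of \<beta>] by (auto simp: mult_param_def)
 show "\<alpha> \<in> pos_medium \<Longrightarrow> mult_param (p1, p2, p3) (2 *\<^sub>R \<alpha>) = 0"
  using inner_medium[of \<alpha>] by (intro *) auto
 show "\<alpha> \<in> pos_long \<Longrightarrow> mult_param (p1, p2, p3) (2 *\<^sub>R \<alpha>) = 0"
  using inner_long[of \<alpha>] by (intro *) auto
qed

definition ordered_pairs :: "('n::{finite,linorder} \<times> 'n) set" where
 "ordered_pairs = {(i, j). i < j}"

lemma finite_pos_roots: "finite (pos_roots :: 'n::{finite,linorder} rvec set)"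
proof -
 have 1: "pos_short = range (\<lambda>i. axis i 1 :: 'n rvec)" by (auto simp: pos_short_def)
 have 2: "pos_long = range (\<lambda>i. 2 *\<^sub>R axis i 1 :: 'n rvec)" by (auto simp: pos_long_def)
 have 3: "pos_medium \<subseteq> (\<lambda>(i, j). axis i 1 - axis j 1 :: 'n rvec) ` UNIV \<union> (\<lambda>(i, j). axis i 1 + axis j 1) ` UNIV"
  by (auto simp: pos_medium_def)
 have "finite (pos_medium :: 'n rvec set)" by (rule finite_subset[OF 3]) simp
 then show ?thesis by (simp add: pos_roots_def 1 2)
qed

text \<open>
  The listed roots are pairwise different; the short, medium and long ones are told apart by their
  length.
\<close>

lemma sum_pos_roots:
 fixes g :: "'n::{finite,linorder} rvec \<Rightarrow> 'b::comm_monoid_add"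
 shows "(\<Sum>\<alpha>\<in>pos_roots. g \<alpha>) = (\<Sum>i\<in>UNIV. g (axis i 1))
   + (\<Sum>(i, j)\<in>ordered_pairs. g (axis i 1 - axis j 1) + g (axis i 1 + axis j 1))
   + (\<Sum>i\<in>UNIV. g (2 *\<^sub>R axis i 1))"
proof -
 let ?m = "\<lambda>(i, j). axis i 1 - axis j 1 :: 'n rvec"
 let ?p = "\<lambda>(i, j). axis i 1 + axis j 1 :: 'n rvec"
 have short: "pos_short = range (\<lambda>i. axis i 1 :: 'n rvec)" by (auto simp: pos_short_def)
 have long: "pos_long = range (\<lambda>i. 2 *\<^sub>R axis i 1 :: 'n rvec)" by (auto simp: pos_long_def)
 have med: "pos_medium = ?m ` ordered_pairs \<union> ?p ` ordered_pairs"
  by (auto simp: pos_medium_def ordered_pairs_def image_iff)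
 have i1: "inj (\<lambda>i. axis i 1 :: 'n rvec)"
  by (auto simp: inj_def axis_eq_axis)
 have i2: "inj (\<lambda>i. 2 *\<^sub>R axis i 1 :: 'n rvec)"
  by (auto simp: inj_def axis_eq_axis)
 have im: "inj_on ?m ordered_pairs"
 proof (rule inj_onI, clarsimp simp: ordered_pairs_def)
  fix i j k l :: 'n assume "i < j" "k < l" and eq: "axis i 1 - axis j 1 = (axis k 1 - axis l 1 :: 'n rvec)"
  have e: "(if r = i then 1 else 0) - (if r = j then 1 else 0) = ((if r = k then 1 else 0) - (if r = l then 1 else 0) :: real)" for r
   using arg_cong[OF eq, of "\<lambda>v. v $ r"] by (simp add: axis_entry)
  have "i = k" using e[of i] \<open>i < j\<close> \<open>k < l\<close> by (auto split: if_splits)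
  moreover have "j = l" using e[of j] \<open>i < j\<close> \<open>k < l\<close> by (auto split: if_splits)
  ultimately show "i = k \<and> j = l" ..
 qed
 have ip: "inj_on ?p ordered_pairs"
 proof (rule inj_onI, clarsimp simp: ordered_pairs_def)
  fix i j k l :: 'n assume ij: "i < j" "k < l" and eq: "axis i 1 + axis j 1 = (axis k 1 + axis l 1 :: 'n rvec)"
  have e: "(if r = i then 1 else 0) + (if r = j then 1 else 0) = ((if r = k then 1 else 0) + (if r = l then 1 else 0) :: real)" for r
   using arg_cong[OF eq, of "\<lambda>v. v $ r"] by (simp add: axis_entry)
  have "i = k \<or> i = l" using e[of i] by (auto split: if_splits)
  moreover have "j = k \<or> j = l" using e[of j] by (auto split: if_splits)
  ultimately show "i = k \<and> j = l" using ij by auto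
 qed
 have dmp: "?m ` ordered_pairs \<inter> ?p ` ordered_pairs = {}"
 proof -
  have "axis i 1 - axis j 1 \<noteq> (axis k 1 + axis l 1 :: 'n rvec)" if "i < j" for i j k l :: 'n
  proof
   assume eq: "axis i 1 - axis j 1 = (axis k 1 + axis l 1 :: 'n rvec)"
   show False using arg_cong[OF eq, of "\<lambda>v. v $ j"] that by (auto simp: axis_entry split: if_splits)
  qed
  then show ?thesis by (auto simp: ordered_pairs_def)
 qed
 have d1: "pos_short \<inter> (pos_medium :: 'n rvec set) = {}"
  using inner_short inner_medium by (metis Un_iff disjoint_iff numeral_eq_one_iff semiring_norm(85))
 have d2: "(pos_short \<union> pos_medium) \<inter> (pos_long :: 'n rvec set) = {}"
 proof -
  have "\<alpha> \<notin> pos_long" if "\<alpha> \<in> pos_short \<union> pos_medium" for \<alpha> :: "'n rvec"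
   using inner_short[of \<alpha>] inner_medium[of \<alpha>] inner_long[of \<alpha>] that by auto
  then show ?thesis by blast
 qed
 have fin: "finite (pos_short :: 'n rvec set)" "finite (pos_medium :: 'n rvec set)" "finite (pos_long :: 'n rvec set)"
  using finite_pos_roots[where 'n = 'n] by (simp_all add: pos_roots_def)
 have "(\<Sum>\<alpha>\<in>pos_roots. g \<alpha>) = (\<Sum>\<alpha>\<in>pos_short. g \<alpha>) + (\<Sum>\<alpha>\<in>pos_medium. g \<alpha>) + (\<Sum>\<alpha>\<in>pos_long. g \<alpha>)"
  unfolding pos_roots_def using fin d1 d2 by (simp add: sum.union_disjoint)
 also have "(\<Sum>\<alpha>\<in>pos_medium. g \<alpha>) = (\<Sum>\<alpha>\<in>?m ` ordered_pairs. g \<alpha>) + (\<Sum>\<alpha>\<in>?p ` ordered_pairs. g \<alpha>)"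
  unfolding med by (rule sum.union_disjoint) (use dmp in auto)
 also have "\<dots> = (\<Sum>(i, j)\<in>ordered_pairs. g (axis i 1 - axis j 1) + g (axis i 1 + axis j 1))"
  unfolding sum.reindex[OF im] sum.reindex[OF ip] by (simp add: sum.distrib[symmetric] case_prod_beta)
 finally show ?thesis unfolding short long by (simp add: sum.reindex i1 i2)
qed

lemma sum_ordered_pairs:
 fixes g :: "'n::{finite,linorder} \<Rightarrow> 'n \<Rightarrow> complex"
 assumes sym: "\<And>i j. g i j = g j i"
 shows "2 * (\<Sum>(i, j)\<in>ordered_pairs. g i j) = (\<Sum>i\<in>UNIV. \<Sum>j\<in>UNIV - {i}. g i j)"
proof -
 have "(\<Sum>i\<in>UNIV. \<Sum>j\<in>UNIV - {i}. g i j) = (\<Sum>(i, j)\<in>(SIGMA i:UNIV. UNIV - {i}). g i j)"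
  by (simp add: sum.Sigma)
 also have "(SIGMA i:UNIV. UNIV - {i}) = ordered_pairs \<union> prod.swap ` (ordered_pairs :: ('n \<times> 'n) set)"
  by (auto simp: ordered_pairs_def image_iff not_less_iff_gr_or_eq)
 also have "(\<Sum>(i, j)\<in>ordered_pairs \<union> prod.swap ` ordered_pairs. g i j) =
   (\<Sum>(i, j)\<in>ordered_pairs. g i j) + (\<Sum>(i, j)\<in>prod.swap ` ordered_pairs. g i j)"
  by (rule sum.union_disjoint) (auto simp: ordered_pairs_def)
 also have "(\<Sum>(i, j)\<in>prod.swap ` ordered_pairs. g i j) = (\<Sum>(i, j)\<in>ordered_pairs. g i j)"
  by (subst sum.reindex) (auto simp: case_prod_beta intro!: sum.cong sym)
 finally show ?thesis by simp
qed

section \<open>Hyperbolic identities\<close>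

definition coth :: "complex \<Rightarrow> complex" where "coth z = cosh z / sinh z"
definition csch2 :: "complex \<Rightarrow> complex" where "csch2 z = 1 / (sinh z)\<^sup>2"

lemma coth_minus: "coth (- z) = - coth z"
 by (simp add: coth_def)

lemma csch2_minus: "csch2 (- z) = csch2 z"
 by (simp add: csch2_def)

lemma coth_square: "sinh z \<noteq> 0 \<Longrightarrow> (coth z)\<^sup>2 = 1 + csch2 z"
 using cosh_square_eq[of z] by (simp add: coth_def csch2_def power_divide field_simps)

lemma coth_add_coth:
 assumes "sinh (a - b) \<noteq> 0" "sinh (a + b) \<noteq> 0"
 shows "coth (a - b) + coth (a + b) = 2 * sinh (2 * a) / (cosh (2 * a) - cosh (2 * b))"
  and "cosh (2 * a) - cosh (2 * b) \<noteq> 0"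
proof -
 have e: "cosh (2 * a) - cosh (2 * b) = 2 * (sinh (a - b) * sinh (a + b))"
 proof -
  have "2 * a = (a - b) + (a + b)" "2 * b = (a + b) - (a - b)" by simp_all
  then show ?thesis by (simp only: cosh_add cosh_diff) (simp add: algebra_simps)
 qed
 then show "cosh (2 * a) - cosh (2 * b) \<noteq> 0" using assms by simp
 have s: "sinh (2 * a) = cosh (a - b) * sinh (a + b) + cosh (a + b) * sinh (a - b)"
 proof -
  have "2 * a = (a - b) + (a + b)" by simp
  then show ?thesis by (simp only: sinh_add) (simp add: algebra_simps)
 qed
 show "coth (a - b) + coth (a + b) = 2 * sinh (2 * a) / (cosh (2 * a) - cosh (2 * b))"
  unfolding e s coth_def using assms by (simp add: field_simps)
qed

lemma coth_double:
 assumes "sinh (2 * z) \<noteq> 0"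
 shows "sinh (2 * z) * coth z = cosh (2 * z) + 1" "sinh (2 * z) * coth (2 * z) = cosh (2 * z)"
  "coth z * coth (2 * z) = 1 + csch2 z / 2" "sinh z \<noteq> 0" "csch2 z = 2 * (cosh (2 * z) + 1) * csch2 (2 * z)"
proof -
 have z: "sinh z \<noteq> 0" "cosh z \<noteq> 0" using assms by (auto simp: sinh_double)
 show "sinh z \<noteq> 0" by (rule z)
 have c2: "cosh (2 * z) = 2 * (sinh z)\<^sup>2 + 1" "cosh (2 * z) + 1 = 2 * (cosh z)\<^sup>2"
  using cosh_double[of z] cosh_square_eq[of z] by simp_all
 show "sinh (2 * z) * coth z = cosh (2 * z) + 1"
  unfolding c2(2) sinh_double coth_def using z by (simp add: power2_eq_square)
 show "sinh (2 * z) * coth (2 * z) = cosh (2 * z)" using assms by (simp add: coth_def)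
 show "coth z * coth (2 * z) = 1 + csch2 z / 2"
  unfolding coth_def csch2_def c2(1) sinh_double using z by (simp add: field_simps power2_eq_square)
 show "csch2 z = 2 * (cosh (2 * z) + 1) * csch2 (2 * z)"
  unfolding c2(2) csch2_def sinh_double using z by (simp add: field_simps power2_eq_square)
qed

text \<open>
  Clearing denominators leaves the identity for the Vandermonde determinant of three points.
\<close>

lemma cyclic_identity:
 fixes a b c :: complex
 assumes "a \<noteq> b" "b \<noteq> c" "c \<noteq> a"
 shows "(a\<^sup>2 - 1) / ((a - b) * (a - c)) + (b\<^sup>2 - 1) / ((b - c) * (b - a)) + (c\<^sup>2 - 1) / ((c - a) * (c - b)) = 1"
proof -
 define D where "D = (a - b) * (b - c) * (c - a)"
 have n: "(a - b) * (a - c) \<noteq> 0" "(b - c) * (b - a) \<noteq> 0" "(c - a) * (c - b) \<noteq> 0" and D: "D \<noteq> 0"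
  using assms by (simp_all add: D_def eq_commute[of a c])
 have 1: "(a\<^sup>2 - 1) / ((a - b) * (a - c)) = - ((a\<^sup>2 - 1) * (b - c)) / D"
  unfolding frac_eq_eq[OF n(1) D] unfolding D_def by algebra
 have 2: "(b\<^sup>2 - 1) / ((b - c) * (b - a)) = - ((b\<^sup>2 - 1) * (c - a)) / D"
  unfolding frac_eq_eq[OF n(2) D] unfolding D_def by algebra
 have 3: "(c\<^sup>2 - 1) / ((c - a) * (c - b)) = - ((c\<^sup>2 - 1) * (a - b)) / D"
  unfolding frac_eq_eq[OF n(3) D] unfolding D_def by algebra
 have "- ((a\<^sup>2 - 1) * (b - c)) + - ((b\<^sup>2 - 1) * (c - a)) + - ((c\<^sup>2 - 1) * (a - b)) = D"
  unfolding D_def by algebra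
 then show ?thesis unfolding 1 2 3 add_divide_distrib[symmetric] using D by simp
qed

lemma sum_triples_cyclic:
 fixes F :: "'n::finite \<Rightarrow> 'n \<Rightarrow> 'n \<Rightarrow> complex"
 assumes cyc: "\<And>i j k. i \<noteq> j \<Longrightarrow> j \<noteq> k \<Longrightarrow> k \<noteq> i \<Longrightarrow> F i j k + F j k i + F k i j = 1"
 shows "3 * (\<Sum>i\<in>UNIV. \<Sum>j\<in>UNIV - {i}. \<Sum>k\<in>UNIV - {i} - {j}. F i j k) =
   of_nat CARD('n) * (of_nat CARD('n) - 1) * (of_nat CARD('n) - 2)"
proof -
 define G where "G i j k = (if i \<noteq> j \<and> j \<noteq> k \<and> k \<noteq> i then F i j k else 0)" for i j k
 have e: "(\<Sum>i\<in>UNIV. \<Sum>j\<in>UNIV - {i}. \<Sum>k\<in>UNIV - {i} - {j}. F i j k) = (\<Sum>i\<in>UNIV. \<Sum>j\<in>UNIV. \<Sum>k\<in>UNIV. G i j k)"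
 proof (rule sum.cong[OF refl], rule sum.mono_neutral_cong_left)
  fix i j :: 'n assume "j \<in> UNIV - {i}"
  then show "(\<Sum>k\<in>UNIV - {i} - {j}. F i j k) = (\<Sum>k\<in>UNIV. G i j k)"
   by (intro sum.mono_neutral_cong_left) (auto simp: G_def)
 qed (auto simp: G_def)
 have s1: "(\<Sum>i\<in>UNIV. \<Sum>j\<in>UNIV. \<Sum>k\<in>UNIV. G i j k) = (\<Sum>i\<in>UNIV. \<Sum>j\<in>UNIV. \<Sum>k\<in>UNIV. G j k i)"
 proof -
  have "(\<Sum>i\<in>UNIV. \<Sum>j\<in>UNIV. \<Sum>k\<in>UNIV. G j k i) = (\<Sum>j\<in>UNIV. \<Sum>i\<in>UNIV. \<Sum>k\<in>UNIV. G j k i)" by (rule sum.swap)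
  also have "\<dots> = (\<Sum>j\<in>UNIV. \<Sum>k\<in>UNIV. \<Sum>i\<in>UNIV. G j k i)" by (intro sum.cong refl sum.swap)
  finally show ?thesis by simp
 qed
 have s2: "(\<Sum>i\<in>UNIV. \<Sum>j\<in>UNIV. \<Sum>k\<in>UNIV. G j k i) = (\<Sum>i\<in>UNIV. \<Sum>j\<in>UNIV. \<Sum>k\<in>UNIV. G k i j)"
 proof -
  have "(\<Sum>i\<in>UNIV. \<Sum>j\<in>UNIV. \<Sum>k\<in>UNIV. G k i j) = (\<Sum>j\<in>UNIV. \<Sum>i\<in>UNIV. \<Sum>k\<in>UNIV. G k i j)" by (rule sum.swap)
  also have "\<dots> = (\<Sum>j\<in>UNIV. \<Sum>k\<in>UNIV. \<Sum>i\<in>UNIV. G k i j)" by (intro sum.cong refl sum.swap)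
  finally show ?thesis by simp
 qed
 have "3 * (\<Sum>i\<in>UNIV. \<Sum>j\<in>UNIV. \<Sum>k\<in>UNIV. G i j k) =
   (\<Sum>i\<in>UNIV. \<Sum>j\<in>UNIV. \<Sum>k\<in>UNIV. G i j k + G j k i + G k i j)"
  using s1 s2 by (simp add: sum.distrib)
 also have "\<dots> = (\<Sum>i\<in>UNIV. \<Sum>j\<in>UNIV - {i}. \<Sum>k\<in>UNIV - {i} - {j :: 'n}. (1::complex))"
 proof (rule sum.cong[OF refl], rule sum.mono_neutral_cong_right)
  fix i j :: 'n assume j: "j \<in> UNIV - {i}"
  show "(\<Sum>k\<in>UNIV. G i j k + G j k i + G k i j) = (\<Sum>k\<in>UNIV - {i} - {j}. (1::complex))"
   by (intro sum.mono_neutral_cong_right) (use j cyc in \<open>auto simp: G_def\<close>)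
 qed (auto simp: G_def)
 also have "\<dots> = of_nat CARD('n) * (of_nat CARD('n) - 1) * (of_nat CARD('n) - 2)"
 proof -
  have 1: "(\<Sum>k\<in>UNIV - {i} - {j}. (1::complex)) = of_nat CARD('n) - 2" if "j \<in> UNIV - {i}" for i j :: 'n
  proof -
   have "card (UNIV - {i} - {j}) + 2 = CARD('n)"
    using that card_Suc_Diff1[of "UNIV :: 'n set" i] card_Suc_Diff1[of "UNIV - {i}" j] by simp
   then have "of_nat (card (UNIV - {i} - {j})) + 2 = (of_nat CARD('n) :: complex)"
    by (metis of_nat_add of_nat_numeral)
   then show ?thesis by (simp add: algebra_simps)
  qed
  have 2: "of_nat (card (UNIV - {i})) = (of_nat CARD('n) - 1 :: complex)" for i :: 'n
  proof -
   have "Suc (card (UNIV - {i})) = CARD('n)" by (rule card_Suc_Diff1) auto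
   then have "of_nat (card (UNIV - {i})) + 1 = (of_nat CARD('n) :: complex)" by (metis add.commute of_nat_Suc)
   then show ?thesis by (simp add: algebra_simps)
  qed
  have "(\<Sum>j\<in>UNIV - {i}. \<Sum>k\<in>UNIV - {i} - {j}. (1::complex)) = (of_nat CARD('n) - 1) * (of_nat CARD('n) - 2)" for i :: 'n
  proof -
   have "(\<Sum>j\<in>UNIV - {i}. \<Sum>k\<in>UNIV - {i} - {j}. (1::complex)) = (\<Sum>j\<in>UNIV - {i}. of_nat CARD('n) - 2)"
    by (rule sum.cong[OF refl 1])
   then show ?thesis using 2 by simp
  qed
  then show ?thesis by (simp add: mult.assoc)
 qed
 finally show ?thesis using e by simp
qed

section \<open>The square of the logarithmic derivative of delta\<close>

definition coth_pair :: "'n::finite cvec \<Rightarrow> 'n \<Rightarrow> 'n \<Rightarrow> complex" where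
 "coth_pair x i j = coth (x $ i - x $ j) + coth (x $ i + x $ j)"

definition csch2_pair :: "'n::finite cvec \<Rightarrow> 'n \<Rightarrow> 'n \<Rightarrow> complex" where
 "csch2_pair x i j = csch2 (x $ i - x $ j) + csch2 (x $ i + x $ j)"

text \<open>
  The logarithmic derivative of \<open>\<delta>\<close> in the direction \<open>x_i\<close>, for the
  parameters \<open>(q, 1, 1/2)\<close>; drift_deriv is its derivative in the same direction.
\<close>

definition drift :: "complex \<Rightarrow> 'n::finite cvec \<Rightarrow> 'n \<Rightarrow> complex" where
 "drift q x i = q * coth (x $ i) + coth (2 * x $ i) + (\<Sum>j\<in>UNIV - {i}. coth_pair x i j)"

definition drift_deriv :: "complex \<Rightarrow> 'n::finite cvec \<Rightarrow> 'n \<Rightarrow> complex" where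
 "drift_deriv q x i = - (q * csch2 (x $ i)) - 2 * csch2 (2 * x $ i) - (\<Sum>j\<in>UNIV - {i}. csch2_pair x i j)"

lemma csch2_pair_sym: "csch2_pair x i j = csch2_pair x j i"
 using csch2_minus[of "x $ i - x $ j"] by (simp add: csch2_pair_def add.commute)

lemma of_nat_card_remove: "of_nat (card (UNIV - {i :: 'n::finite})) = (of_nat CARD('n) - 1 :: complex)"
proof -
 have "Suc (card (UNIV - {i})) = CARD('n)" by (rule card_Suc_Diff1) auto
 then have "of_nat (card (UNIV - {i})) + 1 = (of_nat CARD('n) :: complex)" by (metis add.commute of_nat_Suc)
 then show ?thesis by (simp add: algebra_simps)
qed

lemma sum_off_diag_symmetric:
 fixes G :: "'n::finite \<Rightarrow> 'n \<Rightarrow> complex"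
 assumes "\<And>i j. i \<noteq> j \<Longrightarrow> G i j + G j i = 2 * C"
 shows "(\<Sum>i\<in>UNIV. \<Sum>j\<in>UNIV - {i}. G i j) = of_nat CARD('n) * (of_nat CARD('n) - 1) * C"
proof -
 have "2 * (\<Sum>i\<in>UNIV. \<Sum>j\<in>UNIV - {i}. G i j) = (\<Sum>i\<in>UNIV. \<Sum>j\<in>UNIV - {i}. G i j + G j i)"
  using sum_off_diag_swap[of G] by (simp add: sum.distrib)
 also have "\<dots> = (\<Sum>i\<in>(UNIV :: 'n set). \<Sum>j\<in>UNIV - {i}. 2 * C)"
  by (intro sum.cong refl assms) auto
 also have "\<dots> = 2 * (of_nat CARD('n) * (of_nat CARD('n) - 1) * C)"
  by (simp add: of_nat_card_remove)
 finally show ?thesis by simp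
qed

text \<open>
  In the variables \<open>z_i = cosh (2 x_i)\<close> the mixed terms are rational:
  \<open>coth_pair x i j = 2 sinh (2 x_i) / (z_i - z_j)\<close>. Products over pairs
  become constant after symmetrization in i and j, products over triples after cyclic
  symmetrization. Only the single roots leave a potential.
\<close>

theorem drift_square_sum:
 fixes x :: "'n::{finite,linorder} cvec"
 assumes x: "x \<in> regular_set"
 defines "n \<equiv> of_nat CARD('n) :: complex"
 shows "(\<Sum>i\<in>UNIV. (drift q x i)\<^sup>2 + drift_deriv q x i) =
   n * (q + 1)\<^sup>2 + 2 * (q + 1) * (n * (n - 1)) + 2 * (n * (n - 1)) + 4 * (n * (n - 1) * (n - 2)) / 3
   + (\<Sum>i\<in>UNIV. q\<^sup>2 * csch2 (x $ i) - csch2 (2 * x $ i))"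
proof -
 note r = regular_set_sinh[OF x]
 define z where "z i = cosh (2 * x $ i)" for i
 define s where "s i = sinh (2 * x $ i)" for i
 define h where "h i = q * coth (x $ i) + coth (2 * x $ i)" for i
 have T: "coth_pair x i j = 2 * s i / (z i - z j)" and zz: "z i \<noteq> z j" if "i \<noteq> j" for i j
  using coth_add_coth[OF r(3)[OF that] r(4)[OF that]] by (simp_all add: coth_pair_def s_def z_def)
 have s2: "(s i)\<^sup>2 = (z i)\<^sup>2 - 1" for i
  using cosh_square_eq[of "2 * x $ i"] by (simp add: s_def z_def)
 have hs: "h i * s i = q * (z i + 1) + z i" for i
  using coth_double(1,2)[OF r(2)[of i]] by (simp add: h_def s_def z_def algebra_simps)
 have single: "(h i)\<^sup>2 - q * csch2 (x $ i) - 2 * csch2 (2 * x $ i) = (q + 1)\<^sup>2 + (q\<^sup>2 * csch2 (x $ i) - csch2 (2 * x $ i))" for i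
 proof -
  have "(h i)\<^sup>2 = q\<^sup>2 * (coth (x $ i))\<^sup>2 + 2 * q * (coth (x $ i) * coth (2 * x $ i)) + (coth (2 * x $ i))\<^sup>2"
   by (simp add: h_def power2_eq_square algebra_simps)
  then show ?thesis
   unfolding coth_double(3)[OF r(2)] coth_square[OF r(1)] coth_square[OF r(2)]
   by (simp add: power2_eq_square algebra_simps)
 qed
 have cross: "(\<Sum>i\<in>UNIV. \<Sum>j\<in>UNIV - {i}. 2 * h i * coth_pair x i j) = n * (n - 1) * (2 * (q + 1))"
  unfolding n_def
 proof (rule sum_off_diag_symmetric)
  fix i j :: 'n assume ij: "i \<noteq> j"
  have "2 * h i * coth_pair x i j = 4 * (q * (z i + 1) + z i) / (z i - z j)"
   using T[OF ij] hs[of i] by simp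
  moreover have "2 * h j * coth_pair x j i = 4 * (q * (z j + 1) + z j) / (z j - z i)"
   using T[OF ij[symmetric]] hs[of j] by simp
  moreover have "4 * (q * (z j + 1) + z j) / (z j - z i) = - (4 * (q * (z j + 1) + z j)) / (z i - z j)"
   using zz[OF ij] by (simp add: field_simps)
  moreover have "4 * (q * (z i + 1) + z i) + - (4 * (q * (z j + 1) + z j)) = 4 * (q + 1) * (z i - z j)"
   by (simp add: algebra_simps)
  ultimately show "2 * h i * coth_pair x i j + 2 * h j * coth_pair x j i = 2 * (2 * (q + 1))"
   using zz[OF ij] by (simp add: add_divide_distrib[symmetric] del: minus_mult_right)
 qed
 have square: "(\<Sum>i\<in>UNIV. \<Sum>j\<in>UNIV - {i}. (coth_pair x i j)\<^sup>2 - csch2_pair x i j) = n * (n - 1) * 2"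
  unfolding n_def
 proof (rule sum_off_diag_symmetric)
  fix i j :: 'n assume ij: "i \<noteq> j"
  have e: "(coth_pair x i j)\<^sup>2 - csch2_pair x i j = 2 + 2 * (coth (x $ i - x $ j) * coth (x $ i + x $ j))" if "i \<noteq> j" for i j
   using coth_square[OF r(3)[OF that]] coth_square[OF r(4)[OF that]]
   by (simp add: coth_pair_def csch2_pair_def power2_eq_square algebra_simps)
  have "coth (x $ j - x $ i) = - coth (x $ i - x $ j)" using coth_minus[of "x $ i - x $ j"] by simp
  then show "(coth_pair x i j)\<^sup>2 - csch2_pair x i j + ((coth_pair x j i)\<^sup>2 - csch2_pair x j i) = 2 * 2"
   unfolding e[OF ij] e[OF ij[symmetric]] by (simp add: add.commute)
 qed
 have triple: "3 * (\<Sum>i\<in>UNIV. \<Sum>j\<in>UNIV - {i}. \<Sum>k\<in>UNIV - {i} - {j}. coth_pair x i j * coth_pair x i k / 4) = n * (n - 1) * (n - 2)"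
  unfolding n_def
 proof (rule sum_triples_cyclic)
  fix i j k :: 'n assume d: "i \<noteq> j" "j \<noteq> k" "k \<noteq> i"
  have e: "coth_pair x i j * coth_pair x i k / 4 = ((z i)\<^sup>2 - 1) / ((z i - z j) * (z i - z k))" if "i \<noteq> j" "i \<noteq> k" for i j k
   unfolding T[OF that(1)] T[OF that(2)] s2[symmetric] by (simp add: power2_eq_square)
  show "coth_pair x i j * coth_pair x i k / 4 + coth_pair x j k * coth_pair x j i / 4 + coth_pair x k i * coth_pair x k j / 4 = 1"
   using d by (simp only: e[OF d(1) d(3)[symmetric]] e[OF d(2) d(1)[symmetric]] e[OF d(3) d(2)[symmetric]])
    (rule cyclic_identity; use zz d in blast)
 qed
 have expand: "(drift q x i)\<^sup>2 + drift_deriv q x i =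
   ((h i)\<^sup>2 - q * csch2 (x $ i) - 2 * csch2 (2 * x $ i)) + (\<Sum>j\<in>UNIV - {i}. 2 * h i * coth_pair x i j)
   + (\<Sum>j\<in>UNIV - {i}. (coth_pair x i j)\<^sup>2 - csch2_pair x i j)
   + 4 * (\<Sum>j\<in>UNIV - {i}. \<Sum>k\<in>UNIV - {i} - {j}. coth_pair x i j * coth_pair x i k / 4)" for i
 proof -
  let ?t = "\<lambda>j. coth_pair x i j"
  let ?S = "\<Sum>j\<in>UNIV - {i}. ?t j"
  have "?S\<^sup>2 = (\<Sum>j\<in>UNIV - {i}. \<Sum>k\<in>UNIV - {i}. ?t j * ?t k)"
   by (simp add: power2_eq_square sum_product)
  also have "\<dots> = (\<Sum>j\<in>UNIV - {i}. (?t j)\<^sup>2 + (\<Sum>k\<in>UNIV - {i} - {j}. ?t j * ?t k))"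
   by (rule sum.cong[OF refl]) (simp add: sum.remove[where A = "UNIV - {i}"] power2_eq_square)
  finally have S2: "?S\<^sup>2 = (\<Sum>j\<in>UNIV - {i}. (?t j)\<^sup>2) + (\<Sum>j\<in>UNIV - {i}. \<Sum>k\<in>UNIV - {i} - {j}. ?t j * ?t k)"
   by (simp add: sum.distrib)
  have d: "drift q x i = h i + ?S" by (simp add: drift_def h_def)
  have dd: "drift_deriv q x i = - (q * csch2 (x $ i)) - 2 * csch2 (2 * x $ i) - (\<Sum>j\<in>UNIV - {i}. csch2_pair x i j)"
   by (simp add: drift_deriv_def)
  have q4: "4 * (\<Sum>j\<in>UNIV - {i}. \<Sum>k\<in>UNIV - {i} - {j}. ?t j * ?t k / 4) = (\<Sum>j\<in>UNIV - {i}. \<Sum>k\<in>UNIV - {i} - {j}. ?t j * ?t k)"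
   by (simp add: sum_distrib_left)
  have hS: "(\<Sum>j\<in>UNIV - {i}. 2 * h i * ?t j) = 2 * h i * ?S" by (simp add: sum_distrib_left)
  have sq: "(h i + ?S)\<^sup>2 = (h i)\<^sup>2 + 2 * h i * ?S + ?S\<^sup>2" by (rule power2_sum[of "h i" ?S, unfolded add.assoc, THEN trans]) (simp add: algebra_simps)
  show ?thesis unfolding d dd q4 hS sq S2 sum_subtractf by (simp add: algebra_simps)
 qed
 have "(\<Sum>i\<in>UNIV. (drift q x i)\<^sup>2 + drift_deriv q x i) =
   (\<Sum>i\<in>UNIV. (q + 1)\<^sup>2 + (q\<^sup>2 * csch2 (x $ i) - csch2 (2 * x $ i)))
   + (\<Sum>i\<in>UNIV. \<Sum>j\<in>UNIV - {i}. 2 * h i * coth_pair x i j)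
   + (\<Sum>i\<in>UNIV. \<Sum>j\<in>UNIV - {i}. (coth_pair x i j)\<^sup>2 - csch2_pair x i j)
   + 4 * (\<Sum>i\<in>UNIV. \<Sum>j\<in>UNIV - {i}. \<Sum>k\<in>UNIV - {i} - {j}. coth_pair x i j * coth_pair x i k / 4)"
  unfolding expand single by (simp only: sum.distrib sum_distrib_left)
 also have "(\<Sum>i\<in>UNIV. \<Sum>j\<in>UNIV - {i}. \<Sum>k\<in>UNIV - {i} - {j}. coth_pair x i j * coth_pair x i k / 4) = n * (n - 1) * (n - 2) / 3"
  using triple by (simp add: field_simps)
 also have "(\<Sum>i\<in>UNIV. (q + 1)\<^sup>2 + (q\<^sup>2 * csch2 (x $ i) - csch2 (2 * x $ i))) =
   n * (q + 1)\<^sup>2 + (\<Sum>i\<in>UNIV. q\<^sup>2 * csch2 (x $ i) - csch2 (2 * x $ i))"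
  by (simp add: sum.distrib n_def)
 finally show ?thesis unfolding cross square by (simp add: algebra_simps)
qed

lemma u_potential_eq:
 fixes x :: "'n::{finite,linorder} cvec"
 shows "u_potential (r1, r2, r3) x =
   of_real (r1 * (r1 + 2 * r3 - 1)) * (\<Sum>i\<in>UNIV. csch2 (x $ i))
   + of_real (r2 * (r2 - 1)) * (\<Sum>i\<in>UNIV. \<Sum>j\<in>UNIV - {i}. csch2_pair x i j)
   + of_real (4 * (r3 * (r3 - 1))) * (\<Sum>i\<in>UNIV. csch2 (2 * x $ i))"
proof -
 let ?r = "(r1, r2, r3)"
 define g where "g \<alpha> = of_real (mult_param ?r \<alpha> * (mult_param ?r \<alpha> + 2 * mult_param ?r (2 *\<^sub>R \<alpha>) - 1) * (\<alpha> \<bullet> \<alpha>))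
    / (sinh (root_eval \<alpha> x))\<^sup>2" for \<alpha> :: "'n rvec"
 have short: "g (axis i 1) = of_real (r1 * (r1 + 2 * r3 - 1)) * csch2 (x $ i)" for i
 proof -
  have "axis i 1 \<in> (pos_short :: 'n rvec set)" by (auto simp: pos_short_def)
  then show ?thesis using mult_param_short[of "axis i 1" r1 r2 r3] inner_short[of "axis i 1"]
   by (simp add: g_def mult_param_double root_eval_axis csch2_def)
 qed
 have med: "g \<alpha> = of_real (2 * (r2 * (r2 - 1))) * csch2 (root_eval \<alpha> x)" if "\<alpha> \<in> pos_medium" for \<alpha>
  using that inner_medium[of \<alpha>] mult_param_medium[OF that] by (simp add: g_def mult_param_double csch2_def)
 have long: "g (2 *\<^sub>R axis i 1) = of_real (4 * (r3 * (r3 - 1))) * csch2 (2 * x $ i)" for i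
 proof -
  have l: "2 *\<^sub>R axis i 1 \<in> (pos_long :: 'n rvec set)" by (auto simp: pos_long_def)
  have "(2 *\<^sub>R axis i 1 :: 'n rvec) \<bullet> (2 *\<^sub>R axis i 1) = 4" by (simp add: inner_axis_axis)
  then show ?thesis using mult_param_long[OF l] mult_param_double(3)[OF l]
   by (simp only: g_def root_eval_simps root_eval_axis csch2_def) (simp add: mult_ac)
 qed
 have pair: "g (axis i 1 - axis j 1) + g (axis i 1 + axis j 1) = of_real (2 * (r2 * (r2 - 1))) * csch2_pair x i j"
  if "i < j" for i j
 proof -
  have "axis i 1 - axis j 1 \<in> (pos_medium :: 'n rvec set)" "axis i 1 + axis j 1 \<in> (pos_medium :: 'n rvec set)"
   using that by (auto simp: pos_medium_def)
  then show ?thesis by (simp add: med root_eval_simps root_eval_axis csch2_pair_def distrib_left)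
 qed
 have "u_potential ?r x = (\<Sum>\<alpha>\<in>pos_roots. g \<alpha>)" by (simp add: u_potential_def g_def)
 also have "\<dots> = (\<Sum>i\<in>UNIV. of_real (r1 * (r1 + 2 * r3 - 1)) * csch2 (x $ i))
   + (\<Sum>(i, j)\<in>ordered_pairs. of_real (2 * (r2 * (r2 - 1))) * csch2_pair x i j)
   + (\<Sum>i\<in>UNIV. of_real (4 * (r3 * (r3 - 1))) * csch2 (2 * x $ i))"
  unfolding sum_pos_roots short long
  by (intro arg_cong2[where f = "(+)"] refl sum.cong) (auto simp: ordered_pairs_def pair)
 also have "(\<Sum>(i, j)\<in>ordered_pairs. of_real (2 * (r2 * (r2 - 1))) * csch2_pair x i j) =
   of_real (r2 * (r2 - 1)) * (2 * (\<Sum>(i, j)\<in>ordered_pairs. csch2_pair x i j))"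
  by (simp add: sum_distrib_left case_prod_beta algebra_simps)
 finally show ?thesis unfolding sum_ordered_pairs[OF csch2_pair_sym] by (simp add: sum_distrib_left)
qed

text \<open>
  The potential u combines the potential from drift_square_sum with the one of the Casimir element.
  All single-root terms are multiples of \<open>csch2 (2 x_k)\<close> with a coefficient that is
  polynomial in \<open>cosh (2 x_k)\<close>; the equation
  \<open>(z^2 - 1) csch2 (2 x_k) = 1\<close> for \<open>z = cosh (2 x_k)\<close> reduces
  them to \<open>csch2 (x_k)\<close>, \<open>csch2 (2 x_k)\<close> and a constant.
\<close>

theorem drift_potential_identity:
 fixes x :: "'n::{finite,linorder} cvec" and \<kappa>1 \<kappa>2 \<kappa>t1 \<kappa>v :: int
 assumes x: "x \<in> regular_set" and M: "CARD('n) \<le> M"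
 defines "q \<equiv> of_nat (M - CARD('n)) :: complex"
 shows "(\<Sum>i\<in>UNIV. (drift q x i)\<^sup>2 + drift_deriv q x i)
   - u_potential (real_of_int (\<kappa>2 - \<kappa>1) + (real M - real CARD('n)), real_of_int \<kappa>v + 1, real_of_int (\<kappa>t1 - \<kappa>2) + 1/2) x
   + of_real (C_const M CARD('n) \<kappa>1 \<kappa>2) =
   2 * (of_nat M * (of_int \<kappa>1)\<^sup>2 + of_nat CARD('n) * (of_int \<kappa>2)\<^sup>2
   - (\<Sum>k\<in>UNIV. \<Sum>l\<in>UNIV - {k}. (of_int (\<kappa>v * (\<kappa>v + 1)) / (sinh (x $ k - x $ l))\<^sup>2
     + of_int (\<kappa>v * (\<kappa>v + 1)) / (sinh (x $ k + x $ l))\<^sup>2) / 2)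
   - (\<Sum>k\<in>UNIV. q * (of_int (\<kappa>t1 - \<kappa>1) / (sinh (x $ k))\<^sup>2))
   - (\<Sum>k\<in>UNIV. ((of_int \<kappa>t1 - of_int (\<kappa>2 + \<kappa>1 - \<kappa>t1)) - cosh (2 * x $ k) * (of_int \<kappa>1 - of_int \<kappa>2))\<^sup>2
     / (sinh (2 * x $ k))\<^sup>2 / 2))"
proof -
 note r = regular_set_sinh[OF x]
 define n where "n = (of_nat CARD('n) :: complex)"
 have qn: "of_nat M = q + n" using M by (simp add: q_def n_def of_nat_diff)
 have Mn: "real M - real CARD('n) = real (M - CARD('n))" using M by (simp add: of_nat_diff)
 define A where "A = (\<Sum>i\<in>UNIV. csch2 (x $ i))"
 define B where "B = (\<Sum>i\<in>UNIV. csch2 (2 * x $ i))"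
 define P where "P = (\<Sum>i\<in>UNIV. \<Sum>j\<in>UNIV - {i}. csch2_pair x i j)"
 define a b c d where abcd: "a = (of_int \<kappa>1 :: complex)" "b = (of_int \<kappa>2 :: complex)" "c = (of_int \<kappa>t1 :: complex)" "d = (of_int \<kappa>v :: complex)"
 have u: "u_potential (real_of_int (\<kappa>2 - \<kappa>1) + (real M - real CARD('n)), real_of_int \<kappa>v + 1, real_of_int (\<kappa>t1 - \<kappa>2) + 1/2) x
   = (b - a + q) * (b - a + q + 2 * (c - b)) * A + (d + 1) * d * P + 4 * ((c - b + 1/2) * (c - b - 1/2)) * B"
  unfolding u_potential_eq Mn A_def[symmetric] B_def[symmetric] P_def[symmetric]
  by (simp add: abcd q_def algebra_simps)
 have C: "of_real (C_const M CARD('n) \<kappa>1 \<kappa>2) =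
   (q + 2 * n - (q + 2 * n) ^ 3) / 6 + (q ^ 3 - q) / 6 + (a + b)\<^sup>2 * n + 2 * q * a\<^sup>2"
 proof -
  have "of_real (real M) = q + n" "of_real (real M - real CARD('n)) = q" "of_real (real CARD('n)) = n"
   using qn by (simp_all add: n_def)
  note e = this
  have "of_real (C_const M CARD('n) \<kappa>1 \<kappa>2) = (q + n + n - (q + n + n) ^ 3) / 6 + (q ^ 3 - (q + n) + n) / 6 + (a + b)\<^sup>2 * n + 2 * q * a\<^sup>2"
   unfolding C_const_def of_real_add of_real_diff[of "_ + _"] of_real_divide of_real_power of_real_mult
   using e by (simp add: abcd)
  then show ?thesis by (simp add: algebra_simps)
 qed
 have pairs: "(\<Sum>k\<in>UNIV. \<Sum>l\<in>UNIV - {k}. (of_int (\<kappa>v * (\<kappa>v + 1)) / (sinh (x $ k - x $ l))\<^sup>2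
     + of_int (\<kappa>v * (\<kappa>v + 1)) / (sinh (x $ k + x $ l))\<^sup>2) / 2) = (d * (d + 1)) * P / 2"
  by (simp add: P_def csch2_pair_def csch2_def sum_distrib_left abcd sum_divide_distrib algebra_simps)
 have shorts: "(\<Sum>k\<in>UNIV. q * (of_int (\<kappa>t1 - \<kappa>1) / (sinh (x $ k))\<^sup>2)) = q * (c - a) * A"
  by (simp add: A_def csch2_def sum_distrib_left abcd)
 have one: "((of_int \<kappa>t1 - of_int (\<kappa>2 + \<kappa>1 - \<kappa>t1)) - cosh (2 * x $ k) * (of_int \<kappa>1 - of_int \<kappa>2))\<^sup>2 / (sinh (2 * x $ k))\<^sup>2 / 2
   = ((b - a)\<^sup>2 + ((b - a)\<^sup>2 + 2 * (b - a) * (c - b)) * csch2 (x $ k) + 4 * (c - b)\<^sup>2 * csch2 (2 * x $ k)) / 2" for k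
 proof -
  define z where "z = cosh (2 * x $ k)"
  define w where "w = csch2 (2 * x $ k)"
  have zw: "(z\<^sup>2 - 1) * w = 1"
   using cosh_square_eq[of "2 * x $ k"] r(2)[of k] by (simp add: z_def w_def csch2_def)
  have Aw: "csch2 (x $ k) = 2 * (z + 1) * w"
   using coth_double(5)[OF r(2)[of k]] by (simp add: z_def w_def)
  have "((of_int \<kappa>t1 - of_int (\<kappa>2 + \<kappa>1 - \<kappa>t1)) - cosh (2 * x $ k) * (of_int \<kappa>1 - of_int \<kappa>2))\<^sup>2 / (sinh (2 * x $ k))\<^sup>2 / 2
   = (2 * c - b - a - z * (a - b))\<^sup>2 * w / 2"
   by (simp add: abcd z_def w_def csch2_def algebra_simps)
  also have "(2 * c - b - a - z * (a - b))\<^sup>2 * w = (b - a)\<^sup>2 + ((b - a)\<^sup>2 + 2 * (b - a) * (c - b)) * (2 * (z + 1) * w) + 4 * (c - b)\<^sup>2 * w"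
   using zw by algebra
  finally show ?thesis unfolding Aw w_def[symmetric] .
 qed
 have longs: "(\<Sum>k\<in>UNIV. ((of_int \<kappa>t1 - of_int (\<kappa>2 + \<kappa>1 - \<kappa>t1)) - cosh (2 * x $ k) * (of_int \<kappa>1 - of_int \<kappa>2))\<^sup>2
     / (sinh (2 * x $ k))\<^sup>2 / 2) = (n * (b - a)\<^sup>2 + ((b - a)\<^sup>2 + 2 * (b - a) * (c - b)) * A + 4 * (c - b)\<^sup>2 * B) / 2"
  unfolding one by (simp add: n_def A_def B_def sum.distrib sum_distrib_left sum_divide_distrib[symmetric])
 have AB: "(\<Sum>i\<in>UNIV. q\<^sup>2 * csch2 (x $ i) - csch2 (2 * x $ i)) = q\<^sup>2 * A - B"
  by (simp add: A_def B_def sum_subtractf sum_distrib_left)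
 show ?thesis
  unfolding pairs shorts longs u C drift_square_sum[OF x] AB
  unfolding qn abcd[symmetric] n_def[symmetric]
  by (simp add: field_simps power2_eq_square power3_eq_cube)
qed

section \<open>The conjugated Laplacian\<close>

lemma partial_mult:
 assumes "holomorphic_several f U" "holomorphic_several g U" "x \<in> U"
 shows "partial i (\<lambda>y. f y * g y) x = partial i f x * g x + f x * partial i g x"
 by (rule partial_eq)
  (use DERIV_mult[OF partial_has_field_derivative[OF assms(1,3), of i] partial_has_field_derivative[OF assms(2,3), of i]]
   in \<open>simp add: algebra_simps\<close>)

lemma partial_add:
 assumes "holomorphic_several f U" "holomorphic_several g U" "x \<in> U"
 shows "partial i (\<lambda>y. f y + g y) x = partial i f x + partial i g x"
 by (rule partial_eq)
  (use DERIV_add[OF partial_has_field_derivative[OF assms(1,3), of i] partial_has_field_derivative[OF assms(2,3), of i]]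
   in simp)

lemma partial_compose:
 assumes "holomorphic_several f U" "x \<in> U" "DERIV F (f x) :> d"
 shows "partial i (\<lambda>y. F (f y)) x = d * partial i f x"
proof (rule partial_eq)
 have "DERIV F (f (x + 0 *s axis i 1)) :> d" using assms(3) by simp
 from DERIV_chain2[OF this partial_has_field_derivative[OF assms(1,2), of i]]
 show "DERIV (\<lambda>t. F (f (x + t *s axis i 1))) 0 :> d * partial i f x" by simp
qed

lemma holomorphic_root_eval: "holomorphic_several (root_eval \<alpha>) U"
 unfolding root_eval_def
 by (intro holo_sum holo_mult holo_const holo_coord)

lemma partial_root_eval: "partial i (root_eval \<alpha>) x = of_real (\<alpha> $ i)"
proof (rule partial_eq)
 have "root_eval \<alpha> (x + t *s axis i 1) = root_eval \<alpha> x + t * of_real (\<alpha> $ i)" for t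
 proof -
  have "(\<Sum>k\<in>UNIV. of_real (\<alpha> $ k) * (t * axis i 1 $ k)) = (\<Sum>k\<in>UNIV. if k = i then t * of_real (\<alpha> $ i) else 0)"
   by (intro sum.cong refl) (auto simp: axis_def)
  then show ?thesis by (simp add: root_eval_def sum.distrib distrib_left)
 qed
 then show "DERIV (\<lambda>t. root_eval \<alpha> (x + t *s axis i 1)) 0 :> of_real (\<alpha> $ i)"
  by (auto intro!: derivative_eq_intros)
qed

lemma holomorphic_sinh_root: "holomorphic_several (\<lambda>y. sinh (root_eval \<alpha> y)) U"
 by (rule holo_compose[OF holomorphic_root_eval])
  (auto simp: field_differentiable_def intro!: exI derivative_eq_intros)

text \<open>
 A continuous logarithm of a holomorphic function is holomorphic: near a point it differs from the
 principal logarithm of a quotient by a constant.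
\<close>

lemma continuous_log_holomorphic:
 fixes \<theta> h :: "'n::finite cvec \<Rightarrow> complex"
 assumes U: "open U" and h: "holomorphic_several h U" and cont: "continuous_on U \<theta>"
  and exp: "\<And>x. x \<in> U \<Longrightarrow> exp (\<theta> x) = h x"
 shows "holomorphic_several \<theta> U"
 unfolding holomorphic_several_def
proof
 fix x assume x: "x \<in> U"
 define g where "g y = h y / h x" for y
 have hx: "h x \<noteq> 0" using exp[OF x] by (metis exp_not_eq_zero)
 have g: "holomorphic_several g U" unfolding g_def
  using hx by (intro holo_divide h holo_const)
 have "g x = 1" using hx by (simp add: g_def)
 then have "holomorphic_several (\<lambda>y. \<theta> x + Ln (g y)) {x}"
  by (intro holo_add holo_const
    holo_compose[OF holo_subset[OF g]])
   (use x in \<open>auto intro!: field_differentiable_at_Ln\<close>)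
 then obtain f' where f': "((\<lambda>y. \<theta> x + Ln (g y)) has_derivative f') (at x)" "\<And>c v. f' (c *s v) = c * f' v"
  unfolding holomorphic_several_def by blast
 have "(\<theta> \<longlongrightarrow> \<theta> x) (at x)" using cont x U by (simp add: continuous_on_eq_continuous_at isCont_def)
 then have "eventually (\<lambda>y. dist (\<theta> y) (\<theta> x) < pi) (at x)" by (rule tendstoD) (simp add: pi_gt_zero)
 moreover have "eventually (\<lambda>y. y \<in> U) (at x)" by (rule eventually_at_in_open'[OF U x])
 ultimately have "eventually (\<lambda>y. \<theta> x + Ln (g y) = \<theta> y) (at x)"
 proof eventually_elim
  case (elim y)
  have "\<bar>Im (\<theta> y - \<theta> x)\<bar> < pi" using elim(1) abs_Im_le_cmod[of "\<theta> y - \<theta> x"] by (simp add: dist_norm)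
  then have "Ln (exp (\<theta> y - \<theta> x)) = \<theta> y - \<theta> x" by (intro Ln_exp) auto
  moreover have "exp (\<theta> y - \<theta> x) = g y" using exp[OF elim(2)] exp[OF x] by (simp add: exp_diff g_def)
  ultimately show ?case by simp
 qed
 then have "(\<theta> has_derivative f') (at x)"
  by (rule has_derivative_transform_eventually[OF f'(1)]) (simp_all add: \<open>g x = 1\<close>)
 with f'(2) show "\<exists>f'. (\<theta> has_derivative f') (at x) \<and> (\<forall>c v. f' (c *s v) = c * f' v)" by blast
qed

lemma log_sinh_branch_holomorphic:
 assumes "open U" "log_sinh_branch U \<theta>" "\<alpha> \<in> pos_roots"
 shows "holomorphic_several (\<theta> \<alpha>) U"
 using assms by (intro continuous_log_holomorphic[OF assms(1) holomorphic_sinh_root[of \<alpha>]]) (auto simp: log_sinh_branch_def)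

lemma partial_log_sinh_branch:
 assumes U: "open U" and \<theta>: "log_sinh_branch U \<theta>" and \<alpha>: "\<alpha> \<in> pos_roots" and x: "x \<in> U"
 shows "partial i (\<theta> \<alpha>) x = of_real (\<alpha> $ i) * coth (root_eval \<alpha> x)"
proof -
 have e: "exp (\<theta> \<alpha> y) = sinh (root_eval \<alpha> y)" if "y \<in> U" for y
  using \<theta> \<alpha> that by (auto simp: log_sinh_branch_def)
 have "exp (\<theta> \<alpha> x) * partial i (\<theta> \<alpha>) x = partial i (\<lambda>y. exp (\<theta> \<alpha> y)) x"
  by (rule partial_compose[OF log_sinh_branch_holomorphic[OF U \<theta> \<alpha>] x DERIV_exp, symmetric])
 also have "\<dots> = partial i (\<lambda>y. sinh (root_eval \<alpha> y)) x"
  by (rule partial_cong[OF U x]) (rule e)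
 also have "\<dots> = cosh (root_eval \<alpha> x) * of_real (\<alpha> $ i)"
  unfolding partial_root_eval[symmetric, of \<alpha> i x]
  by (rule partial_compose[OF holomorphic_root_eval UNIV_I]) (auto intro!: derivative_eq_intros)
 finally have "sinh (root_eval \<alpha> x) * partial i (\<theta> \<alpha>) x = cosh (root_eval \<alpha> x) * of_real (\<alpha> $ i)"
  unfolding e[OF x] .
 moreover have "sinh (root_eval \<alpha> x) \<noteq> 0" using e[OF x] by (metis exp_not_eq_zero)
 ultimately show ?thesis by (simp add: coth_def field_simps)
qed

lemma sum_indicator_first: "(\<Sum>k\<in>UNIV. (if k = i then 1 else 0) * F k) = (F i :: complex)" for i :: "'n::finite"
proof -
 have "(\<Sum>k\<in>UNIV. (if k = i then 1 else 0) * F k) = (\<Sum>k\<in>UNIV. if k = i then F k else 0)"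
  by (intro sum.cong) auto
 then show ?thesis by simp
qed

text \<open>
  Summation over the positive roots collects the roots in which \<open>x_i\<close> occurs; those of
  medium length come in pairs.
\<close>

lemma drift_sum_roots:
 fixes x :: "'n::{finite,linorder} cvec"
 shows "(\<Sum>\<alpha>\<in>pos_roots. of_real (mult_param (q, 1, 1/2) \<alpha>) * (of_real (\<alpha> $ i) * coth (root_eval \<alpha> x)))
   = drift (of_real q) x i"
proof -
 define g where "g \<alpha> = of_real (mult_param (q, 1, 1/2) \<alpha>) * (of_real (\<alpha> $ i) * coth (root_eval \<alpha> x))" for \<alpha>
 let ?d = "\<lambda>k::'n. (if k = i then 1 else 0 :: complex)"
 define G where "G k l = ?d k * coth_pair x k l + ?d l * coth_pair x l k" for k l
 have short: "g (axis k 1) = ?d k * (of_real q * coth (x $ k))" for k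
 proof -
  have "axis k 1 \<in> (pos_short :: 'n rvec set)" by (auto simp: pos_short_def)
  from mult_param_short[OF this] show ?thesis
   by (simp add: g_def root_eval_axis axis_entry)
 qed
 have long: "g (2 *\<^sub>R axis k 1) = ?d k * coth (2 * x $ k)" for k
 proof -
  have "2 *\<^sub>R axis k 1 \<in> (pos_long :: 'n rvec set)" by (auto simp: pos_long_def)
  from mult_param_long[OF this] show ?thesis
   unfolding g_def root_eval_simps root_eval_axis by (simp add: axis_entry)
 qed
 have pair: "g (axis k 1 - axis l 1) + g (axis k 1 + axis l 1) = G k l" if "k < l" for k l
 proof -
  have "axis k 1 - axis l 1 \<in> (pos_medium :: 'n rvec set)" "axis k 1 + axis l 1 \<in> (pos_medium :: 'n rvec set)"
   using that by (auto simp: pos_medium_def)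
  note m = this[THEN mult_param_medium]
  have "coth (x $ l - x $ k) = - coth (x $ k - x $ l)" using coth_minus[of "x $ k - x $ l"] by simp
  then show ?thesis using that
   unfolding g_def m root_eval_simps root_eval_axis
   by (auto simp: G_def coth_pair_def axis_entry add.commute)
 qed
 have "(\<Sum>\<alpha>\<in>pos_roots. g \<alpha>) = (\<Sum>k\<in>UNIV. ?d k * (of_real q * coth (x $ k)))
   + (\<Sum>(k, l)\<in>ordered_pairs. G k l) + (\<Sum>k\<in>UNIV. ?d k * coth (2 * x $ k))"
  unfolding sum_pos_roots short long
  by (intro arg_cong2[where f = "(+)"] refl sum.cong) (auto simp: ordered_pairs_def pair)
 also have "(\<Sum>(k, l)\<in>ordered_pairs. G k l) = (\<Sum>l\<in>UNIV - {i}. coth_pair x i l)"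
 proof -
  have "2 * (\<Sum>(k, l)\<in>ordered_pairs. G k l) = (\<Sum>k\<in>UNIV. \<Sum>l\<in>UNIV - {k}. G k l)"
   by (rule sum_ordered_pairs) (simp add: G_def add.commute)
  also have "\<dots> = 2 * (\<Sum>k\<in>UNIV. \<Sum>l\<in>UNIV - {k}. ?d k * coth_pair x k l)"
   using sum_off_diag_swap[of "\<lambda>k l. ?d k * coth_pair x k l"]
   unfolding G_def sum.distrib by (simp only: mult_2)
  also have "(\<Sum>k\<in>UNIV. \<Sum>l\<in>UNIV - {k}. ?d k * coth_pair x k l) = (\<Sum>l\<in>UNIV - {i}. coth_pair x i l)"
   unfolding sum_distrib_left[symmetric] by (rule sum_indicator_first)
  finally show ?thesis by simp
 qed
 finally show ?thesis unfolding g_def sum_indicator_first by (simp add: drift_def)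
qed

lemma delta_exp:
 assumes "x \<in> U"
 shows "delta p \<theta> x = exp (\<Sum>\<alpha>\<in>pos_roots. of_real (mult_param p \<alpha>) * \<theta> \<alpha> x)"
 by (simp add: delta_def exp_sum finite_pos_roots)

lemma partial_sum:
 assumes "finite A" "\<And>a. a \<in> A \<Longrightarrow> holomorphic_several (f a) U" "x \<in> U"
 shows "partial i (\<lambda>y. \<Sum>a\<in>A. c a * f a y) x = (\<Sum>a\<in>A. c a * partial i (f a) x)"
proof (rule partial_eq)
 show "DERIV (\<lambda>t. \<Sum>a\<in>A. c a * f a (x + t *s axis i 1)) 0 :> (\<Sum>a\<in>A. c a * partial i (f a) x)"
  using assms by (auto intro!: DERIV_sum DERIV_cmult partial_has_field_derivative)
qed

lemma delta_holomorphic: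
 assumes "open U" "log_sinh_branch U \<theta>"
 shows "holomorphic_several (delta p \<theta>) U"
 unfolding delta_def
 by (intro holo_prod
   holo_compose[OF holo_mult[OF holo_const log_sinh_branch_holomorphic[OF assms]]])
  (auto simp: field_differentiable_def intro!: exI derivative_eq_intros)

lemma partial_delta:
 fixes \<theta> :: "'n::{finite,linorder} rvec \<Rightarrow> 'n cvec \<Rightarrow> complex"
 assumes U: "open U" and \<theta>: "log_sinh_branch U \<theta>" and x: "x \<in> U"
 shows "partial i (delta (q, 1, 1/2) \<theta>) x = delta (q, 1, 1/2) \<theta> x * drift (of_real q) x i"
proof -
 let ?m = "\<lambda>\<alpha>. of_real (mult_param (q, 1, 1/2) \<alpha>) :: complex"
 have hol: "holomorphic_several (\<lambda>y. \<Sum>\<alpha>\<in>pos_roots. ?m \<alpha> * \<theta> \<alpha> y) U"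
  by (intro holo_sum holo_mult holo_const log_sinh_branch_holomorphic[OF U \<theta>])
 have "partial i (delta (q, 1, 1/2) \<theta>) x = partial i (\<lambda>y. exp (\<Sum>\<alpha>\<in>pos_roots. ?m \<alpha> * \<theta> \<alpha> y)) x"
  by (rule partial_cong[OF U x]) (rule delta_exp)
 also have "\<dots> = exp (\<Sum>\<alpha>\<in>pos_roots. ?m \<alpha> * \<theta> \<alpha> x) * partial i (\<lambda>y. \<Sum>\<alpha>\<in>pos_roots. ?m \<alpha> * \<theta> \<alpha> y) x"
  by (rule partial_compose[OF hol x DERIV_exp])
 also have "partial i (\<lambda>y. \<Sum>\<alpha>\<in>pos_roots. ?m \<alpha> * \<theta> \<alpha> y) x = (\<Sum>\<alpha>\<in>pos_roots. ?m \<alpha> * partial i (\<theta> \<alpha>) x)"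
  by (rule partial_sum[OF finite_pos_roots log_sinh_branch_holomorphic[OF U \<theta>] x])
 also have "\<dots> = (\<Sum>\<alpha>\<in>pos_roots. ?m \<alpha> * (of_real (\<alpha> $ i) * coth (root_eval \<alpha> x)))"
  by (intro sum.cong refl) (simp add: partial_log_sinh_branch[OF U \<theta> _ x])
 finally show ?thesis unfolding drift_sum_roots delta_exp[OF x, symmetric] .
qed

lemma coth_differentiable: "sinh z \<noteq> 0 \<Longrightarrow> DERIV coth z :> - csch2 z"
 unfolding coth_def[abs_def] csch2_def
 by (auto intro!: derivative_eq_intros simp: field_simps power2_eq_square cosh_square_eq[unfolded power2_eq_square])

lemma holomorphic_coth:
 "holomorphic_several f U \<Longrightarrow> (\<And>x. x \<in> U \<Longrightarrow> sinh (f x) \<noteq> 0) \<Longrightarrow> holomorphic_several (\<lambda>x. coth (f x)) U"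
 by (rule holo_compose) (auto simp: field_differentiable_def intro: coth_differentiable)

lemma holomorphic_csch2:
 assumes f: "holomorphic_several f U" and nz: "\<And>x. x \<in> U \<Longrightarrow> sinh (f x) \<noteq> 0"
 shows "holomorphic_several (\<lambda>x. c / (sinh (f x))\<^sup>2) U"
proof -
 have "holomorphic_several (\<lambda>x. sinh (f x)) U"
  by (rule holo_compose[OF f]) (auto simp: field_differentiable_def intro!: exI derivative_eq_intros)
 then show ?thesis using nz
  by (intro holo_divide holo_const holo_power) auto
qed

lemmas holo_intros = holo_const holo_coord holo_add
 holo_mult holo_diff holo_sum holo_power
 holomorphic_coth holomorphic_csch2

lemma drift_holomorphic: "holomorphic_several (\<lambda>y. drift q y i) regular_set"
 unfolding drift_def coth_pair_def
 by (intro holo_intros) (auto simp: regular_set_sinh)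

lemma partial_drift:
 fixes x :: "'n::{finite,linorder} cvec"
 assumes x: "x \<in> regular_set"
 shows "partial i (\<lambda>y. drift q y i) x = drift_deriv q x i"
proof (rule partial_eq)
 note r = regular_set_sinh[OF x]
 have e: "(x + t *s axis i 1) $ j = x $ j + t * (if j = i then 1 else 0)" for t j by (simp add: axis_def)
 have c: "DERIV (\<lambda>t. coth (a + t * b)) 0 :> - csch2 a * b" if "sinh a \<noteq> 0" for a b
 proof -
  have "DERIV (\<lambda>t. a + t * b) 0 :> b" by (auto intro!: derivative_eq_intros)
  moreover have "DERIV coth (a + 0 * b) :> - csch2 a" using coth_differentiable[OF that] by simp
  ultimately show ?thesis by (rule DERIV_chain2[rotated])
 qed
 have "drift q (x + t *s axis i 1) i = q * coth (x $ i + t * 1) + coth (2 * x $ i + t * 2)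
   + (\<Sum>j\<in>UNIV - {i}. coth (x $ i - x $ j + t * 1) + coth (x $ i + x $ j + t * 1))" for t
  unfolding drift_def coth_pair_def e by (auto simp: algebra_simps intro!: sum.cong)
 moreover have "DERIV (\<lambda>t. q * coth (x $ i + t * 1) + coth (2 * x $ i + t * 2)
   + (\<Sum>j\<in>UNIV - {i}. coth (x $ i - x $ j + t * 1) + coth (x $ i + x $ j + t * 1))) 0 :> q * (- csch2 (x $ i) * 1) + - csch2 (2 * x $ i) * 2 +
    (\<Sum>j\<in>UNIV - {i}. - csch2 (x $ i - x $ j) * 1 + - csch2 (x $ i + x $ j) * 1)"
  by (intro DERIV_add DERIV_cmult DERIV_sum c) (auto simp: r)
 moreover have "q * (- csch2 (x $ i) * 1) + - csch2 (2 * x $ i) * 2 +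
    (\<Sum>j\<in>UNIV - {i}. - csch2 (x $ i - x $ j) * 1 + - csch2 (x $ i + x $ j) * 1) = drift_deriv q x i"
  by (simp add: drift_deriv_def csch2_pair_def sum_negf sum_subtractf sum.distrib)
 ultimately show "DERIV (\<lambda>t. drift q (x + t *s axis i 1) i) 0 :> drift_deriv q x i" by simp
qed

text \<open>
  The product rule, twice.
\<close>

theorem delta_laplacian:
 fixes \<theta> :: "'n::{finite,linorder} rvec \<Rightarrow> 'n cvec \<Rightarrow> complex"
 assumes U: "open U" "U \<subseteq> regular_set" and \<theta>: "log_sinh_branch U \<theta>" and \<psi>: "holomorphic_several \<psi> U" and x: "x \<in> U"
 shows "inverse (delta (q, 1, 1/2) \<theta> x) * laplacian_A (\<lambda>y. delta (q, 1, 1/2) \<theta> y * \<psi> y) x =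
  (\<Sum>i\<in>UNIV. partial i (partial i \<psi>) x + 2 * drift (of_real q) x i * partial i \<psi> x
    + ((drift (of_real q) x i)\<^sup>2 + drift_deriv (of_real q) x i) * \<psi> x)"
proof -
 let ?D = "delta (q, 1, 1/2) \<theta>" and ?q = "of_real q :: complex"
 have D: "holomorphic_several ?D U" by (rule delta_holomorphic[OF U(1) \<theta>])
 have L: "holomorphic_several (\<lambda>y. drift ?q y i) U" for i
  by (rule holo_subset[OF drift_holomorphic U(2)])
 have P: "holomorphic_several (partial i \<psi>) U" for i by (rule partial_holomorphic[OF \<psi> U(1)])
 have nz: "?D x \<noteq> 0" by (simp add: delta_exp[OF x])
 have "partial i (partial i (\<lambda>y. ?D y * \<psi> y)) x =
   ?D x * (partial i (partial i \<psi>) x + 2 * drift ?q x i * partial i \<psi> x + ((drift ?q x i)\<^sup>2 + drift_deriv ?q x i) * \<psi> x)" for i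
 proof -
  have "partial i (partial i (\<lambda>y. ?D y * \<psi> y)) x = partial i (\<lambda>y. ?D y * (drift ?q y i * \<psi> y + partial i \<psi> y)) x"
   by (rule partial_cong[OF U(1) x])
    (simp only: partial_mult[OF D \<psi>] partial_delta[OF U(1) \<theta>], simp add: algebra_simps)
  also have "\<dots> = partial i ?D x * (drift ?q x i * \<psi> x + partial i \<psi> x)
    + ?D x * (partial i (\<lambda>y. drift ?q y i * \<psi> y) x + partial i (partial i \<psi>) x)"
   by (simp add: partial_mult[OF D holo_add[OF holo_mult[OF L \<psi>] P] x]
     partial_add[OF holo_mult[OF L \<psi>] P x])
  also have "partial i (\<lambda>y. drift ?q y i * \<psi> y) x = drift_deriv ?q x i * \<psi> x + drift ?q x i * partial i \<psi> x"
   using partial_mult[OF L \<psi> x] partial_drift[of x] x U(2) by auto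
  finally show ?thesis unfolding partial_delta[OF U(1) \<theta> x] by (simp add: algebra_simps power2_eq_square)
 qed
 then show ?thesis using nz by (simp add: laplacian_A_def sum_distrib_left[symmetric])
qed

section \<open>The one-dimensional space of values on A\<close>

lemma det_twist_vec: "det_twist b \<sigma> g *v w = (det g powi b) *s (\<sigma> g *v w)"
 by (simp add: det_twist_def matrix_vector_mult_def vec_eq_iff sum_distrib_left mult.assoc)

lemma rational_rep_det_twist:
 fixes \<sigma> :: "'r::finite cmat \<Rightarrow> 'd::finite cmat"
 assumes \<sigma>: "rational_rep \<sigma>" shows "rational_rep (det_twist b \<sigma>)"
 unfolding rational_rep_def
proof (intro conjI allI ballI)
 show "regular_GL (\<lambda>g. det_twist b \<sigma> g $ i $ j)" for i j
  unfolding det_twist_def using \<sigma>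
  by (auto simp: intro!: regular_GL_mult regular_GL_det_powi rational_rep_regular)
 show "det_twist b \<sigma> (mat 1) = mat 1"
  by (simp add: det_twist_def rational_rep_one[OF \<sigma>] vec_eq_iff)
 fix g h :: "'r cmat" assume gh: "g \<in> GL" "h \<in> GL"
 then show "det_twist b \<sigma> (g ** h) = det_twist b \<sigma> g ** det_twist b \<sigma> h"
  unfolding det_twist_def rational_rep_mult[OF \<sigma> gh] det_mul power_int_mult_distrib
  by (simp add: vec_eq_iff matrix_matrix_mult_def[of "\<sigma> g"] matrix_matrix_mult_def[of "\<chi> i j. _ i j"] sum_distrib_left mult_ac)
qed

lemma drep_det_twist_unit:
 fixes \<sigma> :: "'r::{finite,linorder} cmat \<Rightarrow> 'd::finite cmat"
 assumes \<sigma>: "rational_rep \<sigma>"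
 shows "drep (det_twist b \<sigma>) (E i j) *v w =
  drep \<sigma> (E i j) *v w + (if i = j then of_int b else 0) *s w"
proof -
 let ?l = "line1 (E i j :: 'r cmat)"
 let ?X = "E i j :: 'r cmat"
 have "(drep (det_twist b \<sigma>) ?X *v w) $ p = (drep \<sigma> ?X *v w + (if i = j then of_int b else 0) *s w) $ p" for p
 proof -
  have d: "DERIV (\<lambda>t. (det_twist b \<sigma> (?l t) *v w) $ p) 0 :> (drep (det_twist b \<sigma>) ?X *v w) $ p"
   by (rule drep_curve_vec[OF rational_rep_det_twist[OF \<sigma>] line1_derivative line1_0])
  have "DERIV (\<lambda>t. det (?l t) powi b * (\<sigma> (?l t) *v w) $ p) 0 :> (if i = j then of_int b else 0) * (\<sigma> (?l 0) *v w) $ p + (drep \<sigma> ?X *v w) $ p * det (?l 0) powi b"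
  proof (rule DERIV_mult)
   show "DERIV (\<lambda>t. (\<sigma> (?l t) *v w) $ p) 0 :> (drep \<sigma> ?X *v w) $ p"
    by (rule drep_curve_vec[OF \<sigma> line1_derivative line1_0])
   show "DERIV (\<lambda>t. det (?l t) powi b) 0 :> (if i = j then of_int b else 0)"
    by (auto simp: line1_unit_det intro!: derivative_eq_intros)
  qed
  then have "DERIV (\<lambda>t. (det_twist b \<sigma> (?l t) *v w) $ p) 0 :> (if i = j then of_int b else 0) * (\<sigma> (?l 0) *v w) $ p + (drep \<sigma> ?X *v w) $ p * det (?l 0) powi b"
   by (simp add: det_twist_vec)
  from DERIV_unique[OF d this] show ?thesis
   by (simp add: rational_rep_one[OF \<sigma>])
 qed
 then show ?thesis by (simp add: vec_eq_iff)
qed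

lemma tensor_vec_scale: "tensor_vec (c *s u) v = c *s tensor_vec u v" "tensor_vec u (c *s v) = c *s tensor_vec u v"
 by (simp_all add: tensor_vec_def vec_eq_iff)

lemma tensor_vec_zero: "tensor_vec u 0 = 0" "tensor_vec 0 v = 0"
 by (simp_all add: tensor_vec_def vec_eq_iff)

lemma tensor_vec_cancel: "u \<noteq> 0 \<Longrightarrow> tensor_vec u v = tensor_vec u v' \<Longrightarrow> v = v'"
 unfolding vec_eq_iff[where x = u] by (auto simp: tensor_vec_def vec_eq_iff)

text \<open>
  The two representations of the theorem: W has highest weight \<open>\<kappa>1 + cW\<close> on
  the first n places and \<open>\<kappa>1\<close> on the others, V has highest weight
  \<open>\<kappa> (n - 1), - \<kappa>, ..., - \<kappa>\<close> and is twisted by the power b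
  of the determinant. The vector v1 has weight b in every coordinate.
\<close>

locale radial_data = W: rectangular_rep \<rho> "initial CARD('n)" \<kappa>1 cW \<xi> w0 +
  V: rectangular_rep \<sigma> "{i0}" "- int \<kappa>" "\<kappa> * CARD('n)" \<eta> v0
 for \<rho> :: "'m::{finite,linorder} cmat \<Rightarrow> 'w::finite cmat"
  and \<sigma> :: "'n::{finite,linorder} cmat \<Rightarrow> 'v::finite cmat"
  and \<kappa>1 cW \<xi> w0 \<kappa> i0 \<eta> v0 +
 fixes \<kappa>2 b :: int and \<tau> :: "'n cmat \<Rightarrow> 'v cmat" and v1 :: "'v cvec"
 assumes le: "CARD('n) \<le> CARD('m)" and least: "\<And>i. i0 \<le> i"
  and b: "b = \<kappa>2 - int cW" and tau: "\<tau> = det_twist b \<sigma>"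
  and v1: "v1 \<in> V_tilde b \<tau>" "v1 \<noteq> 0"
begin

lemma tau_rational: "rational_rep \<tau>"
 unfolding tau by (rule rational_rep_det_twist[OF V.rational])

lemma V_tilde_zero_weight:
 assumes v: "v \<in> V_tilde b \<tau>" and t: "\<And>i. t $ i \<noteq> 0"
 shows "\<sigma> (diag_matrix t) *v v = v"
proof -
 have nz: "(\<Prod>i\<in>UNIV. t $ i powi b) \<noteq> 0" using t by (simp add: prod_zero_iff)
 have "(\<Prod>i\<in>UNIV. t $ i powi b) *s v = \<tau> (diag_matrix t) *v v"
  using v t by (simp add: V_tilde_def)
 also have "\<dots> = (\<Prod>i\<in>UNIV. t $ i powi b) *s (\<sigma> (diag_matrix t) *v v)"
  unfolding tau det_twist_vec by (simp add: det_diag_matrix prod_powi)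
 finally show ?thesis using nz by (simp add: vec_eq_iff)
qed

lemma V_tilde_function:
 assumes "v \<in> V_tilde b \<tau>"
 shows "\<exists>k. \<forall>g\<in>GL. dot \<eta> (\<sigma> g *v v) = k * (det g powi - int \<kappa> * (\<Prod>b\<in>UNIV. g $ i0 $ b ^ \<kappa>))"
 by (rule V.zero_weight_function[OF refl least refl refl V_tilde_zero_weight[OF assms]])

lemma v1_function:
 obtains k where "k \<noteq> 0" "\<And>g. g \<in> GL \<Longrightarrow> dot \<eta> (\<sigma> g *v v1) = k * (det g powi - int \<kappa> * (\<Prod>b\<in>UNIV. g $ i0 $ b ^ \<kappa>))"
proof -
 obtain k where k: "\<forall>g\<in>GL. dot \<eta> (\<sigma> g *v v1) = k * (det g powi - int \<kappa> * (\<Prod>b\<in>UNIV. g $ i0 $ b ^ \<kappa>))"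
  using V_tilde_function[OF v1(1)] by blast
 have "k \<noteq> 0" using k V.separation[of v1] v1(2) by auto
 then show thesis using k that by blast
qed

text \<open>
  The coefficient function of a vector of weight zero is determined up to a factor, so weight zero
  vectors form a line.
\<close>

lemma V_tilde_line:
 assumes v: "v \<in> V_tilde b \<tau>" shows "\<exists>s. v = s *s v1"
proof -
 obtain k where k: "k \<noteq> 0" "\<And>g. g \<in> GL \<Longrightarrow> dot \<eta> (\<sigma> g *v v1) = k * (det g powi - int \<kappa> * (\<Prod>b\<in>UNIV. g $ i0 $ b ^ \<kappa>))"
  using v1_function by blast
 obtain l where l: "\<forall>g\<in>GL. dot \<eta> (\<sigma> g *v v) = l * (det g powi - int \<kappa> * (\<Prod>b\<in>UNIV. g $ i0 $ b ^ \<kappa>))"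
  using V_tilde_function[OF v] by blast
 have "v = (l / k) *s v1"
  by (rule V.separation_eq) (use k l in \<open>simp add: mv_scale dot_scale\<close>)
 then show ?thesis ..
qed

lemma range_emb_initial: "i \<in> initial CARD('n) \<longleftrightarrow> i \<in> range (emb :: 'n \<Rightarrow> 'm)"
 using range_emb[OF le] by simp

lemma emb_initial: "(emb (k :: 'n) :: 'm) \<in> initial CARD('n)"
 by (simp add: range_emb_initial)

lemma drep_tau: "drep \<tau> (E i j) *v w = drep \<sigma> (E i j) *v w + (if i = j then of_int b else 0) *s w"
 unfolding tau by (rule drep_det_twist_unit[OF V.rational])

lemma drep_tau_raise_lower:
 assumes "i \<noteq> j"
 shows "drep \<tau> (E i j) *v (drep \<tau> (E j i) *v v1) = (of_nat \<kappa> * (of_nat \<kappa> + 1)) *s v1"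
proof -
 obtain k where k: "\<And>g. g \<in> GL \<Longrightarrow> dot \<eta> (\<sigma> g *v v1) = k * (det g powi - int \<kappa> * (\<Prod>b\<in>UNIV. g $ i0 $ b ^ \<kappa>))"
  using v1_function by blast
 show ?thesis
  using V.zero_weight_raise_lower[OF k assms] assms by (simp add: drep_tau)
qed

lemma drep_tau_diagonal: "drep \<tau> (E i i) *v v1 = of_int b *s v1"
 using V.zero_weight_diagonal[OF V_tilde_zero_weight[OF v1(1)]] by (simp add: drep_tau)

abbreviation F where "F \<equiv> spherical_functions \<kappa>1 \<kappa>2 \<rho> \<tau>"

lemma spherical: "f \<in> F \<Longrightarrow> spherical \<rho> \<tau> \<kappa>1 \<kappa>2 f"
 by unfold_locales (use le W.rational tau_rational in auto)

definition e0 :: "('w \<times> 'v) cvec" where "e0 = tensor_vec w0 v1"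

lemma e0_nonzero: "e0 \<noteq> 0"
 using tensor_vec_cancel[OF W.v0_nonzero, of v1 0] v1(2) by (auto simp: e0_def tensor_vec_zero)

definition torus_block :: "'n cvec \<Rightarrow> 'm cmat" where
 "torus_block t = (\<chi> i j. if i = j then (\<Prod>k\<in>UNIV. if emb k = i then t $ k else 1) else 0)"

lemma prod_emb: "(\<Prod>k\<in>UNIV. if (emb k :: 'm) = emb (l::'n) then t k else 1) = (t l :: complex)"
proof -
 have "(\<Prod>k\<in>UNIV. if (emb k :: 'm) = emb l then t k else 1) = (\<Prod>k\<in>UNIV. if k = l then t k else 1)"
  by (intro prod.cong refl) (simp add: emb_eq[OF le])
 then show ?thesis by simp
qed

lemma det_torus_block: "det (torus_block t) = (\<Prod>k\<in>UNIV. t $ k)"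
proof -
 have "det (torus_block t) = det (\<chi> i j. torus_block t $ emb i $ emb (j::'n))"
 proof (rule det_embed[OF emb_inj[OF le]])
  fix i j :: 'm assume ij: "i \<notin> range (emb :: 'n \<Rightarrow> 'm) \<or> j \<notin> range (emb :: 'n \<Rightarrow> 'm)"
  show "torus_block t $ i $ j = (if i = j then 1 else 0)"
   using ij by (auto simp: torus_block_def intro!: prod.neutral)
 qed
 also have "(\<chi> i j. torus_block t $ emb i $ emb (j::'n)) = diag_matrix t"
  by (simp add: vec_eq_iff torus_block_def diag_matrix_def emb_eq[OF le] prod_emb)
 finally show ?thesis by (simp add: det_diag_matrix)
qed

lemma torus_block_off_diagonal: "i \<noteq> j \<Longrightarrow> torus_block t $ i $ j = 0"
 by (simp add: torus_block_def)

lemma minor_torus_block: "minor (initial CARD('n)) (torus_block t) = det (torus_block t)"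
proof -
 have "mask (initial CARD('n)) (torus_block t) = torus_block t"
  by (auto simp: mask_def vec_eq_iff torus_block_def range_emb_initial mat_def intro!: prod.neutral)
 then show ?thesis by (simp add: minor_def)
qed

lemma mult_amat_block:
 fixes x :: "'n cvec" and h :: "'m cmat"
 assumes "\<And>i j. i \<in> range (emb :: 'n \<Rightarrow> 'm) \<or> j \<in> range (emb :: 'n \<Rightarrow> 'm) \<Longrightarrow> h $ i $ j = (if i = j then d i else 0)"
  and "\<And>k :: 'n. d (emb k) = t $ k"
 shows "block_diag h (diag_matrix t) ** amat x = amat x ** block_diag h (diag_matrix t)"
proof (rule vec_Plus_eqI)
 have right: "(\<Sum>k\<in>UNIV. f k * (if k = j then u k else 0)) = f j * u j" for f u :: "'b::finite \<Rightarrow> complex" and j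
  by (simp add: if_distrib[where f = "\<lambda>z. _ * z"] cong: if_cong)
 note m = matrix_matrix_mult_def[of "block_diag _ _"] matrix_matrix_mult_def[of "amat _"] sum_UNIV_Plus
 note a = amat_entries[OF le refl, of x]
 have dt: "diag_matrix t $ k $ l = (if k = l then t $ k else 0)" for k l by (simp add: diag_matrix_def)
 have h: "h $ i $ j = (if i = j then d i else 0)" if "a_coord x i \<noteq> 0 \<or> a_coord x j \<noteq> 0" for i j
  using assms(1) a_coord_complement[OF le] that by blast
 fix i j :: 'm and i' j' :: 'n
 have h1: "h $ i $ emb j' = (if i = emb j' then t $ j' else 0)" "h $ emb i' $ j = (if j = emb i' then t $ i' else 0)"
  using assms by auto
 show "(block_diag h (diag_matrix t) ** amat x) $ Inl i $ Inl j = (amat x ** block_diag h (diag_matrix t)) $ Inl i $ Inl j"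
 proof -
  have "h $ i $ j * cosh (a_coord x j) = cosh (a_coord x i) * h $ i $ j"
   using h[of i j] by (cases "a_coord x i \<noteq> 0 \<or> a_coord x j \<noteq> 0") auto
  then show ?thesis by (simp add: m a right sum_delta_mult)
 qed
 show "(block_diag h (diag_matrix t) ** amat x) $ Inl i $ Inr j' = (amat x ** block_diag h (diag_matrix t)) $ Inl i $ Inr j'"
  by (simp add: m a right sum_delta_mult dt h1)
 show "(block_diag h (diag_matrix t) ** amat x) $ Inr i' $ Inl j = (amat x ** block_diag h (diag_matrix t)) $ Inr i' $ Inl j"
  by (simp add: m a right sum_delta_mult dt h1)
 show "(block_diag h (diag_matrix t) ** amat x) $ Inr i' $ Inr j' = (amat x ** block_diag h (diag_matrix t)) $ Inr i' $ Inr j'"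
  by (simp add: m a right sum_delta_mult dt)
qed

lemma value_stabilizer:
 assumes f: "f \<in> F" and k: "k1 \<in> GL" "k2 \<in> GL" and comm: "block_diag k1 k2 ** amat x = amat x ** block_diag k1 k2"
 shows "tensor_mat (\<rho> k1) (\<tau> k2) *v f (amat x) = (det k1 powi \<kappa>1 * det k2 powi \<kappa>2) *s f (amat x)"
proof -
 have a: "(amat x :: ('m + 'n) cmat) \<in> GL" by (rule amat_GL[OF le refl])
 show ?thesis using f a k comm unfolding spherical_functions_def by (metis (mono_tags, lifting) mem_Collect_eq)
qed

text \<open>
  The elements of K that commute with \<open>a\<close> multiply \<open>f a\<close> by a character.
  The diagonal matrices supported on the indices of the first block that do not occur in
  \<open>a\<close> make the W-component a multiple of w0; the torus embedded diagonally in both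
  blocks gives the V-component the weight b.
\<close>

lemma value_on_line:
 fixes x :: "'n cvec"
 assumes f: "f \<in> F"
 shows "\<exists>s. f (amat x) = s *s e0"
proof -
 let ?v = "f (amat x)"
 have "\<exists>y. \<forall>j. (\<chi> i. ?v $ (i, j)) = y j *s w0"
 proof (rule choice, rule allI, rule W.complement_weight_multiple_v0)
  fix j and t :: complex assume t: "t \<noteq> 0"
  let ?h = "W.complement_diag t :: 'm cmat"
  have dh: "det ?h \<noteq> 0" unfolding W.complement_diag_def det_diag_matrix using t by simp
  have "tensor_mat (\<rho> ?h) (\<tau> (mat 1)) *v ?v = (det ?h powi \<kappa>1 * det (mat 1 :: 'n cmat) powi \<kappa>2) *s ?v"
  proof (rule value_stabilizer[OF f])
   show "?h \<in> GL" using dh by (simp add: GL_iff_det)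
   have one: "mat 1 = (diag_matrix 1 :: 'n cmat)" by (simp add: diag_matrix_def mat_def vec_eq_iff)
   show "block_diag ?h (mat 1) ** amat x = amat x ** block_diag ?h (mat 1)"
    unfolding one by (rule mult_amat_block[where d = "\<lambda>i. if i \<in> initial CARD('n) then 1 else t"])
     (auto simp: W.complement_diag_entry emb_initial)
  qed simp
  then have e: "tensor_mat (\<rho> ?h) (mat 1) *v ?v = (det ?h powi \<kappa>1) *s ?v"
   by (simp add: rational_rep_one[OF tau_rational])
  show "\<rho> ?h *v (\<chi> i. ?v $ (i, j)) = (det ?h powi \<kappa>1) *s (\<chi> i. ?v $ (i, j))"
  proof (rule vec_eq_iff[THEN iffD2], rule allI)
   fix i
   have "(tensor_mat (\<rho> ?h) (mat 1) *v ?v) $ (i, j) = (\<Sum>k\<in>UNIV. \<Sum>l\<in>UNIV. \<rho> ?h $ i $ k * (if j = l then 1 else 0) * ?v $ (k, l))"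
    by (simp add: matrix_vector_mult_def tensor_mat_def UNIV_Times_UNIV[symmetric] sum.cartesian_product case_prod_beta mat_def
      del: UNIV_Times_UNIV)
   also have "\<dots> = (\<rho> ?h *v (\<chi> i. ?v $ (i, j))) $ i"
    by (simp add: matrix_vector_mult_def if_distrib[where f = "\<lambda>z. _ * z"] if_distrib[where f = "\<lambda>z. z * _"] cong: if_cong)
   finally show "(\<rho> ?h *v (\<chi> i. ?v $ (i, j))) $ i = ((det ?h powi \<kappa>1) *s (\<chi> i. ?v $ (i, j))) $ i"
    using arg_cong[OF e, of "\<lambda>v. v $ (i, j)"] by simp
  qed
 qed
 then obtain y where y: "\<And>j. (\<chi> i. ?v $ (i, j)) = y j *s w0" by blast
 have v: "?v = tensor_vec w0 (\<chi> j. y j)"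
 proof (rule vec_eq_iff[THEN iffD2], rule allI)
  fix p :: "'w \<times> 'v"
  show "?v $ p = tensor_vec w0 (\<chi> j. y j) $ p"
   using arg_cong[OF y[of "snd p"], of "\<lambda>u. u $ fst p"] by (simp add: tensor_vec_def mult.commute)
 qed
 have "(\<chi> j. y j) \<in> V_tilde b \<tau>"
  unfolding V_tilde_def
 proof (intro CollectI allI impI)
  fix t :: "'n cvec" assume t: "\<forall>i. t $ i \<noteq> 0"
  define d where "d = (\<Prod>k\<in>UNIV. t $ k)"
  have d: "d \<noteq> 0" "det (torus_block t) = d" "det (diag_matrix t) = d"
   using t by (simp_all add: d_def det_torus_block det_diag_matrix prod_zero_iff)
  have gl: "torus_block t \<in> GL" "diag_matrix t \<in> GL" using d by (simp_all add: GL_iff_det)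
  have "tensor_mat (\<rho> (torus_block t)) (\<tau> (diag_matrix t)) *v ?v = (d powi \<kappa>1 * d powi \<kappa>2) *s ?v"
   using value_stabilizer[OF f gl mult_amat_block[where d = "\<lambda>i. \<Prod>k\<in>UNIV. if emb k = i then t $ k else 1"]] d
   by (auto simp: torus_block_def prod_emb)
  moreover have "\<rho> (torus_block t) *v w0 = (d powi \<kappa>1 * d ^ cW) *s w0"
   using W.parabolic_v0[OF gl(1)] d by (metis torus_block_off_diagonal minor_torus_block)
  ultimately have "(d powi \<kappa>1 * d ^ cW) *s tensor_vec w0 (\<tau> (diag_matrix t) *v (\<chi> j. y j)) = (d powi \<kappa>1 * d powi \<kappa>2) *s tensor_vec w0 (\<chi> j. y j)"
   by (simp add: v tensor_mat_vec tensor_vec_scale)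
  then have "tensor_vec w0 ((d ^ cW) *s (\<tau> (diag_matrix t) *v (\<chi> j. y j))) = tensor_vec w0 ((d powi \<kappa>2) *s (\<chi> j. y j))"
   using d(1) by (simp add: tensor_vec_scale vec_eq_iff mult.assoc)
  then have e: "(d ^ cW) *s (\<tau> (diag_matrix t) *v (\<chi> j. y j)) = (d powi \<kappa>2) *s (\<chi> j. y j)"
   by (rule tensor_vec_cancel[OF W.v0_nonzero])
  have "d powi \<kappa>2 = d ^ cW * d powi b"
   using d(1) power_int_add[of d "int cW" b] by (simp add: b)
  with e have "\<tau> (diag_matrix t) *v (\<chi> j. y j) = (d powi b) *s (\<chi> j. y j)"
   using d(1) by (simp add: vec_eq_iff mult.assoc)
  then show "\<tau> (diag_matrix t) *v (\<chi> j. y j) = (\<Prod>i\<in>UNIV. t $ i powi b) *s (\<chi> j. y j)"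
   by (simp add: d_def prod_powi)
 qed
 from V_tilde_line[OF this] obtain s where "(\<chi> j. y j) = s *s v1" ..
 then have "?v = s *s e0" by (simp add: v e0_def tensor_vec_scale)
 then show ?thesis ..
qed

end

section \<open>Restriction to A\<close>

lemma amat_entry_derivative:
 fixes x :: "'n::{finite,linorder} cvec"
 assumes le: "CARD('n) \<le> CARD('m::{finite,linorder})"
 shows "DERIV (\<lambda>t. (amat (x + t *s axis k 1) :: ('m + 'n) cmat) $ p $ q) 0 :> (amat x ** a_unit k :: ('m + 'n) cmat) $ p $ q"
proof -
 have e: "(x + t *s axis k 1) $ j = x $ j + t * (if j = k then 1 else 0)" for t j by (simp add: axis_def)
 have ac: "a_coord (x + t *s axis k 1) i = a_coord x i + t * (if i = emb k then 1 else 0)" for t and i :: 'm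
 proof (cases "i \<in> range (emb :: 'n \<Rightarrow> 'm)")
  case True
  then obtain l :: 'n where "i = emb l" by blast
  then show ?thesis by (simp only: a_coord_emb[OF le] e emb_eq[OF le])
 qed (auto simp: a_coord_complement[OF le])
 have ch: "DERIV (\<lambda>t. cosh (u + t * w)) 0 :> sinh u * w"
  and sh: "DERIV (\<lambda>t. sinh (u + t * w)) 0 :> cosh u * w" for u w :: complex
  by (auto intro!: derivative_eq_intros)
 note a = amat_entries[OF le refl]
 have m: "(amat x ** a_unit k :: ('m + 'n) cmat) $ p $ q =
   (if q = Inr k then amat x $ p $ Inl (emb k) else 0) + (if q = Inl (emb k) then amat x $ p $ Inr k else 0)"
  by (simp add: a_unit_def matrix_add_ldistrib mult_unit_entry)
 show ?thesis
 proof (cases p; cases q)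
  fix i j assume pq: "p = Inl i" "q = Inl j"
  show ?thesis
  proof (cases "i = j")
   case True
   have "DERIV (\<lambda>t. cosh (a_coord x i + t * (if i = emb k then 1 else 0))) 0 :> (if i = emb k then sinh (x $ k) else 0)"
    using ch[of "a_coord x i" "if i = emb k then 1 else 0"] by (cases "i = emb k") (simp_all add: a_coord_emb[OF le])
   then show ?thesis unfolding m unfolding pq a ac using True by auto
  next
   case False
   then show ?thesis unfolding m unfolding pq a by auto
  qed
 next
  fix i j' assume pq: "p = Inl i" "q = Inr j'"
  show ?thesis
  proof (cases "i = emb j'")
   case True
   have "DERIV (\<lambda>t. sinh (x $ j' + t * (if j' = k then 1 else 0))) 0 :> (if j' = k then cosh (x $ k) else 0)"
    using sh[of "x $ j'" "if j' = k then 1 else 0"] by (cases "j' = k") simp_all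
   then show ?thesis unfolding m unfolding pq a e using True by (auto simp: emb_eq[OF le] a_coord_emb[OF le])
  next
   case False
   then show ?thesis unfolding m unfolding pq a by auto
  qed
 next
  fix i' j assume pq: "p = Inr i'" "q = Inl j"
  show ?thesis
  proof (cases "j = emb i'")
   case True
   have "DERIV (\<lambda>t. sinh (x $ i' + t * (if i' = k then 1 else 0))) 0 :> (if i' = k then cosh (x $ k) else 0)"
    using sh[of "x $ i'" "if i' = k then 1 else 0"] by (cases "i' = k") simp_all
   then show ?thesis unfolding m unfolding pq a e using True by (auto simp: emb_eq[OF le])
  next
   case False
   then show ?thesis unfolding m unfolding pq a by auto
  qed
 next
  fix i' j' assume pq: "p = Inr i'" "q = Inr j'"
  show ?thesis
  proof (cases "i' = j'")
   case True
   have "DERIV (\<lambda>t. cosh (x $ i' + t * (if i' = k then 1 else 0))) 0 :> (if i' = k then sinh (x $ k) else 0)"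
    using ch[of "x $ i'" "if i' = k then 1 else 0"] by (cases "i' = k") simp_all
   then show ?thesis unfolding m unfolding pq a e using True by (auto simp: emb_eq[OF le])
  next
   case False
   then show ?thesis unfolding m unfolding pq a by (auto simp: emb_eq[OF le])
  qed
 qed
qed

lemma partial_amat:
 fixes x :: "'n::{finite,linorder} cvec" and h :: "('m::{finite,linorder} + 'n) cmat \<Rightarrow> 'd::finite cvec"
 assumes le: "CARD('n) \<le> CARD('m)" and h: "regular_vec h"
 shows "partial k (\<lambda>y. h (amat y) $ p) x = rd (a_unit k) h (amat x) $ p"
proof (rule partial_eq)
 have "DERIV (\<lambda>t. h (amat (x + t *s axis k 1)) $ p) 0 :> dder (\<lambda>g. h g $ p) (amat (x + 0 *s axis k 1)) (amat x ** a_unit k)"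
  by (rule dder_curve[where c = "\<lambda>t. amat (x + t *s axis k 1)", OF regular_vecD[OF h] amat_GL[OF le refl] amat_entry_derivative[OF le]])
 then show "DERIV (\<lambda>t. h (amat (x + t *s axis k 1)) $ p) 0 :> rd (a_unit k) h (amat x) $ p"
  by (simp add: rd_def dv_def)
qed

lemma regular_amat_holomorphic:
 fixes p :: "('m::{finite,linorder} + 'n::{finite,linorder}) cmat \<Rightarrow> complex"
 assumes le: "CARD('n) \<le> CARD('m)" and p: "regular_GL p"
 shows "holomorphic_several (\<lambda>y. p (amat y)) UNIV"
proof -
 have hyp: "holomorphic_several (\<lambda>y. cosh (f y)) UNIV" "holomorphic_several (\<lambda>y. sinh (f y)) UNIV"
  if "holomorphic_several f UNIV" for f :: "'n cvec \<Rightarrow> complex"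
  by (rule holo_compose[OF that]; auto simp: field_differentiable_def intro!: exI derivative_eq_intros)+
 have coord: "holomorphic_several (\<lambda>y::'n cvec. a_coord y i) UNIV" for i :: 'm
 proof -
  have "holomorphic_several (\<lambda>y::'n cvec. if emb l = i then y $ l else 0) UNIV" for l
   by (cases "emb l = i") (simp_all add: holo_coord holo_const)
  then show ?thesis unfolding a_coord_def by (rule holo_sum)
 qed
 have cond: "holomorphic_several (\<lambda>y. if P then f y else 0) UNIV"
  if "holomorphic_several f UNIV" for P and f :: "'n cvec \<Rightarrow> complex"
  using that by (cases P) (simp_all add: holo_const)
 have entry: "holomorphic_several (\<lambda>y. (amat y :: ('m + 'n) cmat) $ i $ j) UNIV" for i j
  unfolding amat_def
  by (cases i; cases j) (auto simp: cond hyp coord holo_coord holo_const)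
 have det: "holomorphic_several (\<lambda>y. det (amat y :: ('m + 'n) cmat)) UNIV"
  unfolding det_def by (intro holo_sum holo_mult holo_const holo_prod entry)
 obtain P where P: "polynomial_GL P" "\<And>g. g \<in> GL \<Longrightarrow> p g = P g" using p unfolding regular_GL_def by blast
 from P(1) have "holomorphic_several (\<lambda>y. P (amat y)) UNIV"
 proof induction
  case inverse_det
  have "(amat y :: ('m + 'n) cmat) \<in> GL" for y :: "'n cvec" by (rule amat_GL[OF le refl])
  then show ?case by (intro holo_inverse det) (simp add: GL_iff_det)
 qed (simp_all add: holo_const holo_add holo_mult entry)
 then show ?thesis
  by (rule holo_cong[OF open_UNIV, rotated]) (simp add: P(2)[OF amat_GL[OF le refl]])
qed

section \<open>The radial part\<close>

text \<open>
  The potential of the radial part before conjugation by \<open>\<delta>\<close>.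
\<close>

definition zeroth_order :: "nat \<Rightarrow> int \<Rightarrow> int \<Rightarrow> int \<Rightarrow> int \<Rightarrow> 'n::{finite,linorder} cvec \<Rightarrow> complex" where
 "zeroth_order M \<kappa>1 \<kappa>2 \<kappa>t1 \<kappa>v x = of_nat M * (of_int \<kappa>1)\<^sup>2 + of_nat CARD('n) * (of_int \<kappa>2)\<^sup>2
   - (\<Sum>k\<in>UNIV. \<Sum>l\<in>UNIV - {k}. (of_int (\<kappa>v * (\<kappa>v + 1)) / (sinh (x $ k - x $ l))\<^sup>2
     + of_int (\<kappa>v * (\<kappa>v + 1)) / (sinh (x $ k + x $ l))\<^sup>2) / 2)
   - (\<Sum>k\<in>UNIV. of_nat (M - CARD('n)) * (of_int (\<kappa>t1 - \<kappa>1) / (sinh (x $ k))\<^sup>2))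
   - (\<Sum>k\<in>UNIV. ((of_int \<kappa>t1 - of_int (\<kappa>2 + \<kappa>1 - \<kappa>t1)) - cosh (2 * x $ k) * (of_int \<kappa>1 - of_int \<kappa>2))\<^sup>2
     / (sinh (2 * x $ k))\<^sup>2 / 2)"

definition radial_operator :: "nat \<Rightarrow> int \<Rightarrow> int \<Rightarrow> int \<Rightarrow> int \<Rightarrow>
  ('n::{finite,linorder} cvec \<Rightarrow> complex) \<Rightarrow> 'n cvec \<Rightarrow> complex" where
 "radial_operator M \<kappa>1 \<kappa>2 \<kappa>t1 \<kappa>v \<psi> x =
   (\<Sum>k\<in>UNIV. 1/2 * partial k (partial k \<psi>) x + drift (of_nat (M - CARD('n))) x k * partial k \<psi> x)
   + zeroth_order M \<kappa>1 \<kappa>2 \<kappa>t1 \<kappa>v x * \<psi> x"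

lemma zeroth_order_holomorphic: "holomorphic_several (zeroth_order M \<kappa>1 \<kappa>2 \<kappa>t1 \<kappa>v) regular_set"
proof -
 have ch: "holomorphic_several (\<lambda>x. cosh (2 * x $ k)) regular_set" for k
  by (rule holo_compose[OF holo_mult[OF holo_const holo_coord]])
   (auto simp: field_differentiable_def intro!: exI derivative_eq_intros)
 have c2: "holomorphic_several (\<lambda>x. c / (sinh (f x))\<^sup>2 / 2) regular_set"
  if "holomorphic_several f regular_set" "\<And>x. x \<in> regular_set \<Longrightarrow> sinh (f x) \<noteq> 0" for f c
  using holomorphic_csch2[OF that, of "c / 2"] by (simp add: mult.commute)
 have two: "holomorphic_several (\<lambda>x. ((of_int \<kappa>t1 - of_int (\<kappa>2 + \<kappa>1 - \<kappa>t1)) - cosh (2 * x $ k) * (of_int \<kappa>1 - of_int \<kappa>2))\<^sup>2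
     / (sinh (2 * x $ k))\<^sup>2 / 2) regular_set" for k
 proof -
  have "holomorphic_several (\<lambda>x. ((of_int \<kappa>t1 - of_int (\<kappa>2 + \<kappa>1 - \<kappa>t1)) - cosh (2 * x $ k) * (of_int \<kappa>1 - of_int \<kappa>2))\<^sup>2
    * (1 / 2 / (sinh (2 * x $ k))\<^sup>2)) regular_set"
   by (intro holo_intros ch) (simp add: regular_set_sinh)
  then show ?thesis by (simp add: mult.commute)
 qed
 have one: "holomorphic_several (\<lambda>x. (of_int (\<kappa>v * (\<kappa>v + 1)) / (sinh (x $ k - x $ l))\<^sup>2
     + of_int (\<kappa>v * (\<kappa>v + 1)) / (sinh (x $ k + x $ l))\<^sup>2) / 2) regular_set" if "k \<noteq> l" for k l
  unfolding add_divide_distrib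
  by (intro holo_add c2 holo_diff holo_coord)
   (simp_all add: regular_set_sinh(3,4)[OF _ that])
 show ?thesis
  unfolding zeroth_order_def
  by (intro holo_intros one two) (auto simp: regular_set_sinh(1))
qed

text \<open>
  The words of length two, one and zero carry the second derivatives, the drift and the potential.
\<close>

lemma radial_operator_scalar_diff_op:
 "scalar_diff_op (radial_operator M \<kappa>1 \<kappa>2 \<kappa>t1 \<kappa>v :: ('n::{finite,linorder} cvec \<Rightarrow> complex) \<Rightarrow> _)"
 unfolding scalar_diff_op_def
proof (intro exI conjI ballI allI)
 let ?S2 = "range (\<lambda>k::'n. [k, k])" and ?S1 = "range (\<lambda>k::'n. [k])"
 let ?c = "\<lambda>I (x::'n cvec). if I = [] then zeroth_order M \<kappa>1 \<kappa>2 \<kappa>t1 \<kappa>v x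
   else if length I = 1 then drift (of_nat (M - CARD('n))) x (hd I) else 1/2"
 show "finite (insert [] (?S1 \<union> ?S2))" by simp
 show "holomorphic_several (?c I) regular_set" for I
  by (cases "I = []"; cases "length I = 1") (simp_all add: zeroth_order_holomorphic drift_holomorphic holo_const)
 fix \<psi> and x :: "'n cvec"
 have i: "inj (\<lambda>k::'n. [k, k])" "inj (\<lambda>k::'n. [k])" by (auto simp: inj_def)
 have "(\<Sum>I\<in>insert [] (?S1 \<union> ?S2). ?c I x * foldr partial I \<psi> x) =
   ?c [] x * foldr partial [] \<psi> x + ((\<Sum>I\<in>?S1. ?c I x * foldr partial I \<psi> x) + (\<Sum>I\<in>?S2. ?c I x * foldr partial I \<psi> x))"
 proof -
  have "?S1 \<inter> ?S2 = {}" by auto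
  moreover have "[] \<notin> ?S1 \<union> ?S2" by auto
  ultimately show ?thesis by (subst sum.insert) (auto simp: sum.union_disjoint)
 qed
 then show "radial_operator M \<kappa>1 \<kappa>2 \<kappa>t1 \<kappa>v \<psi> x = (\<Sum>I\<in>insert [] (?S1 \<union> ?S2). ?c I x * foldr partial I \<psi> x)"
  unfolding sum.reindex[OF i(1)] sum.reindex[OF i(2)] radial_operator_def
  by (simp add: sum.distrib)
qed

theorem radial_operator_conjugation:
 fixes \<kappa>1 \<kappa>2 \<kappa>t1 \<kappa>v :: int and \<theta> :: "'n::{finite,linorder} rvec \<Rightarrow> 'n cvec \<Rightarrow> complex"
 assumes U: "open U" "U \<subseteq> regular_set" and \<theta>: "log_sinh_branch U \<theta>" and \<psi>: "holomorphic_several \<psi> U" and x: "x \<in> U"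
  and M: "CARD('n) \<le> M"
 defines "s \<equiv> (real M - real CARD('n), 1, 1/2)"
  and "r \<equiv> (real_of_int (\<kappa>2 - \<kappa>1) + (real M - real CARD('n)), real_of_int \<kappa>v + 1, real_of_int (\<kappa>t1 - \<kappa>2) + 1/2)"
 shows "2 * radial_operator M \<kappa>1 \<kappa>2 \<kappa>t1 \<kappa>v \<psi> x = inverse (delta s \<theta> x) *
   (laplacian_A (\<lambda>y. delta s \<theta> y * \<psi> y) x - u_potential r x * (delta s \<theta> x * \<psi> x)
    + of_real (C_const M CARD('n) \<kappa>1 \<kappa>2) * (delta s \<theta> x * \<psi> x))"
proof -
 let ?q = "of_nat (M - CARD('n)) :: complex"
 have q: "of_real (real M - real CARD('n)) = ?q" using M by (simp add: of_nat_diff)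
 have nz: "delta s \<theta> x \<noteq> 0" by (simp add: delta_exp[OF x])
 have z: "(\<Sum>i\<in>UNIV. (drift ?q x i)\<^sup>2 + drift_deriv ?q x i) = 2 * zeroth_order M \<kappa>1 \<kappa>2 \<kappa>t1 \<kappa>v x
   + u_potential r x - of_real (C_const M CARD('n) \<kappa>1 \<kappa>2)"
  using drift_potential_identity[OF subsetD[OF U(2) x] M, of \<kappa>2 \<kappa>1 \<kappa>v \<kappa>t1]
  unfolding zeroth_order_def[symmetric] r_def[symmetric] by (simp add: algebra_simps)
 have "inverse (delta s \<theta> x) * laplacian_A (\<lambda>y. delta s \<theta> y * \<psi> y) x =
   (\<Sum>i\<in>UNIV. partial i (partial i \<psi>) x + 2 * drift ?q x i * partial i \<psi> x) + (\<Sum>i\<in>UNIV. (drift ?q x i)\<^sup>2 + drift_deriv ?q x i) * \<psi> x"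
  unfolding s_def delta_laplacian[OF U \<theta> \<psi> x] q sum_distrib_right sum.distrib[symmetric] ..
 also have "(\<Sum>i\<in>UNIV. partial i (partial i \<psi>) x + 2 * drift ?q x i * partial i \<psi> x) =
   2 * (\<Sum>k\<in>UNIV. 1/2 * partial k (partial k \<psi>) x + drift ?q x k * partial k \<psi> x)"
  by (simp add: sum_distrib_left algebra_simps)
 finally show ?thesis unfolding z radial_operator_def using nz
  by (simp add: field_simps)
qed

context radial_data
begin

lemma A_scalar_eqI:
 fixes f :: "('m + 'n) cmat \<Rightarrow> ('w \<times> 'v) cvec"
 shows "f (amat x) = s *s e0 \<Longrightarrow> A_scalar e0 f x = s"
 unfolding A_scalar_def mexp_a_matrix[OF le] using e0_nonzero
 by (intro the_equality) (auto simp: vec_eq_iff)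

lemma A_scalar: "f \<in> F \<Longrightarrow> f (amat x) = A_scalar e0 f x *s e0"
 using value_on_line A_scalar_eqI by metis

lemma A_scalar_component:
 obtains p where "e0 $ p \<noteq> 0" "\<And>f x. f \<in> F \<Longrightarrow> A_scalar e0 f x = f (amat x) $ p / e0 $ p"
proof -
 obtain p where p: "e0 $ p \<noteq> 0" using e0_nonzero by (auto simp: vec_eq_iff)
 have "A_scalar e0 f x = f (amat x) $ p / e0 $ p" if "f \<in> F" for f x
  using arg_cong[OF A_scalar[OF that, of x], of "\<lambda>v. v $ p"] p by (simp add: field_simps)
 then show thesis using p that by blast
qed

lemma A_scalar_holomorphic:
 assumes f: "f \<in> F" shows "holomorphic_several (A_scalar e0 f) UNIV"
proof -
 interpret spherical \<rho> \<tau> \<kappa>1 \<kappa>2 f by (rule spherical[OF f])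
 obtain p where p: "e0 $ p \<noteq> 0" "\<And>x. A_scalar e0 f x = f (amat x) $ p / e0 $ p"
  using A_scalar_component f by metis
 have "A_scalar e0 f = (\<lambda>x. f (amat x) $ p * (1 / e0 $ p))" by (auto simp: p(2))
 moreover have "holomorphic_several (\<lambda>x. f (amat x) $ p * (1 / e0 $ p)) UNIV"
  by (rule holo_mult[OF regular_amat_holomorphic[OF le regular_vecD[OF regular_f]] holo_const])
 ultimately show ?thesis by (simp only:)
qed

lemma rd_A_scalar:
 assumes f: "f \<in> F"
 shows "rd (a_unit k) f (amat x) = partial k (A_scalar e0 f) x *s e0"
  and "rd (a_unit k) (rd (a_unit k) f) (amat x) = partial k (partial k (A_scalar e0 f)) x *s e0"
proof -
 interpret spherical \<rho> \<tau> \<kappa>1 \<kappa>2 f by (rule spherical[OF f])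
 have c: "partial k (\<lambda>y. c * g y) y = c * partial k g y" if "holomorphic_several g UNIV" for c g and y :: "'n cvec"
  by (rule partial_eq) (use partial_has_field_derivative[OF that, of y k] in \<open>auto intro!: DERIV_cmult\<close>)
 have h: "rd (a_unit k) f' (amat x) = partial k \<phi> x *s e0"
  if f': "regular_vec f'" "\<And>y. f' (amat y) = \<phi> y *s e0" "holomorphic_several \<phi> UNIV"
  for f' :: "('m + 'n) cmat \<Rightarrow> ('w \<times> 'v) cvec" and \<phi> and x :: "'n cvec"
 proof (rule vec_eq_iff[THEN iffD2], rule allI)
  fix p
  have "rd (a_unit k) f' (amat x) $ p = partial k (\<lambda>y. f' (amat y) $ p) x" by (rule partial_amat[OF le f'(1), symmetric])
  also have "\<dots> = e0 $ p * partial k \<phi> x" using c[OF f'(3)] by (simp add: f'(2) mult.commute[of _ "e0 $ p"])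
  finally show "rd (a_unit k) f' (amat x) $ p = (partial k \<phi> x *s e0) $ p" by simp
 qed
 show 1: "rd (a_unit k) f (amat x) = partial k (A_scalar e0 f) x *s e0" for x
  by (rule h[OF regular_f A_scalar[OF f] A_scalar_holomorphic[OF f]])
 show "rd (a_unit k) (rd (a_unit k) f) (amat x) = partial k (partial k (A_scalar e0 f)) x *s e0"
  by (rule h[OF regular_rd[OF regular_f] 1 partial_holomorphic[OF A_scalar_holomorphic[OF f] open_UNIV]])
qed

text \<open>
  The line spanned by e0 satisfies the hypotheses of spherical_line with
  \<open>tW = \<kappa>1 + cW\<close>, \<open>tV = b\<close>, \<open>c = cW\<close> and
  \<open>K = \<kappa> (\<kappa> + 1)\<close>.
\<close>

theorem casimir_radial_operator:
 assumes f: "f \<in> F" and x: "x \<in> regular_set"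
 shows "D_casimir f (mexp (a_matrix x)) =
   radial_operator CARD('m) \<kappa>1 \<kappa>2 (\<kappa>1 + int cW) (int \<kappa>) (A_scalar e0 f) x *s e0"
proof -
 interpret spherical \<rho> \<tau> \<kappa>1 \<kappa>2 f by (rule spherical[OF f])
 have pi1_e: "pi1 X *v tensor_vec u v = tensor_vec (drep \<rho> X *v u) v"
  and pi2_e: "pi2 Y *v tensor_vec u v = tensor_vec u (drep \<tau> Y *v v)" for X Y u v
  by (simp_all add: pi1_def pi2_def tensor_mat_vec)
 interpret spherical_line \<rho> \<tau> \<kappa>1 \<kappa>2 f e0 "of_int (\<kappa>1 + int cW)" "of_int b" "of_nat cW" "of_nat \<kappa> * (of_nat \<kappa> + 1)"
  x "A_scalar e0 f x" "amat x"
 proof unfold_locales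
  show "pi1 (E (emb k) (emb l)) *v e0 = 0" if "k \<noteq> l" for k l :: 'n
   using W.drep_parabolic_v0[of "emb k" "emb l"] that
   by (simp add: e0_def pi1_e emb_eq[OF le] emb_initial tensor_vec_zero)
  show "pi1 (E (emb k) j) *v e0 = 0" if "j \<notin> range (emb :: 'n \<Rightarrow> 'm)" for k :: 'n and j
  proof -
   have "emb k \<noteq> j" using that by blast
   then show ?thesis
    using W.drep_parabolic_v0[of "emb k" j] by (simp add: e0_def pi1_e emb_initial tensor_vec_zero)
  qed
  show "pi1 (E (emb k) (emb k)) *v e0 = of_int (\<kappa>1 + int cW) *s e0" for k :: 'n
   by (simp only: e0_def pi1_e W.drep_diagonal_v0 emb_initial if_True tensor_vec_scale of_int_add of_int_of_nat_eq)
  show "pi1 (E (emb k) j) *v (pi1 (E j (emb k)) *v e0) = of_nat cW *s e0"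
   if "j \<notin> range (emb :: 'n \<Rightarrow> 'm)" for k :: 'n and j
   using W.drep_raise_lower_v0[of "emb k" j] that
   by (simp add: e0_def pi1_e emb_initial range_emb_initial tensor_vec_scale)
  show "pi2 (E k l) *v (pi2 (E l k) *v e0) = (of_nat \<kappa> * (of_nat \<kappa> + 1)) *s e0" if "k \<noteq> l" for k l
   using drep_tau_raise_lower[OF that] by (simp add: e0_def pi2_e tensor_vec_scale)
  show "pi2 (E k k) *v e0 = of_int b *s e0" for k
   by (simp add: e0_def pi2_e drep_tau_diagonal tensor_vec_scale)
  show "f (amat x) = A_scalar e0 f x *s e0" by (rule A_scalar[OF f])
  show "x \<in> regular_set" by (rule x)
 qed simp
 have fo: "first_order k = drift (of_nat (CARD('m) - CARD('n))) x k" for k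
  by (simp add: first_order_def drift_def coth_def coth_pair_def)
 have zo: "zero_order = zeroth_order CARD('m) \<kappa>1 \<kappa>2 (\<kappa>1 + int cW) (int \<kappa>) x"
  unfolding zero_order_def zeroth_order_def by (simp add: b algebra_simps)
 show ?thesis
  unfolding mexp_a_matrix[OF le] casimir_radial rd_A_scalar[OF f] fo zo A_scalar[OF f, of x] radial_operator_def
  by (simp add: vec_eq_iff sum_distrib_right distrib_right mult.assoc)
qed

end

section \<open>The projection-valued map and its blocks\<close>

definition J_matrix :: "('m::finite + 'n::finite) cmat" where
 "J_matrix = block_diag (mat 1) 0"

text \<open>
  The projection onto the image of the first block, seen in the moving frame g. It is unchanged by K
  on the right and conjugated by K on the left, so its blocks are building blocks for spherical
  functions.
\<close>

definition proj :: "('m::finite + 'n::finite) cmat \<Rightarrow> ('m + 'n) cmat" where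
 "proj g = g ** J_matrix ** matrix_inv g"

definition upper_right :: "('m::finite + 'n::finite) cmat \<Rightarrow> ((complex, 'n) vec, 'm) vec" where
 "upper_right M = (\<chi> i j. M $ Inl i $ Inr j)"

definition lower_right :: "('m::finite + 'n::finite) cmat \<Rightarrow> 'n cmat" where
 "lower_right M = (\<chi> i j. M $ Inr i $ Inr j)"

definition upper_left :: "('m::finite + 'n::finite) cmat \<Rightarrow> 'm cmat" where
 "upper_left M = (\<chi> i j. M $ Inl i $ Inl j)"

lemma matrix_inv_eqI:
 fixes g h :: "'r::finite cmat"
 assumes gh: "g ** h = mat 1" shows "matrix_inv g = h"
proof -
 have "det g * det h = 1" using arg_cong[OF gh, of det] by (simp add: det_mul)
 then have g: "g \<in> GL" by (auto simp: GL_iff_det)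
 have "matrix_inv g = matrix_inv g ** (g ** h)" by (simp add: gh)
 also have "\<dots> = h" by (simp add: matrix_mul_assoc matrix_inv_GL(2)[OF g])
 finally show ?thesis .
qed

lemma matrix_inv_mult:
 assumes "g \<in> GL" "h \<in> GL" shows "matrix_inv (g ** h) = matrix_inv h ** matrix_inv (g :: 'r::finite cmat)"
proof (rule matrix_inv_eqI)
 have "g ** h ** (matrix_inv h ** matrix_inv g) = g ** (h ** matrix_inv h) ** matrix_inv g"
  by (simp add: matrix_mul_assoc)
 then show "g ** h ** (matrix_inv h ** matrix_inv g) = mat 1"
  by (simp add: matrix_inv_GL(1)[OF assms(2)] matrix_inv_GL(1)[OF assms(1)] matrix_mul_rid)
qed

lemma matrix_inv_block_diag:
 assumes "k1 \<in> GL" "k2 \<in> GL"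
 shows "matrix_inv (block_diag k1 k2) = block_diag (matrix_inv k1) (matrix_inv k2)"
 by (rule matrix_inv_eqI) (simp add: block_diag_mult matrix_inv_GL(1)[OF assms(1)] matrix_inv_GL(1)[OF assms(2)] block_diag_1)

lemma proj_right:
 assumes "g \<in> GL" "k1 \<in> GL" "k2 \<in> GL" shows "proj (g ** block_diag k1 k2) = proj g"
proof -
 have "block_diag k1 k2 ** J_matrix ** matrix_inv (block_diag k1 k2) = J_matrix"
  unfolding matrix_inv_block_diag[OF assms(2,3)] J_matrix_def block_diag_mult
  by (simp add: matrix_inv_GL(1)[OF assms(2)])
 then have "g ** (block_diag k1 k2 ** J_matrix ** matrix_inv (block_diag k1 k2)) ** matrix_inv g = g ** J_matrix ** matrix_inv g"
  by simp
 then show ?thesis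
  unfolding proj_def matrix_inv_mult[OF assms(1) block_diag_GL[OF assms(2,3)]] by (simp add: matrix_mul_assoc)
qed

lemma proj_left:
 assumes "g \<in> GL" "k1 \<in> GL" "k2 \<in> GL"
 shows "proj (block_diag k1 k2 ** g) = block_diag k1 k2 ** proj g ** block_diag (matrix_inv k1) (matrix_inv k2)"
 unfolding proj_def matrix_inv_mult[OF block_diag_GL[OF assms(2,3)] assms(1)] matrix_inv_block_diag[OF assms(2,3)]
 by (simp add: matrix_mul_assoc)

lemma blocks_conjugate:
 "upper_right (block_diag k1 k2 ** M ** block_diag l1 l2) = k1 ** upper_right M ** l2"
 "lower_right (block_diag k1 k2 ** M ** block_diag l1 l2) = k2 ** lower_right M ** l2"
 "upper_left (block_diag k1 k2 ** M ** block_diag l1 l2) = k1 ** upper_left M ** l1"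
 by (simp_all add: vec_eq_iff upper_right_def lower_right_def upper_left_def matrix_matrix_mult_def sum_UNIV_Plus)

lemma upper_left_left: "upper_left (block_diag k1 k2 ** g) = k1 ** upper_left g"
 and upper_left_right: "upper_left (g ** block_diag k1 k2) = upper_left g ** k1"
 by (simp_all add: vec_eq_iff upper_left_def matrix_matrix_mult_def sum_UNIV_Plus)

lemma proj_regular: "regular_GL (\<lambda>g. proj g $ i $ j)"
 unfolding proj_def
 by (intro regular_GL_matrix_mult regular_GL_entry regular_GL_const regular_GL_matrix_inv)

lemma amat_inverse:
 assumes le: "CARD('n) \<le> CARD('m::{finite,linorder})"
 shows "matrix_inv (amat (x :: 'n::{finite,linorder} cvec) :: ('m + 'n) cmat) = amat (- x)"
 by (rule matrix_inv_eqI[OF amat_mult_minus[OF le refl]])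

lemma proj_amat:
 fixes x :: "'n::{finite,linorder} cvec"
 assumes le: "CARD('n) \<le> CARD('m::{finite,linorder})"
 shows "upper_right (proj (amat x :: ('m + 'n) cmat)) $ emb k $ l = (if k = l then - (cosh (x $ k) * sinh (x $ k)) else 0)"
  and "lower_right (proj (amat x :: ('m + 'n) cmat)) = diag_matrix (\<chi> i. - (sinh (x $ i))\<^sup>2)"
proof -
 let ?a = "amat x :: ('m + 'n) cmat"
 have J: "(?a ** J_matrix) $ p $ q = (case q of Inl j \<Rightarrow> ?a $ p $ Inl j | Inr j \<Rightarrow> 0)" for p q
  by (cases q) (simp_all add: matrix_matrix_mult_def sum_UNIV_Plus J_matrix_def mat_def if_distrib[where f = "\<lambda>z. _ * z"] cong: if_cong)
 note a = amat_entries[OF le refl]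
 have p: "proj ?a $ p $ q = (\<Sum>i\<in>UNIV. ?a $ p $ Inl i * amat (- x) $ Inl i $ q)" for p q
  unfolding proj_def amat_inverse[OF le] matrix_matrix_mult_def[of "?a ** J_matrix"] by (simp add: J sum_UNIV_Plus)
 show "upper_right (proj ?a) $ emb k $ l = (if k = l then - (cosh (x $ k) * sinh (x $ k)) else 0)"
  by (simp add: upper_right_def p a sum_delta_mult emb_eq[OF le] a_coord_emb[OF le])
 show "lower_right (proj ?a) = diag_matrix (\<chi> i. - (sinh (x $ i))\<^sup>2)"
  by (simp add: vec_eq_iff lower_right_def diag_matrix_def p a sum_delta_mult emb_eq[OF le] power2_eq_square)
qed

section \<open>Matrix powers\<close>

definition mpow :: "'r::finite cmat \<Rightarrow> nat \<Rightarrow> 'r cmat" where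
 "mpow X j = ((**) X ^^ j) (mat 1)"

lemma mpow_simps: "mpow X 0 = mat 1" "mpow X (Suc j) = X ** mpow X j"
 by (simp_all add: mpow_def)

lemma mpow_conjugate:
 assumes "k \<in> GL"
 shows "mpow (k ** X ** matrix_inv k) j = k ** mpow X j ** matrix_inv k"
proof (induction j)
 case (Suc j)
 have "mpow (k ** X ** matrix_inv k) (Suc j) = k ** X ** (matrix_inv k ** k) ** mpow X j ** matrix_inv k"
  by (simp add: mpow_simps Suc matrix_mul_assoc)
 then show ?case by (simp add: matrix_inv_GL(2)[OF assms] mpow_simps matrix_mul_assoc)
qed (simp add: mpow_simps matrix_inv_GL(1)[OF assms])

lemma mpow_diag: "mpow (diag_matrix z) j = diag_matrix (\<chi> i. z $ i ^ j)"
proof (induction j)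
 case (Suc j)
 show ?case unfolding mpow_simps Suc
  by (simp add: vec_eq_iff matrix_matrix_mult_def diag_matrix_def if_distrib[where f = "\<lambda>z. z * _"] cong: if_cong)
qed (simp add: mpow_simps diag_matrix_def mat_def vec_eq_iff)

lemma mpow_regular:
 assumes "\<And>i j. regular_GL (\<lambda>g. X g $ i $ j)"
 shows "regular_GL (\<lambda>g. mpow (X g) k $ i $ j)"
 by (induction k arbitrary: i j) (simp_all add: mpow_simps assms regular_GL_const regular_GL_matrix_mult)

lemma trace_conjugate: "k \<in> GL \<Longrightarrow> trace (k ** X ** matrix_inv k) = trace (X :: 'r::finite cmat)"
 by (metis matrix_inv_GL(2) matrix_mul_assoc matrix_mul_lid trace_mul_sym)

section \<open>Biinvariant functions\<close>

definition biinvariant :: "(('m::finite + 'n::finite) cmat \<Rightarrow> complex) \<Rightarrow> bool" where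
 "biinvariant h \<longleftrightarrow> regular_GL h \<and> (\<forall>g\<in>GL. \<forall>k1\<in>GL. \<forall>k2\<in>GL.
   h (block_diag k1 k2 ** g) = h g \<and> h (g ** block_diag k1 k2) = h g)"

text \<open>
  Under K the lower right block of the projection is conjugated or unchanged, so its conjugation
  invariants are invariant on both sides. Restricted to A they are power sums of
  \<open>- sinh^2 (x_i)\<close>.
\<close>

lemma biinvariant_trace: "biinvariant (\<lambda>g. trace (mpow (lower_right (proj g)) j))"
proof -
 have "regular_GL (\<lambda>g. trace (mpow (lower_right (proj g)) j))"
  unfolding trace_def by (intro regular_GL_sum mpow_regular) (simp add: lower_right_def proj_regular)
 then show ?thesis
  by (simp add: biinvariant_def proj_right proj_left blocks_conjugate mpow_conjugate trace_conjugate)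
qed

lemma biinvariant_const: "biinvariant (\<lambda>g. c)"
 and biinvariant_add: "biinvariant h \<Longrightarrow> biinvariant h' \<Longrightarrow> biinvariant (\<lambda>g. h g + h' g)"
 and biinvariant_mult: "biinvariant h \<Longrightarrow> biinvariant h' \<Longrightarrow> biinvariant (\<lambda>g. h g * h' g)"
 by (simp_all add: biinvariant_def regular_GL_const regular_GL_add regular_GL_mult)

lemma biinvariant_sum: "finite A \<Longrightarrow> (\<And>i. i \<in> A \<Longrightarrow> biinvariant (h i)) \<Longrightarrow> biinvariant (\<lambda>g. \<Sum>i\<in>A. h i g)"
 by (induction A rule: finite_induct) (simp_all add: biinvariant_const biinvariant_add)

lemma power_sum_algebra_biinvariant:
 fixes P :: "'n::{finite,linorder} cvec \<Rightarrow> complex"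
 assumes le: "CARD('n) \<le> CARD('m::{finite,linorder})"
  and P: "power_sum_algebra (\<lambda>t. - (sinh t)\<^sup>2) P"
 shows "\<exists>h :: ('m + 'n) cmat \<Rightarrow> complex. biinvariant h \<and> (\<forall>y. h (amat y) = P y)"
 using P
proof induction
 case (const c)
 show ?case using biinvariant_const by blast
next
 case (power_sum q)
 let ?h = "\<lambda>g :: ('m + 'n) cmat. \<Sum>j\<le>degree q. coeff q j * trace (mpow (lower_right (proj g)) j)"
 have "biinvariant ?h"
  by (intro biinvariant_sum biinvariant_mult biinvariant_const biinvariant_trace) simp
 moreover have "?h (amat y) = (\<Sum>j\<in>UNIV. poly q (- (sinh (y $ j))\<^sup>2))" for y :: "'n cvec"
 proof -
  have "trace (mpow (lower_right (proj (amat y :: ('m + 'n) cmat))) j) = (\<Sum>i\<in>UNIV. (- (sinh (y $ i))\<^sup>2) ^ j)" for j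
   unfolding proj_amat[OF le] mpow_diag by (simp add: trace_def diag_matrix_def)
  then show ?thesis
   by (simp add: poly_altdef sum_distrib_left sum.swap[where A = UNIV])
 qed
 ultimately show ?case by blast
next
 case (add f g)
 then obtain h h' :: "('m + 'n) cmat \<Rightarrow> complex" where "biinvariant h" "\<forall>y. h (amat y) = f y" "biinvariant h'" "\<forall>y. h' (amat y) = g y" by blast
 then show ?case by (intro exI[of _ "\<lambda>g. h g + h' g"]) (simp add: biinvariant_add)
next
 case (mult f g)
 then obtain h h' :: "('m + 'n) cmat \<Rightarrow> complex" where "biinvariant h" "\<forall>y. h (amat y) = f y" "biinvariant h'" "\<forall>y. h' (amat y) = g y" by blast
 then show ?case by (intro exI[of _ "\<lambda>g. h g * h' g"]) (simp add: biinvariant_mult)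
qed

section \<open>A spherical function without zeros on the regular set\<close>

text \<open>
  A linear relation between the rows is a polynomial of degree less than n with n roots.
\<close>

lemma vandermonde_nonzero:
 fixes z :: "'n::{finite,linorder} \<Rightarrow> complex"
 assumes inj: "inj z"
 shows "det (\<chi> i b. z b ^ card {..<i}) \<noteq> 0"
proof
 let ?V = "(\<chi> i b. z b ^ card {..<i}) :: 'n cmat"
 assume "det ?V = 0"
 then have "det (transpose ?V) = 0" by (simp add: det_transpose)
 then have "\<not> invertible (transpose ?V)" by (simp add: invertible_det_nz)
 then obtain y where y: "transpose ?V *v y = 0" "y \<noteq> 0"
  using matrix_left_invertible_ker[of "transpose ?V"] invertible_left_inverse[of "transpose ?V"] by blast
 define p where "p = (\<Sum>i\<in>UNIV. monom (y $ i) (card {..<i}))"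
 have coeff: "coeff p (card {..<i}) = y $ i" for i
 proof -
  have "coeff p (card {..<i}) = (\<Sum>j\<in>UNIV. if j = i then y $ j else 0)"
   unfolding p_def coeff_sum by (intro sum.cong refl) (simp add: rank_inj)
  then show ?thesis by simp
 qed
 obtain i where i: "y $ i \<noteq> 0" using y(2) by (auto simp: vec_eq_iff)
 then have p0: "p \<noteq> 0" using coeff[of i] by auto
 have "poly p (z b) = 0" for b
  using arg_cong[OF y(1), of "\<lambda>v. v $ b"]
  by (simp add: p_def poly_sum poly_monom matrix_vector_mult_def transpose_def mult.commute)
 then have "range z \<subseteq> {t. poly p t = 0}" by auto
 then have "card (range z) \<le> card {t. poly p t = 0}" by (rule card_mono[OF poly_roots_finite[OF p0]])
 also have "\<dots> \<le> degree p" by (rule card_poly_roots_bound[OF p0])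
 finally have "CARD('n) \<le> degree p" by (simp add: card_image[OF inj])
 moreover have "degree p < CARD('n)"
  unfolding p_def
  by (rule degree_sum_less) (auto intro: le_less_trans[OF degree_monom_le rank_less])
 ultimately show False by simp
qed

context radial_data
begin

text \<open>
  The coefficient functions of equivariant maps into the representation spaces: U is a matrix of
  size m by n, X a square matrix of size n. The second one is the determinant of the Krylov matrix
  with rows \<open>r, r X, r X^2, ...\<close>, where r is the row i0 of h.
\<close>

definition W_coefficient :: "((complex, 'n) vec, 'm) vec \<Rightarrow> 'm cmat \<Rightarrow> complex" where
 "W_coefficient U h = det h powi \<kappa>1 * det (\<chi> k l. (h ** U) $ emb (k::'n) $ l) ^ cW"

definition V_coefficient :: "'n cmat \<Rightarrow> 'n cmat \<Rightarrow> complex" where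
 "V_coefficient X h = det h powi - int \<kappa> * det (\<chi> i b. \<Sum>a\<in>UNIV. h $ i0 $ a * mpow X (card {..<i}) $ a $ b) ^ \<kappa>"

lemma W_coefficient_model: "W_coefficient U \<in> W.model"
proof -
 \<comment> \<open>U padded by zero columns to a square matrix\<close>
 define Z :: "'m cmat" where "Z = (\<chi> i j. \<Sum>l\<in>UNIV. if emb l = j then U $ i $ l else 0)"
 have "minor (initial CARD('n)) (h ** Z) = det (\<chi> k l. (h ** U) $ emb (k::'n) $ l)" for h
 proof -
  have "det (mask (initial CARD('n)) (h ** Z)) = det (\<chi> k l. mask (initial CARD('n)) (h ** Z) $ emb (k::'n) $ emb l)"
   by (rule det_embed[OF emb_inj[OF le]]) (auto simp: mask_def range_emb_initial mat_def)
  also have "(\<chi> k l. mask (initial CARD('n)) (h ** Z) $ emb (k::'n) $ emb l) = (\<chi> k l. (h ** U) $ emb (k::'n) $ l)"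
   by (simp add: vec_eq_iff mask_def emb_initial Z_def matrix_matrix_mult_def emb_eq[OF le])
  finally show ?thesis by (simp add: minor_def)
 qed
 then show ?thesis using W.minor_model[of Z] by (simp add: W_coefficient_def[abs_def])
qed

lemma V_coefficient_model: "V_coefficient X \<in> V.model"
 unfolding V_coefficient_def[abs_def] by (rule V.det_model[OF refl refl])

lemma W_coefficient_equivariant:
 assumes k: "k1 \<in> GL" "k2 \<in> GL"
 shows "W_coefficient (k1 ** U ** matrix_inv k2) h = inverse (det k2) ^ cW * inverse (det k1) powi \<kappa>1 * W_coefficient U (h ** k1)"
proof -
 have "(\<chi> k l. (h ** (k1 ** U ** matrix_inv k2)) $ emb (k::'n) $ l) = (\<chi> k l. ((h ** k1) ** U) $ emb (k::'n) $ l) ** matrix_inv k2"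
  by (simp add: matrix_mul_assoc) (simp add: vec_eq_iff matrix_matrix_mult_def[of _ "matrix_inv k2"])
 moreover have "det h powi \<kappa>1 = inverse (det k1) powi \<kappa>1 * det (h ** k1) powi \<kappa>1"
  using k by (simp add: det_mul power_int_mult_distrib power_int_inverse GL_iff_det)
 ultimately show ?thesis
  unfolding W_coefficient_def by (simp add: det_mul det_matrix_inv[OF k(2)] power_mult_distrib mult_ac)
qed

lemma V_coefficient_equivariant:
 assumes k: "k \<in> GL"
 shows "V_coefficient (k ** X ** matrix_inv k) h = V_coefficient X (h ** k)"
proof -
 have e1: "(\<chi> i b. \<Sum>a\<in>UNIV. h $ i0 $ a * mpow (k ** X ** matrix_inv k) (card {..<i}) $ a $ b) =
   (\<chi> i b. \<Sum>a\<in>UNIV. (h ** k) $ i0 $ a * mpow X (card {..<i}) $ a $ b) ** matrix_inv k"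
 proof -
  have "(\<Sum>a\<in>UNIV. h $ i0 $ a * M $ a $ b) = (h ** M) $ i0 $ b" for h M :: "'n cmat" and b
   by (simp add: matrix_matrix_mult_def)
  note e = this
  have "(h ** (k ** mpow X j ** matrix_inv k)) $ i0 $ b = ((h ** k ** mpow X j) ** matrix_inv k) $ i0 $ b" for j b
   by (simp add: matrix_mul_assoc)
  then show ?thesis
   unfolding mpow_conjugate[OF k] e by (simp add: vec_eq_iff matrix_matrix_mult_def[of _ "matrix_inv k"])
 qed
 have e2: "det h powi - int \<kappa> = det k ^ \<kappa> * det (h ** k) powi - int \<kappa>"
  using k by (simp add: det_mul power_int_minus power_mult_distrib GL_iff_det)
 show ?thesis
  unfolding V_coefficient_def e1 det_mul[of _ "matrix_inv k"] det_matrix_inv[OF k] e2 using k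
  by (simp add: power_mult_distrib power_inverse GL_iff_det)
qed

lemma W_vector:
 obtains \<Phi> G a where "finite G" "G \<subseteq> GL" "\<And>U. \<Phi> U = (\<Sum>h\<in>G. W_coefficient U h *s a h)"
  "\<And>U g. g \<in> GL \<Longrightarrow> dot \<xi> (\<rho> g *v \<Phi> U) = W_coefficient U g"
proof -
 obtain G a where G: "finite G" "G \<subseteq> GL"
  "\<And>F g. F \<in> W.model \<Longrightarrow> g \<in> GL \<Longrightarrow> dot \<xi> (\<rho> g *v (\<Sum>h\<in>G. F h *s a h)) = F g"
  using W.model_vector by blast
 show thesis by (rule that[OF G(1,2) refl G(3)[OF W_coefficient_model]])
qed

lemma V_vector:
 obtains \<Phi> G a where "finite G" "G \<subseteq> GL" "\<And>X. \<Phi> X = (\<Sum>h\<in>G. V_coefficient X h *s a h)"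
  "\<And>X g. g \<in> GL \<Longrightarrow> dot \<eta> (\<sigma> g *v \<Phi> X) = V_coefficient X g"
proof -
 obtain G a where G: "finite G" "G \<subseteq> GL"
  "\<And>F g. F \<in> V.model \<Longrightarrow> g \<in> GL \<Longrightarrow> dot \<eta> (\<sigma> g *v (\<Sum>h\<in>G. F h *s a h)) = F g"
  using V.model_vector by blast
 show thesis by (rule that[OF G(1,2) refl G(3)[OF V_coefficient_model]])
qed

lemma regular_GL_coefficients:
 assumes "finite G" "\<And>h. h \<in> G \<Longrightarrow> regular_GL (\<lambda>g. q g h)" "\<And>g. \<Phi> g = (\<Sum>h\<in>G. q g h *s a h)"
 shows "regular_GL (\<lambda>g. (\<Phi> g :: 'd::finite cvec) $ p)"
proof -
 have "(\<lambda>g. \<Phi> g $ p) = (\<lambda>g. \<Sum>h\<in>G. q g h * a h $ p)" by (simp add: assms(3))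
 then show ?thesis using assms(2) by (auto intro!: regular_GL_sum regular_GL_mult regular_GL_const)
qed

text \<open>
  Up to powers of determinants, \<open>f g\<close> is the tensor product of the vectors of W and V
  attached to the off-diagonal block U and the lower right block X of the projection of g. The
  determinant of the upper left block of g occurs with the exponent
  \<open>\<kappa>1 - \<kappa>2\<close>, which has to be nonnegative. On A the first vector is
  nonzero because the diagonal entries of U are, the second one because the Krylov matrix is a
  Vandermonde matrix in the distinct numbers \<open>- sinh^2 (x_i)\<close>.
\<close>

theorem nonvanishing_spherical_function:
 assumes \<kappa>: "\<kappa>2 \<le> \<kappa>1"
 shows "\<exists>f\<in>F. \<forall>x\<in>regular_set. A_scalar e0 f x \<noteq> 0"
proof -
 obtain \<Phi> G a where \<Phi>: "finite G" "G \<subseteq> GL" "\<And>U. \<Phi> U = (\<Sum>h\<in>G. W_coefficient U h *s a h)"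
  "\<And>U g. g \<in> GL \<Longrightarrow> dot \<xi> (\<rho> g *v \<Phi> U) = W_coefficient U g"
  by (rule W_vector) blast
 obtain \<Psi> G' a' where \<Psi>: "finite G'" "G' \<subseteq> GL" "\<And>X. \<Psi> X = (\<Sum>h\<in>G'. V_coefficient X h *s a' h)"
  "\<And>X g. g \<in> GL \<Longrightarrow> dot \<eta> (\<sigma> g *v \<Psi> X) = V_coefficient X g"
  by (rule V_vector) blast
 define d where "d = nat (\<kappa>1 - \<kappa>2)"
 have d: "int d = \<kappa>1 - \<kappa>2" using \<kappa> by (simp add: d_def)
 define f :: "('m + 'n) cmat \<Rightarrow> ('w \<times> 'v) cvec" where
  "f g = (det g powi \<kappa>2 * det (upper_left g) ^ d) *s tensor_vec (\<Phi> (upper_right (proj g))) (\<Psi> (lower_right (proj g)))" for g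
 have \<Phi>_eq: "\<Phi> (k1 ** U ** matrix_inv k2) = (inverse (det k2) ^ cW * inverse (det k1) powi \<kappa>1) *s (\<rho> k1 *v \<Phi> U)"
  if k: "k1 \<in> GL" "k2 \<in> GL" for k1 k2 U
 proof (rule W.separation_eq)
  fix h :: "'m cmat" assume h: "h \<in> GL"
  have "dot \<xi> (\<rho> h *v ((inverse (det k2) ^ cW * inverse (det k1) powi \<kappa>1) *s (\<rho> k1 *v \<Phi> U)))
    = (inverse (det k2) ^ cW * inverse (det k1) powi \<kappa>1) * dot \<xi> (\<rho> (h ** k1) *v \<Phi> U)"
   by (simp add: mv_scale dot_scale rational_rep_mult[OF W.rational h k(1)] matrix_vector_mul_assoc)
  then show "dot \<xi> (\<rho> h *v \<Phi> (k1 ** U ** matrix_inv k2)) =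
    dot \<xi> (\<rho> h *v ((inverse (det k2) ^ cW * inverse (det k1) powi \<kappa>1) *s (\<rho> k1 *v \<Phi> U)))"
   by (simp add: \<Phi>(4)[OF h] \<Phi>(4)[OF mult_GL[OF h k(1)]] W_coefficient_equivariant[OF k])
 qed
 have \<Psi>_eq: "\<Psi> (k ** X ** matrix_inv k) = \<sigma> k *v \<Psi> X" if k: "k \<in> GL" for k X
 proof (rule V.separation_eq)
  fix h :: "'n cmat" assume h: "h \<in> GL"
  have "dot \<eta> (\<sigma> h *v (\<sigma> k *v \<Psi> X)) = dot \<eta> (\<sigma> (h ** k) *v \<Psi> X)"
   by (simp add: rational_rep_mult[OF V.rational h k] matrix_vector_mul_assoc)
  then show "dot \<eta> (\<sigma> h *v \<Psi> (k ** X ** matrix_inv k)) = dot \<eta> (\<sigma> h *v (\<sigma> k *v \<Psi> X))"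
   by (simp add: \<Psi>(4)[OF h] \<Psi>(4)[OF mult_GL[OF h k]] V_coefficient_equivariant[OF k])
 qed
 \<comment> \<open>the exponents of the two determinants on the right and on the left\<close>
 have scalar: "(u * v) powi \<kappa>2 * u ^ d = u powi \<kappa>1 * v powi \<kappa>2" if "u \<noteq> 0" for u v :: complex
 proof -
  have "u powi \<kappa>1 = u powi \<kappa>2 * u ^ d" using power_int_add[of u \<kappa>2 "int d"] that by (simp add: d) (simp flip: d)
  then show ?thesis by (simp add: power_int_mult_distrib)
 qed
 have scalar': "(u * v) powi \<kappa>2 * u ^ d * (inverse v ^ cW * inverse u powi \<kappa>1) = v powi b" if "u \<noteq> 0" "v \<noteq> 0" for u v :: complex
 proof -
  have "v powi \<kappa>2 = v powi b * v ^ cW" using power_int_add[of v b "int cW"] that b by simp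
  then show ?thesis unfolding scalar[OF that(1)] using that
   by (simp add: power_inverse power_int_inverse field_simps)
 qed
 have "f \<in> F"
  unfolding spherical_functions_def
 proof (intro CollectI conjI ballI allI)
  have UR: "regular_GL (\<lambda>g. upper_right (proj g) $ i $ j)" for i :: 'm and j :: 'n
   by (simp add: upper_right_def proj_regular)
  have LR: "regular_GL (\<lambda>g. lower_right (proj g :: ('m + 'n) cmat) $ i $ j)" for i j :: 'n
   by (simp add: lower_right_def proj_regular)
  have 1: "regular_GL (\<lambda>g. W_coefficient (upper_right (proj g)) h)" for h
   unfolding W_coefficient_def
   by (intro regular_GL_mult regular_GL_const regular_GL_power regular_GL_det_of)
    (simp add: matrix_matrix_mult_def regular_GL_sum regular_GL_mult regular_GL_const UR)
  have 2: "regular_GL (\<lambda>g. V_coefficient (lower_right (proj g :: ('m + 'n) cmat)) h)" for h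
   unfolding V_coefficient_def
   by (intro regular_GL_mult regular_GL_const regular_GL_power regular_GL_det_of)
    (simp add: regular_GL_sum regular_GL_mult regular_GL_const mpow_regular LR)
  have 3: "regular_GL (\<lambda>g. det (upper_left g :: 'm cmat))"
   by (intro regular_GL_det_of) (simp add: upper_left_def regular_GL_entry)
  fix p
  show "regular_GL (\<lambda>g. f g $ p)"
   unfolding f_def tensor_vec_def
   using regular_GL_coefficients[OF \<Phi>(1) 1 \<Phi>(3)] regular_GL_coefficients[OF \<Psi>(1) 2 \<Psi>(3)]
   by (simp add: regular_GL_mult regular_GL_det_powi regular_GL_power 3)
 next
  fix g :: "('m + 'n) cmat" and k1 :: "'m cmat" and k2 :: "'n cmat" assume g: "g \<in> GL" "k1 \<in> GL" "k2 \<in> GL"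
  then have nz: "det k1 \<noteq> 0" "det k2 \<noteq> 0" by (simp_all add: GL_iff_det)
  show "f (block_diag k1 k2 ** g) = tensor_mat (\<rho> k1) (\<tau> k2) *v f g"
  proof -
   let ?T = "tensor_vec (\<rho> k1 *v \<Phi> (upper_right (proj g))) (\<sigma> k2 *v \<Psi> (lower_right (proj g)))"
   let ?s = "det g powi \<kappa>2 * det (upper_left g) ^ d"
   have "f (block_diag k1 k2 ** g) = (((det k1 * det k2) powi \<kappa>2 * det k1 ^ d * (inverse (det k2) ^ cW * inverse (det k1) powi \<kappa>1)) * ?s) *s ?T"
    unfolding f_def proj_left[OF g] blocks_conjugate upper_left_left \<Phi>_eq[OF g(2,3)] \<Psi>_eq[OF g(3)] tensor_vec_scale det_mul det_block_diag
    by (simp add: vector_smult_assoc power_mult_distrib power_int_mult_distrib mult_ac)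
   also have "\<dots> = (det k2 powi b * ?s) *s ?T" unfolding scalar'[OF nz] ..
   also have "\<dots> = tensor_mat (\<rho> k1) (\<tau> k2) *v f g"
    unfolding f_def mv_scale tensor_mat_vec tau det_twist_vec tensor_vec_scale
    by (simp add: vector_smult_assoc mult_ac)
   finally show ?thesis .
  qed
  show "f (g ** block_diag k1 k2) = (det k1 powi \<kappa>1 * det k2 powi \<kappa>2) *s f g"
   unfolding f_def proj_right[OF g] upper_left_right det_mul det_block_diag scalar[OF nz(1), symmetric]
   by (simp add: vector_smult_assoc power_mult_distrib power_int_mult_distrib mult_ac)
 qed
 moreover have "A_scalar e0 f x \<noteq> 0" if x: "x \<in> regular_set" for x
 proof
  note r = regular_set_sinh[OF x]
  let ?a = "amat x :: ('m + 'n) cmat"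
  have ch: "cosh (x $ k) \<noteq> 0" for k using r(2)[of k] by (auto simp: sinh_double)
  assume "A_scalar e0 f x = 0"
  then have f0: "f ?a = 0" using A_scalar[OF \<open>f \<in> F\<close>, of x] by simp
  have "det ?a \<noteq> 0" using amat_GL[OF le refl, of x] by (simp add: GL_iff_det)
  moreover have "det (upper_left ?a) \<noteq> 0"
  proof -
   have "upper_left ?a = diag_matrix (\<chi> i. cosh (a_coord x i))"
    by (simp add: upper_left_def diag_matrix_def vec_eq_iff amat_entries[OF le refl])
   moreover have "cosh (a_coord x i) \<noteq> 0" for i :: 'm
    using ch by (cases "i \<in> range (emb :: 'n \<Rightarrow> 'm)") (auto simp: a_coord_emb[OF le] a_coord_complement[OF le])
   ultimately show ?thesis by (simp add: det_diag_matrix)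
  qed
  ultimately have "tensor_vec (\<Phi> (upper_right (proj ?a))) (\<Psi> (lower_right (proj ?a))) = 0"
   using f0 by (simp add: f_def)
  then have "\<Phi> (upper_right (proj ?a)) = 0 \<or> \<Psi> (lower_right (proj ?a)) = 0"
   using tensor_vec_cancel[of "\<Phi> (upper_right (proj ?a))" "\<Psi> (lower_right (proj ?a))" 0] by (auto simp: tensor_vec_zero)
  moreover have "W_coefficient (upper_right (proj ?a)) (mat 1) \<noteq> 0"
  proof -
   have "(\<chi> k l. (mat 1 ** upper_right (proj ?a)) $ emb (k::'n) $ l) = diag_matrix (\<chi> k. - (cosh (x $ k) * sinh (x $ k)))"
    by (simp add: vec_eq_iff diag_matrix_def proj_amat[OF le])
   then show ?thesis using ch r(1) by (simp add: W_coefficient_def det_diag_matrix)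
  qed
  moreover obtain h where h: "h \<in> GL" "V_coefficient (lower_right (proj ?a)) h \<noteq> 0"
  proof -
   \<comment> \<open>unipotent upper triangular with row i0 equal to \<open>(1, ..., 1)\<close>, a cyclic vector for a diagonal matrix with distinct entries\<close>
   define h :: "'n cmat" where "h = (\<chi> i j. if i = i0 \<or> i = j then 1 else 0)"
   have "det h = (\<Prod>i\<in>UNIV. h $ i $ i)"
    by (rule det_upper_triangular) (use least in \<open>auto simp: h_def dest: leD\<close>)
   then have dh: "det h = 1" by (simp add: h_def)
   define z where "z i = - (sinh (x $ i))\<^sup>2" for i
   have "inj z"
   proof (rule injI, rule ccontr)
    fix i j assume ij: "z i = z j" "i \<noteq> j"
    have "cosh (2 * x $ i) = cosh (2 * x $ j)"
     using ij(1) cosh_double[of "x $ i"] cosh_double[of "x $ j"] cosh_square_eq[of "x $ i"] cosh_square_eq[of "x $ j"]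
     by (simp add: z_def)
    then show False using coth_add_coth(2)[OF r(3)[OF ij(2)] r(4)[OF ij(2)]] by simp
   qed
   have e: "(\<chi> i b. \<Sum>a\<in>UNIV. h $ i0 $ a * mpow (lower_right (proj ?a)) (card {..<i}) $ a $ b) = (\<chi> i b. z b ^ card {..<i})"
    unfolding proj_amat[OF le] mpow_diag by (simp add: vec_eq_iff h_def diag_matrix_def z_def)
   have "V_coefficient (lower_right (proj ?a)) h \<noteq> 0"
    unfolding V_coefficient_def e using vandermonde_nonzero[OF \<open>inj z\<close>] by (simp add: dh)
   then show thesis using dh by (intro that[of h]) (simp_all add: GL_iff_det)
  qed
  ultimately show False
   using \<Phi>(4)[OF mat_1_GL, of "upper_right (proj ?a)"] \<Psi>(4)[OF h(1), of "lower_right (proj ?a)"] by (auto simp: dot_zero)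
 qed
 ultimately show ?thesis by blast
qed

section \<open>Uniqueness of the radial part\<close>

lemma spherical_mult_biinvariant:
 assumes "biinvariant h" "f \<in> F"
 shows "(\<lambda>g. h g *s f g) \<in> F"
 using assms unfolding spherical_functions_def biinvariant_def
 by (auto simp: regular_GL_mult mv_scale vector_smult_assoc mult.commute)

text \<open>
  Two operators that agree on spherical functions agree on the products of one nonvanishing function
  with all power sums in \<open>- sinh^2 (x_i)\<close>. On the regular set these have arbitrary
  jets, because the numbers \<open>- sinh^2 (x_i)\<close> are distinct and the derivative
  \<open>- sinh (2 x_i)\<close> does not vanish.
\<close>

theorem radial_part_unique:
 assumes \<kappa>: "\<kappa>2 \<le> \<kappa>1"
  and R: "scalar_diff_op R" "scalar_diff_op R'"
  and eq: "\<And>f x. f \<in> F \<Longrightarrow> x \<in> regular_set \<Longrightarrow> R (A_scalar e0 f) x = R' (A_scalar e0 f) x"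
  and x: "x \<in> regular_set" and \<psi>: "holomorphic_several \<psi> U" "open U" "x \<in> U"
 shows "R \<psi> x = R' \<psi> x"
proof -
 obtain S c where S: "finite S" "\<And>\<psi> x. x \<in> regular_set \<Longrightarrow> R \<psi> x = (\<Sum>I\<in>S. c I x * foldr partial I \<psi> x)"
  using R(1) unfolding scalar_diff_op_def by blast
 obtain S' c' where S': "finite S'" "\<And>\<psi> x. x \<in> regular_set \<Longrightarrow> R' \<psi> x = (\<Sum>I\<in>S'. c' I x * foldr partial I \<psi> x)"
  using R(2) unfolding scalar_diff_op_def by blast
 define C where "C I = (if I \<in> S then c I x else 0) - (if I \<in> S' then c' I x else 0)" for I
 have diff: "R \<phi> x - R' \<phi> x = (\<Sum>I\<in>S \<union> S'. C I * foldr partial I \<phi> x)" for \<phi>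
 proof -
  have "R \<phi> x = (\<Sum>I\<in>S \<union> S'. (if I \<in> S then c I x else 0) * foldr partial I \<phi> x)"
   unfolding S(2)[OF x] by (rule sum.mono_neutral_cong_left) (use S S' in auto)
  moreover have "R' \<phi> x = (\<Sum>I\<in>S \<union> S'. (if I \<in> S' then c' I x else 0) * foldr partial I \<phi> x)"
   unfolding S'(2)[OF x] by (rule sum.mono_neutral_cong_left) (use S S' in auto)
  ultimately show ?thesis by (simp add: C_def sum_subtractf left_diff_distrib)
 qed
 obtain f where f: "f \<in> F" "A_scalar e0 f x \<noteq> 0" using nonvanishing_spherical_function[OF \<kappa>] x by blast
 let ?\<zeta> = "\<lambda>t::complex. - (sinh t)\<^sup>2"
 note r = regular_set_sinh[OF x]
 have "(\<Sum>I\<in>S \<union> S'. C I * foldr partial I \<psi> x) = 0"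
 proof (rule power_sum_algebra_jets_dense[where \<zeta> = ?\<zeta> and \<phi> = "A_scalar e0 f" and U = U])
  have deriv: "DERIV (?\<zeta>) t :> - sinh (2 * t)" for t
   by (auto intro!: derivative_eq_intros simp: sinh_double)
  then show "?\<zeta> holomorphic_on UNIV" by (auto simp: holomorphic_on_open)
  show "?\<zeta> (x $ i) \<noteq> ?\<zeta> (x $ j)" if ij: "i \<noteq> j" for i j
  proof
   assume "?\<zeta> (x $ i) = ?\<zeta> (x $ j)"
   then have "cosh (2 * x $ i) = cosh (2 * x $ j)"
    using cosh_double[of "x $ i"] cosh_double[of "x $ j"] cosh_square_eq[of "x $ i"] cosh_square_eq[of "x $ j"] by simp
   then show False using coth_add_coth(2)[OF r(3)[OF ij] r(4)[OF ij]] by simp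
  qed
  show "deriv ?\<zeta> (x $ i) \<noteq> 0" for i
   using r(2)[of i] by (simp add: DERIV_imp_deriv[OF deriv])
  show "finite (S \<union> S')" using S S' by simp
  show "holomorphic_several (A_scalar e0 f) UNIV" by (rule A_scalar_holomorphic[OF f(1)])
  fix P :: "'n cvec \<Rightarrow> complex" assume "power_sum_algebra ?\<zeta> P"
  from power_sum_algebra_biinvariant[OF le this]
  obtain h :: "('m + 'n) cmat \<Rightarrow> complex" where h: "biinvariant h" "\<And>y. h (amat y) = P y" by blast
  have hf: "(\<lambda>g. h g *s f g) \<in> F" by (rule spherical_mult_biinvariant[OF h(1) f(1)])
  have "A_scalar e0 (\<lambda>g. h g *s f g) = (\<lambda>y. A_scalar e0 f y * P y)"
  proof
   fix y
   show "A_scalar e0 (\<lambda>g. h g *s f g) y = A_scalar e0 f y * P y"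
    by (rule A_scalar_eqI) (subst A_scalar[OF f(1)], simp add: h(2) vector_smult_assoc mult.commute)
  qed
  then show "(\<Sum>I\<in>S \<union> S'. C I * foldr partial I (\<lambda>y. A_scalar e0 f y * P y) x) = 0"
   unfolding diff[symmetric] using eq[OF hf x] by simp
 qed (use \<psi> f in auto)
 then show ?thesis unfolding diff[symmetric] by simp
qed

end

section \<open>The operator of the theorem\<close>

lemma (in rectangular_rep) W_tilde_line:
 assumes I: "I = initial k" and w: "w \<in> W_tilde k \<beta> \<rho>"
 shows "\<exists>s. w = s *s v0"
proof (rule complement_weight_multiple_v0)
 fix t :: complex assume t: "t \<noteq> 0"
 have "complement_diag t \<in> GL"
  unfolding complement_diag_def GL_iff_det det_diag_matrix using t by simp
 moreover have "complement_diag t $ i $ j = mat 1 $ i $ j" if "i \<in> initial k \<or> j \<in> initial k" for i j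
  using that by (auto simp: complement_diag_entry mat_def I[symmetric])
 ultimately show "\<rho> (complement_diag t) *v w = (det (complement_diag t) powi \<beta>) *s w"
  using w by (simp add: W_tilde_def)
qed

lemma V_tilde_scale: "v \<in> V_tilde c \<tau> \<Longrightarrow> s *s v \<in> V_tilde c \<tau>"
 by (simp add: V_tilde_def mv_scale vector_smult_assoc mult.commute)

lemma span_line:
 assumes "A \<subseteq> range (\<lambda>s. s *s (u :: 'd::finite cvec))"
 shows "vec.span A \<subseteq> range (\<lambda>s. s *s u)"
proof (rule vec.span_minimal[OF assms])
 have line: "c *s u \<in> range (\<lambda>s. s *s u)" for c by (rule rangeI)
 show "vec.subspace (range (\<lambda>s. s *s u))"
 proof (rule vec.subspaceI)
  show "0 \<in> range (\<lambda>s. s *s u)" using line[of 0] by simp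
  show "v + w \<in> range (\<lambda>s. s *s u)" if "v \<in> range (\<lambda>s. s *s u)" "w \<in> range (\<lambda>s. s *s u)" for v w
  proof -
   from that obtain a b where "v = a *s u" "w = b *s u" by blast
   then show ?thesis using line[of "a + b"] by (simp only: vector_sadd_rdistrib)
  qed
  show "c *s v \<in> range (\<lambda>s. s *s u)" if "v \<in> range (\<lambda>s. s *s u)" for c v
  proof -
   from that obtain a where "v = a *s u" by blast
   then show ?thesis using line[of "c * a"] by (simp only: vector_smult_assoc)
  qed
 qed
qed

text \<open>
  The spaces of the two factors are lines, so the given vector e is a product vector; its scalar is
  absorbed into the second factor.
\<close>

lemma radial_data_exists:
 fixes \<rho> :: "'m::{finite,linorder} cmat \<Rightarrow> 'w::finite cmat"
  and \<sigma> \<tau> :: "'n::{finite,linorder} cmat \<Rightarrow> 'v::finite cmat"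
 assumes le: "CARD('n) \<le> CARD('m)" and v: "\<kappa>v \<ge> 0" and t: "\<kappa>t1 \<ge> \<kappa>1"
  and L: "is_L (W_weight CARD('n) \<kappa>1 \<kappa>t1) \<rho>" "is_L (V_weight \<kappa>v) \<sigma>"
  and tau: "\<tau> = det_twist (\<kappa>2 + \<kappa>1 - \<kappa>t1) \<sigma>"
  and e: "e \<in> U_tilde \<kappa>1 \<kappa>2 \<kappa>t1 \<rho> \<tau>" "e \<noteq> 0"
 obtains \<xi> w0 i0 \<eta> v0 v1 where
  "radial_data \<rho> \<sigma> \<kappa>1 (nat (\<kappa>t1 - \<kappa>1)) \<xi> w0 (nat \<kappa>v) i0 \<eta> v0 \<kappa>2 (\<kappa>2 + \<kappa>1 - \<kappa>t1) \<tau> v1"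
  "e = radial_data.e0 w0 v1"
proof -
 define cW where "cW = nat (\<kappa>t1 - \<kappa>1)"
 define \<kappa> where "\<kappa> = nat \<kappa>v"
 have cW: "int cW = \<kappa>t1 - \<kappa>1" and \<kappa>: "int \<kappa> = \<kappa>v" using t v by (simp_all add: cW_def \<kappa>_def)
 define i0 :: 'n where "i0 = Min UNIV"
 have least: "i0 \<le> i" for i by (simp add: i0_def)
 have i0: "initial 1 = {i0}" unfolding initial_1 using least by (auto intro: antisym)
 have "is_L (\<lambda>i. if i \<in> initial CARD('n) then \<kappa>1 + int cW else \<kappa>1) \<rho>"
 proof -
  have "W_weight CARD('n) \<kappa>1 \<kappa>t1 = (\<lambda>i::'m. if i \<in> initial CARD('n) then \<kappa>1 + int cW else \<kappa>1)"
   by (auto simp: W_weight_def cW)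
  then show ?thesis using L(1) by simp
 qed
 from is_L_rectangular[OF this]
 obtain \<xi> w0 where W: "rectangular_rep \<rho> (initial CARD('n)) \<kappa>1 cW \<xi> w0"
  using initial_down_closed by blast
 have "is_L (\<lambda>i. if i \<in> {i0} then - int \<kappa> + int (\<kappa> * CARD('n)) else - int \<kappa>) \<sigma>"
 proof -
  have "V_weight \<kappa>v = (\<lambda>i. if i \<in> {i0} then - int \<kappa> + int (\<kappa> * CARD('n)) else - int \<kappa>)"
   unfolding V_weight_def i0 by (auto simp: \<kappa> algebra_simps)
  then show ?thesis using L(2) by simp
 qed
 from is_L_rectangular[OF this]
 obtain \<eta> v0 where V: "rectangular_rep \<sigma> {i0} (- int \<kappa>) (\<kappa> * CARD('n)) \<eta> v0"
  using least by (auto dest: leD)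
 let ?b = "\<kappa>2 + \<kappa>1 - \<kappa>t1"
 have bb: "\<kappa>1 + \<kappa>2 - \<kappa>t1 = ?b" by simp
 have data: "radial_data \<rho> \<sigma> \<kappa>1 cW \<xi> w0 \<kappa> i0 \<eta> v0 \<kappa>2 ?b \<tau> v" if "v \<in> V_tilde ?b \<tau>" "v \<noteq> 0" for v
  unfolding radial_data_def radial_data_axioms_def
  using W V le least that tau cW by simp
 have "\<exists>v\<in>V_tilde ?b \<tau>. v \<noteq> 0"
 proof (rule ccontr)
  assume "\<not> ?thesis"
  then have "{tensor_vec w v | w v. w \<in> W_tilde CARD('n) \<kappa>1 \<rho> \<and> v \<in> V_tilde ?b \<tau>} \<subseteq> range (\<lambda>s. s *s 0)"
   by (auto simp: tensor_vec_zero)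
  from span_line[OF this] show False using e by (auto simp: U_tilde_def bb)
 qed
 then obtain v where v: "v \<in> V_tilde ?b \<tau>" "v \<noteq> 0" by blast
 interpret D: radial_data \<rho> \<sigma> \<kappa>1 cW \<xi> w0 \<kappa> i0 \<eta> v0 \<kappa>2 ?b \<tau> v by (rule data[OF v])
 have "{tensor_vec w v' | w v'. w \<in> W_tilde CARD('n) \<kappa>1 \<rho> \<and> v' \<in> V_tilde ?b \<tau>} \<subseteq> range (\<lambda>s. s *s tensor_vec w0 v)"
 proof clarify
  fix w v' assume "w \<in> W_tilde CARD('n) \<kappa>1 \<rho>" "v' \<in> V_tilde ?b \<tau>"
  then obtain s s' where "w = s *s w0" "v' = s' *s v"
   using D.W.W_tilde_line[OF refl] D.V_tilde_line by blast
  then have "tensor_vec w v' = (s * s') *s tensor_vec w0 v" by (simp add: tensor_vec_scale vector_smult_assoc mult.commute)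
  then show "tensor_vec w v' \<in> range (\<lambda>s. s *s tensor_vec w0 v)" by blast
 qed
 from span_line[OF this] obtain s where s: "e = s *s tensor_vec w0 v"
  using e(1) by (auto simp: U_tilde_def bb)
 have s0: "s *s v \<noteq> 0" using s e(2) v(2) by (auto simp: vec_eq_iff)
 have d: "radial_data \<rho> \<sigma> \<kappa>1 cW \<xi> w0 \<kappa> i0 \<eta> v0 \<kappa>2 ?b \<tau> (s *s v)" by (rule data[OF V_tilde_scale[OF v(1)] s0])
 have "e = radial_data.e0 w0 (s *s v)" unfolding radial_data.e0_def[OF d] by (simp add: s tensor_vec_scale)
 with d show thesis unfolding cW_def \<kappa>_def by (rule that)
qed

theorem theorem1:
  fixes \<kappa>1 \<kappa>2 \<kappa>t1 \<kappa>v :: int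
    and \<rho> :: "'m::{finite,linorder} cmat \<Rightarrow> 'w::finite cmat"
    and \<sigma> \<tau> :: "'n::{finite,linorder} cmat \<Rightarrow> 'v::finite cmat"
    and e :: "('w \<times> 'v) cvec"
    and k1 k2 k3 :: int
    and s r :: "real \<times> real \<times> real"
  assumes "CARD('n) \<le> CARD('m)"
    and "\<kappa>v \<ge> 0"
    and "k1 = \<kappa>2 - \<kappa>1" and "k2 = \<kappa>v" and "k3 = \<kappa>t1 - \<kappa>2"
    and "k3 \<ge> k1 + k3" and "k1 + k3 \<ge> 0"
    and "s = (real CARD('m) - real CARD('n), 1, 1 / 2)"
    and "r = (real_of_int k1, real_of_int k2, real_of_int k3) + s"
    and "is_L (W_weight CARD('n) \<kappa>1 \<kappa>t1) \<rho>"
    and "is_L (V_weight \<kappa>v) \<sigma>"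
    and "\<tau> = det_twist (\<kappa>2 + \<kappa>1 - \<kappa>t1) \<sigma>"
    and "e \<in> U_tilde \<kappa>1 \<kappa>2 \<kappa>t1 \<rho> \<tau>" and "e \<noteq> 0"
  shows "(\<exists>R. is_radial_part (spherical_functions \<kappa>1 \<kappa>2 \<rho> \<tau>) e D_casimir R) \<and>
    (\<forall>R. is_radial_part (spherical_functions \<kappa>1 \<kappa>2 \<rho> \<tau>) e D_casimir R \<longrightarrow>
      (\<forall>U \<psi> \<theta>. open U \<and> U \<subseteq> regular_set \<and> log_sinh_branch U \<theta> \<and> holomorphic_several \<psi> U \<longrightarrow>
        (\<forall>x\<in>U. 2 * R \<psi> x =
           inverse (delta s \<theta> x) *
             (laplacian_A (\<lambda>y. delta s \<theta> y * \<psi> y) x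
              - u_potential r x * (delta s \<theta> x * \<psi> x)
              + of_real (C_const CARD('m) CARD('n) \<kappa>1 \<kappa>2) * (delta s \<theta> x * \<psi> x)))))"
proof -
 have t: "\<kappa>t1 \<ge> \<kappa>1" using assms(3,5,7) by simp
 obtain \<xi> w0 i0 \<eta> v0 v1 where
  data: "radial_data \<rho> \<sigma> \<kappa>1 (nat (\<kappa>t1 - \<kappa>1)) \<xi> w0 (nat \<kappa>v) i0 \<eta> v0 \<kappa>2 (\<kappa>2 + \<kappa>1 - \<kappa>t1) \<tau> v1"
  and e: "e = radial_data.e0 w0 v1"
  using radial_data_exists[OF assms(1,2) t assms(10-14)] by blast
 interpret radial_data \<rho> \<sigma> \<kappa>1 "nat (\<kappa>t1 - \<kappa>1)" \<xi> w0 "nat \<kappa>v" i0 \<eta> v0 \<kappa>2 "\<kappa>2 + \<kappa>1 - \<kappa>t1" \<tau> v1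
  by (rule data)
 define R1 :: "('n cvec \<Rightarrow> complex) \<Rightarrow> 'n cvec \<Rightarrow> complex" where "R1 = radial_operator CARD('m) \<kappa>1 \<kappa>2 \<kappa>t1 \<kappa>v"
 have R1: "scalar_diff_op R1" unfolding R1_def by (rule radial_operator_scalar_diff_op)
 have D: "D_casimir f (mexp (a_matrix x)) = R1 (A_scalar e0 f) x *s e0" if "f \<in> F" "x \<in> regular_set" for f and x :: "'n cvec"
  using casimir_radial_operator[OF that] t assms(2) by (simp add: R1_def)
 have s: "s = (real CARD('m) - real CARD('n), 1, 1/2)" using assms(8) by simp
 have r: "r = (real_of_int (\<kappa>2 - \<kappa>1) + (real CARD('m) - real CARD('n)), real_of_int \<kappa>v + 1, real_of_int (\<kappa>t1 - \<kappa>2) + 1/2)"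
  unfolding assms(9) s assms(3-5) by simp
 have "is_radial_part F e0 D_casimir R1"
  unfolding is_radial_part_def using R1 D by blast
 moreover have "2 * R \<psi> x = inverse (delta s \<theta> x) *
       (laplacian_A (\<lambda>y. delta s \<theta> y * \<psi> y) x
       - u_potential r x * (delta s \<theta> x * \<psi> x)
       + of_real (C_const CARD('m) CARD('n) \<kappa>1 \<kappa>2) * (delta s \<theta> x * \<psi> x))"
  if R: "is_radial_part F e0 D_casimir R"
   and U: "open U \<and> U \<subseteq> regular_set \<and> log_sinh_branch U \<theta> \<and> holomorphic_several \<psi> U" and x: "x \<in> U" for R U \<psi> \<theta> x
 proof -
  have "R \<psi> x = R1 \<psi> x"
  proof (rule radial_part_unique[OF _ _ R1])
   show "\<kappa>2 \<le> \<kappa>1" using assms(3,5,6) by simp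
   show "scalar_diff_op R" using R by (simp add: is_radial_part_def)
   show "x \<in> regular_set" "holomorphic_several \<psi> U" "open U" "x \<in> U" using U x by auto
   fix f and y :: "'n cvec" assume f: "f \<in> F" "y \<in> regular_set"
   then have "R (A_scalar e0 f) y *s e0 = R1 (A_scalar e0 f) y *s e0"
    using R D[OF f] unfolding is_radial_part_def by metis
   then show "R (A_scalar e0 f) y = R1 (A_scalar e0 f) y" using e0_nonzero by (auto simp: vec_eq_iff)
  qed
  then show ?thesis
   unfolding s r R1_def using radial_operator_conjugation[of U \<theta> \<psi> x "CARD('m)"] U x assms(1) by simp
 qed
 ultimately show ?thesis unfolding e by blast
qed

end
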